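(* Let $(G_n)_{n\ge 1}$ be a sequence of (possibly random) finite connected graphs, $G_n$ having $n$ vertices, which converges locally in probability to a (possibly random) rooted graph $(G,o)$. Let $\mathbb{G}_n=(G_n,o_n,w_n)$ and $\mathbb{G}=(G,o,w)$ be the respective standard extensions of $G_n$ and $(G,o)$. Let $\theta(p)=\mathbb{P}(|\mathcal{C}^{\mathbb{G}}_o(p)|=\infty)$ for $p\in[0,1]$ (the annealed probability, averaging over both the random graph and the weights), let $p_c=\inf\{p:\theta(p)>0\}$, let $\theta^{-1}(t)=\inf\{p:\theta(p)>t\}$ for $t\in[0,1)$, and let $\theta^{-1}(1)=1$. Let $(k_n(\cdot))_{n\ge1}$ be a linearly growing sequence with respect to $(G_n)_{n\ge1}$. Assume that: (1) the (infinite) rooted weighted graph $\mathbb{G}$ is such that, for any $p$, $\theta(p)>0$ if and only if $\mathbb{P}\big(\exists v\in V(\mathbb{F}^{\mathbb{G}}):|\mathcal{C}^{\mathbb{G}}_v(p)|=\infty\big)=1$; (2) $p\mapsto\theta(p)$, considered as a function on $(p_c,1]$, is continuous and strictly monotone; (3) for any $p$, $$\lim_{k\to\infty}\limsup_{n\to\infty}\frac1{n^2}\mathbb{E}\Big[\Big|\Big\{u,v\in V(\mathbb{G}_n):|\mathcal{C}^{\mathbb{G}_n}_u(p)|\ge k,\ |\mathcal{C}^{\mathbb{G}_n}_v(p)|\ge k,\ \mathcal{C}^{\mathbb{G}_n}_u(p)\cap\mathcal{C}^{\mathbb{G}_n}_v(p)=\varnothing\Big\}\Big|\Big]=0,$$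 where the set is the set of pairs of vertices $u,v$ with the stated properties. Then, in the sense of local process convergence, as $n\to\infty$, $$\big(\mathcal{P}_{k_n(t)}(\mathbb{G}_n)\big)_{t\in[0,1]}\longrightarrow\big(\mathbb{F}^{\mathbb{G}}_+(\theta^{-1}(t))\big)_{t\in[0,1]}.$$
   Context: Graphs are simple and locally finite. A rooted weighted graph is a triple $\mathbb{G}=(G,o,w)$ with $o\in V(G)$ and $w:E(G)\to\mathbb{R}$ injective (weights may be defined on a larger edge set). $|G|$ is the number of vertices. Standard extension: for a finite (possibly random) graph $G$, it is $(G,o,w)$ with $o$ uniform in $V(G)$ and $w$ i.i.d. Uniform$([0,1])$ edge weights independent of $(G,o)$; for a rooted graph $(G,o)$ it is $(G,o,w)$ with $w$ i.i.d. Uniform$([0,1])$ edge weights independent of $(G,o)$. Components: $\mathcal{C}^{\mathbb{G}}_v(p)$ is the connected component of $v$ in the graph obtained from $\mathbb{G}$ by keeping all vertices and only the edges $e$ with $w(e)\le p$. Minimum spanning forest: $\mathrm{F}^{\mathbb{G}}$ has vertex set $V(G)$, and $e=\{u,v\}\in E(G)$ is an edge of it iff $\mathcal{C}^{\mathbb{G}\setminus\{e\}}_u(w(e))$ and $\mathcal{C}^{\mathbb{G}\setminus\{e\}}_v(w(e))$ are disjoint and not both infinite, where $\mathbb{G}\setminus\{e\}$ is $\mathbb{G}$ with the edge $e$ removed. $\mathbb{F}^{\mathbb{G}}$ is the rooted weighted tree given by the connected component of $\mathrm{F}^{\mathbb{G}}$ containing $o$, with root $o$ and weights $w$. If $G$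 is finite and connected, this is the minimum spanning tree. Prim's algorithm: for connected $\mathbb{G}=(G,o,w)$, $T_1=(\{o\},\varnothing)$, and $T_k$ is obtained from $T_{k-1}$ by adding the edge of minimal weight among the edges with exactly one endpoint in $T_{k-1}$, together with its other endpoint; if $G$ is finite, $T_k=T_{|G|}$ for $k\ge|G|$. $\mathcal{P}_k(\mathbb{G})=(T_k,o,w)$, and $\mathcal{P}_\infty(\mathbb{G})=(\bigcup_kT_k,o,w)$ (the invasion percolation cluster). Expanded invasion percolation cluster: $\mathbb{F}^{\mathbb{G}}_+(p)$ is the connected component containing $o$ of the graph on $V(G)$ with edge set $E(\mathcal{P}_\infty(\mathbb{G}))\cup\{e\in E(\mathbb{F}^{\mathbb{G}}):w(e)\le p\}$, rooted at $o$, with weights $w$. Local metric: $B_r(\mathbb{G})$ is the rooted weighted subgraph induced by the vertices at graph distance at most $r$ from the root. $\mathbb{G}\equiv_r\mathbb{G}'$ means that there is a root-preserving graph isomorphism $\varphi:B_r(\mathbb{G})\to B_r(\mathbb{G}')$ with $|w(e)-w'(\varphi(e))|\le 1/r$ for all edges $e$ of $B_r(\mathbb{G})$. Set $d(\mathbb{G},\mathbb{G}')=(1+\sup\{r\ge0:\mathbb{G}\equiv_r\mathbb{G}'\})^{-1}$. Unweighted rooted graphs are treated as having all edge weights equal to $1$. Local convergence in probability of $(G_n)$ to $(G,o)$: for every bounded $d$-continuous $h$, $\mathbb{E}[h(G_n,o_n)\mid G_n]\to\mathbb{E}[h(G,o)]$ in probability, with $o_n$ uniform in $V(G_n)$. Linearly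 growing sequence with respect to $(G_n)$: a sequence of functions $k_n(\cdot)$ on $[0,1]$ (the values $k_n(t)$ being numbers of steps) such that $\lim_{n\to\infty}k_n(t)/n=t$ for any $t\in[0,1]$, and such that $(k_n(0))_{n\ge1}$ is a slowly growing radius diverging to infinity for which there exists a coupling of $(\mathbb{G}_n)_{n\ge1}$ and $\mathbb{G}$ satisfying $\mathbb{P}\big(\mathbb{G}_m\equiv_{k_n(0)}\mathbb{G}\text{ and }\mathbb{F}^{\mathbb{G}_m}\equiv_{k_n(0)}\mathbb{F}^{\mathbb{G}}\big)=1$ for all $m\ge n$. Local process convergence: a sequence of càdlàg processes $(\mathbb{G}_n(t))_{t\in[0,1]}$ on the space of rooted weighted graphs converges to a càdlàg process $(\mathbb{G}(t))_{t\in[0,1]}$ if and only if (i) for all integers $r\ge1$, all times $t_1,\dots,t_k$ and all rooted weighted graphs $H_1,\dots,H_k$, $\lim_{n\to\infty}\mathbb{P}(\mathbb{G}_n(t_1)\equiv_rH_1,\dots,\mathbb{G}_n(t_k)\equiv_rH_k)=\mathbb{P}(\mathbb{G}(t_1)\equiv_rH_1,\dots,\mathbb{G}(t_k)\equiv_rH_k)$; (ii) for all $\varepsilon>0$, $\lim_{\delta\to0}\mathbb{P}(d(\mathbb{G}(1),\mathbb{G}(1-\delta))\ge\varepsilon)=0$; (iii) for all $\varepsilon>0$, there exists $\delta_n\in(0,1)$ such that $\lim_{n\to\infty}\mathbb{P}\big(\exists\, t<t'<t''<t+\delta_n:\ d(\mathbb{G}_n(t),\mathbb{G}_n(t'))\ge\varepsilon\text{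 and }d(\mathbb{G}_n(t'),\mathbb{G}_n(t''))\ge\varepsilon\big)=0$.
   Formalization: In "linearly growing", the coupling probabilities for m ≥ n are only required to tend to 1 uniformly in m ≥ n (equal to 1 is impossible), and each k_n(·) is assumed càdlàg, so that the process P_{k_n(t)}(G_n) is càdlàg and local process convergence is defined. *)

theory Defs
  imports "HOL-Probability.Probability"
begin

record 'v graph =
  verts :: "'v set"
  edges :: "'v set set"

definition simple_graph :: "'v graph \<Rightarrow> bool" where
  "simple_graph G \<longleftrightarrow> (\<forall>e\<in>edges G. e \<subseteq> verts G \<and> card e = 2)"

definition locally_finite_graph :: "'v graph \<Rightarrow> bool" where
  "locally_finite_graph G \<longleftrightarrow> (\<forall>v\<in>verts G. finite {e \<in> edges G. v \<in> e})"

definition adj :: "'v graph \<Rightarrow> 'v rel" where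
  "adj G = {(u, v). {u, v} \<in> edges G}"

definition connected_graph :: "'v graph \<Rightarrow> bool" where
  "connected_graph G \<longleftrightarrow>
     verts G \<noteq> {} \<and> (\<forall>u\<in>verts G. \<forall>v\<in>verts G. (u, v) \<in> (adj G)\<^sup>*)"

definition component :: "'v graph \<Rightarrow> 'v \<Rightarrow> 'v set" where
  "component G v = {u \<in> verts G. (v, u) \<in> (adj G)\<^sup>*}"

definition induced_subgraph :: "'v graph \<Rightarrow> 'v set \<Rightarrow> 'v graph" where
  "induced_subgraph G S = \<lparr>verts = verts G \<inter> S, edges = {e \<in> edges G. e \<subseteq> S}\<rparr>"

text \<open>
  The triple \<open>(G, o, w)\<close> of a graph, a root and edge weights.  The weights are a total function on
  vertex sets; only its values on the edges of \<open>G\<close> matter.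
\<close>
type_synonym 'v rwgraph = "'v graph \<times> 'v \<times> ('v set \<Rightarrow> real)"

abbreviation graph_of :: "'v rwgraph \<Rightarrow> 'v graph" where "graph_of \<equiv> fst"
abbreviation root_of :: "'v rwgraph \<Rightarrow> 'v" where "root_of \<equiv> (\<lambda>x. fst (snd x))"
abbreviation weight_of :: "'v rwgraph \<Rightarrow> 'v set \<Rightarrow> real" where "weight_of \<equiv> (\<lambda>x. snd (snd x))"

definition rooted_graph :: "'v graph \<times> 'v \<Rightarrow> bool" where
  "rooted_graph = (\<lambda>(G, \<rho>). simple_graph G \<and> locally_finite_graph G \<and> \<rho> \<in> verts G)"

definition rooted_weighted_graph :: "'v rwgraph \<Rightarrow> bool" where
  "rooted_weighted_graph = (\<lambda>(G, \<rho>, w). rooted_graph (G, \<rho>) \<and> inj_on w (edges G))"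

fun cluster :: "'v rwgraph \<Rightarrow> 'v \<Rightarrow> real \<Rightarrow> 'v set" where
  "cluster (G, \<rho>, w) v p = component \<lparr>verts = verts G, edges = {e \<in> edges G. w e \<le> p}\<rparr> v"

fun remove_edge :: "'v rwgraph \<Rightarrow> 'v set \<Rightarrow> 'v rwgraph" where
  "remove_edge (G, \<rho>, w) e = (\<lparr>verts = verts G, edges = edges G - {e}\<rparr>, \<rho>, w)"

definition spanning_forest :: "'v rwgraph \<Rightarrow> 'v graph" where
  "spanning_forest \<GG> =
     \<lparr>verts = verts (graph_of \<GG>),
      edges = {e \<in> edges (graph_of \<GG>). \<exists>u v. e = {u, v} \<and>
         (let C\<^sub>u = cluster (remove_edge \<GG> e) u (weight_of \<GG> e);
              C\<^sub>v = cluster (remove_edge \<GG> e) v (weight_of \<GG> e)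
          in C\<^sub>u \<inter> C\<^sub>v = {} \<and> \<not> (infinite C\<^sub>u \<and> infinite C\<^sub>v))}\<rparr>"

definition root_component :: "'v graph \<Rightarrow> 'v \<Rightarrow> 'v graph" where
  "root_component H \<rho> = induced_subgraph H (component H \<rho>)"

definition msf :: "'v rwgraph \<Rightarrow> 'v rwgraph" where
  "msf \<GG> = (root_component (spanning_forest \<GG>) (root_of \<GG>), root_of \<GG>, weight_of \<GG>)"

definition boundary_edges :: "'v graph \<Rightarrow> 'v graph \<Rightarrow> 'v set set" where
  "boundary_edges G T = {e \<in> edges G. card (e \<inter> verts T) = 1}"

definition prim_step :: "'v graph \<Rightarrow> ('v set \<Rightarrow> real) \<Rightarrow> 'v graph \<Rightarrow> 'v graph" where
  "prim_step G w T =
     (if boundary_edges G T = {} then T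
      else let e = arg_min_on w (boundary_edges G T)
           in \<lparr>verts = verts T \<union> e, edges = insert e (edges T)\<rparr>)"

text \<open>
  \<open>prim_tree \<GG> k\<close> is \<open>T\<^sub>k\<close> for \<open>k \<ge> 1\<close>; the tree \<open>T\<^sub>1\<close> is the single root, and the value at
  the unused index \<open>0\<close> is set to \<open>T\<^sub>1\<close>.
\<close>
definition prim_tree :: "'v rwgraph \<Rightarrow> nat \<Rightarrow> 'v graph" where
  "prim_tree \<GG> k =
     (prim_step (graph_of \<GG>) (weight_of \<GG>) ^^ (k - 1)) \<lparr>verts = {root_of \<GG>}, edges = {}\<rparr>"

definition prim :: "nat \<Rightarrow> 'v rwgraph \<Rightarrow> 'v rwgraph" where
  "prim k \<GG> = (prim_tree \<GG> k, root_of \<GG>, weight_of \<GG>)"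

definition invasion_cluster :: "'v rwgraph \<Rightarrow> 'v rwgraph" where
  "invasion_cluster \<GG> =
     (\<lparr>verts = (\<Union>k\<in>{1..}. verts (prim_tree \<GG> k)), edges = (\<Union>k\<in>{1..}. edges (prim_tree \<GG> k))\<rparr>,
      root_of \<GG>, weight_of \<GG>)"

definition expanded_invasion_cluster :: "real \<Rightarrow> 'v rwgraph \<Rightarrow> 'v rwgraph" where
  "expanded_invasion_cluster p \<GG> =
     (root_component
        \<lparr>verts = verts (graph_of \<GG>),
         edges = edges (graph_of (invasion_cluster \<GG>)) \<union>
                 {e \<in> edges (graph_of (msf \<GG>)). weight_of \<GG> e \<le> p}\<rparr> (root_of \<GG>),
      root_of \<GG>, weight_of \<GG>)"

definition ball_graph :: "real \<Rightarrow> 'v rwgraph \<Rightarrow> 'v graph" where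
  "ball_graph r \<GG> =
     induced_subgraph (graph_of \<GG>) {v. \<exists>n. real n \<le> r \<and> (root_of \<GG>, v) \<in> adj (graph_of \<GG>) ^^ n}"

text \<open>
  For \<open>r = 0\<close> the bound \<open>1 / r\<close> is irrelevant, because then the ball has no edges.
\<close>
definition local_equiv :: "real \<Rightarrow> 'v rwgraph \<Rightarrow> 'u rwgraph \<Rightarrow> bool" where
  "local_equiv r \<GG> \<HH> \<longleftrightarrow>
     (let B = ball_graph r \<GG>; B' = ball_graph r \<HH> in
      \<exists>\<phi>. bij_betw \<phi> (verts B) (verts B') \<and> \<phi> (root_of \<GG>) = root_of \<HH> \<and>
          (\<forall>u\<in>verts B. \<forall>v\<in>verts B. {u, v} \<in> edges B \<longleftrightarrow> {\<phi> u, \<phi> v} \<in> edges B') \<and>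
          (\<forall>e\<in>edges B. \<bar>weight_of \<GG> e - weight_of \<HH> (\<phi> ` e)\<bar> \<le> 1 / r))"

text \<open>The supremum is taken in the extended reals; if it is infinite, the distance is \<open>0\<close>.\<close>
definition local_dist :: "'v rwgraph \<Rightarrow> 'u rwgraph \<Rightarrow> real" where
  "local_dist \<GG> \<HH> =
     real_of_ereal (inverse (1 + (SUP r\<in>{r. 0 \<le> r \<and> local_equiv r \<GG> \<HH>}. ereal r)))"

definition local_dist_unweighted :: "'v graph \<times> 'v \<Rightarrow> 'u graph \<times> 'u \<Rightarrow> real" where
  "local_dist_unweighted = (\<lambda>(G, \<rho>) (G', \<rho>'). local_dist (G, \<rho>, \<lambda>_. 1) (G', \<rho>', \<lambda>_. 1))"

text \<open>
  A random graph is a random variable with values in the (simple, locally finite) graphs with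
  vertices in \<open>\<nat>\<close>.  A connected locally finite graph is countable and every notion used below is
  invariant under isomorphism, so that this labelling loses no generality.
\<close>
definition graph_space :: "nat graph measure" where
  "graph_space =
     (let \<Omega> = {G. simple_graph G \<and> locally_finite_graph G} in
      sigma \<Omega> ({{G \<in> \<Omega>. v \<in> verts G} | v. True} \<union> {{G \<in> \<Omega>. {u, v} \<in> edges G} | u v. True}))"

definition rooted_graph_space :: "(nat graph \<times> nat) measure" where
  "rooted_graph_space =
     restrict_space (graph_space \<Otimes>\<^sub>M count_space UNIV) {(G, \<rho>). \<rho> \<in> verts G}"

definition all_edges :: "nat set set" where
  "all_edges = {e. card e = 2}"

definition weight_space :: "(nat set \<Rightarrow> real) measure" where
  "weight_space = vimage_algebra UNIV (\<lambda>w. restrict w all_edges) (\<Pi>\<^sub>M e\<in>all_edges. borel)"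

text \<open>
  Injectivity of the weights is not imposed on the points of this space: i.i.d. uniform weights are
  only almost surely injective.
\<close>
definition rwgraph_space :: "nat rwgraph measure" where
  "rwgraph_space =
     restrict_space (graph_space \<Otimes>\<^sub>M (count_space UNIV \<Otimes>\<^sub>M weight_space)) {(G, \<rho>, w). \<rho> \<in> verts G}"

text \<open>
  The weights are indexed by all pairs of natural numbers, so that an i.i.d. family independent of
  the graph makes sense also when the graph, and thus its edge set, is random.
\<close>
definition standard_extension_rooted :: "'a measure \<Rightarrow> ('a \<Rightarrow> nat rwgraph) \<Rightarrow> bool" where
  "standard_extension_rooted M \<GG> \<longleftrightarrow>
     prob_space M \<and>
     (\<lambda>\<omega>. (graph_of (\<GG> \<omega>), root_of (\<GG> \<omega>))) \<in> M \<rightarrow>\<^sub>M rooted_graph_space \<and>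
     prob_space.indep_vars M (\<lambda>_. borel) (\<lambda>e \<omega>. weight_of (\<GG> \<omega>) e) all_edges \<and>
     (\<forall>e\<in>all_edges. distr M borel (\<lambda>\<omega>. weight_of (\<GG> \<omega>) e) = uniform_measure lborel {0..1}) \<and>
     prob_space.indep_set M
       (sets (vimage_algebra (space M) (\<lambda>\<omega>. (graph_of (\<GG> \<omega>), root_of (\<GG> \<omega>))) rooted_graph_space))
       (sets (vimage_algebra (space M) (\<lambda>\<omega>. weight_of (\<GG> \<omega>)) weight_space))"

definition graph_algebra :: "'a measure \<Rightarrow> ('a \<Rightarrow> nat rwgraph) \<Rightarrow> 'a measure" where
  "graph_algebra M \<GG> = vimage_algebra (space M) (\<lambda>\<omega>. graph_of (\<GG> \<omega>)) graph_space"

text \<open>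
  For a finite random graph, the root is moreover uniform in the vertex set: its conditional
  distribution given the graph is uniform.
\<close>
definition standard_extension :: "'a measure \<Rightarrow> ('a \<Rightarrow> nat rwgraph) \<Rightarrow> bool" where
  "standard_extension M \<GG> \<longleftrightarrow>
     standard_extension_rooted M \<GG> \<and>
     (\<forall>v. AE \<omega> in M. real_cond_exp M (graph_algebra M \<GG>) (\<lambda>\<omega>. indicator {v} (root_of (\<GG> \<omega>))) \<omega> =
            (if v \<in> verts (graph_of (\<GG> \<omega>)) then 1 / real (card (verts (graph_of (\<GG> \<omega>)))) else 0))"

definition bounded_local_continuous :: "(nat graph \<times> nat \<Rightarrow> real) \<Rightarrow> bool" where
  "bounded_local_continuous h \<longleftrightarrow>
     (\<exists>B. \<forall>x. rooted_graph x \<longrightarrow> \<bar>h x\<bar> \<le> B) \<and>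
     (\<forall>x. rooted_graph x \<longrightarrow> (\<forall>\<epsilon>>0. \<exists>\<delta>>0. \<forall>y. rooted_graph y \<longrightarrow>
        local_dist_unweighted x y < \<delta> \<longrightarrow> \<bar>h x - h y\<bar> < \<epsilon>))"

definition local_convergence_in_probability ::
  "(nat \<Rightarrow> 'a measure) \<Rightarrow> (nat \<Rightarrow> 'a \<Rightarrow> nat rwgraph) \<Rightarrow> 'b measure \<Rightarrow> ('b \<Rightarrow> nat rwgraph) \<Rightarrow> bool" where
  "local_convergence_in_probability M \<GG> M' \<GG>' \<longleftrightarrow>
     (\<forall>h. bounded_local_continuous h \<longrightarrow> (\<forall>\<epsilon>>0.
       (\<lambda>n. \<P>(\<omega> in M n.
          \<bar>real_cond_exp (M n) (graph_algebra (M n) (\<GG> n))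
              (\<lambda>\<omega>. h (graph_of (\<GG> n \<omega>), root_of (\<GG> n \<omega>))) \<omega>
           - (\<integral>\<omega>'. h (graph_of (\<GG>' \<omega>'), root_of (\<GG>' \<omega>')) \<partial>M')\<bar> \<ge> \<epsilon>)) \<longlonglongrightarrow> 0))"

definition theta :: "'b measure \<Rightarrow> ('b \<Rightarrow> nat rwgraph) \<Rightarrow> real \<Rightarrow> real" where
  "theta M \<GG> p = \<P>(\<omega> in M. infinite (cluster (\<GG> \<omega>) (root_of (\<GG> \<omega>)) p))"

definition p_crit :: "'b measure \<Rightarrow> ('b \<Rightarrow> nat rwgraph) \<Rightarrow> real" where
  "p_crit M \<GG> = Inf {p \<in> {0..1}. theta M \<GG> p > 0}"

definition theta_inv :: "'b measure \<Rightarrow> ('b \<Rightarrow> nat rwgraph) \<Rightarrow> real \<Rightarrow> real" where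
  "theta_inv M \<GG> t = (if t = 1 then 1 else Inf {p \<in> {0..1}. theta M \<GG> p > t})"

text \<open>Right-continuity with left limits on \<open>[0,1]\<close>, with respect to a distance \<open>D\<close> on \<open>S\<close>.\<close>
definition cadlag_path :: "('s \<Rightarrow> 's \<Rightarrow> real) \<Rightarrow> 's set \<Rightarrow> (real \<Rightarrow> 's) \<Rightarrow> bool" where
  "cadlag_path D S x \<longleftrightarrow>
     (\<forall>t\<in>{0..<1}. ((\<lambda>s. D (x s) (x t)) \<longlongrightarrow> 0) (at_right t)) \<and>
     (\<forall>t\<in>{0<..1}. \<exists>y\<in>S. ((\<lambda>s. D (x s) y) \<longlongrightarrow> 0) (at_left t))"

definition cadlag_process :: "'a measure \<Rightarrow> (real \<Rightarrow> 'a \<Rightarrow> nat rwgraph) \<Rightarrow> bool" where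
  "cadlag_process M X \<longleftrightarrow>
     (\<forall>t\<in>{0..1}. X t \<in> M \<rightarrow>\<^sub>M rwgraph_space) \<and>
     (AE \<omega> in M. cadlag_path local_dist (Collect rooted_weighted_graph) (\<lambda>t. X t \<omega>))"

definition local_process_convergence ::
  "(nat \<Rightarrow> 'a measure) \<Rightarrow> (nat \<Rightarrow> real \<Rightarrow> 'a \<Rightarrow> nat rwgraph) \<Rightarrow>
   'b measure \<Rightarrow> (real \<Rightarrow> 'b \<Rightarrow> nat rwgraph) \<Rightarrow> bool" where
  "local_process_convergence M X M' X' \<longleftrightarrow>
     (\<forall>n\<ge>1. cadlag_process (M n) (X n)) \<and> cadlag_process M' X' \<and>
     (\<forall>r\<ge>1. \<forall>tHs. (\<forall>(t, H)\<in>set tHs. t \<in> {0..1} \<and> rooted_weighted_graph H) \<longrightarrow>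
        (\<lambda>n. \<P>(\<omega> in M n. \<forall>(t, H)\<in>set tHs. local_equiv (real r) (X n t \<omega>) (H :: nat rwgraph)))
          \<longlonglongrightarrow> \<P>(\<omega> in M'. \<forall>(t, H)\<in>set tHs. local_equiv (real r) (X' t \<omega>) H)) \<and>
     (\<forall>\<epsilon>>0. ((\<lambda>\<delta>. \<P>(\<omega> in M'. local_dist (X' 1 \<omega>) (X' (1 - \<delta>) \<omega>) \<ge> \<epsilon>)) \<longlongrightarrow> 0) (at_right 0)) \<and>
     (\<forall>\<epsilon>>0. \<exists>\<delta>. (\<forall>n. 0 < \<delta> n \<and> \<delta> n < 1) \<and>
        (\<lambda>n. \<P>(\<omega> in M n. \<exists>t t' t''. {t, t', t''} \<subseteq> {0..1} \<and> t < t' \<and> t' < t'' \<and> t'' < t + \<delta> n \<and>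
           local_dist (X n t \<omega>) (X n t' \<omega>) \<ge> \<epsilon> \<and> local_dist (X n t' \<omega>) (X n t'' \<omega>) \<ge> \<epsilon>)) \<longlonglongrightarrow> 0)"

text \<open>
  Couplings of \<open>(\<GG>\<^sub>n)\<^sub>n\<close> and \<open>\<GG>'\<close>, as joint laws with the prescribed marginals.
\<close>
definition coupling ::
  "(nat \<Rightarrow> nat rwgraph measure) \<Rightarrow> nat rwgraph measure \<Rightarrow>
   ((nat \<Rightarrow> nat rwgraph) \<times> nat rwgraph) measure \<Rightarrow> bool" where
  "coupling \<mu> \<mu>' Q \<longleftrightarrow>
     prob_space Q \<and> sets Q = sets ((\<Pi>\<^sub>M n\<in>{1..}. rwgraph_space) \<Otimes>\<^sub>M rwgraph_space) \<and>
     (\<forall>n\<ge>1. distr Q rwgraph_space (\<lambda>(x, y). x n) = \<mu> n) \<and> distr Q rwgraph_space snd = \<mu>'"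

text \<open>
  Right-continuity with left limits of each \<open>k\<^sub>n\<close> is what makes the process
  \<open>t \<mapsto> prim (k\<^sub>n t) \<GG>\<^sub>n\<close> right-continuous with left limits, as local process convergence presupposes.

  The coupling condition asks that the probability of local agreement up to radius \<open>k\<^sub>n(0)\<close>
  tends to \<open>1\<close>, uniformly over \<open>m \<ge> n\<close>.  This contains the case that these probabilities are all
  equal to \<open>1\<close>; but that case alone would be void, because the expected degree of the root in the
  spanning tree of \<open>\<GG>\<^sub>m\<close> is \<open>2 - 2/m\<close>, so that almost sure agreement of
  \<open>msf \<GG>\<^sub>m\<close> and \<open>msf \<GG>'\<close> up to a radius \<open>\<ge> 1\<close> is possible for at most one \<open>m\<close>.
\<close>
definition linearly_growing ::
  "(nat \<Rightarrow> 'a measure) \<Rightarrow> (nat \<Rightarrow> 'a \<Rightarrow> nat rwgraph) \<Rightarrow> 'b measure \<Rightarrow> ('b \<Rightarrow> nat rwgraph) \<Rightarrow>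
   (nat \<Rightarrow> real \<Rightarrow> nat) \<Rightarrow> bool" where
  "linearly_growing M \<GG> M' \<GG>' k \<longleftrightarrow>
     (\<forall>n\<ge>1. cadlag_path dist UNIV (k n)) \<and>
     (\<forall>t\<in>{0..1}. (\<lambda>n. real (k n t) / real n) \<longlonglongrightarrow> t) \<and>
     filterlim (\<lambda>n. k n 0) at_top sequentially \<and>
     (\<exists>Q. coupling (\<lambda>n. distr (M n) rwgraph_space (\<GG> n)) (distr M' rwgraph_space \<GG>') Q \<and>
        (\<lambda>n. INF m\<in>{n..}. \<P>(z in Q.
            local_equiv (real (k n 0)) (fst z m) (snd z) \<and>
            local_equiv (real (k n 0)) (msf (fst z m)) (msf (snd z)))) \<longlonglongrightarrow> 1)"

end

theory Submission
  imports Defs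
begin

text \<open>
  Near the root, Prim's tree and the expanded invasion cluster are both made of edges of the
  minimum spanning forest, and the coupling makes the forests of \<open>\<GG>\<^sub>n\<close> and of the limit \<open>\<GG>\<close>
  agree on large balls.  What has to be understood is therefore which of these finitely many
  edges Prim's algorithm has collected after \<open>k\<^sub>n(t) \<approx> t n\<close> steps.  The answer is governed by one
  deterministic fact (\<open>unexhausted_cluster_keeps_low\<close>): as long as the cluster at level \<open>p\<close> of
  some vertex of \<open>T\<^sub>K\<close> is not swallowed by the growing tree, every edge added after step \<open>K\<close> has
  weight at most \<open>p\<close>, so that the tree stays inside the level-\<open>p\<close> clusters of the vertices of \<open>T\<^sub>K\<close>.

  Levels below \<open>\<theta>\<inverse>(t)\<close> are exhausted (\<open>lower\<close>).  For \<open>p < \<theta>\<inverse>(t)\<close> strict monotonicity gives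
  \<open>\<theta>(p) < t\<close>.  If a level-\<open>p\<close> cluster of a vertex of \<open>T\<^sub>K\<close> were not swallowed, all of the about \<open>t n\<close>
  vertices of the tree would lie in the level-\<open>p\<close> clusters of boundedly many vertices.  Clusters
  with fewer than \<open>j\<close> vertices contribute a bounded number, the others at most the number of all
  vertices in clusters of size at least \<open>j\<close>, which is about \<open>\<theta>\<^sub>j(p) n < t n\<close>.

  Levels above \<open>\<theta>\<inverse>(t)\<close> are not needed (\<open>upper\<close>).  Let \<open>\<theta>(p\<^sub>1) > t\<close> and \<open>p\<^sub>2 > p\<^sub>1\<close>.  In the limit graph
  the tree meets an infinite cluster at level \<open>p\<^sub>1\<close>, hence so does the invasion cluster
  (\<open>invasion_hits_infinite_cluster\<close>), and from some step \<open>K\<close> on the invasion uses only weights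
  up to \<open>p\<^sub>1\<close>.  Finitely many further steps are copied to \<open>\<GG>\<^sub>n\<close>, where by the pigeonhole principle
  some vertex of \<open>T\<^sub>K\<close> has a cluster of size at least \<open>j\<close> at level \<open>p\<^sub>2\<close>.  By the assumption on
  separated pairs, almost all vertices in clusters of size at least \<open>j\<close> lie in a single cluster of about
  \<open>\<theta>(p\<^sub>2) n > k\<^sub>n(t)\<close> vertices (\<open>intermediate_prob\<close>), so that this cluster is not swallowed
  in \<open>k\<^sub>n(t)\<close> steps and only weights up to \<open>p\<^sub>2\<close> occur after step \<open>K\<close>.

  Together, with high probability the tree consists near the root of \<open>T\<^sub>K\<close> and of the edges of the
  spanning tree of weight at most \<open>\<theta>\<inverse>(t)\<close> that are connected to the root in this way; edges with
  a weight close to \<open>\<theta>\<inverse>(t)\<close> do not occur near the root, because weights have no atoms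
  (\<open>prim_local_agreement\<close>, \<open>closeness\<close>).

  The probabilistic input on \<open>\<GG>\<^sub>n\<close> consists of two statements.  The number of vertices in clusters
  of size at least \<open>j\<close>, divided by \<open>n\<close>, tends to \<open>\<theta>\<^sub>j(p)\<close> (\<open>concentration\<close>): its conditional mean given the graph is
  the average over the vertices of a local function, and its conditional variance is small, because far
  apart vertices have independent clusters up to size \<open>j\<close>.  And since the root is uniform, a property
  unlikely at the root is unlikely throughout a ball of bounded radius around the root (\<open>mass_transport\<close>).

  All comparisons take place on the coupling space.  Errors are measured by outer
  probability (\<open>outer_le\<close>), so that events that compare two random graphs need no proof of
  measurability.
\<close>

section \<open>Reachability and clusters\<close>

definition edge_rel :: "'v set set \<Rightarrow> 'v rel" where
  "edge_rel E = {(u, v). {u, v} \<in> E}"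

lemma adj_eq: "adj G = edge_rel (edges G)"
  by (simp add: adj_def edge_rel_def)

lemma edge_rel_sym: "sym (edge_rel E)"
  by (auto simp: sym_def edge_rel_def insert_commute)

lemma edge_rel_rtrancl_sym: "(u, v) \<in> (edge_rel E)\<^sup>* \<Longrightarrow> (v, u) \<in> (edge_rel E)\<^sup>*"
  by (meson edge_rel_sym sym_rtrancl symE)

lemma edge_rel_mono: "E \<subseteq> E' \<Longrightarrow> edge_rel E \<subseteq> edge_rel E'"
  by (auto simp: edge_rel_def)

lemma edge_rel_rtrancl_mono: "E \<subseteq> E' \<Longrightarrow> (u, v) \<in> (edge_rel E)\<^sup>* \<Longrightarrow> (u, v) \<in> (edge_rel E')\<^sup>*"
  by (meson edge_rel_mono rtrancl_mono subsetD)

lemma rtrancl_exits: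
  assumes "(u, x) \<in> r\<^sup>*" "u \<in> S" "x \<notin> S"
  obtains a b where "(u, a) \<in> r\<^sup>*" "(a, b) \<in> r" "a \<in> S" "b \<notin> S" "(b, x) \<in> r\<^sup>*"
proof -
  have "\<exists>a b. (u, a) \<in> r\<^sup>* \<and> (a, b) \<in> r \<and> a \<in> S \<and> b \<notin> S \<and> (b, x) \<in> r\<^sup>*"
    using assms
  proof (induction rule: converse_rtrancl_induct)
    case base then show ?case by simp
  next
    case (step y z)
    show ?case
    proof (cases "z \<in> S")
      case True then show ?thesis using step by (meson converse_rtrancl_into_rtrancl)
    next
      case False then show ?thesis using step by blast
    qed
  qed
  then show thesis using that by blast
qed

abbreviation low_edges :: "'v graph \<Rightarrow> ('v set \<Rightarrow> real) \<Rightarrow> real \<Rightarrow> 'v set set" where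
  "low_edges G w p \<equiv> {e \<in> edges G. w e \<le> p}"

lemma cluster_eq: "cluster (G, \<rho>, w) v p = {u \<in> verts G. (v, u) \<in> (edge_rel (low_edges G w p))\<^sup>*}"
  by (simp add: component_def adj_eq)

lemma cluster_remove_edge:
  "cluster (remove_edge (G, \<rho>, w) e) v p =
     {u \<in> verts G. (v, u) \<in> (edge_rel {f \<in> edges G - {e}. w f \<le> p})\<^sup>*}"
  by (simp add: component_def adj_eq)

declare cluster.simps [simp del] remove_edge.simps [simp del]

lemma simple_edgeD:
  assumes "simple_graph G" "{a, b} \<in> edges G"
  shows "a \<in> verts G" "b \<in> verts G" "a \<noteq> b"
  using assms by (auto simp: simple_graph_def)

lemma simple_edgeE:
  assumes "simple_graph G" "e \<in> edges G"
  obtains a b where "e = {a, b}" "a \<noteq> b" "a \<in> verts G" "b \<in> verts G"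
  using assms unfolding simple_graph_def by (metis card_2_iff insert_subset)

lemma rtrancl_verts:
  assumes "simple_graph G" "E \<subseteq> edges G" "(u, v) \<in> (edge_rel E)\<^sup>*" "u \<in> verts G"
  shows "v \<in> verts G"
  using assms(3,4,1,2) by (induction rule: rtrancl_induct) (auto simp: edge_rel_def dest: simple_edgeD(2))

lemma spanning_forest_edge_iff:
  assumes "a \<noteq> b"
  shows "{a, b} \<in> edges (spanning_forest (G, \<rho>, w)) \<longleftrightarrow> {a, b} \<in> edges G \<and>
     (let C = (\<lambda>v. {u \<in> verts G. (v, u) \<in> (edge_rel {f \<in> edges G - {{a, b}}. w f \<le> w {a, b}})\<^sup>*})
      in C a \<inter> C b = {} \<and> \<not> (infinite (C a) \<and> infinite (C b)))"
proof -
  have *: "(\<exists>u v. {a, b} = {u, v} \<and> Q u v) \<longleftrightarrow> Q a b" if "\<And>u v. Q u v \<longleftrightarrow> Q v u" for Q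
    using that by (auto simp: doubleton_eq_iff)
  show ?thesis
    unfolding spanning_forest_def Let_def cluster_remove_edge fst_conv snd_conv graph.simps mem_Collect_eq
    by (subst *) (auto simp: Int_commute)
qed

lemma spanning_forest_edges: "edges (spanning_forest (G, \<rho>, w)) \<subseteq> edges G"
  by (auto simp: spanning_forest_def)

lemma verts_spanning_forest [simp]: "verts (spanning_forest (G, \<rho>, w)) = verts G"
  by (simp add: spanning_forest_def)

section \<open>Prim's algorithm and its ponds\<close>

locale prim_graph =
  fixes G :: "'v graph" and \<rho> :: 'v and w :: "'v set \<Rightarrow> real"
  assumes simple: "simple_graph G" and locfin: "locally_finite_graph G" and root: "\<rho> \<in> verts G"
begin

text \<open>
  The index is shifted so that \<open>tr k\<close> has \<open>k\<close> edges as long as the boundary is nonempty; thus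
  no case distinction at the index \<open>0\<close> is needed.
\<close>
definition tr :: "nat \<Rightarrow> 'v graph" where "tr k = prim_tree (G, \<rho>, w) (Suc k)"

abbreviation "bd k \<equiv> boundary_edges G (tr k)"

lemma prim_tree_tr: "prim_tree (G, \<rho>, w) k = tr (k - 1)"
  by (cases k) (auto simp: tr_def prim_tree_def)

lemma tr_0 [simp]: "verts (tr 0) = {\<rho>}" "edges (tr 0) = {}"
  by (simp_all add: tr_def prim_tree_def)

lemma tr_Suc: "tr (Suc k) = prim_step G w (tr k)"
  by (simp add: tr_def prim_tree_def)

lemma boundary_edgesE:
  assumes "e \<in> boundary_edges G t"
  obtains a b where "e = {a, b}" "a \<in> verts t" "b \<notin> verts t" "e \<in> edges G" "b \<in> verts G"
proof -
  have e: "e \<in> edges G" "card (e \<inter> verts t) = 1" using assms by (auto simp: boundary_edges_def)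
  obtain a b where ab: "e = {a, b}" "a \<noteq> b" "a \<in> verts G" "b \<in> verts G"
    using simple e(1) by (rule simple_edgeE)
  show thesis
  proof (cases "a \<in> verts t")
    case True
    then have "b \<notin> verts t" using e(2) ab by (auto simp: Int_insert_left split: if_splits)
    then show ?thesis using that[of a b] True ab e by auto
  next
    case False
    then have "b \<in> verts t" using e(2) ab by (auto simp: Int_insert_left split: if_splits)
    then show ?thesis using that[of b a] False ab e by (simp add: insert_commute)
  qed
qed

lemma boundary_edgesI:
  "{a, b} \<in> edges G \<Longrightarrow> a \<in> verts t \<Longrightarrow> b \<notin> verts t \<Longrightarrow> {a, b} \<in> boundary_edges G t"
  by (auto simp: boundary_edges_def Int_insert_left)

lemma finite_boundary:
  assumes "finite (verts t)" "verts t \<subseteq> verts G"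
  shows "finite (boundary_edges G t)"
proof (rule finite_subset)
  show "boundary_edges G t \<subseteq> (\<Union>v\<in>verts t. {e \<in> edges G. v \<in> e})"
  proof
    fix e assume e: "e \<in> boundary_edges G t"
    then obtain a b where "e = {a, b}" "a \<in> verts t" "e \<in> edges G" by (rule boundary_edgesE)
    then show "e \<in> (\<Union>v\<in>verts t. {e \<in> edges G. v \<in> e})" by auto
  qed
  show "finite (\<Union>v\<in>verts t. {e \<in> edges G. v \<in> e})"
    using assms locfin by (auto simp: locally_finite_graph_def)
qed

lemma tr_sub: "finite (verts (tr k)) \<and> verts (tr k) \<subseteq> verts G"
proof (induction k)
  case 0 then show ?case using root by simp
next
  case (Suc k)
  have "e \<subseteq> verts G \<and> finite e" if "e \<in> edges G" for e
    using simple that by (auto elim!: simple_edgeE)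
  moreover have "arg_min_on w (bd k) \<in> edges G" if "bd k \<noteq> {}"
    using arg_min_if_finite(1)[OF finite_boundary that] Suc by (auto simp: boundary_edges_def)
  ultimately show ?case using Suc by (auto simp: tr_Suc prim_step_def Let_def)
qed

lemmas finite_verts_tr = tr_sub[THEN conjunct1] and verts_tr_sub = tr_sub[THEN conjunct2]

lemma finite_bd: "finite (bd k)"
  using finite_boundary tr_sub by blast

lemma tr_stop: "bd k = {} \<Longrightarrow> tr (Suc k) = tr k"
  by (simp add: tr_Suc prim_step_def)

lemma tr_step:
  assumes "bd k \<noteq> {}"
  obtains a b where "a \<in> verts (tr k)" "b \<notin> verts (tr k)" "b \<in> verts G" "{a, b} \<in> edges G"
    "verts (tr (Suc k)) = insert b (verts (tr k))" "edges (tr (Suc k)) = insert {a, b} (edges (tr k))"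
    "\<And>f. f \<in> bd k \<Longrightarrow> w {a, b} \<le> w f" "{a, b} = arg_min_on w (bd k)"
proof -
  let ?e = "arg_min_on w (bd k)"
  have e: "?e \<in> bd k" "\<And>f. f \<in> bd k \<Longrightarrow> w ?e \<le> w f"
    using arg_min_if_finite[OF finite_bd assms, of w] by (auto simp: not_less)
  obtain a b where ab: "?e = {a, b}" "a \<in> verts (tr k)" "b \<notin> verts (tr k)" "?e \<in> edges G" "b \<in> verts G"
    using e(1) by (rule boundary_edgesE)
  show thesis
    by (rule that[of a b]) (use ab e assms in \<open>auto simp: tr_Suc prim_step_def Let_def\<close>)
qed

lemma tr_mono_Suc: "verts (tr k) \<subseteq> verts (tr (Suc k)) \<and> edges (tr k) \<subseteq> edges (tr (Suc k))"
proof (cases "bd k = {}")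
  case True then show ?thesis using tr_stop by auto
next
  case False then show ?thesis by (elim tr_step[of k]) auto
qed

lemma verts_tr_mono: "j \<le> k \<Longrightarrow> verts (tr j) \<subseteq> verts (tr k)"
  using lift_Suc_mono_le[of "\<lambda>k. verts (tr k)" j k] tr_mono_Suc by blast

lemma edges_tr_mono: "j \<le> k \<Longrightarrow> edges (tr j) \<subseteq> edges (tr k)"
  using lift_Suc_mono_le[of "\<lambda>k. edges (tr k)" j k] tr_mono_Suc by blast

lemma tr_invariants:
  "edges (tr k) \<subseteq> edges G \<and> \<Union> (edges (tr k)) \<subseteq> verts (tr k) \<and> finite (edges (tr k)) \<and>
   (\<forall>v\<in>verts (tr k). (\<rho>, v) \<in> (edge_rel (edges (tr k)))\<^sup>*)"
proof (induction k)
  case 0 then show ?case by simp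
next
  case (Suc k)
  show ?case
  proof (cases "bd k = {}")
    case True then show ?thesis using Suc tr_stop by simp
  next
    case False
    then obtain a b where s: "a \<in> verts (tr k)" "b \<notin> verts (tr k)" "b \<in> verts G" "{a, b} \<in> edges G"
      "verts (tr (Suc k)) = insert b (verts (tr k))" "edges (tr (Suc k)) = insert {a, b} (edges (tr k))"
      by (rule tr_step) blast
    have old: "(\<rho>, v) \<in> (edge_rel (edges (tr (Suc k))))\<^sup>*" if "v \<in> verts (tr k)" for v
      using Suc that edge_rel_rtrancl_mono[of "edges (tr k)" "edges (tr (Suc k))"] tr_mono_Suc by blast
    have "(a, b) \<in> edge_rel (edges (tr (Suc k)))" using s by (auto simp: edge_rel_def)
    then have "(\<rho>, b) \<in> (edge_rel (edges (tr (Suc k))))\<^sup>*"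
      using old[OF s(1)] by (rule rtrancl_into_rtrancl[rotated])
    then have "\<forall>v\<in>verts (tr (Suc k)). (\<rho>, v) \<in> (edge_rel (edges (tr (Suc k))))\<^sup>*"
      using old unfolding s(5) by simp
    then show ?thesis using Suc s by auto
  qed
qed

lemma edges_tr_sub: "edges (tr k) \<subseteq> edges G" 
  and edges_tr_verts: "e \<in> edges (tr k) \<Longrightarrow> e \<subseteq> verts (tr k)"
  and finite_edges_tr: "finite (edges (tr k))"
  and tr_connected: "v \<in> verts (tr k) \<Longrightarrow> (\<rho>, v) \<in> (edge_rel (edges (tr k)))\<^sup>*"
  using tr_invariants[of k] by auto

lemma root_in_tr: "\<rho> \<in> verts (tr k)"
  using verts_tr_mono[of 0 k] by auto

lemma card_tr_le: "card (verts (tr k)) \<le> Suc k"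
proof (induction k)
  case (Suc k)
  show ?case
  proof (cases "bd k = {}")
    case True then show ?thesis using Suc tr_stop by simp
  next
    case False
    then obtain b where "verts (tr (Suc k)) = insert b (verts (tr k))" by (rule tr_step) blast
    then show ?thesis using Suc by (metis card_insert_le_m1 diff_Suc_1 Suc_le_mono card_insert_if finite_verts_tr le_SucI)
  qed
qed simp

text \<open>
  \<open>S\<close> is the part of the tree grown since the last step that used an edge heavier than \<open>q\<close>.  At
  that step every boundary edge was heavier than \<open>q\<close>, so each boundary edge of weight at most \<open>q\<close> is attached
  to a vertex added then or later.  In the theory of invasion percolation such a set is called a pond.
\<close>
lemma pond:
  "\<exists>S. S \<noteq> {} \<and> S \<subseteq> verts (tr k) \<and>
       (\<forall>u\<in>S. \<forall>v\<in>S. (u, v) \<in> (edge_rel {e \<in> edges (tr k). w e \<le> q})\<^sup>*) \<and>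
       (\<forall>e\<in>bd k. w e \<le> q \<longrightarrow> e \<inter> verts (tr k) \<subseteq> S)"
proof (induction k)
  case 0 show ?case by (rule exI[of _ "{\<rho>}"]) auto
next
  case (Suc k)
  show ?case
  proof (cases "bd k = {}")
    case True then show ?thesis using Suc tr_stop by simp
  next
    case False
    then obtain a b where s: "a \<in> verts (tr k)" "b \<notin> verts (tr k)" "b \<in> verts G" "{a, b} \<in> edges G"
      "verts (tr (Suc k)) = insert b (verts (tr k))" "edges (tr (Suc k)) = insert {a, b} (edges (tr k))"
      "\<And>f. f \<in> bd k \<Longrightarrow> w {a, b} \<le> w f"
      by (rule tr_step) blast
    obtain S where S: "S \<noteq> {}" "S \<subseteq> verts (tr k)"
      "\<forall>u\<in>S. \<forall>v\<in>S. (u, v) \<in> (edge_rel {e \<in> edges (tr k). w e \<le> q})\<^sup>*"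
      "\<forall>e\<in>bd k. w e \<le> q \<longrightarrow> e \<inter> verts (tr k) \<subseteq> S" using Suc by blast
    have bd: "e \<in> bd k" if "e \<in> bd (Suc k)" "b \<notin> e" for e
      using that s(5) by (auto simp: boundary_edges_def Int_insert_right)
    show ?thesis
    proof (cases "w {a, b} \<le> q")
      case True
      have "a \<in> S" using S(4) boundary_edgesI[OF s(4,1,2)] True s(1) by auto
      let ?R = "edge_rel {e \<in> edges (tr (Suc k)). w e \<le> q}"
      have "(u, v) \<in> ?R\<^sup>*" if "u \<in> S" "v \<in> S" for u v
        using that S(3) edge_rel_rtrancl_mono[of "{e \<in> edges (tr k). w e \<le> q}" "{e \<in> edges (tr (Suc k)). w e \<le> q}"]
          s(6) by blast
      moreover have "(a, b) \<in> ?R\<^sup>*" "(b, a) \<in> ?R\<^sup>*"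
        using s(6) True by (auto simp: edge_rel_def insert_commute)
      ultimately have "\<forall>u\<in>insert b S. \<forall>v\<in>insert b S. (u, v) \<in> ?R\<^sup>*"
        using \<open>a \<in> S\<close> by (auto intro: rtrancl_trans[of _ a] rtrancl_trans[of b a])
      moreover have "\<forall>e\<in>bd (Suc k). w e \<le> q \<longrightarrow> e \<inter> verts (tr (Suc k)) \<subseteq> insert b S"
      proof (intro ballI impI)
        fix e assume e: "e \<in> bd (Suc k)" "w e \<le> q"
        show "e \<inter> verts (tr (Suc k)) \<subseteq> insert b S"
        proof (cases "b \<in> e")
          case True
          obtain c d where "e = {c, d}" "c \<in> verts (tr (Suc k))" "d \<notin> verts (tr (Suc k))"
            using e(1) by (rule boundary_edgesE) blast
          then show ?thesis using True s(5) by auto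
        next
          case False then show ?thesis using bd[OF e(1) False] S(4) e(2) s(5) by auto
        qed
      qed
      ultimately show ?thesis using S(2) s(5) by (intro exI[of _ "insert b S"]) auto
    next
      case False
      \<comment> \<open>The step itself crosses a heavy edge, so a new pond starts at \<open>b\<close>.\<close>
      have "e \<inter> verts (tr (Suc k)) \<subseteq> {b}" if "e \<in> bd (Suc k)" "w e \<le> q" for e
      proof (cases "b \<in> e")
        case True
        note e = that
        obtain c d where "e = {c, d}" "c \<in> verts (tr (Suc k))" "d \<notin> verts (tr (Suc k))"
          using e(1) by (rule boundary_edgesE) blast
        then show ?thesis using True s(5) by auto
      next
        case b: False then show ?thesis using s(7)[OF bd[OF that(1) b]] that(2) False by simp
      qed
      then show ?thesis using s(5) by (intro exI[of _ "{b}"]) auto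
    qed
  qed
qed

text \<open>
  A path at level \<open>p\<close> from \<open>u\<close> to a vertex outside of the tree leaves the tree through an edge of weight
  at most \<open>p\<close>, which competes with the edge that the algorithm selects.
\<close>
lemma unexhausted_cluster_keeps_low:
  assumes "u \<in> verts (tr K)" "K \<le> k" "\<not> cluster (G, \<rho>, w) u p \<subseteq> verts (tr k)"
    "e \<in> edges (tr k)" "e \<notin> edges (tr K)"
  shows "w e \<le> p"
  using assms(2-5)
proof (induction k rule: dec_induct)
  case base then show ?case by simp
next
  case (step k)
  have nsub: "\<not> cluster (G, \<rho>, w) u p \<subseteq> verts (tr k)" using step.prems tr_mono_Suc by blast
  then obtain x where x: "(u, x) \<in> (edge_rel (low_edges G w p))\<^sup>*" "x \<notin> verts (tr k)"
    by (auto simp: cluster_eq)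
  have "u \<in> verts (tr k)" using assms(1) verts_tr_mono step by blast
  then obtain c d where cd: "(c, d) \<in> edge_rel (low_edges G w p)" "c \<in> verts (tr k)" "d \<notin> verts (tr k)"
    using rtrancl_exits[OF x(1) _ x(2)] by blast
  then have f: "{c, d} \<in> bd k" "w {c, d} \<le> p" using boundary_edgesI by (auto simp: edge_rel_def)
  then have "bd k \<noteq> {}" by auto
  then obtain a b where "edges (tr (Suc k)) = insert {a, b} (edges (tr k))"
      "\<And>f. f \<in> bd k \<Longrightarrow> w {a, b} \<le> w f" by (rule tr_step) metis
  then have "e \<in> edges (tr k) \<or> w e \<le> w {c, d}" using step.prems(2) f(1) by auto
  then show ?case using step.IH[OF nsub _ step.prems(3)] f(2) by auto
qed

lemma tr_covered_by_clusters:
  assumes "K \<le> k" "\<And>e. e \<in> edges (tr k) \<Longrightarrow> e \<notin> edges (tr K) \<Longrightarrow> w e \<le> p"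
  shows "verts (tr k) \<subseteq> (\<Union>x\<in>verts (tr K). cluster (G, \<rho>, w) x p)"
  using assms
proof (induction k rule: dec_induct)
  case base then show ?case using verts_tr_sub by (fastforce simp: cluster_eq)
next
  case (step k)
  have IH: "verts (tr k) \<subseteq> (\<Union>x\<in>verts (tr K). cluster (G, \<rho>, w) x p)"
    using step tr_mono_Suc by blast
  show ?case
  proof (cases "bd k = {}")
    case True then show ?thesis using IH tr_stop by simp
  next
    case False
    then obtain a b where s: "a \<in> verts (tr k)" "b \<notin> verts (tr k)" "b \<in> verts G" "{a, b} \<in> edges G"
      "verts (tr (Suc k)) = insert b (verts (tr k))" "edges (tr (Suc k)) = insert {a, b} (edges (tr k))"
      by (rule tr_step) blast
    have "{a, b} \<notin> edges (tr K)" using s(2) edges_tr_verts[of "{a,b}" K] verts_tr_mono[OF step(1)] by auto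
    then have "(a, b) \<in> edge_rel (low_edges G w p)" using step.prems s by (auto simp: edge_rel_def)
    moreover obtain x where "x \<in> verts (tr K)" "a \<in> cluster (G, \<rho>, w) x p" using IH s(1) by blast
    ultimately have "b \<in> cluster (G, \<rho>, w) x p" using s(3) by (auto simp: cluster_eq intro: rtrancl_into_rtrancl)
    then show ?thesis using IH s(5) \<open>x \<in> verts (tr K)\<close> by auto
  qed
qed

end

section \<open>The minimum spanning forest\<close>

lemma rtrancl_finite_edges:
  assumes "(x, y) \<in> (edge_rel E)\<^sup>*"
  obtains P where "finite P" "P \<subseteq> E" "(x, y) \<in> (edge_rel P)\<^sup>*"
proof -
  have "\<exists>P. finite P \<and> P \<subseteq> E \<and> (x, y) \<in> (edge_rel P)\<^sup>*"
    using assms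
  proof (induction rule: rtrancl_induct)
    case base then show ?case by (intro exI[of _ "{}"]) auto
  next
    case (step y z)
    then obtain P where P: "finite P" "P \<subseteq> E" "(x, y) \<in> (edge_rel P)\<^sup>*" by blast
    have "(x, y) \<in> (edge_rel (insert {y, z} P))\<^sup>*" using edge_rel_rtrancl_mono[OF _ P(3)] by blast
    moreover have "(y, z) \<in> edge_rel (insert {y, z} P)" by (simp add: edge_rel_def)
    ultimately have "(x, z) \<in> (edge_rel (insert {y, z} P))\<^sup>*" by (rule rtrancl_into_rtrancl)
    then show ?case using P step(2) by (intro exI[of _ "insert {y, z} P"]) (auto simp: edge_rel_def)
  qed
  then show thesis using that by blast
qed

text \<open>
  If removing \<open>e\<close> disconnects \<open>x\<close> from \<open>v\<close>, the first and the last passage through \<open>e\<close> have the same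
  direction, since otherwise \<open>e\<close> could be avoided.
\<close>
lemma rtrancl_insert_edge:
  assumes xv: "(x, v) \<in> (edge_rel (insert e P))\<^sup>*" and n: "(x, v) \<notin> (edge_rel P)\<^sup>*"
  obtains c d where "e = {c, d}" "(x, c) \<in> (edge_rel P)\<^sup>*" "(d, v) \<in> (edge_rel P)\<^sup>*"
proof -
  let ?P = "(edge_rel P)\<^sup>*"
  obtain c d where cd: "(c, d) \<in> edge_rel (insert e P)" "(x, c) \<in> ?P" "(x, d) \<notin> ?P"
    by (rule rtrancl_exits[OF xv, of "{y. (x, y) \<in> ?P}"]) (use n in auto)
  have e: "e = {c, d}"
    using cd by (auto simp: edge_rel_def intro: rtrancl_into_rtrancl)
  obtain c' d' where cd': "(c', d') \<in> edge_rel (insert e P)" "(c', v) \<notin> ?P" "(d', v) \<in> ?P"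
    by (rule rtrancl_exits[OF xv, of "{y. (y, v) \<notin> ?P}"]) (use n in auto)
  have e': "e = {c', d'}"
    using cd' by (auto simp: edge_rel_def intro: converse_rtrancl_into_rtrancl)
  have "d' \<noteq> c" using cd(2) cd'(3) n by (meson rtrancl_trans)
  then have "d' = d" using e e' by (auto simp: doubleton_eq_iff)
  then show thesis using that e cd cd' by blast
qed

locale inj_prim_graph = prim_graph +
  assumes inj: "inj_on w (edges G)"
begin

abbreviation F :: "'a set set" where "F \<equiv> edges (spanning_forest (G, \<rho>, w))"

abbreviation below :: "'a set \<Rightarrow> 'a rel" where
  "below e \<equiv> (edge_rel {f \<in> edges G - {e}. w f \<le> w e})\<^sup>*"

lemma F_iff:
  assumes "{a, b} \<in> edges G"
  shows "{a, b} \<in> F \<longleftrightarrow>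
    {u \<in> verts G. (a, u) \<in> below {a, b}} \<inter> {u \<in> verts G. (b, u) \<in> below {a, b}} = {} \<and>
    \<not> (infinite {u \<in> verts G. (a, u) \<in> below {a, b}} \<and> infinite {u \<in> verts G. (b, u) \<in> below {a, b}})"
  using spanning_forest_edge_iff[of a b G \<rho> w] simple_edgeD(3)[OF simple assms] assms by (simp add: Let_def)

lemma F_not_below: "{a, b} \<in> F \<Longrightarrow> (a, b) \<notin> below {a, b}"
  using F_iff[of a b] spanning_forest_edges[of G \<rho> w] simple_edgeD[OF simple, of a b] by blast

lemma F_sub: "F \<subseteq> edges G" by (rule spanning_forest_edges)

text \<open>
  When \<open>{a, b}\<close> is selected, it is the only boundary edge of weight at most \<open>w {a, b}\<close>.  So a path
  below this weight cannot cross the boundary: the clusters of \<open>a\<close> and \<open>b\<close> are disjoint, and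
  that of \<open>a\<close> stays in the finite tree.
\<close>
lemma edges_tr_forest: "edges (tr k) \<subseteq> F"
proof (induction k)
  case 0 then show ?case by simp
next
  case (Suc k)
  show ?case
  proof (cases "bd k = {}")
    case True then show ?thesis using Suc tr_stop by simp
  next
    case False
    then obtain a b where s: "a \<in> verts (tr k)" "b \<notin> verts (tr k)" "b \<in> verts G" "{a, b} \<in> edges G"
      "edges (tr (Suc k)) = insert {a, b} (edges (tr k))" "\<And>f. f \<in> bd k \<Longrightarrow> w {a, b} \<le> w f"
      by (rule tr_step) metis
    have stay: "u \<in> verts (tr k) \<longleftrightarrow> v \<in> verts (tr k)" if "(u, v) \<in> below {a, b}" for u v
      using that
    proof (induction rule: rtrancl_induct)
      case base then show ?case by simp
    next
      case (step y z)
      have yz: "{y, z} \<in> edges G" "{y, z} \<noteq> {a, b}" "w {y, z} \<le> w {a, b}"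
        using step(2) by (auto simp: edge_rel_def)
      have "{y, z} \<notin> bd k"
      proof
        assume "{y, z} \<in> bd k"
        then have "w {y, z} = w {a, b}" using s(6) yz(3) by force
        then show False using inj yz s(4) by (auto dest: inj_onD)
      qed
      then have "y \<in> verts (tr k) \<longleftrightarrow> z \<in> verts (tr k)"
        using boundary_edgesI[OF yz(1)] boundary_edgesI[of z y "tr k"] yz(1) by (auto simp: insert_commute)
      then show ?case using step by blast
    qed
    have 1: "{u \<in> verts G. (a, u) \<in> below {a, b}} \<subseteq> verts (tr k)" using stay s(1) by blast
    have "{u \<in> verts G. (b, u) \<in> below {a, b}} \<inter> verts (tr k) = {}" using stay s(2) by blast
    then have "{a, b} \<in> F"
      using 1 finite_subset[OF 1 finite_verts_tr] unfolding F_iff[OF s(4)] by (simp add: disjoint_iff) blast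
    then show ?thesis using Suc.IH s(5) by simp
  qed
qed

text \<open>
  Suppose the second endpoint \<open>d\<close> of \<open>{a, d}\<close> enters through another edge \<open>{c, d}\<close>.  This edge is no heavier
  than \<open>{a, d}\<close>, so \<open>a\<close> and \<open>c\<close> belong to the same pond at level \<open>w {a, d}\<close>.  Then \<open>a\<close> and \<open>d\<close> are joined
  below \<open>{a, d}\<close>, and \<open>{a, d}\<close> is not an edge of the forest.
\<close>
lemma forest_edge_in_tr:
  assumes "e \<in> F" "e \<subseteq> verts (tr k)"
  shows "e \<in> edges (tr k)"
  using assms(2)
proof (induction k)
  case 0
  obtain a b where "e = {a, b}" "a \<noteq> b" using simple_edgeE[OF simple, of e] assms(1) F_sub by (metis subsetD)
  then show ?case using 0 by auto
next
  case (Suc k)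
  show ?case
  proof (cases "e \<subseteq> verts (tr k)")
    case True then show ?thesis using Suc tr_mono_Suc by blast
  next
    case e: False
    have "bd k \<noteq> {}" using Suc.prems e tr_stop by metis
    then obtain c d where s: "c \<in> verts (tr k)" "d \<notin> verts (tr k)" "d \<in> verts G" "{c, d} \<in> edges G"
      "verts (tr (Suc k)) = insert d (verts (tr k))"
      "edges (tr (Suc k)) = insert {c, d} (edges (tr k))" "\<And>f. f \<in> bd k \<Longrightarrow> w {c, d} \<le> w f"
      by (rule tr_step) metis
    obtain x y where "e = {x, y}" "x \<noteq> y" using simple_edgeE[OF simple, of e] assms(1) F_sub by (metis subsetD)
    then obtain a where a: "e = {a, d}" "a \<in> verts (tr k)" using Suc.prems e s(5) by auto
    have eG: "{a, d} \<in> edges G" using assms(1) F_sub a by auto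
    have ebd: "{a, d} \<in> bd k" using boundary_edgesI[OF eG a(2) s(2)] .
    show ?thesis
    proof (cases "{a, d} = {c, d}")
      case True then show ?thesis using s a by simp
    next
      case False
      obtain S where S: 
        "\<forall>u\<in>S. \<forall>v\<in>S. (u, v) \<in> (edge_rel {e \<in> edges (tr k). w e \<le> w {a, d}})\<^sup>*"
        "\<forall>e\<in>bd k. w e \<le> w {a, d} \<longrightarrow> e \<inter> verts (tr k) \<subseteq> S" using pond[of k "w {a, d}"] by blast
      have le: "w {c, d} \<le> w {a, d}" using s(7)[OF ebd] .
      have "a \<in> S" using S(2) ebd a(2) by auto
      moreover have "c \<in> S" using S(2) boundary_edgesI[OF s(4,1,2)] s(1) le by auto
      ultimately have "(a, c) \<in> (edge_rel {e \<in> edges (tr k). w e \<le> w {a, d}})\<^sup>*" using S(1) by blast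
      moreover have "{e \<in> edges (tr k). w e \<le> w {a, d}} \<subseteq> {f \<in> edges G - {{a, d}}. w f \<le> w {a, d}}"
        using edges_tr_sub edges_tr_verts[of "{a, d}" k] s(2) by auto
      ultimately have "(a, c) \<in> below {a, d}" by (rule edge_rel_rtrancl_mono[rotated])
      moreover have "(c, d) \<in> edge_rel {f \<in> edges G - {{a, d}}. w f \<le> w {a, d}}"
        using False s(4) le by (auto simp: edge_rel_def)
      ultimately have "(a, d) \<in> below {a, d}" by (rule rtrancl_into_rtrancl)
      then show ?thesis using F_not_below assms(1) a(1) by blast
    qed
  qed
qed

abbreviation A :: "'a graph" where "A \<equiv> graph_of (msf (G, \<rho>, w))"

lemma msf_eq: "msf (G, \<rho>, w) = (A, \<rho>, w)"
  by (simp add: msf_def)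

lemma verts_A: "verts A = {v \<in> verts G. (\<rho>, v) \<in> (edge_rel F)\<^sup>*}"
  by (auto simp: msf_def root_component_def induced_subgraph_def component_def adj_eq)

lemma edges_A: "edges A = {e \<in> F. e \<subseteq> verts A}"
  unfolding verts_A by (auto simp: msf_def root_component_def induced_subgraph_def component_def adj_eq)

lemma verts_tr_A: "verts (tr k) \<subseteq> verts A"
proof
  fix v assume "v \<in> verts (tr k)"
  then show "v \<in> verts A"
    using edge_rel_rtrancl_mono[OF edges_tr_forest tr_connected] verts_tr_sub[of k] by (auto simp: verts_A)
qed

lemma edges_tr_A: "edges (tr k) \<subseteq> edges A"
  using edges_tr_forest edges_tr_verts verts_tr_A by (fastforce simp: edges_A)

lemma msf_inj_prim_graph: "inj_prim_graph A \<rho> w"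
proof
  show "simple_graph A" using simple F_sub by (auto simp: simple_graph_def edges_A)
  show "locally_finite_graph A"
    unfolding locally_finite_graph_def
  proof
    fix v assume "v \<in> verts A"
    then have "finite {e \<in> edges G. v \<in> e}" using locfin by (auto simp: locally_finite_graph_def verts_A)
    then show "finite {e \<in> edges A. v \<in> e}" by (rule rev_finite_subset) (use F_sub in \<open>auto simp: edges_A\<close>)
  qed
  show "\<rho> \<in> verts A" using root by (auto simp: verts_A)
  show "inj_on w (edges A)" using inj F_sub by (auto simp: inj_on_def edges_A)
qed

interpretation msf: inj_prim_graph A \<rho> w by (rule msf_inj_prim_graph)

text \<open>
  Selected edges belong to the forest, and the forest has fewer competitors, so the algorithm makes the same
  choices in the spanning tree.  Agreement of spanning trees thus suffices to compare the
  algorithm on two graphs.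
\<close>
lemma tr_msf: "prim_graph.tr A \<rho> w k = tr k"
proof (induction k)
  case 0 then show ?case by (simp add: msf.tr_def tr_def prim_tree_def)
next
  case (Suc k)
  have sub: "boundary_edges A (tr k) \<subseteq> bd k" using F_sub by (auto simp: boundary_edges_def edges_A)
  show ?case
  proof (cases "bd k = {}")
    case True
    then show ?thesis using sub Suc tr_stop[OF True] msf.tr_stop[of k] by auto
  next
    case False
    then obtain a b where s: "a \<in> verts (tr k)" "b \<notin> verts (tr k)" "{a, b} \<in> edges G"
      "edges (tr (Suc k)) = insert {a, b} (edges (tr k))" "\<And>f. f \<in> bd k \<Longrightarrow> w {a, b} \<le> w f"
      "{a, b} = arg_min_on w (bd k)"
      by (rule tr_step) metis
    have eA: "{a, b} \<in> edges A" using edges_tr_A[of "Suc k"] s(4) by auto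
    then have bA: "{a, b} \<in> boundary_edges A (tr k)" using msf.boundary_edgesI s by blast
    let ?f = "arg_min_on w (boundary_edges A (tr k))"
    have fin: "finite (boundary_edges A (tr k))" using finite_subset[OF sub finite_bd] .
    have f: "?f \<in> boundary_edges A (tr k)" "w ?f \<le> w {a, b}"
      using arg_min_if_finite[OF fin, of w] bA by (auto simp: not_less)
    then have "w ?f = w {a, b}" using s(5) sub by force
    then have "?f = {a, b}" using f(1) eA msf.inj by (auto simp: boundary_edges_def dest: inj_onD)
    then show ?thesis using Suc bA False s(6) by (auto simp: msf.tr_Suc tr_Suc prim_step_def)
  qed
qed

text \<open>
  The finite approximation at step \<open>K\<close> of the edge set of the expanded invasion cluster.
\<close>
definition exp_edges :: "nat \<Rightarrow> real \<Rightarrow> 'a set set" where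
  "exp_edges K p = edges (tr K) \<union> {e \<in> edges A. w e \<le> p}"

lemma exp_edges_sub: "exp_edges K p \<subseteq> edges A"
  using edges_tr_A by (auto simp: exp_edges_def)

text \<open>
  If the level-\<open>p\<close> clusters of all vertices of \<open>tr K\<close> are swallowed by \<open>tr k\<close>, every path that starts at the root and uses
  only the edges of \<open>exp_edges K p\<close> stays in these clusters, hence in \<open>tr k\<close>; by \<open>forest_edge_in_tr\<close> its edges
  are edges of \<open>tr k\<close>.
\<close>
lemma exp_edges_reach:
  assumes "K \<le> k" "\<And>x. x \<in> verts (tr K) \<Longrightarrow> cluster (G, \<rho>, w) x p \<subseteq> verts (tr k)"
    "(\<rho>, v) \<in> edge_rel (exp_edges K p) ^^ n"
  shows "(\<rho>, v) \<in> edge_rel (edges (tr k)) ^^ n \<and> (\<exists>x\<in>verts (tr K). v \<in> cluster (G, \<rho>, w) x p)"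
  using assms(3)
proof (induction n arbitrary: v)
  case 0 then show ?case using root_in_tr root by (auto simp: cluster_eq)
next
  case (Suc n)
  then obtain u where u: "(\<rho>, u) \<in> edge_rel (exp_edges K p) ^^ n" "{u, v} \<in> exp_edges K p"
    by (auto simp: edge_rel_def)
  obtain x where x: "x \<in> verts (tr K)" "u \<in> cluster (G, \<rho>, w) x p" using Suc.IH[OF u(1)] by blast
  have vG: "v \<in> verts G" using u(2) exp_edges_sub[of K p] F_sub simple_edgeD(2)[OF simple, of u v] unfolding edges_A by blast
  have 1: "\<exists>x\<in>verts (tr K). v \<in> cluster (G, \<rho>, w) x p"
  proof (cases "{u, v} \<in> edges (tr K)")
    case True
    then have "v \<in> verts (tr K)" using edges_tr_verts by blast
    then show ?thesis using vG by (auto simp: cluster_eq)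
  next
    case False
    then have "{u, v} \<in> edges G" "w {u, v} \<le> p" using u(2) F_sub by (auto simp: exp_edges_def edges_A)
    then have "(u, v) \<in> edge_rel (low_edges G w p)" by (auto simp: edge_rel_def)
    then show ?thesis using x vG by (auto simp: cluster_eq intro: rtrancl_into_rtrancl)
  qed
  have "{u, v} \<subseteq> verts (tr k)" using x 1 assms(2) by blast
  moreover have "{u, v} \<in> F" using u(2) exp_edges_sub[of K p] unfolding edges_A by blast
  ultimately have "{u, v} \<in> edges (tr k)" using forest_edge_in_tr by blast
  then show ?case using Suc.IH[OF u(1)] 1 by (auto simp: edge_rel_def)
qed

end

section \<open>Prim's algorithm on connected graphs\<close>

locale connected_prim_graph = inj_prim_graph +
  assumes conn: "connected_graph G"
begin

lemma bd_nonempty: "verts (tr k) \<noteq> verts G \<Longrightarrow> bd k \<noteq> {}"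
proof -
  assume "verts (tr k) \<noteq> verts G"
  then obtain x where x: "x \<in> verts G" "x \<notin> verts (tr k)" using verts_tr_sub by blast
  have "(\<rho>, x) \<in> (edge_rel (edges G))\<^sup>*" using conn x root by (auto simp: connected_graph_def adj_eq)
  then obtain a b where "(a, b) \<in> edge_rel (edges G)" "a \<in> verts (tr k)" "b \<notin> verts (tr k)"
    using rtrancl_exits[OF _ root_in_tr x(2)] by blast
  then have "{a, b} \<in> bd k" using boundary_edgesI by (auto simp: edge_rel_def)
  then show ?thesis by auto
qed

lemma card_tr: "card (verts (tr k)) = Suc k \<or> verts (tr k) = verts G"
proof (induction k)
  case (Suc k)
  show ?case
  proof (cases "verts (tr k) = verts G")
    case True then show ?thesis using verts_tr_sub[of "Suc k"] tr_mono_Suc[of k] by blast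
  next
    case False
    then obtain a b where "b \<notin> verts (tr k)" "verts (tr (Suc k)) = insert b (verts (tr k))"
      using tr_step[OF bd_nonempty] by metis
    then show ?thesis using Suc False finite_verts_tr by auto
  qed
qed simp

lemma card_tr_infinite: "infinite (verts G) \<Longrightarrow> card (verts (tr k)) = Suc k"
  using card_tr[of k] finite_verts_tr[of k] by auto

lemma escapes_finite:
  assumes "infinite (verts G)" "finite U"
  shows "\<not> verts (tr (j + card U)) \<subseteq> U"
proof
  assume "verts (tr (j + card U)) \<subseteq> U"
  then have "Suc (j + card U) \<le> card U" using card_mono[OF assms(2)] card_tr_infinite[OF assms(1)] by metis
  then show False by simp
qed

lemma card_tr_finite: "finite (verts G) \<Longrightarrow> card (verts (tr k)) = min (Suc k) (card (verts G))"
  using card_tr[of k] card_tr_le[of k] card_mono[OF _ verts_tr_sub, of k] by (auto simp: min_def)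

text \<open>
  The boundary edge \<open>{a, b}\<close> is available forever and never used, so all later edges are at most as heavy.
  The pond argument shows that every later vertex is joined to \<open>a\<close> below \<open>{a, b}\<close>.
\<close>
lemma rejected_edge_infinite_cluster:
  assumes ab: "{a, b} \<in> edges G" "a \<in> verts (tr j)" "\<And>i. b \<notin> verts (tr i)" and inf: "infinite (verts G)"
  shows "infinite {u \<in> verts G. (a, u) \<in> below {a, b}}"
    and "\<And>i e. j \<le> i \<Longrightarrow> e \<in> edges (tr i) \<Longrightarrow> e \<notin> edges (tr j) \<Longrightarrow> w e \<le> w {a, b}"
proof -
  let ?C = "{u \<in> verts G. (a, u) \<in> below {a, b}}"
  have main: "verts (tr i) \<subseteq> verts (tr j) \<union> ?C \<and> (\<forall>e\<in>edges (tr i) - edges (tr j). w e \<le> w {a, b})" if "j \<le> i" for i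
    using that
  proof (induction i rule: dec_induct)
    case base then show ?case by simp
  next
    case (step i)
    have ai: "a \<in> verts (tr i)" using ab(2) verts_tr_mono[OF step(1)] by blast
    have ebd: "{a, b} \<in> bd i" using boundary_edgesI[OF ab(1) ai ab(3)] .
    then have "bd i \<noteq> {}" by auto
    then obtain c d where s: "c \<in> verts (tr i)" "d \<notin> verts (tr i)" "d \<in> verts G" "{c, d} \<in> edges G"
      "verts (tr (Suc i)) = insert d (verts (tr i))"
      "edges (tr (Suc i)) = insert {c, d} (edges (tr i))" "\<And>f. f \<in> bd i \<Longrightarrow> w {c, d} \<le> w f"
      by (rule tr_step) metis
    obtain S where S: 
        "\<forall>u\<in>S. \<forall>v\<in>S. (u, v) \<in> (edge_rel {e \<in> edges (tr i). w e \<le> w {a, b}})\<^sup>*"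
        "\<forall>e\<in>bd i. w e \<le> w {a, b} \<longrightarrow> e \<inter> verts (tr i) \<subseteq> S" using pond[of i "w {a, b}"] by blast
    have le: "w {c, d} \<le> w {a, b}" using s(7)[OF ebd] .
    have "a \<in> S" using S(2) ebd ai by auto
    moreover have "c \<in> S" using S(2) boundary_edgesI[OF s(4,1,2)] s(1) le by auto
    ultimately have "(a, c) \<in> (edge_rel {e \<in> edges (tr i). w e \<le> w {a, b}})\<^sup>*" using S(1) by blast
    moreover have "{e \<in> edges (tr i). w e \<le> w {a, b}} \<subseteq> {f \<in> edges G - {{a, b}}. w f \<le> w {a, b}}"
      using edges_tr_sub edges_tr_verts[of "{a, b}" i] ab(3)[of i] by auto
    ultimately have "(a, c) \<in> below {a, b}" by (rule edge_rel_rtrancl_mono[rotated])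
    moreover have "{c, d} \<noteq> {a, b}" using s(5) ab(3)[of "Suc i"] s(2) ai by (auto simp: doubleton_eq_iff)
    then have "(c, d) \<in> edge_rel {f \<in> edges G - {{a, b}}. w f \<le> w {a, b}}"
      using s(4) le by (auto simp: edge_rel_def)
    ultimately have "(a, d) \<in> below {a, b}" by (rule rtrancl_into_rtrancl)
    then show ?case using step s le by auto
  qed
  then show "\<And>i e. j \<le> i \<Longrightarrow> e \<in> edges (tr i) \<Longrightarrow> e \<notin> edges (tr j) \<Longrightarrow> w e \<le> w {a, b}" by blast
  show "infinite ?C"
  proof
    assume fin: "finite ?C"
    have "finite (verts (tr j) \<union> ?C)" using fin finite_verts_tr by blast
    then show False using escapes_finite[OF inf, of _ j] main by (meson le_add1)
  qed
qed

text \<open>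
  If all level-\<open>p\<close> clusters met by the invasion were finite, a smallest set \<open>P\<close> of forest edges joining the invaded
  set to \<open>v\<close> would start with a rejected edge \<open>{a, b}\<close> heavier than \<open>p\<close>.  Below the heaviest edge of \<open>P\<close>, the side
  of \<open>a\<close> is infinite by \<open>rejected_edge_infinite_cluster\<close>, and the side of \<open>v\<close> contains the infinite
  level-\<open>p\<close> cluster of \<open>v\<close>.  An edge between two infinite clusters is not in the forest.
\<close>
lemma invasion_hits_infinite_cluster:
  assumes v: "v \<in> verts A" "infinite (cluster (G, \<rho>, w) v p)"
  obtains k u where "u \<in> verts (tr k)" "infinite (cluster (G, \<rho>, w) u p)"
proof (rule ccontr)
  assume "\<not> thesis"
  with that have fin: "finite (cluster (G, \<rho>, w) u p)" if "u \<in> verts (tr k)" for u k using that by blast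
  have inf: "infinite (verts G)" using v(2) by (rule contrapos_nn) (auto simp: cluster_eq elim: rev_finite_subset)
  define I where "I = (\<Union>k. verts (tr k))"
  have vI: "v \<notin> I" using fin v(2) by (auto simp: I_def)
  have "\<exists>P a. finite P \<and> P \<subseteq> F \<and> a \<in> I \<and> (a, v) \<in> (edge_rel P)\<^sup>*"
  proof -
    have "(\<rho>, v) \<in> (edge_rel F)\<^sup>*" using v(1) by (simp add: verts_A)
    then obtain P where "finite P" "P \<subseteq> F" "(\<rho>, v) \<in> (edge_rel P)\<^sup>*" by (rule rtrancl_finite_edges)
    moreover have "\<rho> \<in> I" using root_in_tr by (auto simp: I_def)
    ultimately show ?thesis by blast
  qed
  then obtain P where P: "finite P \<and> P \<subseteq> F \<and> (\<exists>a. a \<in> I \<and> (a, v) \<in> (edge_rel P)\<^sup>*)"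
    and least: "\<And>Q. finite Q \<and> Q \<subseteq> F \<and> (\<exists>a. a \<in> I \<and> (a, v) \<in> (edge_rel Q)\<^sup>*) \<Longrightarrow> card P \<le> card Q"
    using ex_has_least_nat[of "\<lambda>P. finite P \<and> P \<subseteq> F \<and> (\<exists>a. a \<in> I \<and> (a, v) \<in> (edge_rel P)\<^sup>*)" _ card] by metis
  then obtain a0 where "a0 \<in> I" "(a0, v) \<in> (edge_rel P)\<^sup>*" by blast
  then obtain a b where ab: "(a, b) \<in> edge_rel P" "a \<in> I" "b \<notin> I" "(b, v) \<in> (edge_rel P)\<^sup>*"
    using rtrancl_exits[OF _ _ vI] by blast
  have abP: "{a, b} \<in> P" using ab(1) by (simp add: edge_rel_def)
  have abG: "{a, b} \<in> edges G" using abP P F_sub by blast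
  have av: "(a, v) \<in> (edge_rel P)\<^sup>*" using ab by (meson converse_rtrancl_into_rtrancl)
  obtain j where j: "a \<in> verts (tr j)" using ab(2) by (auto simp: I_def)
  have bI: "b \<notin> verts (tr i)" for i using ab(3) by (auto simp: I_def)
  note rej = rejected_edge_infinite_cluster[OF abG j bI inf]
  have pab: "p < w {a, b}"
  proof (rule ccontr)
    assume "\<not> p < w {a, b}"
    then have le: "w e \<le> p" if "e \<in> edges (tr i)" "e \<notin> edges (tr j)" "j \<le> i" for e i
      using rej(2)[of i e] that by auto
    let ?U = "\<Union>x\<in>verts (tr j). cluster (G, \<rho>, w) x p"
    have "finite ?U" using finite_verts_tr fin by blast
    moreover have "verts (tr (j + card ?U)) \<subseteq> ?U" using le by (intro tr_covered_by_clusters) auto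
    ultimately show False using escapes_finite[OF inf] by blast
  qed
  \<comment> \<open>Minimality of \<open>P\<close> makes its heaviest edge \<open>e\<close> a bridge, with \<open>a\<close> and \<open>v\<close> on different sides.\<close>
  obtain e where e: "e \<in> P" "\<And>f. f \<in> P \<Longrightarrow> w f \<le> w e"
  proof -
    have "Max (w ` P) \<in> w ` P" using P abP by (intro Max_in) auto
    then obtain e where "e \<in> P" "w e = Max (w ` P)" by auto
    then show thesis using that[of e] P by auto
  qed
  have lt: "P - {e} \<subseteq> {f \<in> edges G - {e}. w f \<le> w e}" using e P F_sub by auto
  have nP: "(a, v) \<notin> (edge_rel (P - {e}))\<^sup>*"
  proof
    assume "(a, v) \<in> (edge_rel (P - {e}))\<^sup>*"
    then have "card P \<le> card (P - {e})" using least[of "P - {e}"] P ab(2) by blast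
    then show False using card_Diff1_less[of P e] e P by simp
  qed
  have "insert e (P - {e}) = P" using e by auto
  then obtain c d where cd: "e = {c, d}" "(a, c) \<in> (edge_rel (P - {e}))\<^sup>*" "(d, v) \<in> (edge_rel (P - {e}))\<^sup>*"
    using rtrancl_insert_edge[of a v e "P - {e}"] av nP by metis
  have ac: "(a, c) \<in> below e" and dv: "(d, v) \<in> below e" using edge_rel_rtrancl_mono[OF lt] cd by auto
  have eG: "{c, d} \<in> edges G" using e P F_sub cd by blast
  have aV: "(a, u) \<in> below e" if "(a, u) \<in> below {a, b}" for u
  proof (cases "e = {a, b}")
    case True then show ?thesis using that by simp
  next
    case False
    then have "w {a, b} \<noteq> w e" using inj abG eG cd by (auto dest: inj_onD)
    then have "w {a, b} < w e" using e(2)[OF abP] by simp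
    then have "{f \<in> edges G - {{a, b}}. w f \<le> w {a, b}} \<subseteq> {f \<in> edges G - {e}. w f \<le> w e}" by auto
    then show ?thesis using that by (rule edge_rel_rtrancl_mono)
  qed
  have "(c, u) \<in> below e" if "(a, u) \<in> below {a, b}" for u
    using aV[OF that] edge_rel_rtrancl_sym[OF ac] by (rule rtrancl_trans[rotated])
  then have "{u \<in> verts G. (a, u) \<in> below {a, b}} \<subseteq> {u \<in> verts G. (c, u) \<in> below {c, d}}" using cd by auto
  then have 1: "infinite {u \<in> verts G. (c, u) \<in> below {c, d}}" using rej(1) finite_subset by blast
  have "low_edges G w p \<subseteq> {f \<in> edges G - {e}. w f \<le> w e}" using pab e(2)[OF abP] by auto
  then have "(d, u) \<in> below e" if "(v, u) \<in> (edge_rel (low_edges G w p))\<^sup>*" for u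
    by (rule rtrancl_trans[OF dv edge_rel_rtrancl_mono[OF _ that]])
  then have "cluster (G, \<rho>, w) v p \<subseteq> {u \<in> verts G. (d, u) \<in> below {c, d}}" using cd by (auto simp: cluster_eq)
  then have 2: "infinite {u \<in> verts G. (d, u) \<in> below {c, d}}" using v(2) finite_subset by blast
  show False using 1 2 F_iff[OF eG] e P cd by blast
qed

end

section \<open>Balls and local isomorphisms\<close>

text \<open>
  The argument \<open>E\<close> is an edge set instead of a graph, because balls of many subgraphs of the same graph are
  compared.
\<close>
definition ball_set :: "real \<Rightarrow> 'v set set \<Rightarrow> 'v \<Rightarrow> 'v set" where
  "ball_set r E \<rho> = {v. \<exists>n. real n \<le> r \<and> (\<rho>, v) \<in> edge_rel E ^^ n}"

lemma edge_relpow_mono: "E \<subseteq> E' \<Longrightarrow> (u, v) \<in> edge_rel E ^^ n \<Longrightarrow> (u, v) \<in> edge_rel E' ^^ n"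
  by (induction n arbitrary: v) (auto simp: edge_rel_def)

lemma ball_set_mono:
  assumes "r \<le> R" "E \<subseteq> E'" shows "ball_set r E \<rho> \<subseteq> ball_set R E' \<rho>"
  using assms(1) edge_relpow_mono[OF assms(2)] by (auto simp: ball_set_def intro: order_trans)

lemma root_in_ball_set: "0 \<le> r \<Longrightarrow> \<rho> \<in> ball_set r E \<rho>"
  by (auto simp: ball_set_def intro!: exI[of _ 0])

lemma relpow_in_ball_set: "(\<rho>, v) \<in> edge_rel E ^^ n \<Longrightarrow> real n \<le> r \<Longrightarrow> v \<in> ball_set r E \<rho>"
  by (auto simp: ball_set_def)

lemma ball_set_verts:
  assumes "simple_graph G" "\<rho> \<in> verts G" "E \<subseteq> edges G"
  shows "ball_set r E \<rho> \<subseteq> verts G"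
  using rtrancl_verts[OF assms(1,3) _ assms(2)] by (auto simp: ball_set_def dest: relpow_imp_rtrancl)

lemma relpow_Suc_edge: "(\<rho>, v) \<in> edge_rel E ^^ Suc n \<longleftrightarrow> (\<exists>u. (\<rho>, u) \<in> edge_rel E ^^ n \<and> {u, v} \<in> E)"
  by (auto simp: edge_rel_def)

definition ball_iso :: "real \<Rightarrow> 'v set set \<Rightarrow> 'v \<Rightarrow> 'u set set \<Rightarrow> 'u \<Rightarrow> ('v \<Rightarrow> 'u) \<Rightarrow> bool" where
  "ball_iso r E \<rho> E' \<rho>' \<phi> \<longleftrightarrow>
     bij_betw \<phi> (ball_set r E \<rho>) (ball_set r E' \<rho>') \<and> \<phi> \<rho> = \<rho>' \<and>
     (\<forall>u\<in>ball_set r E \<rho>. \<forall>v\<in>ball_set r E \<rho>. {u, v} \<in> E \<longleftrightarrow> {\<phi> u, \<phi> v} \<in> E')"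

lemma ball_isoD:
  assumes "ball_iso r E \<rho> E' \<rho>' \<phi>"
  shows "inj_on \<phi> (ball_set r E \<rho>)" "\<phi> ` ball_set r E \<rho> = ball_set r E' \<rho>'" "\<phi> \<rho> = \<rho>'"
    "\<And>u v. u \<in> ball_set r E \<rho> \<Longrightarrow> v \<in> ball_set r E \<rho> \<Longrightarrow> {u, v} \<in> E \<longleftrightarrow> {\<phi> u, \<phi> v} \<in> E'"
  using assms by (auto simp: ball_iso_def bij_betw_def)

lemma ball_iso_id: "ball_iso r E \<rho> E \<rho> (\<lambda>x. x)"
  by (auto simp: ball_iso_def bij_betw_def)

lemma ball_iso_subgraph_relpow:
  assumes iso: "ball_iso R E \<rho> E' \<rho>' \<phi>" and r: "r \<le> R" and sub: "D \<subseteq> E" "D' \<subseteq> E'"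
    and iff: "\<And>u v. u \<in> ball_set r E \<rho> \<Longrightarrow> v \<in> ball_set r E \<rho> \<Longrightarrow> {u, v} \<in> D \<longleftrightarrow> {\<phi> u, \<phi> v} \<in> D'"
    and n: "real n \<le> r"
  shows "(\<forall>v. (\<rho>, v) \<in> edge_rel D ^^ n \<longrightarrow> (\<rho>', \<phi> v) \<in> edge_rel D' ^^ n) \<and>
         (\<forall>v'. (\<rho>', v') \<in> edge_rel D' ^^ n \<longrightarrow> (\<exists>v. (\<rho>, v) \<in> edge_rel D ^^ n \<and> v' = \<phi> v))"
  using n
proof (induction n)
  case 0 then show ?case using ball_isoD(3)[OF iso] by auto
next
  case (Suc n)
  then have IH: "\<And>v. (\<rho>, v) \<in> edge_rel D ^^ n \<Longrightarrow> (\<rho>', \<phi> v) \<in> edge_rel D' ^^ n"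
    "\<And>v'. (\<rho>', v') \<in> edge_rel D' ^^ n \<Longrightarrow> \<exists>v. (\<rho>, v) \<in> edge_rel D ^^ n \<and> v' = \<phi> v" by auto
  have inE: "v \<in> ball_set r E \<rho>" if "(\<rho>, v) \<in> edge_rel D ^^ k" "real k \<le> r" for v k
    using relpow_in_ball_set[OF that] ball_set_mono[OF order_refl sub(1)] by blast
  show ?case
  proof (intro conjI allI impI)
    fix v assume "(\<rho>, v) \<in> edge_rel D ^^ Suc n"
    note v = this
    then obtain u where u: "(\<rho>, u) \<in> edge_rel D ^^ n" "{u, v} \<in> D" unfolding relpow_Suc_edge by blast
    have "u \<in> ball_set r E \<rho>" "v \<in> ball_set r E \<rho>"
      using inE[OF u(1)] inE[OF v] Suc.prems by auto
    then have "{\<phi> u, \<phi> v} \<in> D'" using iff u(2) by blast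
    then show "(\<rho>', \<phi> v) \<in> edge_rel D' ^^ Suc n" unfolding relpow_Suc_edge using IH(1)[OF u(1)] by blast
  next
    fix v' assume v': "(\<rho>', v') \<in> edge_rel D' ^^ Suc n"
    then obtain u' where u': "(\<rho>', u') \<in> edge_rel D' ^^ n" "{u', v'} \<in> D'" unfolding relpow_Suc_edge by blast
    obtain u where u: "(\<rho>, u) \<in> edge_rel D ^^ n" "u' = \<phi> u" using IH(2)[OF u'(1)] by blast
    have "v' \<in> ball_set R E' \<rho>'"
      using relpow_in_ball_set[OF v' Suc.prems] ball_set_mono[OF r sub(2)] by blast
    then obtain v where v: "v' = \<phi> v" "v \<in> ball_set R E \<rho>" using ball_isoD(2)[OF iso] by auto
    have ub: "u \<in> ball_set r E \<rho>" using inE[OF u(1)] Suc.prems by simp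
    then have uR: "u \<in> ball_set R E \<rho>" using ball_set_mono[OF r order_refl[of E]] by blast
    have "{u, v} \<in> E" using ball_isoD(4)[OF iso uR v(2)] u' u v sub(2) by auto
    then have "(\<rho>, v) \<in> edge_rel E ^^ Suc n"
      unfolding relpow_Suc_edge using edge_relpow_mono[OF sub(1)] u(1) by blast
    then have "v \<in> ball_set r E \<rho>" using relpow_in_ball_set Suc.prems by metis
    then have "{u, v} \<in> D" using iff[OF ub] u' u v by auto
    then show "\<exists>v. (\<rho>, v) \<in> edge_rel D ^^ Suc n \<and> v' = \<phi> v"
      unfolding relpow_Suc_edge using u v by blast
  qed
qed

text \<open>
  Every path of length at most \<open>r\<close> from the root stays in the ball of radius \<open>r\<close>, so an isomorphism of
  balls that respects the edges of subgraphs is an isomorphism of the balls of these subgraphs as well.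
\<close>
lemma ball_iso_subgraph:
  assumes iso: "ball_iso R E \<rho> E' \<rho>' \<phi>" and r: "r \<le> R" and sub: "D \<subseteq> E" "D' \<subseteq> E'"
    and iff: "\<And>u v. u \<in> ball_set r E \<rho> \<Longrightarrow> v \<in> ball_set r E \<rho> \<Longrightarrow> {u, v} \<in> D \<longleftrightarrow> {\<phi> u, \<phi> v} \<in> D'"
  shows "ball_iso r D \<rho> D' \<rho>' \<phi>"
proof -
  have sub1: "ball_set r D \<rho> \<subseteq> ball_set r E \<rho>" using ball_set_mono[OF order_refl sub(1)] .
  have inj: "inj_on \<phi> (ball_set r D \<rho>)"
    using inj_on_subset[OF ball_isoD(1)[OF iso] ball_set_mono[OF r sub(1)]] .
  have "\<phi> ` ball_set r D \<rho> = ball_set r D' \<rho>'"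
  proof (intro set_eqI iffI)
    fix x assume "x \<in> \<phi> ` ball_set r D \<rho>"
    then obtain v n where "x = \<phi> v" "real n \<le> r" "(\<rho>, v) \<in> edge_rel D ^^ n" by (auto simp: ball_set_def)
    then show "x \<in> ball_set r D' \<rho>'"
      using ball_iso_subgraph_relpow[OF iso r sub iff, of n] by (auto simp: ball_set_def)
  next
    fix x assume "x \<in> ball_set r D' \<rho>'"
    then obtain n where n: "real n \<le> r" "(\<rho>', x) \<in> edge_rel D' ^^ n" by (auto simp: ball_set_def)
    then obtain v where "x = \<phi> v" "(\<rho>, v) \<in> edge_rel D ^^ n"
      using ball_iso_subgraph_relpow[OF iso r sub iff, of n] by blast
    then show "x \<in> \<phi> ` ball_set r D \<rho>" using n by (auto simp: ball_set_def)
  qed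
  then show ?thesis using inj ball_isoD(3)[OF iso] iff sub1 by (auto simp: ball_iso_def bij_betw_def)
qed

lemma ball_iso_mono:
  assumes iso: "ball_iso R E \<rho> E' \<rho>' \<phi>" and r: "r \<le> R" shows "ball_iso r E \<rho> E' \<rho>' \<phi>"
  by (rule ball_iso_subgraph[OF iso r order_refl order_refl])
     (use ball_isoD(4)[OF iso] ball_set_mono[OF r order_refl[of E]] in blast)

lemma ball_iso_inverse:
  assumes iso: "ball_iso r E \<rho> E' \<rho>' \<phi>" "0 \<le> r"
  obtains \<psi> where "ball_iso r E' \<rho>' E \<rho> \<psi>" "\<And>v. v \<in> ball_set r E \<rho> \<Longrightarrow> \<psi> (\<phi> v) = v"
    "\<And>v. v \<in> ball_set r E' \<rho>' \<Longrightarrow> \<phi> (\<psi> v) = v"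
proof
  let ?\<psi> = "the_inv_into (ball_set r E \<rho>) \<phi>"
  note D = ball_isoD[OF iso(1)]
  show 1: "?\<psi> (\<phi> v) = v" if "v \<in> ball_set r E \<rho>" for v using the_inv_into_f_f[OF D(1) that] .
  show 2: "\<phi> (?\<psi> v) = v" if "v \<in> ball_set r E' \<rho>'" for v
    using f_the_inv_into_f[OF D(1)] that D(2) by blast
  have b: "bij_betw ?\<psi> (ball_set r E' \<rho>') (ball_set r E \<rho>)"
    using iso by (intro bij_betw_the_inv_into) (simp add: ball_iso_def)
  have 3: "?\<psi> v \<in> ball_set r E \<rho>" if "v \<in> ball_set r E' \<rho>'" for v using b that by (auto simp: bij_betw_def)
  show "ball_iso r E' \<rho>' E \<rho> ?\<psi>"
    unfolding ball_iso_def
  proof (intro conjI ballI)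
    show "?\<psi> \<rho>' = \<rho>" using 1[OF root_in_ball_set[OF iso(2)]] D(3) by simp
    fix u v assume "u \<in> ball_set r E' \<rho>'" "v \<in> ball_set r E' \<rho>'"
    then show "({u, v} \<in> E') = ({?\<psi> u, ?\<psi> v} \<in> E)" using D(4)[OF 3 3] 2 by simp
  qed (rule b)
qed

definition rooted_simple :: "'v graph \<Rightarrow> 'v \<Rightarrow> bool" where
  "rooted_simple G \<rho> \<longleftrightarrow> simple_graph G \<and> \<rho> \<in> verts G"

lemma local_equiv_iff:
  assumes "rooted_simple G \<rho>" "rooted_simple H \<rho>'"
  shows "local_equiv r (G, \<rho>, w) (H, \<rho>', w') \<longleftrightarrow>
    (\<exists>\<phi>. ball_iso r (edges G) \<rho> (edges H) \<rho>' \<phi> \<and>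
         (\<forall>e\<in>edges G. e \<subseteq> ball_set r (edges G) \<rho> \<longrightarrow> \<bar>w e - w' (\<phi> ` e)\<bar> \<le> 1 / r))"
proof -
  have 1: "verts (ball_graph r (G, \<rho>, w)) = ball_set r (edges G) \<rho>"
    "edges (ball_graph r (G, \<rho>, w)) = {e \<in> edges G. e \<subseteq> ball_set r (edges G) \<rho>}"
    using ball_set_verts[of G \<rho> "edges G" r] assms
    by (auto simp: ball_graph_def induced_subgraph_def adj_eq ball_set_def rooted_simple_def)
  have 2: "verts (ball_graph r (H, \<rho>', w')) = ball_set r (edges H) \<rho>'"
    "edges (ball_graph r (H, \<rho>', w')) = {e \<in> edges H. e \<subseteq> ball_set r (edges H) \<rho>'}"
    using ball_set_verts[of H \<rho>' "edges H" r] assms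
    by (auto simp: ball_graph_def induced_subgraph_def adj_eq ball_set_def rooted_simple_def)
  show ?thesis
    unfolding local_equiv_def Let_def 1 2 ball_iso_def fst_conv snd_conv
    by (intro ex_cong1) (auto dest: bij_betwE)
qed

lemma local_equiv_pull:
  assumes "rooted_simple G \<rho>" "rooted_simple G' \<rho>'" "rooted_simple H h"
    and iso: "ball_iso r (edges G) \<rho> (edges G') \<rho>' \<psi>"
    and w: "\<And>e f. e \<in> edges G \<Longrightarrow> e \<subseteq> ball_set r (edges G) \<rho> \<Longrightarrow> f \<in> edges H \<Longrightarrow> f \<subseteq> ball_set r (edges H) h \<Longrightarrow>
         \<bar>w' (\<psi> ` e) - wH f\<bar> \<le> 1 / r \<Longrightarrow> \<bar>w e - wH f\<bar> \<le> 1 / r"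
    and eq: "local_equiv r (G', \<rho>', w') (H, h, wH)"
  shows "local_equiv r (G, \<rho>, w) (H, h, wH)"
proof -
  obtain \<phi> where \<phi>: "ball_iso r (edges G') \<rho>' (edges H) h \<phi>"
    "\<And>e. e\<in>edges G' \<Longrightarrow> e \<subseteq> ball_set r (edges G') \<rho>' \<Longrightarrow> \<bar>w' e - wH (\<phi> ` e)\<bar> \<le> 1 / r"
    using eq unfolding local_equiv_iff[OF assms(2,3)] by blast
  note D = ball_isoD[OF iso] and D' = ball_isoD[OF \<phi>(1)]
  have in': "\<psi> u \<in> ball_set r (edges G') \<rho>'" if "u \<in> ball_set r (edges G) \<rho>" for u using D(2) that by blast
  have "ball_iso r (edges G) \<rho> (edges H) h (\<phi> \<circ> \<psi>)"
    unfolding ball_iso_def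
  proof (intro conjI ballI)
    show "bij_betw (\<phi> \<circ> \<psi>) (ball_set r (edges G) \<rho>) (ball_set r (edges H) h)"
      using iso \<phi>(1) by (intro bij_betw_trans) (auto simp: ball_iso_def)
    show "(\<phi> \<circ> \<psi>) \<rho> = h" using D(3) D'(3) by simp
    fix u v assume "u \<in> ball_set r (edges G) \<rho>" "v \<in> ball_set r (edges G) \<rho>"
    then show "({u, v} \<in> edges G) = ({(\<phi> \<circ> \<psi>) u, (\<phi> \<circ> \<psi>) v} \<in> edges H)"
      using D(4) D'(4) in' by simp
  qed
  moreover have "\<bar>w e - wH ((\<phi> \<circ> \<psi>) ` e)\<bar> \<le> 1 / r" if e: "e \<in> edges G" "e \<subseteq> ball_set r (edges G) \<rho>" for e
  proof -
    obtain a b where ab: "e = {a, b}" using assms(1) e(1) simple_edgeE unfolding rooted_simple_def by metis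
    have ab': "a \<in> ball_set r (edges G) \<rho>" "b \<in> ball_set r (edges G) \<rho>" using e(2) ab by auto
    have 1: "\<psi> ` e \<in> edges G'" "\<psi> ` e \<subseteq> ball_set r (edges G') \<rho>'"
      using D(4)[OF ab'] e(1) ab in' ab' by auto
    have "{\<psi> a, \<psi> b} \<in> edges G'" using 1 ab by simp
    then have 2: "\<phi> ` \<psi> ` e \<in> edges H" "\<phi> ` \<psi> ` e \<subseteq> ball_set r (edges H) h"
      using D'(4)[OF in'[OF ab'(1)] in'[OF ab'(2)]] D'(2) ab in' ab' by auto
    show ?thesis using w[OF e 2 \<phi>(2)[OF 1]] by (simp add: image_comp)
  qed
  ultimately show ?thesis using local_equiv_iff[OF assms(1,3)] by blast
qed

text \<open>
  If the weights on two isomorphic balls differ by at most \<open>\<delta>\<close>, the comparison with a third graph \<open>H\<close> can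
  give different answers only if some weight difference to \<open>H\<close> is within \<open>\<delta>\<close> of the threshold \<open>1 / r\<close>.
\<close>
lemma local_equiv_transfer:
  assumes rs: "rooted_simple G \<rho>" "rooted_simple G' \<rho>'" "rooted_simple H h" and r: "0 \<le> r"
    and iso: "ball_iso r (edges G) \<rho> (edges G') \<rho>' \<psi>"
    and w: "\<And>e. e \<in> edges G \<Longrightarrow> e \<subseteq> ball_set r (edges G) \<rho> \<Longrightarrow> \<bar>w e - w' (\<psi> ` e)\<bar> \<le> \<delta>"
    and generic: "\<And>e f. e \<in> edges G' \<Longrightarrow> e \<subseteq> ball_set r (edges G') \<rho>' \<Longrightarrow> f \<in> edges H \<Longrightarrow> f \<subseteq> ball_set r (edges H) h \<Longrightarrow>
         \<bar>\<bar>w' e - wH f\<bar> - 1 / r\<bar> > \<delta>"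
  shows "local_equiv r (G, \<rho>, w) (H, h, wH) \<longleftrightarrow> local_equiv r (G', \<rho>', w') (H, h, wH)"
proof
  note D = ball_isoD[OF iso]
  have im: "\<psi> ` e \<in> edges G' \<and> \<psi> ` e \<subseteq> ball_set r (edges G') \<rho>'"
    if e: "e \<in> edges G" "e \<subseteq> ball_set r (edges G) \<rho>" for e
  proof -
    obtain a b where ab: "e = {a, b}" using rs(1) e(1) simple_edgeE unfolding rooted_simple_def by metis
    then show ?thesis using D(2) D(4)[of a b] e by auto
  qed
  have close: "\<bar>w' (\<psi> ` e) - wH f\<bar> \<le> 1 / r \<longleftrightarrow> \<bar>w e - wH f\<bar> \<le> 1 / r"
    if "e \<in> edges G" "e \<subseteq> ball_set r (edges G) \<rho>" "f \<in> edges H" "f \<subseteq> ball_set r (edges H) h" for e f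
    using w[OF that(1,2)] generic[of "\<psi> ` e" f] im[OF that(1,2)] that(3,4) by (auto simp: abs_if split: if_splits)
  show "local_equiv r (G, \<rho>, w) (H, h, wH)" if "local_equiv r (G', \<rho>', w') (H, h, wH)"
    using local_equiv_pull[OF rs iso _ that] close by blast
  show "local_equiv r (G', \<rho>', w') (H, h, wH)" if eq: "local_equiv r (G, \<rho>, w) (H, h, wH)"
  proof -
    obtain \<phi> where \<phi>: "ball_iso r (edges G') \<rho>' (edges G) \<rho> \<phi>"
      "\<And>v. v \<in> ball_set r (edges G') \<rho>' \<Longrightarrow> \<psi> (\<phi> v) = v"
      using ball_iso_inverse[OF iso r] by metis
    have inv: "\<psi> ` \<phi> ` e = e" if "e \<subseteq> ball_set r (edges G') \<rho>'" for e
      using \<phi>(2) that by (force simp: image_image subset_eq)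
    have im': "\<phi> ` e \<in> edges G \<and> \<phi> ` e \<subseteq> ball_set r (edges G) \<rho>"
      if e: "e \<in> edges G'" "e \<subseteq> ball_set r (edges G') \<rho>'" for e
    proof -
      obtain a b where ab: "e = {a, b}" using rs(2) e(1) simple_edgeE unfolding rooted_simple_def by metis
      then show ?thesis using ball_isoD(2)[OF \<phi>(1)] ball_isoD(4)[OF \<phi>(1), of a b] e by auto
    qed
    show ?thesis
    proof (rule local_equiv_pull[OF rs(2,1,3) \<phi>(1) _ eq])
      fix e f assume ef: "e \<in> edges G'" "e \<subseteq> ball_set r (edges G') \<rho>'" "f \<in> edges H" "f \<subseteq> ball_set r (edges H) h"
        "\<bar>w (\<phi> ` e) - wH f\<bar> \<le> 1 / r"
      then show "\<bar>w' e - wH f\<bar> \<le> 1 / r" using close[of "\<phi> ` e" f] im'[OF ef(1,2)] inv[OF ef(2)] by simp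
    qed
  qed
qed

lemma local_dist_le:
  assumes "0 < r" "local_equiv r \<GG> \<HH>"
  shows "local_dist \<GG> \<HH> \<le> 1 / (1 + r)" "0 \<le> local_dist \<GG> \<HH>"
proof -
  let ?s = "SUP r\<in>{r. 0 \<le> r \<and> local_equiv r \<GG> \<HH>}. ereal r"
  have s: "ereal r \<le> ?s" using assms by (intro SUP_upper) auto
  have "local_dist \<GG> \<HH> \<le> 1 / (1 + r) \<and> 0 \<le> local_dist \<GG> \<HH>"
  proof (cases ?s)
    case (real x)
    then have "r \<le> x" using s by simp
    then show ?thesis using assms(1) real by (auto simp: local_dist_def inverse_eq_divide frac_le divide_ereal_def one_ereal_def)
  next
    case PInf then show ?thesis using assms(1) by (auto simp: local_dist_def)
  next
    case MInf then show ?thesis using s by auto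
  qed
  then show "local_dist \<GG> \<HH> \<le> 1 / (1 + r)" "0 \<le> local_dist \<GG> \<HH>" by auto
qed

text \<open>
  The equivalence at radius \<open>0\<close> is needed to exclude an empty supremum: its value would be \<open>-\<infinity>\<close>, and the
  distance \<open>0\<close>.
\<close>
lemma local_dist_less_imp_equiv:
  assumes "local_dist \<GG> \<HH> < 1 / (1 + R)" "0 < R" and ex: "local_equiv 0 \<GG> \<HH>"
  obtains r where "R < r" "local_equiv r \<GG> \<HH>"
proof -
  let ?S = "{r. 0 \<le> r \<and> local_equiv r \<GG> \<HH>}"
  let ?s = "SUP r\<in>?S. ereal r"
  have "0 \<le> ?s" using ex by (intro SUP_upper2[of 0]) (auto simp: zero_ereal_def)
  have "ereal R < ?s"
  proof (rule ccontr)
    assume "\<not> ereal R < ?s"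
    then have le: "?s \<le> ereal R" by simp
    then obtain x where x: "?s = ereal x" using \<open>0 \<le> ?s\<close> by (cases ?s) auto
    then have "0 \<le> x" "x \<le> R" using le \<open>0 \<le> ?s\<close> by auto
    then have "local_dist \<GG> \<HH> = 1 / (1 + x)"
      using x by (simp add: local_dist_def inverse_eq_divide divide_ereal_def one_ereal_def)
    then show False using assms(1) \<open>0 \<le> x\<close> \<open>x \<le> R\<close> by (simp add: frac_le leD)
  qed
  then obtain r where "r \<in> ?S" "ereal R < ereal r" by (auto simp: less_SUP_iff)
  then show thesis using that by auto
qed

section \<open>Transferring Prim's algorithm between locally similar graphs\<close>

text \<open>
  Only the edges inside the ball matter for walks of length at most \<open>r\<close> from the root.
\<close>
lemma relpow_local:
  assumes "P \<subseteq> E" "\<And>e. e \<in> P \<Longrightarrow> e \<subseteq> ball_set r E \<rho> \<Longrightarrow> e \<in> D"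
    "(\<rho>, v) \<in> edge_rel P ^^ n" "real n \<le> r"
  shows "(\<rho>, v) \<in> edge_rel D ^^ n"
  using assms(3,4)
proof (induction n arbitrary: v)
  case (Suc n)
  then obtain u where u: "(\<rho>, u) \<in> edge_rel P ^^ n" "{u, v} \<in> P" unfolding relpow_Suc_edge by blast
  have "u \<in> ball_set r E \<rho>" 
    by (rule relpow_in_ball_set[OF edge_relpow_mono[OF assms(1) u(1)]]) (use Suc.prems in simp)
  moreover have "v \<in> ball_set r E \<rho>" 
    by (rule relpow_in_ball_set[OF edge_relpow_mono[OF assms(1) Suc.prems(1)] Suc.prems(2)])
  ultimately have "{u, v} \<in> D" using assms(2) u(2) by auto
  then show ?case unfolding relpow_Suc_edge using Suc.IH[OF u(1)] Suc.prems by auto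
qed simp

lemma ball_set_step: "u \<in> ball_set r E \<rho> \<Longrightarrow> {u, v} \<in> E \<Longrightarrow> r + 1 \<le> s \<Longrightarrow> v \<in> ball_set s E \<rho>"
  unfolding ball_set_def mem_Collect_eq
proof (elim exE conjE)
  fix n assume "{u, v} \<in> E" "r + 1 \<le> s" "real n \<le> r" "(\<rho>, u) \<in> edge_rel E ^^ n"
  then show "\<exists>n. real n \<le> s \<and> (\<rho>, v) \<in> edge_rel E ^^ n"
    by (intro exI[of _ "Suc n"]) (auto simp: edge_rel_def)
qed

lemma ball_iso_cong:
  assumes "ball_set r E \<rho> = ball_set r D \<rho>"
    "\<And>u v. u \<in> ball_set r E \<rho> \<Longrightarrow> v \<in> ball_set r E \<rho> \<Longrightarrow> {u, v} \<in> E \<longleftrightarrow> {u, v} \<in> D"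
    "ball_set r E' \<rho>' = ball_set r D' \<rho>'"
    "\<And>u v. u \<in> ball_set r E' \<rho>' \<Longrightarrow> v \<in> ball_set r E' \<rho>' \<Longrightarrow> {u, v} \<in> E' \<longleftrightarrow> {u, v} \<in> D'"
    "ball_iso r E \<rho> E' \<rho>' \<phi>"
  shows "ball_iso r D \<rho> D' \<rho>' \<phi>"
proof -
  note I = ball_isoD[OF assms(5)]
  have "({u, v} \<in> D) = ({\<phi> u, \<phi> v} \<in> D')" if "u \<in> ball_set r E \<rho>" "v \<in> ball_set r E \<rho>" for u v
    using assms(2,4) I(2,4) that by blast
  then show ?thesis using assms(5) unfolding ball_iso_def assms(1,3) by blast
qed

definition rooted_part :: "'v set \<Rightarrow> 'v set set \<Rightarrow> 'v \<Rightarrow> 'v graph" where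
  "rooted_part V E \<rho> = root_component \<lparr>verts = V, edges = E\<rparr> \<rho>"

lemma rooted_part_simps:
  "verts (rooted_part V E \<rho>) = {v \<in> V. (\<rho>, v) \<in> (edge_rel E)\<^sup>*}"
  "edges (rooted_part V E \<rho>) = {e \<in> E. e \<subseteq> verts (rooted_part V E \<rho>)}"
  by (auto simp: rooted_part_def root_component_def induced_subgraph_def component_def adj_eq)

lemma rooted_part_ball:
  assumes "simple_graph G" "\<rho> \<in> verts G" "E \<subseteq> edges G"
  shows "ball_set r (edges (rooted_part (verts G) E \<rho>)) \<rho> = ball_set r E \<rho>"
    and "u \<in> ball_set r E \<rho> \<Longrightarrow> v \<in> ball_set r E \<rho> \<Longrightarrow>
         {u, v} \<in> edges (rooted_part (verts G) E \<rho>) \<longleftrightarrow> {u, v} \<in> E"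
proof -
  have b: "ball_set r E \<rho> \<subseteq> verts (rooted_part (verts G) E \<rho>)"
    using ball_set_verts[OF assms, of r] unfolding rooted_part_simps ball_set_def
    by (auto dest: relpow_imp_rtrancl)
  then show "u \<in> ball_set r E \<rho> \<Longrightarrow> v \<in> ball_set r E \<rho> \<Longrightarrow>
         {u, v} \<in> edges (rooted_part (verts G) E \<rho>) \<longleftrightarrow> {u, v} \<in> E"
    unfolding rooted_part_simps(2) by blast
  have 1: "edges (rooted_part (verts G) E \<rho>) \<subseteq> E" unfolding rooted_part_simps(2) by blast
  have "(\<rho>, v) \<in> edge_rel (edges (rooted_part (verts G) E \<rho>)) ^^ n"
    if "(\<rho>, v) \<in> edge_rel E ^^ n" "real n \<le> r" for v n
    by (rule relpow_local[OF order_refl _ that]) (use b in \<open>auto simp: rooted_part_simps(2)\<close>)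
  then show "ball_set r (edges (rooted_part (verts G) E \<rho>)) \<rho> = ball_set r E \<rho>"
    using edge_relpow_mono[OF 1] unfolding ball_set_def by blast
qed

lemma rooted_part_simple:
  assumes "simple_graph G" "\<rho> \<in> verts G" "E \<subseteq> edges G"
  shows "rooted_simple (rooted_part (verts G) E \<rho>) \<rho>"
  using assms unfolding rooted_simple_def simple_graph_def rooted_part_simps by auto

lemma rooted_part_rooted_graph:
  assumes "rooted_graph (G, \<rho>)" "E \<subseteq> edges G"
  shows "rooted_graph (rooted_part (verts G) E \<rho>, \<rho>)"
proof -
  have "locally_finite_graph (rooted_part (verts G) E \<rho>)"
    unfolding locally_finite_graph_def
  proof
    fix v assume "v \<in> verts (rooted_part (verts G) E \<rho>)"
    then have "finite {e \<in> edges G. v \<in> e}"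
      using assms(1) by (auto simp: rooted_part_simps rooted_graph_def locally_finite_graph_def)
    then show "finite {e \<in> edges (rooted_part (verts G) E \<rho>). v \<in> e}"
      by (rule rev_finite_subset) (use assms(2) in \<open>auto simp: rooted_part_simps\<close>)
  qed
  then show ?thesis using rooted_part_simple[of G \<rho> E] assms by (auto simp: rooted_graph_def rooted_simple_def)
qed

context prim_graph
begin

definition inv_edges :: "'v set set" where "inv_edges = (\<Union>k. edges (tr k))"

lemma expanded_eq:
  "expanded_invasion_cluster p (G, \<rho>, w) =
    (rooted_part (verts G) (inv_edges \<union> {e \<in> edges (graph_of (msf (G, \<rho>, w))). w e \<le> p}) \<rho>, \<rho>, w)"
proof -
  have "edges (graph_of (invasion_cluster (G, \<rho>, w))) = inv_edges"
    unfolding invasion_cluster_def inv_edges_def fst_conv graph.simps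
  proof (intro equalityI subsetI)
    fix e assume "e \<in> (\<Union>k\<in>{1..}. edges (prim_tree (G, \<rho>, w) k))"
    then show "e \<in> (\<Union>k. edges (tr k))" by (auto simp: prim_tree_tr)
  next
    fix e assume "e \<in> (\<Union>k. edges (tr k))"
    then obtain k where "e \<in> edges (tr k)" by auto
    then show "e \<in> (\<Union>k\<in>{1..}. edges (prim_tree (G, \<rho>, w) k))" by (auto simp: tr_def intro!: bexI[of _ "Suc k"])
  qed
  then show ?thesis by (simp add: expanded_invasion_cluster_def rooted_part_def)
qed

lemma tr_in_ball: "verts (tr k) \<subseteq> ball_set (real k) (edges G) \<rho>"
proof (induction k)
  case 0 then show ?case by (simp add: root_in_ball_set)
next
  case (Suc k)
  have mono: "ball_set (real k) (edges G) \<rho> \<subseteq> ball_set (real (Suc k)) (edges G) \<rho>" by (rule ball_set_mono) auto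
  show ?case
  proof (cases "bd k = {}")
    case True then show ?thesis using Suc mono tr_stop by auto
  next
    case False
    then obtain a b where s: "a \<in> verts (tr k)" "{a, b} \<in> edges G" "verts (tr (Suc k)) = insert b (verts (tr k))"
      by (rule tr_step) metis
    have "b \<in> ball_set (real (Suc k)) (edges G) \<rho>"
      by (rule ball_set_step[of a "real k"]) (use Suc s in auto)
    then show ?thesis using Suc mono s(3) by auto
  qed
qed

lemma tr_rooted_simple: "rooted_simple (tr k) \<rho>"
  using simple edges_tr_sub[of k] edges_tr_verts[of _ k] root_in_tr by (auto simp: rooted_simple_def simple_graph_def)

end

text \<open>
  The first \<open>m\<close> steps see only the ball of radius \<open>m\<close>, and they depend only on the order of the weights there.  The
  order is preserved if the weights on one side are more than \<open>2 * \<delta>\<close> apart and the isomorphism changes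
  weights by at most \<open>\<delta>\<close>.
\<close>
lemma tr_ball_iso:
  assumes P: "inj_prim_graph G \<rho> w" and P': "inj_prim_graph G' \<rho>' w'"
    and iso: "ball_iso R (edges G) \<rho> (edges G') \<rho>' \<phi>"
    and wt: "\<And>e. e \<in> edges G \<Longrightarrow> e \<subseteq> ball_set R (edges G) \<rho> \<Longrightarrow> \<bar>w e - w' (\<phi> ` e)\<bar> \<le> \<delta>"
    and sep: "\<And>e f. e \<in> edges G' \<Longrightarrow> f \<in> edges G' \<Longrightarrow> e \<subseteq> ball_set (real m) (edges G') \<rho>' \<Longrightarrow>
        f \<subseteq> ball_set (real m) (edges G') \<rho>' \<Longrightarrow> e \<noteq> f \<Longrightarrow> \<bar>w' e - w' f\<bar> > 2 * \<delta>"
    and km: "k \<le> m" and mR: "real m \<le> R"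
  shows "verts (prim_graph.tr G' \<rho>' w' k) = \<phi> ` verts (prim_graph.tr G \<rho> w k) \<and>
    edges (prim_graph.tr G' \<rho>' w' k) = (`) \<phi> ` edges (prim_graph.tr G \<rho> w k)"
proof -
  interpret P: inj_prim_graph G \<rho> w by fact
  interpret P': inj_prim_graph G' \<rho>' w' by fact
  note D = ball_isoD[OF iso]
  show ?thesis using km
  proof (induction k)
    case 0 then show ?case using D(3) by simp
  next
    case (Suc k)
    then have V: "verts (P'.tr k) = \<phi> ` verts (P.tr k)" and E: "edges (P'.tr k) = (`) \<phi> ` edges (P.tr k)" by auto
    have kR: "real (Suc k) \<le> R" "real k \<le> R" using Suc.prems mR by auto
    have inB: "verts (P.tr k) \<subseteq> ball_set R (edges G) \<rho>"
      using P.tr_in_ball[of k] ball_set_mono[OF kR(2) order_refl[of "edges G"]] by blast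
    have nb: "y \<in> ball_set (real (Suc k)) (edges G) \<rho>" if xy: "x \<in> verts (P.tr k)" "{x, y} \<in> edges G" for x y
      by (rule ball_set_step[of x "real k"]) (use P.tr_in_ball[of k] xy in auto)
   have nb': "y \<in> ball_set (real (Suc k)) (edges G') \<rho>'" if xy: "x \<in> verts (P'.tr k)" "{x, y} \<in> edges G'" for x y
      by (rule ball_set_step[of x "real k"]) (use P'.tr_in_ball[of k] xy in auto)
   have fwd: "b \<in> ball_set R (edges G) \<rho> \<and> \<phi> b \<notin> verts (P'.tr k) \<and> {\<phi> a, \<phi> b} \<in> P'.bd k"
      if ab: "a \<in> verts (P.tr k)" "b \<notin> verts (P.tr k)" "{a, b} \<in> edges G" for a b
    proof -
      have b: "b \<in> ball_set R (edges G) \<rho>" using nb[OF ab(1,3)] ball_set_mono[OF kR(1) order_refl[of "edges G"]] by blast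
      have "\<phi> b \<notin> verts (P'.tr k)" using V inB b ab(2) D(1) by (auto dest: inj_onD)
      moreover have "{\<phi> a, \<phi> b} \<in> edges G'" using D(4) inB ab b by blast
      ultimately show ?thesis using P'.boundary_edgesI V ab(1) b by auto
    qed
    have bwd: "\<exists>a b. a' = \<phi> a \<and> b' = \<phi> b \<and> a \<in> verts (P.tr k) \<and> b \<in> ball_set R (edges G) \<rho> \<and> b \<notin> verts (P.tr k) \<and> {a, b} \<in> edges G"
      if ab: "a' \<in> verts (P'.tr k)" "b' \<notin> verts (P'.tr k)" "{a', b'} \<in> edges G'" for a' b'
    proof -
      obtain a where a: "a' = \<phi> a" "a \<in> verts (P.tr k)" using V ab(1) by auto
      have "b' \<in> ball_set R (edges G') \<rho>'" using nb'[OF ab(1,3)] ball_set_mono[OF kR(1) order_refl[of "edges G'"]] by blast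
      then obtain b where b: "b' = \<phi> b" "b \<in> ball_set R (edges G) \<rho>" using D(2) by auto
      have "{a, b} \<in> edges G" using D(4)[of a b] a b inB ab(3) by auto
      then show ?thesis using a b V ab(2) by blast
    qed
    show ?case
    proof (cases "P.bd k = {}")
      case True
      have "P'.bd k = {}"
      proof (rule ccontr)
        assume "P'.bd k \<noteq> {}"
        then obtain e where "e \<in> P'.bd k" by auto
        then obtain a' b' where "a' \<in> verts (P'.tr k)" "b' \<notin> verts (P'.tr k)" "{a', b'} \<in> edges G'"
          by (metis P'.boundary_edgesE)
        from bwd[OF this] have "P.bd k \<noteq> {}" using P.boundary_edgesI by fastforce
        then show False using True by simp
      qed
      then show ?thesis using True P.tr_stop P'.tr_stop V E by simp
    next
      case False
      then obtain a b where s: "a \<in> verts (P.tr k)" "b \<notin> verts (P.tr k)" "{a, b} \<in> edges G"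
        "verts (P.tr (Suc k)) = insert b (verts (P.tr k))"
        "edges (P.tr (Suc k)) = insert {a, b} (edges (P.tr k))" "\<And>f. f \<in> P.bd k \<Longrightarrow> w {a, b} \<le> w f"
        by (rule P.tr_step) metis
      note ab = fwd[OF s(1-3)]
      then have "P'.bd k \<noteq> {}" by auto
      then obtain a' b' where s': "a' \<in> verts (P'.tr k)" "b' \<notin> verts (P'.tr k)" "{a', b'} \<in> edges G'"
        "verts (P'.tr (Suc k)) = insert b' (verts (P'.tr k))"
        "edges (P'.tr (Suc k)) = insert {a', b'} (edges (P'.tr k))" "\<And>f. f \<in> P'.bd k \<Longrightarrow> w' {a', b'} \<le> w' f"
        by (rule P'.tr_step) metis
      obtain x y where xy: "a' = \<phi> x" "b' = \<phi> y" "x \<in> verts (P.tr k)" "y \<in> ball_set R (edges G) \<rho>"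
        "y \<notin> verts (P.tr k)" "{x, y} \<in> edges G" using bwd[OF s'(1-3)] by blast
      have wx: "\<bar>w {x, y} - w' {a', b'}\<bar> \<le> \<delta>" using wt[of "{x, y}"] xy inB by auto
      have wa: "\<bar>w {a, b} - w' {\<phi> a, \<phi> b}\<bar> \<le> \<delta>" using wt[of "{a, b}"] s inB ab by auto
      have "w {a, b} \<le> w {x, y}" using s(6) P.boundary_edgesI xy by blast
      moreover have "w' {a', b'} \<le> w' {\<phi> a, \<phi> b}" using s'(6) ab by blast
      ultimately have close: "\<bar>w' {a', b'} - w' {\<phi> a, \<phi> b}\<bar> \<le> 2 * \<delta>" using wx wa by linarith
      have km': "real k \<le> real m" "real (Suc k) \<le> real m" using Suc.prems by auto
      have m: "verts (P'.tr k) \<subseteq> ball_set (real m) (edges G') \<rho>'"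
        using P'.tr_in_ball[of k] ball_set_mono[OF km'(1) order_refl[of "edges G'"]] by blast
      have ina: "\<phi> a \<in> verts (P'.tr k)" using V s(1) by blast
      have abG: "{\<phi> a, \<phi> b} \<in> edges G'" using ab by (auto simp: boundary_edges_def)
      have "\<phi> b \<in> ball_set (real m) (edges G') \<rho>'" "b' \<in> ball_set (real m) (edges G') \<rho>'"
        using nb'[OF ina abG] nb'[OF s'(1,3)] ball_set_mono[OF km'(2) order_refl[of "edges G'"]] by blast+
      then have eq: "{a', b'} = {\<phi> a, \<phi> b}"
        using sep[OF s'(3) abG] m s'(1) ina close by fastforce
      then have "b' = \<phi> b" using s'(1,2) ab ina by (auto simp: doubleton_eq_iff)
      then show ?thesis using V E s(4,5) s'(4,5) eq by auto
    qed
  qed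
qed

context connected_prim_graph begin

text \<open>
  After \<open>K + Suc K * j\<close> steps the tree has \<open>Suc K * Suc j\<close> vertices, all of them in the clusters of the
  \<open>Suc K\<close> vertices of \<open>tr K\<close>.
\<close>
lemma pigeonhole_cluster:
  assumes "finite (verts G)" "K + Suc K * j < card (verts G)"
    "\<And>e. e \<in> edges (tr (K + Suc K * j)) \<Longrightarrow> e \<notin> edges (tr K) \<Longrightarrow> w e \<le> p"
  obtains u where "u \<in> verts (tr K)" "j \<le> card (cluster (G, \<rho>, w) u p)"
proof (rule ccontr)
  assume "\<not> thesis"
  with that have lt: "card (cluster (G, \<rho>, w) u p) \<le> j" if "u \<in> verts (tr K)" for u
    using that by (meson nle_le)
  have fin: "finite (cluster (G, \<rho>, w) u p)" for u using assms(1) by (auto simp: cluster_eq)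
  have "Suc (K + Suc K * j) = card (verts (tr (K + Suc K * j)))"
    using card_tr_finite[OF assms(1)] assms(2) by simp
  also have "\<dots> \<le> card (\<Union>u\<in>verts (tr K). cluster (G, \<rho>, w) u p)"
    using tr_covered_by_clusters[of K "K + Suc K * j" p] assms(3) fin finite_verts_tr by (intro card_mono) auto
  also have "\<dots> \<le> (\<Sum>u\<in>verts (tr K). card (cluster (G, \<rho>, w) u p))"
    by (rule card_UN_le[OF finite_verts_tr])
  also have "\<dots> \<le> card (verts (tr K)) * j" using sum_bounded_above[of "verts (tr K)" _ j] lt by simp
  also have "\<dots> \<le> Suc K * j" using card_tr_le[of K] by (rule mult_le_mono1)
  finally show False by simp
qed

end

lemma prim_graph_ball_finite:
  assumes "prim_graph G \<rho>"
  shows "finite {v. (\<rho>, v) \<in> edge_rel (edges G) ^^ n}"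
proof (induction n)
  case (Suc n)
  interpret prim_graph G \<rho> "\<lambda>_. 0" by fact
  have V: "{v. (\<rho>, v) \<in> edge_rel (edges G) ^^ n} \<subseteq> verts G"
    using rtrancl_verts[OF simple order_refl _ root] by (auto dest: relpow_imp_rtrancl)
  have "{v. (\<rho>, v) \<in> edge_rel (edges G) ^^ Suc n} \<subseteq> \<Union> (\<Union>u\<in>{v. (\<rho>, v) \<in> edge_rel (edges G) ^^ n}. {e \<in> edges G. u \<in> e})"
  proof
    fix v assume "v \<in> {v. (\<rho>, v) \<in> edge_rel (edges G) ^^ Suc n}"
    then obtain u where "(\<rho>, u) \<in> edge_rel (edges G) ^^ n" "{u, v} \<in> edges G"
      unfolding mem_Collect_eq relpow_Suc_edge by blast
    then show "v \<in> \<Union> (\<Union>u\<in>{v. (\<rho>, v) \<in> edge_rel (edges G) ^^ n}. {e \<in> edges G. u \<in> e})" by auto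
  qed
  moreover have "finite (\<Union> (\<Union>u\<in>{v. (\<rho>, v) \<in> edge_rel (edges G) ^^ n}. {e \<in> edges G. u \<in> e}))"
  proof (rule finite_Union)
    show "finite (\<Union>u\<in>{v. (\<rho>, v) \<in> edge_rel (edges G) ^^ n}. {e \<in> edges G. u \<in> e})"
      by (rule finite_UN_I[OF Suc]) (use locfin V in \<open>auto simp: locally_finite_graph_def\<close>)
    show "finite M" if "M \<in> (\<Union>u\<in>{v. (\<rho>, v) \<in> edge_rel (edges G) ^^ n}. {e \<in> edges G. u \<in> e})" for M
      using simple that by (auto simp: simple_graph_def card_2_iff)
  qed
  ultimately show ?case by (rule finite_subset)
qed simp

lemma finite_ball_set:
  assumes "prim_graph G \<rho>" shows "finite (ball_set r (edges G) \<rho>)"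
proof -
  have "ball_set r (edges G) \<rho> \<subseteq> (\<Union>n\<le>nat \<lfloor>r\<rfloor>. {v. (\<rho>, v) \<in> edge_rel (edges G) ^^ n})"
    by (force simp: ball_set_def le_nat_floor)
  then show ?thesis using prim_graph_ball_finite[OF assms] finite_subset by blast
qed

context inj_prim_graph begin

text \<open>
  The level is replaced by a condition \<open>Q\<close> on edges, because the left limits in time of the expanded clusters need not be
  given by a condition of the form \<open>w e \<le> p\<close>.
\<close>
definition expanded :: "('a set \<Rightarrow> bool) \<Rightarrow> 'a rwgraph" where
  "expanded Q = (rooted_part (verts G) (inv_edges \<union> {e \<in> edges A. Q e}) \<rho>, \<rho>, w)"

lemma expanded_le: "expanded_invasion_cluster p (G, \<rho>, w) = expanded (\<lambda>e. w e \<le> p)"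
  unfolding expanded_def expanded_eq ..

lemma A_sub: "edges A \<subseteq> edges G" using F_sub by (auto simp: edges_A)

lemma expanded_edges_sub: "inv_edges \<union> {e \<in> edges A. Q e} \<subseteq> edges A"
  using edges_tr_A by (auto simp: inv_edges_def)

lemma expanded_equiv:
  assumes "0 < r" "\<And>e. e \<in> edges G \<Longrightarrow> e \<subseteq> ball_set r (edges G) \<rho> \<Longrightarrow> Q e \<longleftrightarrow> Q' e"
  shows "local_equiv r (expanded Q) (expanded Q')"
proof -
  have sub: "inv_edges \<union> {e \<in> edges A. Q e} \<subseteq> edges G" for Q using expanded_edges_sub A_sub by blast
  have "ball_iso r (inv_edges \<union> {e \<in> edges A. Q e}) \<rho> (inv_edges \<union> {e \<in> edges A. Q' e}) \<rho> (\<lambda>x. x)"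
    by (rule ball_iso_subgraph[OF ball_iso_id order_refl sub sub]) (use assms(2) A_sub in auto)
  then have 1: "ball_iso r (edges (rooted_part (verts G) (inv_edges \<union> {e \<in> edges A. Q e}) \<rho>)) \<rho>
     (edges (rooted_part (verts G) (inv_edges \<union> {e \<in> edges A. Q' e}) \<rho>)) \<rho> (\<lambda>x. x)"
    by (rule ball_iso_cong[rotated 4])
       (use rooted_part_ball[OF simple root sub] in auto)
  show ?thesis
    unfolding expanded_def
    by (subst local_equiv_iff[OF rooted_part_simple[OF simple root sub] rooted_part_simple[OF simple root sub]])
       (use 1 assms(1) in auto)
qed

lemma expanded_rwgraph: "rooted_weighted_graph (expanded Q)"
proof -
  have sub: "inv_edges \<union> {e \<in> edges A. Q e} \<subseteq> edges G" using expanded_edges_sub A_sub by blast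
  have "rooted_graph (G, \<rho>)" using simple locfin root by (simp add: rooted_graph_def)
  from rooted_part_rooted_graph[OF this sub] show ?thesis
    unfolding expanded_def rooted_weighted_graph_def
    using inj_on_subset[OF inj, of "edges (rooted_part (verts G) (inv_edges \<union> {e \<in> edges A. Q e}) \<rho>)"] sub
    by (auto simp: rooted_part_simps)
qed

end

text \<open>
  The tree after \<open>k\<close> steps is squeezed between two descriptions.  It contains whatever \<open>exp_edges K p''\<close> reaches from the root, by
  \<open>lower\<close>; and its edges outside of \<open>tr K\<close> have weight at most \<open>p'\<close>, by \<open>upper\<close>.  No weight near the
  root lies between \<open>p''\<close> and \<open>p'\<close>, so that both bounds coincide there; and since the invasion
  is finished near the root at step \<open>K\<close>, the common value corresponds under the isomorphism to the expanded invasion cluster.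
\<close>
lemma prim_local_agreement:
  assumes P: "inj_prim_graph G \<rho> w" and P': "inj_prim_graph G' \<rho>' w'" and H: "rooted_simple H h"
    and Kk: "K \<le> k" and r: "0 < r" "r \<le> real m" and Km: "K \<le> m" "real m \<le> R"
    and lower: "\<And>x. x \<in> verts (prim_graph.tr G \<rho> w K) \<Longrightarrow> cluster (G, \<rho>, w) x p'' \<subseteq> verts (prim_graph.tr G \<rho> w k)"
    and upper: "\<And>e. e \<in> edges (prim_graph.tr G \<rho> w k) \<Longrightarrow> e \<notin> edges (prim_graph.tr G \<rho> w K) \<Longrightarrow> w e \<le> p'"
    and eq: "local_equiv R (msf (G, \<rho>, w)) (msf (G', \<rho>', w'))"
    and sep: "\<And>e f. e \<in> edges G' \<Longrightarrow> f \<in> edges G' \<Longrightarrow> e \<subseteq> ball_set (real m) (edges G') \<rho>' \<Longrightarrow>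
        f \<subseteq> ball_set (real m) (edges G') \<rho>' \<Longrightarrow> e \<noteq> f \<Longrightarrow> \<bar>w' e - w' f\<bar> > 2 / R"
    and pp: "p'' \<le> p" "p \<le> p'"
    and gap: "\<And>e. e \<in> edges G' \<Longrightarrow> e \<subseteq> ball_set r (edges G') \<rho>' \<Longrightarrow> w' e < p'' - 1 / R \<or> p' + 1 / R < w' e"
    and inv: "\<And>e. e \<in> prim_graph.inv_edges G' \<rho>' w' \<Longrightarrow> e \<subseteq> ball_set r (edges G') \<rho>' \<Longrightarrow> e \<in> edges (prim_graph.tr G' \<rho>' w' K)"
    and generic: "\<And>e f. e \<in> edges G' \<Longrightarrow> e \<subseteq> ball_set r (edges G') \<rho>' \<Longrightarrow> f \<in> edges H \<Longrightarrow> f \<subseteq> ball_set r (edges H) h \<Longrightarrow>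
         \<bar>\<bar>w' e - wH f\<bar> - 1 / r\<bar> > 1 / R"
  shows "local_equiv r (prim (Suc k) (G, \<rho>, w)) (H, h, wH) \<longleftrightarrow>
         local_equiv r (expanded_invasion_cluster p (G', \<rho>', w')) (H, h, wH)"
proof -
  interpret P: inj_prim_graph G \<rho> w by fact
  interpret P': inj_prim_graph G' \<rho>' w' by fact
  interpret M: inj_prim_graph P.A \<rho> w by (rule P.msf_inj_prim_graph)
  interpret M': inj_prim_graph P'.A \<rho>' w' by (rule P'.msf_inj_prim_graph)
  have rs: "rooted_simple P.A \<rho>" "rooted_simple P'.A \<rho>'"
    using M.simple M.root M'.simple M'.root by (auto simp: rooted_simple_def)
  have rR: "r \<le> R" "0 < R" using r Km by auto
  have eqA: "local_equiv R (P.A, \<rho>, w) (P'.A, \<rho>', w')"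
    by (subst P.msf_eq[symmetric], subst P'.msf_eq[symmetric]) (rule eq)
  obtain \<phi> where \<phi>: "ball_iso R (edges P.A) \<rho> (edges P'.A) \<rho>' \<phi> \<and>
      (\<forall>e\<in>edges P.A. e \<subseteq> ball_set R (edges P.A) \<rho> \<longrightarrow> \<bar>w e - w' (\<phi> ` e)\<bar> \<le> 1 / R)"
    using eqA unfolding local_equiv_iff[OF rs] by (rule exE)
  have iso: "ball_iso R (edges P.A) \<rho> (edges P'.A) \<rho>' \<phi>"
    and wt: "\<And>e. e \<in> edges P.A \<Longrightarrow> e \<subseteq> ball_set R (edges P.A) \<rho> \<Longrightarrow> \<bar>w e - w' (\<phi> ` e)\<bar> \<le> 1 / R"
    using \<phi> by simp_all
  note D = ball_isoD[OF iso]
  have b': "ball_set s (edges P'.A) \<rho>' \<subseteq> ball_set s (edges G') \<rho>'" for s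
    using ball_set_mono[OF order_refl P'.A_sub] .
  have bR: "ball_set r (edges P.A) \<rho> \<subseteq> ball_set R (edges P.A) \<rho>" by (rule ball_set_mono[OF rR(1) order_refl])
  have trK: "verts (P'.tr K) = \<phi> ` verts (P.tr K) \<and> edges (P'.tr K) = (`) \<phi> ` edges (P.tr K)"
  proof -
    have "\<bar>w' e - w' f\<bar> > 2 * (1 / R)" if "e \<in> edges P'.A" "f \<in> edges P'.A"
      "e \<subseteq> ball_set (real m) (edges P'.A) \<rho>'" "f \<subseteq> ball_set (real m) (edges P'.A) \<rho>'" "e \<noteq> f" for e f
      using sep[of e f] that b'[of "real m"] P'.A_sub by auto
    from tr_ball_iso[OF P.msf_inj_prim_graph P'.msf_inj_prim_graph iso wt this Km] show ?thesis
      unfolding P.tr_msf P'.tr_msf .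
  qed
  let ?X = "P'.inv_edges \<union> {e \<in> edges P'.A. w' e \<le> p}"
  note isor = ball_iso_mono[OF iso rR(1)]
  have KR: "verts (P.tr K) \<subseteq> ball_set R (edges P.A) \<rho>"
    using M.tr_in_ball[of K] ball_set_mono[of "real K" R "edges P.A"] Km unfolding P.tr_msf by fastforce
  have edge: "{u, v} \<in> P.exp_edges K p'' \<longleftrightarrow> {\<phi> u, \<phi> v} \<in> ?X" "w {u, v} \<le> p' \<Longrightarrow> {u, v} \<in> edges P.A \<Longrightarrow> w {u, v} \<le> p''"
    if uv: "u \<in> ball_set r (edges P.A) \<rho>" "v \<in> ball_set r (edges P.A) \<rho>" for u v
  proof -
    have uvR: "u \<in> ball_set R (edges P.A) \<rho>" "v \<in> ball_set R (edges P.A) \<rho>" using uv bR by auto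
    have uv': "{\<phi> u, \<phi> v} \<subseteq> ball_set r (edges P'.A) \<rho>'" using uv ball_isoD(2)[OF isor] by auto
    then have uvG: "{\<phi> u, \<phi> v} \<subseteq> ball_set r (edges G') \<rho>'" using b' by blast
    have E: "{u, v} \<in> edges P.A \<longleftrightarrow> {\<phi> u, \<phi> v} \<in> edges P'.A" using D(4)[OF uvR] .
    have T: "{u, v} \<in> edges (P.tr K) \<longleftrightarrow> {\<phi> u, \<phi> v} \<in> edges (P'.tr K)"
    proof
      assume "{u, v} \<in> edges (P.tr K)"
      from imageI[OF this, of "(`) \<phi>"] show "{\<phi> u, \<phi> v} \<in> edges (P'.tr K)" using trK by simp
    next
      assume "{\<phi> u, \<phi> v} \<in> edges (P'.tr K)"
      then obtain f where f: "f \<in> edges (P.tr K)" "\<phi> ` {u, v} = \<phi> ` f" using trK by auto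
      have "f \<subseteq> ball_set R (edges P.A) \<rho>" using P.edges_tr_verts[OF f(1)] KR by blast
      then have "{u, v} = f" using inj_on_image_eq_iff[OF D(1)] f(2) uvR by (metis empty_subsetI insert_subset)
      then show "{u, v} \<in> edges (P.tr K)" using f by simp
    qed
    have W: "w {u, v} \<le> p'' \<longleftrightarrow> w' {\<phi> u, \<phi> v} \<le> p" "w {u, v} \<le> p' \<longleftrightarrow> w {u, v} \<le> p''" if e: "{u, v} \<in> edges P.A"
    proof -
      have "\<bar>w {u, v} - w' {\<phi> u, \<phi> v}\<bar> \<le> 1 / R" using wt[OF e] uvR by auto
      moreover have "w' {\<phi> u, \<phi> v} < p'' - 1 / R \<or> p' + 1 / R < w' {\<phi> u, \<phi> v}"
        using gap E e P'.A_sub uvG by blast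
      moreover have "0 < 1 / R" using rR by simp
      ultimately show "w {u, v} \<le> p'' \<longleftrightarrow> w' {\<phi> u, \<phi> v} \<le> p" "w {u, v} \<le> p' \<longleftrightarrow> w {u, v} \<le> p''"
        using pp by linarith+
    qed
    have I: "{\<phi> u, \<phi> v} \<in> edges (P'.tr K) \<longleftrightarrow> {\<phi> u, \<phi> v} \<in> P'.inv_edges"
      using inv[OF _ uvG] by (auto simp: P'.inv_edges_def)
    show "{u, v} \<in> P.exp_edges K p'' \<longleftrightarrow> {\<phi> u, \<phi> v} \<in> ?X"
      using T I E W(1) unfolding P.exp_edges_def by blast
    show "w {u, v} \<le> p' \<Longrightarrow> {u, v} \<in> edges P.A \<Longrightarrow> w {u, v} \<le> p''" using W(2) by blast
  qed
  have iso1: "ball_iso r (P.exp_edges K p'') \<rho> ?X \<rho>' \<phi>"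
    by (rule ball_iso_subgraph[OF iso rR(1) P.exp_edges_sub P'.expanded_edges_sub edge(1)])
  have up: "e \<in> P.exp_edges K p''" if e: "e \<in> edges (P.tr k)" "e \<subseteq> ball_set r (edges P.A) \<rho>" for e
  proof -
    obtain a b where ab: "e = {a, b}" using simple_edgeE[OF P.simple] e(1) P.edges_tr_sub by (metis subsetD)
    have "e \<in> edges P.A" using e(1) P.edges_tr_A by blast
    then show ?thesis using upper[OF e(1)] edge(2)[of a b] e(2) ab by (auto simp: P.exp_edges_def)
  qed
  have up_relpow: "(\<rho>, v) \<in> edge_rel (P.exp_edges K p'') ^^ n" if "(\<rho>, v) \<in> edge_rel (edges (P.tr k)) ^^ n" "real n \<le> r" for v n
    by (rule relpow_local[OF P.edges_tr_A up that])
  have low_relpow: "(\<rho>, v) \<in> edge_rel (edges (P.tr k)) ^^ n \<and> v \<in> verts (P.tr k)"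
    if v: "(\<rho>, v) \<in> edge_rel (P.exp_edges K p'') ^^ n" for v n
    using P.exp_edges_reach[OF Kk lower v] lower by blast
  have ball_eq: "ball_set r (P.exp_edges K p'') \<rho> = ball_set r (edges (P.tr k)) \<rho>"
    using up_relpow low_relpow unfolding ball_set_def by blast
  have edge_eq: "{u, v} \<in> P.exp_edges K p'' \<longleftrightarrow> {u, v} \<in> edges (P.tr k)"
    if uv: "u \<in> ball_set r (P.exp_edges K p'') \<rho>" "v \<in> ball_set r (P.exp_edges K p'') \<rho>" for u v
  proof
    have "{u, v} \<subseteq> verts (P.tr k)" using low_relpow uv by (auto simp: ball_set_def)
    then show "{u, v} \<in> P.exp_edges K p'' \<Longrightarrow> {u, v} \<in> edges (P.tr k)"
      using P.forest_edge_in_tr P.exp_edges_sub unfolding P.edges_A by blast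
    have "{u, v} \<subseteq> ball_set r (edges P.A) \<rho>" using uv ball_set_mono[OF order_refl P.exp_edges_sub, of r K p'' \<rho>] by blast
    then show "{u, v} \<in> edges (P.tr k) \<Longrightarrow> {u, v} \<in> P.exp_edges K p''" using up by blast
  qed
  have subX: "?X \<subseteq> edges G'" using P'.expanded_edges_sub P'.A_sub by blast
  note RP = rooted_part_ball[OF P'.simple P'.root subX]
  have iso2: "ball_iso r (edges (P.tr k)) \<rho> (edges (rooted_part (verts G') ?X \<rho>')) \<rho>' \<phi>"
    by (rule ball_iso_cong[OF ball_eq edge_eq RP(1)[symmetric] RP(2)[symmetric] iso1])
  show ?thesis
    unfolding P'.expanded_eq prim_def P.tr_def[symmetric] fst_conv snd_conv
  proof (rule local_equiv_transfer[OF P.tr_rooted_simple rooted_part_simple[OF P'.simple P'.root subX] H _ iso2])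
    show "0 \<le> r" using r by simp
    show "\<bar>w e - w' (\<phi> ` e)\<bar> \<le> 1 / R" if "e \<in> edges (P.tr k)" "e \<subseteq> ball_set r (edges (P.tr k)) \<rho>" for e
    proof (rule wt)
      show "e \<in> edges P.A" using that P.edges_tr_A by blast
      show "e \<subseteq> ball_set R (edges P.A) \<rho>"
        using that(2) bR ball_set_mono[OF order_refl P.edges_tr_A, of r k \<rho>] by blast
    qed
    show "1 / R < \<bar>\<bar>w' e - wH f\<bar> - 1 / r\<bar>"
      if "e \<in> edges (rooted_part (verts G') ?X \<rho>')" "e \<subseteq> ball_set r (edges (rooted_part (verts G') ?X \<rho>')) \<rho>'"
        "f \<in> edges H" "f \<subseteq> ball_set r (edges H) h" for e f
    proof (rule generic)
      show "e \<in> edges G'" using that(1) subX by (auto simp: rooted_part_simps)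
      show "e \<subseteq> ball_set r (edges G') \<rho>'" using that(2) RP(1) ball_set_mono[OF order_refl subX, of r \<rho>'] by blast
    qed (use that in auto)
  qed
qed

text \<open>
  By \<open>tr_ball_iso\<close> the edges added between the steps \<open>K\<close> and \<open>L\<close> correspond to each other, with weights that
  differ by at most \<open>1 / R\<close>.
\<close>
lemma tr_low_weights_transfer:
  assumes P: "inj_prim_graph G \<rho> w" and P': "inj_prim_graph G' \<rho>' w'"
    and KL: "K \<le> L" "L \<le> m" "real m \<le> R"
    and eq: "local_equiv R (msf (G, \<rho>, w)) (msf (G', \<rho>', w'))"
    and sep: "\<And>e f. e \<in> edges G' \<Longrightarrow> f \<in> edges G' \<Longrightarrow> e \<subseteq> ball_set (real m) (edges G') \<rho>' \<Longrightarrow>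
        f \<subseteq> ball_set (real m) (edges G') \<rho>' \<Longrightarrow> e \<noteq> f \<Longrightarrow> \<bar>w' e - w' f\<bar> > 2 / R"
    and low: "\<And>e. e \<in> edges (prim_graph.tr G' \<rho>' w' L) \<Longrightarrow> e \<notin> edges (prim_graph.tr G' \<rho>' w' K) \<Longrightarrow> w' e \<le> p"
    and e: "e \<in> edges (prim_graph.tr G \<rho> w L)" "e \<notin> edges (prim_graph.tr G \<rho> w K)"
  shows "w e \<le> p + 1 / R"
proof -
  interpret P: inj_prim_graph G \<rho> w by fact
  interpret P': inj_prim_graph G' \<rho>' w' by fact
  interpret M: inj_prim_graph P.A \<rho> w by (rule P.msf_inj_prim_graph)
  interpret M': inj_prim_graph P'.A \<rho>' w' by (rule P'.msf_inj_prim_graph)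
  have rs: "rooted_simple P.A \<rho>" "rooted_simple P'.A \<rho>'"
    using M.simple M.root M'.simple M'.root by (auto simp: rooted_simple_def)
  have eqA: "local_equiv R (P.A, \<rho>, w) (P'.A, \<rho>', w')"
    by (subst P.msf_eq[symmetric], subst P'.msf_eq[symmetric]) (rule eq)
  obtain \<phi> where \<phi>: "ball_iso R (edges P.A) \<rho> (edges P'.A) \<rho>' \<phi> \<and>
      (\<forall>e\<in>edges P.A. e \<subseteq> ball_set R (edges P.A) \<rho> \<longrightarrow> \<bar>w e - w' (\<phi> ` e)\<bar> \<le> 1 / R)"
    using eqA unfolding local_equiv_iff[OF rs] by (rule exE)
  have iso: "ball_iso R (edges P.A) \<rho> (edges P'.A) \<rho>' \<phi>"
    and wt: "\<And>e. e \<in> edges P.A \<Longrightarrow> e \<subseteq> ball_set R (edges P.A) \<rho> \<Longrightarrow> \<bar>w e - w' (\<phi> ` e)\<bar> \<le> 1 / R"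
    using \<phi> by simp_all
  note D = ball_isoD[OF iso]
  have b': "ball_set s (edges P'.A) \<rho>' \<subseteq> ball_set s (edges G') \<rho>'" for s
    using ball_set_mono[OF order_refl P'.A_sub] .
  have tr: "edges (P'.tr j) = (`) \<phi> ` edges (P.tr j)" if "j \<le> m" for j
  proof -
    have "\<bar>w' e - w' f\<bar> > 2 * (1 / R)" if "e \<in> edges P'.A" "f \<in> edges P'.A"
      "e \<subseteq> ball_set (real m) (edges P'.A) \<rho>'" "f \<subseteq> ball_set (real m) (edges P'.A) \<rho>'" "e \<noteq> f" for e f
      using sep[of e f] that b'[of "real m"] P'.A_sub by auto
    from tr_ball_iso[OF P.msf_inj_prim_graph P'.msf_inj_prim_graph iso wt this \<open>j \<le> m\<close> KL(3)] show ?thesis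
      unfolding P.tr_msf P'.tr_msf by (rule conjunct2)
  qed
  have LR: "verts (P.tr j) \<subseteq> ball_set R (edges P.A) \<rho>" if "j \<le> m" for j
    using M.tr_in_ball[of j] ball_set_mono[of "real j" R "edges P.A"] that KL unfolding P.tr_msf by fastforce
  have eR: "f \<subseteq> ball_set R (edges P.A) \<rho>" if "f \<in> edges (P.tr j)" "j \<le> m" for f j
    using P.edges_tr_verts[OF that(1)] LR[OF that(2)] by blast
  have "\<phi> ` e \<in> edges (P'.tr L)" using tr[of L] e KL by auto
  moreover have "\<phi> ` e \<notin> edges (P'.tr K)"
  proof
    assume "\<phi> ` e \<in> edges (P'.tr K)"
    then obtain f where f: "f \<in> edges (P.tr K)" "\<phi> ` e = \<phi> ` f" using tr[of K] KL by auto
    have "e = f" using inj_on_image_eq_iff[OF D(1) eR eR] e(1) f KL by (metis order_trans)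
    then show False using f e by simp
  qed
  ultimately have "w' (\<phi> ` e) \<le> p" by (rule low)
  moreover have "\<bar>w e - w' (\<phi> ` e)\<bar> \<le> 1 / R" using wt eR e(1) P.edges_tr_A KL by blast
  ultimately show ?thesis by linarith
qed

section \<open>Measurability of the constructions\<close>

abbreviation "RW \<equiv> rwgraph_space"

lemma space_graph_space: "space graph_space = {G. simple_graph G \<and> locally_finite_graph G}"
  unfolding graph_space_def Let_def by (rule space_measure_of) auto

lemma sets_graph_space: "sets graph_space = sigma_sets {G. simple_graph G \<and> locally_finite_graph G}
   ({{G \<in> {G. simple_graph G \<and> locally_finite_graph G}. v \<in> verts G} | v. True} \<union>
    {{G \<in> {G. simple_graph G \<and> locally_finite_graph G}. {u, v} \<in> edges G} | u v. True})"
  unfolding graph_space_def Let_def by (rule sets_measure_of) auto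

lemma pred_verts [measurable]: "Measurable.pred graph_space (\<lambda>G. v \<in> verts G)"
  unfolding pred_def space_graph_space sets_graph_space by (intro sigma_sets.Basic) blast

lemma pred_edges [measurable]: "Measurable.pred graph_space (\<lambda>G. {u, v} \<in> edges G)"
  unfolding pred_def space_graph_space sets_graph_space by (intro sigma_sets.Basic) blast

lemma measurable_graph_spaceI:
  assumes "\<And>x. x \<in> space M \<Longrightarrow> simple_graph (f x) \<and> locally_finite_graph (f x)"
    and v: "\<And>v. Measurable.pred M (\<lambda>x. v \<in> verts (f x))"
    and e: "\<And>u v. Measurable.pred M (\<lambda>x. {u, v} \<in> edges (f x))"
  shows "f \<in> M \<rightarrow>\<^sub>M graph_space"
  unfolding graph_space_def Let_def
proof (rule measurable_measure_of)
  let ?O = "{G :: nat graph. simple_graph G \<and> locally_finite_graph G}"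
  show "f \<in> space M \<rightarrow> ?O" using assms(1) by auto
  fix y assume "y \<in> {{G \<in> ?O. v \<in> verts G} |v. True} \<union> {{G \<in> ?O. {u, v} \<in> edges G} |u v. True}"
  then consider v where "y = {G \<in> ?O. v \<in> verts G}" | u v where "y = {G \<in> ?O. {u, v} \<in> edges G}" by blast
  then show "f -` y \<inter> space M \<in> sets M"
  proof cases
    case 1
    have "f -` y \<inter> space M = {x \<in> space M. v \<in> verts (f x)}" using assms(1) by (auto simp: 1)
    then show ?thesis using v[of v] by (simp add: pred_def)
  next
    case 2
    have "f -` y \<inter> space M = {x \<in> space M. {u, v} \<in> edges (f x)}" using assms(1) by (auto simp: 2)
    then show ?thesis using e[of u v] by (simp add: pred_def)
  qed
qed auto

lemma space_weight_space [simp]: "space weight_space = UNIV"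
  by (simp add: weight_space_def)

lemma measurable_weight: "e \<in> all_edges \<Longrightarrow> (\<lambda>w. w e) \<in> borel_measurable weight_space"
proof -
  assume e: "e \<in> all_edges"
  have "(\<lambda>w. restrict w all_edges) \<in> weight_space \<rightarrow>\<^sub>M (\<Pi>\<^sub>M e\<in>all_edges. borel)"
    unfolding weight_space_def by (rule measurable_vimage_algebra1) (auto simp: space_PiM)
  moreover have "(\<lambda>x. x e) \<in> borel_measurable (\<Pi>\<^sub>M e\<in>all_edges. (borel :: real measure))"
    using e by (rule measurable_component_singleton)
  ultimately have "(\<lambda>w. restrict w all_edges e) \<in> borel_measurable weight_space"
    by (rule measurable_compose)
  then show ?thesis using e by simp
qed

lemma measurable_weight_spaceI:
  assumes "\<And>e. e \<in> all_edges \<Longrightarrow> (\<lambda>x. f x e) \<in> borel_measurable M"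
  shows "f \<in> M \<rightarrow>\<^sub>M weight_space"
  unfolding weight_space_def
  by (rule measurable_vimage_algebra2) (auto intro!: measurable_restrict assms)

lemma space_RW: "space RW = {(G, \<rho>, w). rooted_graph (G, \<rho>)}"
  by (auto simp: rwgraph_space_def space_restrict_space space_pair_measure space_graph_space rooted_graph_def)

lemma prim_graph_RW: "(G, \<rho>, w) \<in> space RW \<Longrightarrow> prim_graph G \<rho>"
  by (simp add: space_RW rooted_graph_def prim_graph_def)

lemma measurable_RWI:
  assumes "g \<in> M \<rightarrow>\<^sub>M graph_space" "\<rho> \<in> M \<rightarrow>\<^sub>M count_space UNIV" "w \<in> M \<rightarrow>\<^sub>M weight_space"
    "\<And>x. x \<in> space M \<Longrightarrow> \<rho> x \<in> verts (g x)"
  shows "(\<lambda>x. (g x, \<rho> x, w x)) \<in> M \<rightarrow>\<^sub>M RW"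
  unfolding rwgraph_space_def
  by (rule measurable_restrict_space2) (use assms in \<open>auto intro!: measurable_Pair\<close>)

lemma RW_components [measurable]:
  "graph_of \<in> RW \<rightarrow>\<^sub>M graph_space" "root_of \<in> RW \<rightarrow>\<^sub>M count_space UNIV" "weight_of \<in> RW \<rightarrow>\<^sub>M weight_space"
  unfolding rwgraph_space_def by (intro measurable_restrict_space1; measurable)+

lemma RW_preds [measurable]:
  "Measurable.pred RW (\<lambda>x. v \<in> verts (graph_of x))"
  "Measurable.pred RW (\<lambda>x. {u, v} \<in> edges (graph_of x))"
  "Measurable.pred RW (\<lambda>x. root_of x = v)"
  using measurable_compose[OF RW_components(1) pred_verts[of v]] measurable_compose[OF RW_components(1) pred_edges[of u v]]
    measurable_compose[OF RW_components(2), of "\<lambda>r. r = v" "count_space UNIV"] by auto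

text \<open>
  Weights are measurable only on \<open>all_edges\<close>; the default value \<open>0\<close> on loops makes this a
  measurable function for all \<open>u\<close> and \<open>v\<close>, so that countable quantifiers over vertices can be used freely.
\<close>
definition pair_weight :: "nat rwgraph \<Rightarrow> nat \<Rightarrow> nat \<Rightarrow> real" where
  "pair_weight x u v = (if u = v then 0 else weight_of x {u, v})"

lemma measurable_pair_weight [measurable]: "(\<lambda>x. pair_weight x u v) \<in> borel_measurable RW"
proof (cases "u = v")
  case False
  then have "{u, v} \<in> all_edges" by (simp add: all_edges_def)
  from measurable_compose[OF RW_components(3) measurable_weight[OF this]] show ?thesis
    using False by (simp add: pair_weight_def)
qed (simp add: pair_weight_def)

lemma RW_no_loop: "x \<in> space RW \<Longrightarrow> {u, v} \<in> edges (graph_of x) \<Longrightarrow> u \<noteq> v"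
  using simple_edgeD(3)[of "graph_of x" u v] by (auto simp: space_RW rooted_graph_def)

lemma RW_pair_weight: "x \<in> space RW \<Longrightarrow> {u, v} \<in> edges (graph_of x) \<Longrightarrow> pair_weight x u v = weight_of x {u, v}"
  using RW_no_loop by (auto simp: pair_weight_def)

text \<open>
  Measurability is obtained by rewriting a property of well-formed graphs with countable quantifiers over
  vertices, where the two formulations need to agree on the space only.
\<close>
lemma pred_RWI:
  assumes "Measurable.pred RW Q" "\<And>x. x \<in> space RW \<Longrightarrow> P x \<longleftrightarrow> Q x"
  shows "Measurable.pred RW P"
  using assms(1) measurable_cong[of RW P Q] assms(2) by simp

lemma pred_bex_countable:
  assumes "countable X" "\<And>i. i \<in> X \<Longrightarrow> Measurable.pred M (P i)"
  shows "Measurable.pred M (\<lambda>x. \<exists>i\<in>X. P i x)"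
proof -
  have "{x \<in> space M. \<exists>i\<in>X. P i x} = (\<Union>i\<in>X. {x \<in> space M. P i x})" by auto
  also have "\<dots> \<in> sets M" using assms by (intro sets.countable_UN') (auto simp: pred_def)
  finally show ?thesis by (simp add: pred_def)
qed

lemma pred_relpow:
  fixes R :: "'x \<Rightarrow> nat rel"
  assumes [measurable]: "\<And>u v. Measurable.pred M (\<lambda>x. (u, v) \<in> R x)"
  shows "Measurable.pred M (\<lambda>x. (u, v) \<in> R x ^^ n)"
proof (induction n arbitrary: v)
  case (Suc n)
  note [measurable] = Suc
  have "(\<lambda>x. (u, v) \<in> R x ^^ Suc n) = (\<lambda>x. \<exists>y. (u, y) \<in> R x ^^ n \<and> (y, v) \<in> R x)" by auto
  then show ?case by simp
qed simp

lemma pred_rtrancl: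
  fixes R :: "'x \<Rightarrow> nat rel"
  assumes "\<And>u v. Measurable.pred M (\<lambda>x. (u, v) \<in> R x)"
  shows "Measurable.pred M (\<lambda>x. (u, v) \<in> (R x)\<^sup>*)"
proof -
  note [measurable] = pred_relpow[OF assms]
  have "(\<lambda>x. (u, v) \<in> (R x)\<^sup>*) = (\<lambda>x. \<exists>n. (u, v) \<in> R x ^^ n)" by (simp add: rtrancl_is_UN_relpow)
  then show ?thesis by simp
qed

lemma pred_edge_rel_rtrancl:
  assumes "\<And>u v. Measurable.pred M (\<lambda>x. {u, v} \<in> E x)"
  shows "Measurable.pred M (\<lambda>x. (u, v :: nat) \<in> (edge_rel (E x))\<^sup>*)"
  by (rule pred_rtrancl) (use assms in \<open>simp add: edge_rel_def\<close>)

lemma pred_edge_rel_relpow: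
  assumes "\<And>u v. Measurable.pred M (\<lambda>x. {u, v} \<in> E x)"
  shows "Measurable.pred M (\<lambda>x. (u, v :: nat) \<in> edge_rel (E x) ^^ n)"
  by (rule pred_relpow) (use assms in \<open>simp add: edge_rel_def\<close>)

lemma pred_low_edge [measurable]:
  "Measurable.pred RW (\<lambda>x. {u, v} \<in> edges (graph_of x) \<and> weight_of x {u, v} \<le> p)"
  by (rule pred_RWI[of "\<lambda>x. {u, v} \<in> edges (graph_of x) \<and> pair_weight x u v \<le> p"])
     (auto simp: RW_pair_weight)

lemma pred_cluster [measurable]: "Measurable.pred RW (\<lambda>x. u \<in> cluster x v p)"
proof -
  have [measurable]: "Measurable.pred RW (\<lambda>x. (v, u) \<in> (edge_rel (low_edges (graph_of x) (weight_of x) p))\<^sup>*)"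
    by (rule pred_edge_rel_rtrancl) (use pred_low_edge in simp)
  have "(\<lambda>x. u \<in> cluster x v p) = (\<lambda>x. u \<in> verts (graph_of x) \<and> (v, u) \<in> (edge_rel (low_edges (graph_of x) (weight_of x) p))\<^sup>*)"
  proof
    fix x :: "nat rwgraph"
    show "(u \<in> cluster x v p) = (u \<in> verts (graph_of x) \<and> (v, u) \<in> (edge_rel (low_edges (graph_of x) (weight_of x) p))\<^sup>*)"
      using cluster_eq[of "graph_of x" "root_of x" "weight_of x" v p] by auto
  qed
  then show ?thesis by simp
qed

lemma pred_infinite:
  assumes [measurable]: "\<And>v::nat. Measurable.pred M (\<lambda>x. v \<in> S x)"
  shows "Measurable.pred M (\<lambda>x. infinite (S x))"
  unfolding infinite_nat_iff_unbounded by simp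

lemma pred_root_param:
  assumes [measurable]: "\<And>v. Measurable.pred RW (\<lambda>x. P v x)"
  shows "Measurable.pred RW (\<lambda>x. P (root_of x) x)"
proof -
  have "(\<lambda>x. P (root_of x) x) = (\<lambda>x. \<exists>v. root_of x = v \<and> P v x)" by auto
  then show ?thesis by simp
qed

text \<open>
  Lists turn a statement on cardinalities, including that of infinite sets, into one with a countable quantifier.
\<close>
definition has_card :: "nat \<Rightarrow> 'a set \<Rightarrow> bool" where
  "has_card j S \<longleftrightarrow> (\<exists>xs. length xs = j \<and> distinct xs \<and> set xs \<subseteq> S)"

lemma has_card_iff: "has_card j S \<longleftrightarrow> infinite S \<or> j \<le> card S"
proof -
  have "(\<exists>xs. length xs = j \<and> distinct xs \<and> set xs \<subseteq> S) \<longleftrightarrow> (\<exists>T\<subseteq>S. finite T \<and> card T = j)"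
    by (metis List.finite_set distinct_card finite_distinct_list)
  also have "\<dots> \<longleftrightarrow> infinite S \<or> j \<le> card S"
    by (metis infinite_arbitrarily_large card_mono obtain_subset_with_card_n)
  finally show ?thesis by (simp add: has_card_def)
qed

lemma pred_has_card:
  fixes S :: "'x \<Rightarrow> 'c::countable set"
  assumes [measurable]: "\<And>v. Measurable.pred M (\<lambda>x. v \<in> S x)"
  shows "Measurable.pred M (\<lambda>x. has_card j (S x))"
  unfolding has_card_def subset_iff by measurable

lemma measurable_card:
  fixes S :: "'x \<Rightarrow> 'c::countable set"
  assumes "\<And>v. Measurable.pred M (\<lambda>x. v \<in> S x)"
  shows "(\<lambda>x. card (S x)) \<in> M \<rightarrow>\<^sub>M count_space UNIV"
proof -
  note [measurable] = pred_has_card[OF assms]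
  have "card (S x) = j \<longleftrightarrow> (has_card j (S x) \<and> \<not> has_card (Suc j) (S x)) \<or> (j = 0 \<and> (\<forall>i. has_card i (S x)))" for j x
    by (cases "finite (S x)") (auto simp: has_card_iff not_less_eq_eq dest: spec[of _ "Suc (card (S x))"])
  then have "Measurable.pred M (\<lambda>x. card (S x) = j)" for j by simp
  then show ?thesis by (subst measurable_count_space_eq2_countable) (auto simp: pred_def vimage_def Int_def conj_commute)
qed

lemma pred_below [measurable]:
  "Measurable.pred RW (\<lambda>x. (u, v) \<in> (edge_rel {f \<in> edges (graph_of x) - {{a, b}}. weight_of x f \<le> pair_weight x a b})\<^sup>*)"
proof (rule pred_edge_rel_rtrancl)
  fix u v
  show "Measurable.pred RW (\<lambda>x. {u, v} \<in> {f \<in> edges (graph_of x) - {{a, b}}. weight_of x f \<le> pair_weight x a b})"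
    by (rule pred_RWI[of "\<lambda>x. {u, v} \<in> edges (graph_of x) \<and> {u, v} \<noteq> {a, b} \<and> pair_weight x u v \<le> pair_weight x a b"])
       (auto simp: RW_pair_weight)
qed

lemma pred_forest [measurable]: "Measurable.pred RW (\<lambda>x. {a, b} \<in> edges (spanning_forest x))"
proof (cases "a = b")
  case True
  have "{a, b} \<notin> edges (spanning_forest x)" if "x \<in> space RW" for x
    using RW_no_loop[OF that, of a b] True spanning_forest_edges[of "graph_of x" "root_of x" "weight_of x"] by auto
  then show ?thesis using pred_RWI[of "\<lambda>_. False"] by simp
next
  case False
  let ?C = "\<lambda>x v. {u \<in> verts (graph_of x). (v, u) \<in> (edge_rel {f \<in> edges (graph_of x) - {{a, b}}. weight_of x f \<le> pair_weight x a b})\<^sup>*}"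
  have [measurable]: "Measurable.pred RW (\<lambda>x. infinite (?C x v))" for v
    by (rule pred_infinite) (unfold mem_Collect_eq, measurable)
  have "Measurable.pred RW (\<lambda>x. {a, b} \<in> edges (graph_of x) \<and> (\<forall>u. \<not> (u \<in> ?C x a \<and> u \<in> ?C x b)) \<and>
      \<not> (infinite (?C x a) \<and> infinite (?C x b)))"
    unfolding mem_Collect_eq by measurable
  then show ?thesis
  proof (rule pred_RWI)
    fix x assume "x \<in> space RW"
    obtain G \<rho> w where x: "x = (G, \<rho>, w)" by (cases x)
    have pw: "pair_weight (G, \<rho>, w) a b = w {a, b}" using False by (simp add: pair_weight_def)
    show "({a, b} \<in> edges (spanning_forest x)) = ({a, b} \<in> edges (graph_of x) \<and> (\<forall>u. \<not> (u \<in> ?C x a \<and> u \<in> ?C x b)) \<and>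
      \<not> (infinite (?C x a) \<and> infinite (?C x b)))"
      unfolding x fst_conv snd_conv spanning_forest_edge_iff[OF False] Let_def pw
      unfolding disjoint_iff imp_conv_disj de_Morgan_conj by (rule refl)
  qed
qed

lemma msf_verts: "verts (graph_of (msf (G, \<rho>, w))) = {v \<in> verts G. (\<rho>, v) \<in> (edge_rel (edges (spanning_forest (G, \<rho>, w))))\<^sup>*}"
  by (auto simp: msf_def root_component_def induced_subgraph_def component_def adj_eq)

lemma msf_edges: "edges (graph_of (msf (G, \<rho>, w))) = {e \<in> edges (spanning_forest (G, \<rho>, w)). e \<subseteq> verts (graph_of (msf (G, \<rho>, w)))}"
  unfolding msf_verts by (auto simp: msf_def root_component_def induced_subgraph_def component_def adj_eq)

lemma msf_edges_sub: "edges (graph_of (msf x)) \<subseteq> edges (graph_of x)"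
  using msf_edges[of "graph_of x" "root_of x" "weight_of x"] spanning_forest_edges[of "graph_of x" "root_of x" "weight_of x"]
  by simp blast

lemma pred_msf_verts [measurable]: "Measurable.pred RW (\<lambda>x. v \<in> verts (graph_of (msf x)))"
proof -
  have [measurable]: "Measurable.pred RW (\<lambda>x. (root_of x, v) \<in> (edge_rel (edges (spanning_forest x)))\<^sup>*)"
    by (rule pred_root_param) (rule pred_edge_rel_rtrancl[OF pred_forest])
  have "v \<in> verts (graph_of (msf x)) \<longleftrightarrow> v \<in> verts (graph_of x) \<and> (root_of x, v) \<in> (edge_rel (edges (spanning_forest x)))\<^sup>*" for x
    using msf_verts[of "graph_of x" "root_of x" "weight_of x"] by simp
  then show ?thesis by simp
qed

lemma pred_msf_edges [measurable]: "Measurable.pred RW (\<lambda>x. {a, b} \<in> edges (graph_of (msf x)))"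
proof -
  have "{a, b} \<in> edges (graph_of (msf x)) \<longleftrightarrow> {a, b} \<in> edges (spanning_forest x) \<and> a \<in> verts (graph_of (msf x)) \<and> b \<in> verts (graph_of (msf x))" for x
    using msf_edges[of "graph_of x" "root_of x" "weight_of x"] by simp
  then show ?thesis by simp
qed

subsection \<open>Prim\<close>

definition pair_sets :: "nat set set set" where "pair_sets = {B. finite B \<and> (\<forall>e\<in>B. \<exists>a b. e = {a, b})}"

lemma countable_pair_sets: "countable pair_sets"
proof (rule countable_subset)
  have "range (\<lambda>(a :: nat, b). {a, b}) = {e. \<exists>a b. e = {a, b}}" by auto
  then show "pair_sets \<subseteq> {B. finite B \<and> B \<subseteq> range (\<lambda>(a, b). {a, b})}" by (auto simp: pair_sets_def)
  show "countable {B. finite B \<and> B \<subseteq> range (\<lambda>(a :: nat, b). {a, b})}"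
    by (rule countable_Collect_finite_subset) auto
qed

definition finite_graphs :: "nat graph set" where
  "finite_graphs = {t. finite (verts t) \<and> edges t \<in> pair_sets}"

lemma countable_finite_graphs: "countable finite_graphs"
proof (rule countable_subset)
  show "finite_graphs \<subseteq> (\<lambda>(V, E). \<lparr>verts = V, edges = E\<rparr>) ` ({V. finite V} \<times> pair_sets)"
    by (auto simp: finite_graphs_def image_iff) (metis graph.surjective unit.exhaust)
  show "countable ((\<lambda>(V, E). \<lparr>verts = V, edges = E\<rparr>) ` ({V :: nat set. finite V} \<times> pair_sets))"
    using countable_pair_sets uncountable_def by (intro countable_image countable_SIGMA) (auto intro: countable_Collect_finite)
qed

text \<open>
  The selected edge is a choice from this set; knowing the set determines the step even when
  minimal weights are not unique, which may happen on a null set.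
\<close>
definition cheapest :: "nat rwgraph \<Rightarrow> nat graph \<Rightarrow> nat set set" where
  "cheapest x s = {e \<in> boundary_edges (graph_of x) s. \<forall>f\<in>boundary_edges (graph_of x) s. \<not> weight_of x f < weight_of x e}"

lemma arg_min_on_cheapest:
  "arg_min_on (weight_of x) (boundary_edges (graph_of x) s) = (SOME e. e \<in> cheapest x s)"
  unfolding arg_min_on_def arg_min_def is_arg_min_def cheapest_def by (rule arg_cong[of _ _ Eps]) auto

lemma RW_edgeE: "x \<in> space RW \<Longrightarrow> e \<in> edges (graph_of x) \<Longrightarrow> \<exists>a b. e = {a, b}"
  using simple_edgeE[of "graph_of x" e] by (auto simp: space_RW rooted_graph_def) metis

lemma pred_cheapest: "Measurable.pred RW (\<lambda>x. {a, b} \<in> cheapest x s)"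
proof (rule pred_RWI)
  let ?b = "\<lambda>x a b. {a, b} \<in> edges (graph_of x) \<and> card ({a, b} \<inter> verts s) = 1"
  show "Measurable.pred RW (\<lambda>x. ?b x a b \<and> (\<forall>c d. ?b x c d \<longrightarrow> \<not> pair_weight x c d < pair_weight x a b))" by measurable
  fix x assume x: "x \<in> space RW"
  have *: "(\<forall>f\<in>edges (graph_of x). Q f) \<longleftrightarrow> (\<forall>c d. {c, d} \<in> edges (graph_of x) \<longrightarrow> Q {c, d})" for Q
  proof -
    show ?thesis using RW_edgeE[OF x] by metis
  qed
  show "({a, b} \<in> cheapest x s) = (?b x a b \<and> (\<forall>c d. ?b x c d \<longrightarrow> \<not> pair_weight x c d < pair_weight x a b))"
    using *[of "\<lambda>f. card (f \<inter> verts s) = 1 \<longrightarrow> \<not> weight_of x f < weight_of x {a, b}"] RW_pair_weight[OF x]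
    unfolding cheapest_def boundary_edges_def by auto
qed

lemma cheapest_facts:
  assumes "x \<in> space RW" "finite (verts s)" "verts s \<subseteq> verts (graph_of x)"
  shows "cheapest x s \<in> pair_sets" "cheapest x s = {} \<longleftrightarrow> boundary_edges (graph_of x) s = {}"
proof -
  obtain G \<rho> w where x: "x = (G, \<rho>, w)" by (cases x)
  interpret prim_graph G \<rho> w using assms(1) prim_graph_RW x by blast
  have fin: "finite (boundary_edges G s)" using finite_boundary assms x by auto
  show "cheapest x s \<in> pair_sets"
  proof -
    have "cheapest x s \<subseteq> boundary_edges G s" by (auto simp: cheapest_def x)
    moreover have "boundary_edges G s \<subseteq> edges (graph_of x)" by (auto simp: boundary_edges_def x)
    ultimately show ?thesis using finite_subset[OF _ fin] RW_edgeE[OF assms(1)] unfolding pair_sets_def by blast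
  qed
  show "cheapest x s = {} \<longleftrightarrow> boundary_edges (graph_of x) s = {}"
    using arg_min_if_finite[OF fin, of w] x by (auto simp: cheapest_def)
qed

lemma prim_tree_finite_graphs:
  assumes "x \<in> space RW"
  shows "prim_tree x k \<in> finite_graphs" "verts (prim_tree x k) \<subseteq> verts (graph_of x)"
    "simple_graph (prim_tree x k)" "locally_finite_graph (prim_tree x k)" "root_of x \<in> verts (prim_tree x k)"
proof -
  obtain G \<rho> w where x: "x = (G, \<rho>, w)" by (cases x)
  interpret prim_graph G \<rho> w using assms(1) prim_graph_RW x by blast
  have "\<exists>a b. e = {a, b}" if "e \<in> edges (tr k)" for e k
    using simple_edgeE[OF simple] edges_tr_sub that by (metis subsetD)
  then show "prim_tree x k \<in> finite_graphs" 
    using finite_verts_tr finite_edges_tr by (simp add: finite_graphs_def pair_sets_def x prim_tree_tr)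
  show "verts (prim_tree x k) \<subseteq> verts (graph_of x)" using verts_tr_sub by (simp add: x prim_tree_tr)
  show "simple_graph (prim_tree x k)" using tr_rooted_simple by (simp add: x prim_tree_tr rooted_simple_def)
  show "locally_finite_graph (prim_tree x k)" using finite_edges_tr
    by (simp add: x prim_tree_tr locally_finite_graph_def)
  show "root_of x \<in> verts (prim_tree x k)" using root_in_tr by (simp add: x prim_tree_tr)
qed

text \<open>
  There are only countably many possible sets of cheapest boundary edges, and the result of the step is a function of
  this set.
\<close>
lemma pred_prim_step:
  assumes "finite (verts s)"
  shows "Measurable.pred RW (\<lambda>x. verts s \<subseteq> verts (graph_of x) \<and> prim_step (graph_of x) (weight_of x) s = t)"
proof (rule pred_RWI)
  define nxt where "nxt B = (if B = {} then s else let e = SOME e. e \<in> B in \<lparr>verts = verts s \<union> e, edges = insert e (edges s)\<rparr>)" for B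
  have [measurable]: "Measurable.pred RW (\<lambda>x. cheapest x s = B)" if "B \<in> pair_sets" for B
  proof (rule pred_RWI)
    note [measurable] = pred_cheapest
    show "Measurable.pred RW (\<lambda>x. (\<forall>a b. {a, b} \<in> cheapest x s \<longleftrightarrow> {a, b} \<in> B))" by measurable
    fix x assume x: "x \<in> space RW"
    have "\<exists>a b. e = {a, b}" if "e \<in> cheapest x s" for e
      using that RW_edgeE[OF x, of e] by (auto simp: cheapest_def boundary_edges_def)
    moreover have "\<exists>a b. e = {a, b}" if "e \<in> B" for e using \<open>B \<in> pair_sets\<close> that by (auto simp: pair_sets_def)
    ultimately show "cheapest x s = B \<longleftrightarrow> (\<forall>a b. {a, b} \<in> cheapest x s \<longleftrightarrow> {a, b} \<in> B)"
      by (metis equalityI subsetI)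
  qed
  note [measurable] = countable_pair_sets
  have [measurable]: "Measurable.pred RW (\<lambda>x. \<exists>B\<in>pair_sets. cheapest x s = B \<and> nxt B = t)"
    by (rule pred_bex_countable[OF countable_pair_sets]) measurable
  have [measurable]: "Measurable.pred RW (\<lambda>x. verts s \<subseteq> verts (graph_of x))" unfolding subset_iff by measurable
  show "Measurable.pred RW (\<lambda>x. verts s \<subseteq> verts (graph_of x) \<and> (\<exists>B\<in>pair_sets. cheapest x s = B \<and> nxt B = t))"
    by measurable
  fix x assume x: "x \<in> space RW"
  have "prim_step (graph_of x) (weight_of x) s = nxt (cheapest x s) \<and> cheapest x s \<in> pair_sets" if "verts s \<subseteq> verts (graph_of x)"
    using cheapest_facts[OF x assms that] by (simp add: prim_step_def nxt_def arg_min_on_cheapest)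
  then show "(verts s \<subseteq> verts (graph_of x) \<and> prim_step (graph_of x) (weight_of x) s = t) =
      (verts s \<subseteq> verts (graph_of x) \<and> (\<exists>B\<in>pair_sets. cheapest x s = B \<and> nxt B = t))" by auto
qed

lemma pred_prim_tree_eq: "Measurable.pred RW (\<lambda>x. prim_tree x (Suc k) = t)"
proof (induction k arbitrary: t)
  case 0
  have "(\<lambda>x. prim_tree x (Suc 0) = t) = (\<lambda>x. \<exists>v. root_of x = v \<and> \<lparr>verts = {v}, edges = {}\<rparr> = t)"
    by (auto simp: prim_tree_def)
  then show ?case by simp
next
  case (Suc k)
  note [measurable] = Suc pred_prim_step
  have m: "Measurable.pred RW (\<lambda>x. \<exists>s\<in>finite_graphs. prim_tree x (Suc k) = s \<and>
      (verts s \<subseteq> verts (graph_of x) \<and> prim_step (graph_of x) (weight_of x) s = t))"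
  proof (rule pred_bex_countable[OF countable_finite_graphs])
    fix s assume "s \<in> finite_graphs"
    then have "finite (verts s)" by (simp add: finite_graphs_def)
    then show "Measurable.pred RW (\<lambda>x. prim_tree x (Suc k) = s \<and>
      (verts s \<subseteq> verts (graph_of x) \<and> prim_step (graph_of x) (weight_of x) s = t))" by measurable
  qed
  show ?case
  proof (rule pred_RWI[OF m])
    fix x assume x: "x \<in> space RW"
    have "prim_tree x (Suc (Suc k)) = prim_step (graph_of x) (weight_of x) (prim_tree x (Suc k))"
      by (simp add: prim_tree_def)
    then show "(prim_tree x (Suc (Suc k)) = t) = (\<exists>s\<in>finite_graphs. prim_tree x (Suc k) = s \<and>
      (verts s \<subseteq> verts (graph_of x) \<and> prim_step (graph_of x) (weight_of x) s = t))"
      using prim_tree_finite_graphs(1,2)[OF x, of "Suc k"] by auto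
  qed
qed

text \<open>
  The tree takes countably many values, so that every property of it is measurable.
\<close>
lemma pred_prim_tree:
  "Measurable.pred RW (\<lambda>x. P (prim_tree x k))"
proof (rule pred_RWI)
  have eq: "Measurable.pred RW (\<lambda>x. prim_tree x k = t)" for t
    using pred_prim_tree_eq[of "k - 1" t] by (cases k) (auto simp: prim_tree_def)
  show "Measurable.pred RW (\<lambda>x. \<exists>s\<in>finite_graphs. prim_tree x k = s \<and> P s)"
    by (rule pred_bex_countable[OF countable_finite_graphs]) (use eq in measurable)
qed (use prim_tree_finite_graphs(1) in auto)

lemma measurable_prim: "prim k \<in> RW \<rightarrow>\<^sub>M RW"
  unfolding prim_def
  by (intro measurable_RWI measurable_graph_spaceI pred_prim_tree RW_components)
     (use prim_tree_finite_graphs in auto)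

lemma measurable_expanded: "expanded_invasion_cluster p \<in> RW \<rightarrow>\<^sub>M RW"
proof -
  define E where "E x = edges (graph_of (invasion_cluster x)) \<union> {e \<in> edges (graph_of (msf x)). weight_of x e \<le> p}" for x :: "nat rwgraph"
  define X where "X x = rooted_part (verts (graph_of x)) (E x) (root_of x)" for x
  note [measurable] = pred_prim_tree
  have Esub: "E x \<subseteq> edges (graph_of x)" if "x \<in> space RW" for x
  proof -
    obtain G \<rho> w where x: "x = (G, \<rho>, w)" by (cases x)
    interpret prim_graph G \<rho> w using that prim_graph_RW x by blast
    have "edges (graph_of (invasion_cluster x)) \<subseteq> edges G"
      using edges_tr_sub by (auto simp: invasion_cluster_def x prim_tree_tr)
    then show ?thesis using msf_edges_sub[of x] by (auto simp: x E_def)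
  qed
  have [measurable]: "Measurable.pred RW (\<lambda>x. {u, v} \<in> E x)" for u v
  proof (rule pred_RWI)
    show "Measurable.pred RW (\<lambda>x. (\<exists>k. k \<ge> 1 \<and> {u, v} \<in> edges (prim_tree x k)) \<or>
        ({u, v} \<in> edges (graph_of (msf x)) \<and> ({u, v} \<in> edges (graph_of x) \<and> weight_of x {u, v} \<le> p)))" by measurable
    fix x assume "x \<in> space RW"
    have "edges (graph_of (msf x)) \<subseteq> edges (graph_of x)"
      by (rule msf_edges_sub)
    then show "{u, v} \<in> E x \<longleftrightarrow> (\<exists>k. k \<ge> 1 \<and> {u, v} \<in> edges (prim_tree x k)) \<or>
        ({u, v} \<in> edges (graph_of (msf x)) \<and> ({u, v} \<in> edges (graph_of x) \<and> weight_of x {u, v} \<le> p))"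
      by (auto simp: E_def invasion_cluster_def)
  qed
  have [measurable]: "Measurable.pred RW (\<lambda>x. (root_of x, v) \<in> (edge_rel (E x))\<^sup>*)" for v
    by (rule pred_root_param) (rule pred_edge_rel_rtrancl, measurable)
  have "(\<lambda>x. (X x, root_of x, weight_of x)) \<in> RW \<rightarrow>\<^sub>M RW"
  proof (intro measurable_RWI measurable_graph_spaceI RW_components)
    fix x assume x: "x \<in> space RW"
    then have "rooted_graph (graph_of x, root_of x)" by (auto simp: space_RW)
    then have "rooted_graph (X x, root_of x)" unfolding X_def using Esub[OF x] by (rule rooted_part_rooted_graph)
    then show "simple_graph (X x) \<and> locally_finite_graph (X x)" "root_of x \<in> verts (X x)" by (auto simp: rooted_graph_def)
  next
    show "Measurable.pred RW (\<lambda>x. v \<in> verts (X x))" for v unfolding X_def rooted_part_simps mem_Collect_eq by measurable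
    have "(\<lambda>x. {u, v} \<in> edges (X x)) = (\<lambda>x. {u, v} \<in> E x \<and> (u \<in> verts (graph_of x) \<and> (root_of x, u) \<in> (edge_rel (E x))\<^sup>*) \<and>
        (v \<in> verts (graph_of x) \<and> (root_of x, v) \<in> (edge_rel (E x))\<^sup>*))" for u v
      unfolding X_def rooted_part_simps by auto
    then show "Measurable.pred RW (\<lambda>x. {u, v} \<in> edges (X x))" for u v by simp
  qed
  moreover have "expanded_invasion_cluster p = (\<lambda>x. (X x, root_of x, weight_of x))"
    by (auto simp: fun_eq_iff expanded_invasion_cluster_def X_def rooted_part_def E_def)
  ultimately show ?thesis by simp
qed

lemma pred_ball_set [measurable]: "Measurable.pred RW (\<lambda>x. v \<in> ball_set r (edges (graph_of x)) (root_of x))"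
proof -
  have [measurable]: "Measurable.pred RW (\<lambda>x. (root_of x, v) \<in> edge_rel (edges (graph_of x)) ^^ n)" for n
    by (rule pred_root_param) (rule pred_edge_rel_relpow, measurable)
  show ?thesis unfolding ball_set_def mem_Collect_eq by measurable
qed

text \<open>
  An isomorphism onto the finite ball of \<open>H\<close> is an enumeration \<open>xs\<close> of the ball of \<open>x\<close> that
  matches an enumeration \<open>ys\<close> of the ball of \<open>H\<close>, and there are countably many lists.
\<close>
lemma pred_local_equiv:
  assumes H: "rooted_simple H h" and fin: "finite (ball_set r (edges H) h)" and r: "0 < r"
  shows "Measurable.pred RW (\<lambda>x. local_equiv r x (H, h, wH))"
proof -
  obtain ys where ys: "set ys = ball_set r (edges H) h" "distinct ys" using finite_distinct_list[OF fin] by blast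
  let ?l = "length ys"
  define P where "P x xs \<longleftrightarrow> length xs = ?l \<and> distinct xs \<and> (\<forall>v. v \<in> ball_set r (edges (graph_of x)) (root_of x) \<longleftrightarrow> v \<in> set xs) \<and>
     (\<forall>i<?l. ys ! i = h \<longrightarrow> root_of x = xs ! i) \<and>
     (\<forall>i<?l. \<forall>j<?l. ({xs ! i, xs ! j} \<in> edges (graph_of x) \<longleftrightarrow> {ys ! i, ys ! j} \<in> edges H) \<and>
        ({xs ! i, xs ! j} \<in> edges (graph_of x) \<longrightarrow> \<bar>pair_weight x (xs ! i) (xs ! j) - wH {ys ! i, ys ! j}\<bar> \<le> 1 / r))" for x xs
  have "Measurable.pred RW (\<lambda>x. \<exists>xs. P x xs)" unfolding P_def by measurable
  then show ?thesis
  proof (rule pred_RWI)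
    fix x assume xs: "x \<in> space RW"
    obtain G \<rho> w where x: "x = (G, \<rho>, w)" by (cases x)
    have rs: "rooted_simple G \<rho>" using xs x by (auto simp: space_RW rooted_graph_def rooted_simple_def)
    let ?B = "ball_set r (edges G) \<rho>"
    have h: "h \<in> set ys" using root_in_ball_set[of r h "edges H"] r ys by simp
    have edgeE: "\<exists>a b. e = {a, b}" if "e \<in> edges G" for e
      using that rs simple_edgeE unfolding rooted_simple_def by metis
    show "local_equiv r x (H, h, wH) \<longleftrightarrow> (\<exists>xs. P x xs)"
      unfolding x local_equiv_iff[OF rs H]
    proof
      assume "\<exists>\<phi>. ball_iso r (edges G) \<rho> (edges H) h \<phi> \<and> (\<forall>e\<in>edges G. e \<subseteq> ?B \<longrightarrow> \<bar>w e - wH (\<phi> ` e)\<bar> \<le> 1 / r)"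
      then obtain \<phi> where iso_wt: "ball_iso r (edges G) \<rho> (edges H) h \<phi> \<and> (\<forall>e\<in>edges G. e \<subseteq> ?B \<longrightarrow> \<bar>w e - wH (\<phi> ` e)\<bar> \<le> 1 / r)"
        by (rule exE)
      note iso = iso_wt[THEN conjunct1] and wt = iso_wt[THEN conjunct2]
      note D = ball_isoD[OF iso]
      obtain \<psi> where \<psi>: "ball_iso r (edges H) h (edges G) \<rho> \<psi>" "\<And>v. v \<in> ball_set r (edges H) h \<Longrightarrow> \<phi> (\<psi> v) = v"
        by (rule ball_iso_inverse[OF iso less_imp_le[OF r]]) metis
      note D' = ball_isoD[OF \<psi>(1)]
      have inB: "\<psi> (ys ! i) \<in> ?B" if "i < ?l" for i using D'(2) ys(1) that nth_mem by blast
      have "P (G, \<rho>, w) (map \<psi> ys)"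
        unfolding P_def
      proof (intro conjI allI impI)
        show "distinct (map \<psi> ys)" using ys D'(1) by (simp add: distinct_map)
        show "v \<in> ball_set r (edges (graph_of (G, \<rho>, w))) (root_of (G, \<rho>, w)) \<longleftrightarrow> v \<in> set (map \<psi> ys)" for v
          by (simp only: fst_conv snd_conv set_map ys(1) D'(2))
        show "root_of (G, \<rho>, w) = map \<psi> ys ! i" if "i < ?l" "ys ! i = h" for i using that D'(3) by simp
        fix i j assume ij: "i < ?l" "j < ?l"
        have yi: "ys ! i \<in> ball_set r (edges H) h" "ys ! j \<in> ball_set r (edges H) h"
          using nth_mem[OF ij(1)] nth_mem[OF ij(2)] unfolding ys(1) by this+
        show "({map \<psi> ys ! i, map \<psi> ys ! j} \<in> edges (graph_of (G, \<rho>, w))) = ({ys ! i, ys ! j} \<in> edges H)"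
          using D'(4)[OF yi] ij by simp
        assume e: "{map \<psi> ys ! i, map \<psi> ys ! j} \<in> edges (graph_of (G, \<rho>, w))"
        then have "pair_weight (G, \<rho>, w) (map \<psi> ys ! i) (map \<psi> ys ! j) = w {\<psi> (ys ! i), \<psi> (ys ! j)}"
          using RW_pair_weight[OF xs] x ij by simp
        moreover have "\<bar>w {\<psi> (ys ! i), \<psi> (ys ! j)} - wH (\<phi> ` {\<psi> (ys ! i), \<psi> (ys ! j)})\<bar> \<le> 1 / r"
          by (rule wt[rule_format]) (use e ij inB in auto)
        ultimately show "\<bar>pair_weight (G, \<rho>, w) (map \<psi> ys ! i) (map \<psi> ys ! j) - wH {ys ! i, ys ! j}\<bar> \<le> 1 / r"
          unfolding image_insert image_empty \<psi>(2)[OF yi(1)] \<psi>(2)[OF yi(2)] by simp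
      qed simp
      then show "\<exists>xs. P (G, \<rho>, w) xs" by (rule exI)
    next
      assume "\<exists>xs. P (G, \<rho>, w) xs"
      then obtain zs where "P (G, \<rho>, w) zs" by (rule exE)
      note P = this[unfolded P_def]
      have zs: "length zs = ?l" "distinct zs" using P by simp_all
      have zsB: "set zs = ?B" using P by (simp add: set_eq_iff)
      define \<phi> where "\<phi> = (!) ys \<circ> the_inv_into {..<?l} ((!) zs)"
      have bz: "bij_betw ((!) zs) {..<?l} ?B" by (rule bij_betw_nth[OF zs(2)]) (simp_all add: zs zsB)
      have by': "bij_betw ((!) ys) {..<?l} (ball_set r (edges H) h)" by (rule bij_betw_nth[OF ys(2)]) (simp_all add: ys)
      have \<phi>: "\<phi> (zs ! i) = ys ! i" if "i < ?l" for i
        using the_inv_into_f_f[of "(!) zs" "{..<?l}" i] bz that by (simp add: \<phi>_def bij_betw_def)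
      have idx: "\<exists>i<?l. u = zs ! i" if "u \<in> ?B" for u using that zs(1) unfolding zsB[symmetric] in_set_conv_nth by auto
      have "bij_betw \<phi> ?B (ball_set r (edges H) h)"
        unfolding \<phi>_def by (rule bij_betw_trans[OF bij_betw_the_inv_into[OF bz] by'])
      moreover have "\<phi> \<rho> = h"
      proof -
        obtain i where "i < ?l" "ys ! i = h" using h by (metis in_set_conv_nth)
        then show ?thesis using P \<phi>[of i] by simp
      qed
      moreover have "{u, v} \<in> edges G \<longleftrightarrow> {\<phi> u, \<phi> v} \<in> edges H" if "u \<in> ?B" "v \<in> ?B" for u v
      proof -
        obtain i j where ij: "i < ?l" "u = zs ! i" "j < ?l" "v = zs ! j" using idx[OF \<open>u \<in> ?B\<close>] idx[OF \<open>v \<in> ?B\<close>] by auto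
        have "{zs ! i, zs ! j} \<in> edges G \<longleftrightarrow> {ys ! i, ys ! j} \<in> edges H" using P ij by simp
        then show ?thesis unfolding ij(2,4) \<phi>[OF ij(1)] \<phi>[OF ij(3)] .
      qed
      ultimately have "ball_iso r (edges G) \<rho> (edges H) h \<phi>" by (auto simp: ball_iso_def)
      moreover have "\<bar>w e - wH (\<phi> ` e)\<bar> \<le> 1 / r" if e: "e \<in> edges G" "e \<subseteq> ?B" for e
      proof -
        obtain a b where ab: "e = {a, b}" using edgeE[OF e(1)] by blast
        obtain i j where ij: "i < ?l" "a = zs ! i" "j < ?l" "b = zs ! j" using idx[of a] idx[of b] e(2) ab by auto
        have "\<bar>pair_weight (G, \<rho>, w) a b - wH {ys ! i, ys ! j}\<bar> \<le> 1 / r" using P ij e(1) ab by simp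
        moreover have "\<phi> ` e = {ys ! i, ys ! j}" unfolding ab ij(2,4) image_insert image_empty \<phi>[OF ij(1)] \<phi>[OF ij(3)] ..
        moreover have "pair_weight (G, \<rho>, w) a b = w e" using RW_pair_weight[OF xs, of a b] e(1) by (simp add: x ab)
        ultimately show ?thesis by simp
      qed
      ultimately show "\<exists>\<phi>. ball_iso r (edges G) \<rho> (edges H) h \<phi> \<and> (\<forall>e\<in>edges G. e \<subseteq> ?B \<longrightarrow> \<bar>w e - wH (\<phi> ` e)\<bar> \<le> 1 / r)" by blast
    qed
  qed
qed

section \<open>The law of the standard extension\<close>

definition U01 :: "real measure" where "U01 = uniform_measure lborel {0..1}"

lemma prob_space_U01: "prob_space U01"
  unfolding U01_def by (rule prob_space_uniform_measure) auto

lemma sets_U01 [simp, measurable_cong]: "sets U01 = sets borel"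
  by (simp add: U01_def)

lemma space_U01 [simp]: "space U01 = UNIV"
  by (simp add: U01_def)

text \<open>
  Measurability for \<open>weight_space\<close> involves the weights on \<open>all_edges\<close> only, so the identity
  map pushes the product measure, which lives on extensional functions, forward to it.
\<close>
definition weight_law :: "(nat set \<Rightarrow> real) measure" where
  "weight_law = distr (\<Pi>\<^sub>M e\<in>all_edges. U01) weight_space (\<lambda>x. x)"

lemma all_edges_nonempty: "all_edges \<noteq> {}"
proof -
  have "{0, 1} \<in> all_edges" by (simp add: all_edges_def)
  then show ?thesis by blast
qed

lemma countable_all_edges: "countable all_edges"
proof (rule countable_subset)
  show "all_edges \<subseteq> {S. finite S \<and> S \<subseteq> UNIV}" by (auto simp: all_edges_def intro: card_ge_0_finite)
qed (rule countable_Collect_finite_subset, simp)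

lemma prob_space_PiM_U01: "prob_space (\<Pi>\<^sub>M e\<in>I. U01)"
  by (rule prob_space_PiM) (rule prob_space_U01)

lemma measurable_PiM_weight [measurable]: "(\<lambda>x. x) \<in> (\<Pi>\<^sub>M e\<in>all_edges. U01) \<rightarrow>\<^sub>M weight_space"
proof (rule measurable_weight_spaceI)
  fix e assume "e \<in> all_edges"
  then have "(\<lambda>x. x e) \<in> (\<Pi>\<^sub>M e\<in>all_edges. U01) \<rightarrow>\<^sub>M U01" by (rule measurable_component_singleton)
  then show "(\<lambda>x. x e) \<in> borel_measurable (\<Pi>\<^sub>M e\<in>all_edges. U01)"
    using measurable_cong_sets[OF refl sets_U01] by blast
qed

lemma prob_space_weight_law: "prob_space weight_law"
  unfolding weight_law_def by (rule prob_space.prob_space_distr[OF prob_space_PiM_U01 measurable_PiM_weight])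

lemma sets_weight_law [simp, measurable_cong]: "sets weight_law = sets weight_space"
  by (simp add: weight_law_def)

lemma space_weight_law [simp]: "space weight_law = UNIV"
  by (simp add: weight_law_def)

lemma weight_space_restrict:
  assumes "A \<in> sets weight_space" shows "w \<in> A \<longleftrightarrow> restrict w all_edges \<in> A"
proof -
  have "(\<lambda>w. restrict w all_edges) \<in> UNIV \<rightarrow> space (\<Pi>\<^sub>M e\<in>all_edges. (borel :: real measure))"
    by (auto simp: space_PiM)
  note S = sets_vimage_algebra2[OF this]
  obtain B where "A = (\<lambda>w. restrict w all_edges) -` B \<inter> UNIV"
    using assms unfolding weight_space_def S by auto
  then show ?thesis by simp
qed

locale standard_rooted =
  fixes M :: "'a measure" and \<GG> :: "'a \<Rightarrow> nat rwgraph"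
  assumes std: "standard_extension_rooted M \<GG>"
begin

sublocale prob_space M using std by (simp add: standard_extension_rooted_def)

abbreviation "gr \<equiv> (\<lambda>\<omega>. (graph_of (\<GG> \<omega>), root_of (\<GG> \<omega>)))"
abbreviation "wt \<equiv> (\<lambda>\<omega>. weight_of (\<GG> \<omega>))"

lemma gr_measurable [measurable]: "gr \<in> M \<rightarrow>\<^sub>M rooted_graph_space"
  using std by (simp add: standard_extension_rooted_def)

lemma rooted_components [measurable]:
  "fst \<in> rooted_graph_space \<rightarrow>\<^sub>M graph_space" "snd \<in> rooted_graph_space \<rightarrow>\<^sub>M count_space UNIV"
  unfolding rooted_graph_space_def by (intro measurable_restrict_space1; measurable)+

lemma graph_measurable [measurable]: "(\<lambda>\<omega>. graph_of (\<GG> \<omega>)) \<in> M \<rightarrow>\<^sub>M graph_space"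
  using measurable_compose[OF gr_measurable rooted_components(1)] by simp

lemma root_measurable [measurable]: "(\<lambda>\<omega>. root_of (\<GG> \<omega>)) \<in> M \<rightarrow>\<^sub>M count_space UNIV"
  using measurable_compose[OF gr_measurable rooted_components(2)] by simp

lemma weight_rv: "e \<in> all_edges \<Longrightarrow> (\<lambda>\<omega>. weight_of (\<GG> \<omega>) e) \<in> borel_measurable M"
  using std unfolding standard_extension_rooted_def by (auto simp: indep_vars_def)

lemma wt_measurable [measurable]: "wt \<in> M \<rightarrow>\<^sub>M weight_space"
  by (rule measurable_weight_spaceI) (rule weight_rv)

lemma space_rooted: "space rooted_graph_space = {(G, \<rho>). rooted_graph (G, \<rho>)}"
  by (auto simp: rooted_graph_space_def space_restrict_space space_pair_measure space_graph_space rooted_graph_def)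

lemma \<GG>_space: "\<omega> \<in> space M \<Longrightarrow> rooted_graph (graph_of (\<GG> \<omega>), root_of (\<GG> \<omega>))"
  using measurable_space[OF gr_measurable] by (auto simp: space_rooted)

lemma \<GG>_measurable [measurable]: "\<GG> \<in> M \<rightarrow>\<^sub>M RW"
proof -
  have "(\<lambda>\<omega>. (graph_of (\<GG> \<omega>), root_of (\<GG> \<omega>), weight_of (\<GG> \<omega>))) \<in> M \<rightarrow>\<^sub>M RW"
    by (intro measurable_RWI graph_measurable root_measurable wt_measurable)
       (use \<GG>_space in \<open>auto simp: rooted_graph_def\<close>)
  then show ?thesis by simp
qed

lemma distr_wt: "distr M weight_space wt = weight_law"
proof (rule measure_eqI)
  show "sets (distr M weight_space wt) = sets weight_law" by simp
  fix A assume "A \<in> sets (distr M weight_space wt)"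
  then have A [measurable]: "A \<in> sets weight_space" by simp
  let ?R = "\<lambda>\<omega>. \<lambda>e\<in>all_edges. weight_of (\<GG> \<omega>) e"
  have iv: "indep_vars (\<lambda>_. borel) (\<lambda>e \<omega>. weight_of (\<GG> \<omega>) e) all_edges"
    using std by (simp add: standard_extension_rooted_def)
  have U: "distr M borel (\<lambda>\<omega>. weight_of (\<GG> \<omega>) e) = U01" if "e \<in> all_edges" for e
    using std that by (simp add: standard_extension_rooted_def U01_def)
  have "distr M (\<Pi>\<^sub>M e\<in>all_edges. borel) ?R = (\<Pi>\<^sub>M e\<in>all_edges. distr M borel (\<lambda>\<omega>. weight_of (\<GG> \<omega>) e))"
    using iv indep_vars_iff_distr_eq_PiM'[of all_edges "\<lambda>e \<omega>. weight_of (\<GG> \<omega>) e" "\<lambda>_. borel", OF all_edges_nonempty weight_rv]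
    by simp
  also have "\<dots> = (\<Pi>\<^sub>M e\<in>all_edges. U01)" by (rule PiM_cong) (use U in auto)
  finally have eq: "distr M (\<Pi>\<^sub>M e\<in>all_edges. borel) ?R = (\<Pi>\<^sub>M e\<in>all_edges. U01)" .
  have Rm [measurable]: "?R \<in> M \<rightarrow>\<^sub>M (\<Pi>\<^sub>M e\<in>all_edges. borel)" by (intro measurable_restrict weight_rv)
  have AP: "A \<inter> space (\<Pi>\<^sub>M e\<in>all_edges. U01) \<in> sets (\<Pi>\<^sub>M e\<in>all_edges. U01)"
    using measurable_sets[OF measurable_PiM_weight A] by (simp add: vimage_def)
  have sP: "sets (\<Pi>\<^sub>M e\<in>all_edges. U01) = sets (\<Pi>\<^sub>M e\<in>all_edges. (borel :: real measure))"
    by (rule sets_PiM_cong) auto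
  have spP: "space (\<Pi>\<^sub>M e\<in>all_edges. U01) = space (\<Pi>\<^sub>M e\<in>all_edges. (borel :: real measure))"
    by (rule sets_eq_imp_space_eq[OF sP])
  have "emeasure weight_law A = emeasure (\<Pi>\<^sub>M e\<in>all_edges. U01) (A \<inter> space (\<Pi>\<^sub>M e\<in>all_edges. U01))"
    unfolding weight_law_def by (subst emeasure_distr[OF measurable_PiM_weight A]) (simp add: vimage_def)
  also have "\<dots> = emeasure (distr M (\<Pi>\<^sub>M e\<in>all_edges. borel) ?R) (A \<inter> space (\<Pi>\<^sub>M e\<in>all_edges. U01))"
    unfolding eq ..
  also have "\<dots> = emeasure M (?R -` (A \<inter> space (\<Pi>\<^sub>M e\<in>all_edges. U01)) \<inter> space M)"
    using AP sP by (intro emeasure_distr[OF Rm]) simp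
  also have "?R -` (A \<inter> space (\<Pi>\<^sub>M e\<in>all_edges. U01)) \<inter> space M = wt -` A \<inter> space M"
    using weight_space_restrict[OF A] by (auto simp: spP space_PiM)
  also have "emeasure M (wt -` A \<inter> space M) = emeasure (distr M weight_space wt) A"
    by (rule emeasure_distr[symmetric]) auto
  finally show "emeasure (distr M weight_space wt) A = emeasure weight_law A" by simp
qed

lemma product_law: "distr M rooted_graph_space gr \<Otimes>\<^sub>M weight_law =
    distr M (rooted_graph_space \<Otimes>\<^sub>M weight_space) (\<lambda>\<omega>. (gr \<omega>, wt \<omega>))"
proof -
  have g: "sets (vimage_algebra (space M) gr rooted_graph_space) = {gr -` A \<inter> space M | A. A \<in> sets rooted_graph_space}"
    by (rule sets_vimage_algebra2) (use measurable_space[OF gr_measurable] in auto)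
  have w: "sets (vimage_algebra (space M) wt weight_space) = {wt -` A \<inter> space M | A. A \<in> sets weight_space}"
    by (rule sets_vimage_algebra2) auto
  have "indep_set (sets (vimage_algebra (space M) gr rooted_graph_space)) (sets (vimage_algebra (space M) wt weight_space))"
    using std by (simp add: standard_extension_rooted_def)
  note ind = this[unfolded g w]
  interpret G: prob_space "distr M rooted_graph_space gr" by (rule prob_space_distr) measurable
  interpret W: prob_space weight_law by (rule prob_space_weight_law)
  show ?thesis
  proof (rule pair_measure_eqI)
    fix A B assume "A \<in> sets (distr M rooted_graph_space gr)" "B \<in> sets weight_law"
    then have AB [measurable]: "A \<in> sets rooted_graph_space" "B \<in> sets weight_space" by auto
    have "prob ((gr -` A \<inter> space M) \<inter> (wt -` B \<inter> space M)) = prob (gr -` A \<inter> space M) * prob (wt -` B \<inter> space M)"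
      by (rule indep_setD[OF ind]) (use AB in blast)+
    moreover have "(gr -` A \<inter> space M) \<inter> (wt -` B \<inter> space M) = (\<lambda>\<omega>. (gr \<omega>, wt \<omega>)) -` (A \<times> B) \<inter> space M" by auto
    moreover have "emeasure (distr M (rooted_graph_space \<Otimes>\<^sub>M weight_space) (\<lambda>\<omega>. (gr \<omega>, wt \<omega>))) (A \<times> B) =
        emeasure M ((\<lambda>\<omega>. (gr \<omega>, wt \<omega>)) -` (A \<times> B) \<inter> space M)"
      by (rule emeasure_distr) measurable
    moreover have "emeasure (distr M rooted_graph_space gr) A = emeasure M (gr -` A \<inter> space M)"
      by (rule emeasure_distr) measurable
    moreover have "emeasure weight_law B = emeasure M (wt -` B \<inter> space M)"
      unfolding distr_wt[symmetric] by (rule emeasure_distr) measurable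
    ultimately show "emeasure (distr M rooted_graph_space gr) A * emeasure weight_law B =
        emeasure (distr M (rooted_graph_space \<Otimes>\<^sub>M weight_space) (\<lambda>\<omega>. (gr \<omega>, wt \<omega>))) (A \<times> B)"
      by (simp add: emeasure_eq_measure ennreal_mult[symmetric])
  qed (auto intro: G.sigma_finite_measure_axioms W.sigma_finite_measure_axioms sets_pair_measure_cong)
qed

lemma measurable_assoc [measurable]: "(\<lambda>(g, w). (fst g, snd g, w)) \<in> rooted_graph_space \<Otimes>\<^sub>M weight_space \<rightarrow>\<^sub>M RW"
  unfolding case_prod_beta
  by (rule measurable_RWI) (auto simp: space_pair_measure space_rooted rooted_graph_def)

text \<open>
  The weights are independent of the rooted graph, so they can be integrated out first.
\<close>
lemma fubini:
  assumes [measurable]: "f \<in> borel_measurable RW"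
  shows "(\<integral>\<^sup>+\<omega>. f (\<GG> \<omega>) \<partial>M) = (\<integral>\<^sup>+\<omega>. \<integral>\<^sup>+w. f (graph_of (\<GG> \<omega>), root_of (\<GG> \<omega>), w) \<partial>weight_law \<partial>M)"
    and "(\<lambda>g. \<integral>\<^sup>+w. f (fst g, snd g, w) \<partial>weight_law) \<in> borel_measurable rooted_graph_space"
proof -
  interpret W: prob_space weight_law by (rule prob_space_weight_law)
  let ?f = "\<lambda>x. f ((\<lambda>(g, w). (fst g, snd g, w)) x)"
  have m: "?f \<in> borel_measurable (rooted_graph_space \<Otimes>\<^sub>M weight_law)"
    using measurable_compose[OF measurable_assoc assms] by (simp cong: measurable_cong_sets sets_pair_measure_cong)
  have md: "?f \<in> borel_measurable (distr M rooted_graph_space gr \<Otimes>\<^sub>M weight_law)"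
    using m by (simp cong: measurable_cong_sets sets_pair_measure_cong)
  show m2: "(\<lambda>g. \<integral>\<^sup>+w. f (fst g, snd g, w) \<partial>weight_law) \<in> borel_measurable rooted_graph_space"
    using W.borel_measurable_nn_integral_fst[OF m] by simp
  have "(\<integral>\<^sup>+\<omega>. f (\<GG> \<omega>) \<partial>M) = (\<integral>\<^sup>+x. ?f x \<partial>distr M (rooted_graph_space \<Otimes>\<^sub>M weight_space) (\<lambda>\<omega>. (gr \<omega>, wt \<omega>)))"
    by (subst nn_integral_distr) auto
  also have "\<dots> = (\<integral>\<^sup>+x. ?f x \<partial>(distr M rooted_graph_space gr \<Otimes>\<^sub>M weight_law))" unfolding product_law ..
  also have "\<dots> = (\<integral>\<^sup>+g. \<integral>\<^sup>+w. ?f (g, w) \<partial>weight_law \<partial>distr M rooted_graph_space gr)"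
    by (rule W.nn_integral_fst[OF md, symmetric])
  also have "\<dots> = (\<integral>\<^sup>+\<omega>. \<integral>\<^sup>+w. f (graph_of (\<GG> \<omega>), root_of (\<GG> \<omega>), w) \<partial>weight_law \<partial>M)"
    using m2 by (subst nn_integral_distr) auto
  finally show "(\<integral>\<^sup>+\<omega>. f (\<GG> \<omega>) \<partial>M) = (\<integral>\<^sup>+\<omega>. \<integral>\<^sup>+w. f (graph_of (\<GG> \<omega>), root_of (\<GG> \<omega>), w) \<partial>weight_law \<partial>M)" .
qed

lemma weight_distr: "e \<in> all_edges \<Longrightarrow> distr M borel (\<lambda>\<omega>. weight_of (\<GG> \<omega>) e) = U01"
  using std by (simp add: standard_extension_rooted_def U01_def)

lemma AE_weight:
  assumes "e \<in> all_edges" "{x. P x} \<in> sets borel" "AE x in lborel. x \<in> {0..1} \<longrightarrow> P x"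
  shows "AE \<omega> in M. P (weight_of (\<GG> \<omega>) e)"
proof -
  have "AE x in U01. P x" unfolding U01_def using assms(3) by (subst AE_uniform_measure) auto
  then have "AE x in distr M borel (\<lambda>\<omega>. weight_of (\<GG> \<omega>) e). P x" unfolding weight_distr[OF assms(1)] .
  then show ?thesis using assms(2) weight_rv[OF assms(1)] by (subst (asm) AE_distr_iff) auto
qed

lemma AE_weight_neq: "e \<in> all_edges \<Longrightarrow> AE \<omega> in M. weight_of (\<GG> \<omega>) e \<noteq> c"
  by (rule AE_weight) (auto intro: AE_mp[OF AE_lborel_singleton[of c]])

lemma AE_weight_range: "AE \<omega> in M. \<forall>e\<in>all_edges. 0 < weight_of (\<GG> \<omega>) e \<and> weight_of (\<GG> \<omega>) e < 1"
  unfolding AE_ball_countable[OF countable_all_edges]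
proof
  fix e assume e: "e \<in> all_edges"
  have "AE \<omega> in M. 0 \<le> weight_of (\<GG> \<omega>) e \<and> weight_of (\<GG> \<omega>) e \<le> 1"
    by (rule AE_weight[OF e]) auto
  then show "AE \<omega> in M. 0 < weight_of (\<GG> \<omega>) e \<and> weight_of (\<GG> \<omega>) e < 1"
    using AE_weight_neq[OF e, of 0] AE_weight_neq[OF e, of 1] by eventually_elim auto
qed

lemma AE_weight_distinct:
  assumes e: "e \<in> all_edges" "f \<in> all_edges" "e \<noteq> f"
  shows "AE \<omega> in M. weight_of (\<GG> \<omega>) e \<noteq> weight_of (\<GG> \<omega>) f"
proof -
  have iv: "indep_vars (\<lambda>_. borel) (\<lambda>e \<omega>. weight_of (\<GG> \<omega>) e) all_edges"
    using std by (simp add: standard_extension_rooted_def)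
  interpret U: prob_space U01 by (rule prob_space_U01)
  note [measurable] = weight_rv[OF e(1)] weight_rv[OF e(2)]
  have eq: "U01 \<Otimes>\<^sub>M U01 = distr M (borel \<Otimes>\<^sub>M borel) (\<lambda>\<omega>. (weight_of (\<GG> \<omega>) e, weight_of (\<GG> \<omega>) f))"
  proof (rule pair_measure_eqI)
    fix A B assume "A \<in> sets U01" "B \<in> sets U01"
    then have AB [measurable]: "A \<in> sets borel" "B \<in> sets borel" by auto
    let ?S = "\<lambda>j. if j = e then A else B"
    have "prob (\<Inter>j\<in>{e, f}. (\<lambda>\<omega>. weight_of (\<GG> \<omega>) j) -` ?S j \<inter> space M) =
        (\<Prod>j\<in>{e, f}. prob ((\<lambda>\<omega>. weight_of (\<GG> \<omega>) j) -` ?S j \<inter> space M))"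
      by (rule indep_varsD[OF iv]) (use e AB in auto)
    moreover have "(\<Inter>j\<in>{e, f}. (\<lambda>\<omega>. weight_of (\<GG> \<omega>) j) -` ?S j \<inter> space M) =
        (\<lambda>\<omega>. (weight_of (\<GG> \<omega>) e, weight_of (\<GG> \<omega>) f)) -` (A \<times> B) \<inter> space M" using e(3) by auto
    ultimately have "prob ((\<lambda>\<omega>. (weight_of (\<GG> \<omega>) e, weight_of (\<GG> \<omega>) f)) -` (A \<times> B) \<inter> space M) =
        prob ((\<lambda>\<omega>. weight_of (\<GG> \<omega>) e) -` A \<inter> space M) * prob ((\<lambda>\<omega>. weight_of (\<GG> \<omega>) f) -` B \<inter> space M)"
      using e(3) by simp
    moreover have "emeasure (distr M (borel \<Otimes>\<^sub>M borel) (\<lambda>\<omega>. (weight_of (\<GG> \<omega>) e, weight_of (\<GG> \<omega>) f))) (A \<times> B) =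
        emeasure M ((\<lambda>\<omega>. (weight_of (\<GG> \<omega>) e, weight_of (\<GG> \<omega>) f)) -` (A \<times> B) \<inter> space M)"
      by (rule emeasure_distr) measurable
    moreover have "emeasure U01 A = emeasure M ((\<lambda>\<omega>. weight_of (\<GG> \<omega>) e) -` A \<inter> space M)"
      unfolding weight_distr[OF e(1), symmetric] by (rule emeasure_distr) measurable
    moreover have "emeasure U01 B = emeasure M ((\<lambda>\<omega>. weight_of (\<GG> \<omega>) f) -` B \<inter> space M)"
      unfolding weight_distr[OF e(2), symmetric] by (rule emeasure_distr) measurable
    ultimately show "emeasure U01 A * emeasure U01 B =
        emeasure (distr M (borel \<Otimes>\<^sub>M borel) (\<lambda>\<omega>. (weight_of (\<GG> \<omega>) e, weight_of (\<GG> \<omega>) f))) (A \<times> B)"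
      by (simp add: emeasure_eq_measure ennreal_mult[symmetric])
  qed (auto intro: U.sigma_finite_measure_axioms sets_pair_measure_cong)
  interpret P: pair_sigma_finite U01 U01 ..
  have "AE x in U01 \<Otimes>\<^sub>M U01. fst x \<noteq> snd x"
  proof (rule P.AE_pair_measure)
    have "AE y in U01. x \<noteq> y" for x
      unfolding U01_def by (subst AE_uniform_measure) (auto intro: AE_mp[OF AE_lborel_singleton[of x]])
    then show "AE x in U01. AE y in U01. fst (x, y) \<noteq> snd (x, y)" by simp
  qed measurable
  then have "AE x in distr M (borel \<Otimes>\<^sub>M borel) (\<lambda>\<omega>. (weight_of (\<GG> \<omega>) e, weight_of (\<GG> \<omega>) f)). fst x \<noteq> snd x"
    unfolding eq .
  then show ?thesis by (subst (asm) AE_distr_iff) auto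
qed

lemma AE_inj: "AE \<omega> in M. inj_on (weight_of (\<GG> \<omega>)) all_edges"
proof -
  have "AE \<omega> in M. \<forall>e\<in>all_edges. \<forall>f\<in>all_edges. e \<noteq> f \<longrightarrow> weight_of (\<GG> \<omega>) e \<noteq> weight_of (\<GG> \<omega>) f"
    unfolding AE_ball_countable[OF countable_all_edges] using AE_weight_distinct by auto
  then show ?thesis by eventually_elim (auto simp: inj_on_def)
qed

end

locale standard_finite = standard_rooted +
  fixes n :: nat
  assumes stdu: "standard_extension M \<GG>" and n: "n \<ge> 1"
    and fin: "\<And>\<omega>. \<omega> \<in> space M \<Longrightarrow> finite (verts (graph_of (\<GG> \<omega>))) \<and> card (verts (graph_of (\<GG> \<omega>))) = n \<and>
           connected_graph (graph_of (\<GG> \<omega>))"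
begin

lemma subalg: "subalgebra M (graph_algebra M \<GG>)"
  unfolding subalgebra_def
proof
  show "space (graph_algebra M \<GG>) = space M" by (simp add: graph_algebra_def)
  have "(\<lambda>\<omega>. graph_of (\<GG> \<omega>)) \<in> space M \<rightarrow> space graph_space" using measurable_space[OF graph_measurable] by auto
  from sets_vimage_algebra2[OF this] show "sets (graph_algebra M \<GG>) \<subseteq> sets M"
    unfolding graph_algebra_def using measurable_sets[OF graph_measurable] by auto
qed

sublocale GA: sigma_finite_subalgebra M "graph_algebra M \<GG>"
  by (rule finite_measure_subalgebra_is_sigma_finite)
     (simp add: finite_measure_subalgebra_def finite_measure_subalgebra_axioms_def subalg finite_measure_axioms)

text \<open>
  The integral of the conditional expectation of \<open>indicator {v}\<close> over an event of the graph gives the joint law of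
  the graph and the root.
\<close>
lemma root_uniform:
  assumes [measurable]: "A \<in> sets graph_space"
  shows "emeasure M {\<omega> \<in> space M. graph_of (\<GG> \<omega>) \<in> A \<and> root_of (\<GG> \<omega>) = v} =
     ennreal (1 / real n) * emeasure M {\<omega> \<in> space M. graph_of (\<GG> \<omega>) \<in> A \<and> v \<in> verts (graph_of (\<GG> \<omega>))}"
proof -
  let ?B = "{\<omega> \<in> space M. graph_of (\<GG> \<omega>) \<in> A}"
  have B: "?B \<in> sets (graph_algebra M \<GG>)"
  proof -
    have "(\<lambda>\<omega>. graph_of (\<GG> \<omega>)) -` A \<inter> space M \<in> sets (graph_algebra M \<GG>)"
      unfolding graph_algebra_def by (rule in_vimage_algebra) fact
    then show ?thesis by (simp add: vimage_def Int_def conj_commute)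
  qed
  have Bm [measurable]: "?B \<in> sets M" by measurable
  have [measurable]: "Measurable.pred M (\<lambda>\<omega>. v \<in> verts (graph_of (\<GG> \<omega>)))"
    using measurable_compose[OF graph_measurable pred_verts] by simp
  let ?i = "\<lambda>\<omega>. indicator {v} (root_of (\<GG> \<omega>)) :: real"
  have int: "integrable M ?i"
    by (rule integrable_const_bound[of _ 1]) (auto simp: indicator_def)
  have "(LINT \<omega>:?B|M. ?i \<omega>) = (LINT \<omega>:?B|M. real_cond_exp M (graph_algebra M \<GG>) ?i \<omega>)"
    by (rule GA.real_cond_exp_intA[OF int B])
  also have "\<dots> = (LINT \<omega>:?B|M. if v \<in> verts (graph_of (\<GG> \<omega>)) then 1 / real n else 0)"
  proof (rule set_lebesgue_integral_cong_AE)
    have "AE \<omega> in M. real_cond_exp M (graph_algebra M \<GG>) ?i \<omega> =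
        (if v \<in> verts (graph_of (\<GG> \<omega>)) then 1 / real (card (verts (graph_of (\<GG> \<omega>)))) else 0)"
      using stdu by (simp add: standard_extension_def)
    then show "AE \<omega>\<in>?B in M. real_cond_exp M (graph_algebra M \<GG>) ?i \<omega> = (if v \<in> verts (graph_of (\<GG> \<omega>)) then 1 / real n else 0)"
      using AE_space by eventually_elim (use fin in auto)
  qed (auto intro: Bm)
  finally have eq: "(LINT \<omega>:?B|M. ?i \<omega>) = (LINT \<omega>:?B|M. if v \<in> verts (graph_of (\<GG> \<omega>)) then 1 / real n else 0)" .
  have "(LINT \<omega>:?B|M. ?i \<omega>) = (LINT \<omega>|M. indicator {\<omega> \<in> space M. graph_of (\<GG> \<omega>) \<in> A \<and> root_of (\<GG> \<omega>) = v} \<omega>)"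
    unfolding set_lebesgue_integral_def by (rule Bochner_Integration.integral_cong) (auto simp: indicator_def)
  also have "\<dots> = prob {\<omega> \<in> space M. graph_of (\<GG> \<omega>) \<in> A \<and> root_of (\<GG> \<omega>) = v}" by simp
  finally have l: "(LINT \<omega>:?B|M. ?i \<omega>) = prob {\<omega> \<in> space M. graph_of (\<GG> \<omega>) \<in> A \<and> root_of (\<GG> \<omega>) = v}" .
  have "(LINT \<omega>:?B|M. if v \<in> verts (graph_of (\<GG> \<omega>)) then 1 / real n else 0) =
      (LINT \<omega>|M. 1 / real n * indicator {\<omega> \<in> space M. graph_of (\<GG> \<omega>) \<in> A \<and> v \<in> verts (graph_of (\<GG> \<omega>))} \<omega>)"
    unfolding set_lebesgue_integral_def by (rule Bochner_Integration.integral_cong) (auto simp: indicator_def)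
  also have "\<dots> = 1 / real n * prob {\<omega> \<in> space M. graph_of (\<GG> \<omega>) \<in> A \<and> v \<in> verts (graph_of (\<GG> \<omega>))}" by simp
  finally show ?thesis using l eq by (simp add: emeasure_eq_measure ennreal_mult[symmetric])
qed

text \<open>
  The graph and the root may be sampled in two stages.  Summing \<open>root_uniform\<close> over the countably many possible roots extends it
  from events to functions.
\<close>
lemma reroot_graph:
  assumes [measurable]: "f \<in> borel_measurable rooted_graph_space"
  shows "(\<integral>\<^sup>+\<omega>. f (gr \<omega>) \<partial>M) =
    (\<integral>\<^sup>+\<omega>. (\<Sum>v\<in>verts (graph_of (\<GG> \<omega>)). f (graph_of (\<GG> \<omega>), v)) * ennreal (1 / real n) \<partial>M)"
proof -
  define F where "F v G = (if v \<in> verts G then f (G, v) else 0)" for v G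
  have Fm: "F v \<in> borel_measurable graph_space" for v
  proof -
    have Om: "{G \<in> space graph_space. v \<in> verts G} \<in> sets graph_space" using pred_verts[of v] by (simp add: pred_def)
    have "(\<lambda>G. (G, v)) \<in> restrict_space graph_space {G. v \<in> verts G} \<rightarrow>\<^sub>M rooted_graph_space"
      unfolding rooted_graph_space_def
      by (rule measurable_restrict_space2) (auto simp: space_restrict_space space_graph_space intro!: measurable_restrict_space1 measurable_Pair)
    from measurable_compose[OF this assms]
    have "(\<lambda>G. f (G, v) * indicator {G. v \<in> verts G} G) \<in> borel_measurable graph_space"
      using Om by (subst (asm) borel_measurable_restrict_space_iff_ennreal) (auto simp: Int_def conj_commute)
    then show ?thesis by (rule measurable_cong[THEN iffD1, rotated]) (auto simp: F_def)
  qed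
  note [measurable] = Fm
  have [measurable]: "Measurable.pred M (\<lambda>\<omega>. v \<in> verts (graph_of (\<GG> \<omega>)))" for v
    using measurable_compose[OF graph_measurable pred_verts] by simp
  let ?c = "\<lambda>v \<omega>. indicator {\<omega> \<in> space M. root_of (\<GG> \<omega>) = v} \<omega> :: ennreal"
  let ?d = "\<lambda>v \<omega>. ennreal (1 / real n) * indicator {\<omega> \<in> space M. v \<in> verts (graph_of (\<GG> \<omega>))} \<omega> :: ennreal"
  have rootv [measurable]: "{\<omega> \<in> space M. root_of (\<GG> \<omega>) = v} \<in> sets M" for v
    using measurable_sets[OF root_measurable, of "{v}"] by (simp add: vimage_def Int_def conj_commute)
  have cd [measurable]: "?c v \<in> borel_measurable M" "?d v \<in> borel_measurable M" for v by measurable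
  \<comment> \<open>For fixed \<open>v\<close>, the restriction to the event that the root is \<open>v\<close> and the restriction to the event that \<open>v\<close> is a
     vertex induce laws of the graph that differ by the factor \<open>1 / n\<close>.\<close>
  have laws: "distr (density M (?c v)) graph_space (\<lambda>\<omega>. graph_of (\<GG> \<omega>)) = distr (density M (?d v)) graph_space (\<lambda>\<omega>. graph_of (\<GG> \<omega>))" for v
  proof (rule measure_eqI)
    fix A assume "A \<in> sets (distr (density M (?c v)) graph_space (\<lambda>\<omega>. graph_of (\<GG> \<omega>)))"
    then have A [measurable]: "A \<in> sets graph_space" by simp
    have Am: "(\<lambda>\<omega>. graph_of (\<GG> \<omega>)) -` A \<inter> space M \<in> sets M" by measurable
    have em: "emeasure (distr (density M c) graph_space (\<lambda>\<omega>. graph_of (\<GG> \<omega>))) A =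
        (\<integral>\<^sup>+\<omega>. c \<omega> * indicator ((\<lambda>\<omega>. graph_of (\<GG> \<omega>)) -` A \<inter> space M) \<omega> \<partial>M)"
      if [measurable]: "c \<in> borel_measurable M" for c
      using Am emeasure_density[OF that Am] by (subst emeasure_distr) auto
    have "emeasure (distr (density M (?c v)) graph_space (\<lambda>\<omega>. graph_of (\<GG> \<omega>))) A =
       (\<integral>\<^sup>+\<omega>. indicator {\<omega> \<in> space M. graph_of (\<GG> \<omega>) \<in> A \<and> root_of (\<GG> \<omega>) = v} \<omega> \<partial>M)"
      unfolding em[OF cd(1)] by (rule nn_integral_cong) (auto simp add: indicator_def)
    also have "\<dots> = emeasure M {\<omega> \<in> space M. graph_of (\<GG> \<omega>) \<in> A \<and> root_of (\<GG> \<omega>) = v}" by (rule nn_integral_indicator) measurable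
    also have "\<dots> = ennreal (1 / real n) * emeasure M {\<omega> \<in> space M. graph_of (\<GG> \<omega>) \<in> A \<and> v \<in> verts (graph_of (\<GG> \<omega>))}"
      by (rule root_uniform) fact
    also have "\<dots> = (\<integral>\<^sup>+\<omega>. ennreal (1 / real n) * indicator {\<omega> \<in> space M. graph_of (\<GG> \<omega>) \<in> A \<and> v \<in> verts (graph_of (\<GG> \<omega>))} \<omega> \<partial>M)"
      by (rule nn_integral_cmult_indicator[symmetric]) measurable
    also have "\<dots> = emeasure (distr (density M (?d v)) graph_space (\<lambda>\<omega>. graph_of (\<GG> \<omega>))) A"
      unfolding em[OF cd(2)] by (rule nn_integral_cong) (auto simp add: indicator_def)
    finally show "emeasure (distr (density M (?c v)) graph_space (\<lambda>\<omega>. graph_of (\<GG> \<omega>))) A =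
        emeasure (distr (density M (?d v)) graph_space (\<lambda>\<omega>. graph_of (\<GG> \<omega>))) A" .
  qed simp
  have term_eq: "(\<integral>\<^sup>+\<omega>. ?c v \<omega> * F v (graph_of (\<GG> \<omega>)) \<partial>M) = (\<integral>\<^sup>+\<omega>. ?d v \<omega> * F v (graph_of (\<GG> \<omega>)) \<partial>M)" for v
  proof -
    have "(\<integral>\<^sup>+\<omega>. ?c v \<omega> * F v (graph_of (\<GG> \<omega>)) \<partial>M) = (\<integral>\<^sup>+G. F v G \<partial>distr (density M (?c v)) graph_space (\<lambda>\<omega>. graph_of (\<GG> \<omega>)))"
      by (subst nn_integral_distr; (subst nn_integral_density)?) auto
    also have "\<dots> = (\<integral>\<^sup>+\<omega>. ?d v \<omega> * F v (graph_of (\<GG> \<omega>)) \<partial>M)"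
      unfolding laws by (subst nn_integral_distr; (subst nn_integral_density)?) auto
    finally show ?thesis .
  qed
  have "(\<integral>\<^sup>+\<omega>. f (gr \<omega>) \<partial>M) = (\<integral>\<^sup>+\<omega>. (\<Sum>v. ?c v \<omega> * F v (graph_of (\<GG> \<omega>))) \<partial>M)"
  proof (rule nn_integral_cong)
    fix \<omega> assume \<omega>: "\<omega> \<in> space M"
    have "(\<Sum>v. ?c v \<omega> * F v (graph_of (\<GG> \<omega>))) = (\<Sum>v\<in>{root_of (\<GG> \<omega>)}. ?c v \<omega> * F v (graph_of (\<GG> \<omega>)))"
      by (rule suminf_finite) auto
    also have "\<dots> = f (gr \<omega>)" using \<GG>_space[OF \<omega>] \<omega> by (simp add: F_def rooted_graph_def)
    finally show "f (gr \<omega>) = (\<Sum>v. ?c v \<omega> * F v (graph_of (\<GG> \<omega>)))" by simp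
  qed
  also have "\<dots> = (\<Sum>v. \<integral>\<^sup>+\<omega>. ?c v \<omega> * F v (graph_of (\<GG> \<omega>)) \<partial>M)" by (rule nn_integral_suminf) measurable
  also have "\<dots> = (\<Sum>v. \<integral>\<^sup>+\<omega>. ?d v \<omega> * F v (graph_of (\<GG> \<omega>)) \<partial>M)" unfolding term_eq ..
  also have "\<dots> = (\<integral>\<^sup>+\<omega>. (\<Sum>v. ?d v \<omega> * F v (graph_of (\<GG> \<omega>))) \<partial>M)" by (rule nn_integral_suminf[symmetric]) measurable
  also have "\<dots> = (\<integral>\<^sup>+\<omega>. (\<Sum>v\<in>verts (graph_of (\<GG> \<omega>)). f (graph_of (\<GG> \<omega>), v)) * ennreal (1 / real n) \<partial>M)"
  proof (rule nn_integral_cong)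
    fix \<omega> assume \<omega>: "\<omega> \<in> space M"
    have "(\<Sum>v. ?d v \<omega> * F v (graph_of (\<GG> \<omega>))) = (\<Sum>v\<in>verts (graph_of (\<GG> \<omega>)). ?d v \<omega> * F v (graph_of (\<GG> \<omega>)))"
      by (rule suminf_finite) (use fin[OF \<omega>] in auto)
    also have "\<dots> = (\<Sum>v\<in>verts (graph_of (\<GG> \<omega>)). f (graph_of (\<GG> \<omega>), v) * ennreal (1 / real n))"
      by (rule sum.cong) (use \<omega> in \<open>auto simp: F_def mult.commute\<close>)
    finally show "(\<Sum>v. ?d v \<omega> * F v (graph_of (\<GG> \<omega>))) = (\<Sum>v\<in>verts (graph_of (\<GG> \<omega>)). f (graph_of (\<GG> \<omega>), v)) * ennreal (1 / real n)"
      by (simp add: sum_distrib_right)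
  qed
  finally show ?thesis .
qed

end

section \<open>Cluster sizes as local functions, and rerooting\<close>

section \<open>Locality of cluster sizes\<close>

lemma has_card_mono: "has_card j S \<Longrightarrow> S \<subseteq> T \<Longrightarrow> has_card j T"
  unfolding has_card_def by blast

lemma has_card_le: "has_card j S \<Longrightarrow> i \<le> j \<Longrightarrow> has_card i S"
  by (auto simp: has_card_iff)

text \<open>
  As long as the ball of radius \<open>i\<close> does not contain all reachable vertices, it gains a vertex with every increase of \<open>i\<close>.  So a
  cluster with at least \<open>j\<close> vertices has \<open>j\<close> of them at distance less than \<open>j\<close>.
\<close>
lemma reachable_has_card:
  assumes "has_card j {u. (v, u) \<in> r\<^sup>*}"
  shows "has_card j {u. \<exists>i<j. (v, u) \<in> r ^^ i}"
  using assms
proof (induction j)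
  case 0 then show ?case by (simp add: has_card_def)
next
  case (Suc j)
  let ?E = "\<lambda>j. {u. \<exists>i<j. (v, u) \<in> r ^^ i}"
  show ?case
  proof (rule ccontr)
    assume n: "\<not> has_card (Suc j) (?E (Suc j))"
    then have fin: "finite (?E (Suc j))" "card (?E (Suc j)) \<le> j" by (auto simp: has_card_iff)
    have sub: "?E j \<subseteq> ?E (Suc j)" by (auto intro: less_SucI)
    have "has_card j (?E j)" using Suc by (meson has_card_le le_SucI order_refl)
    then have "j \<le> card (?E j)" using finite_subset[OF sub fin(1)] by (auto simp: has_card_iff)
    then have eq: "?E j = ?E (Suc j)" using card_subset_eq[OF fin(1) sub] card_mono[OF fin(1) sub] fin(2) by simp
    have v: "v \<in> ?E (Suc j)" by (auto intro!: exI[of _ 0])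
    have "u \<in> ?E j" if "(v, u) \<in> r\<^sup>*" for u
      using that
    proof (induction rule: rtrancl_induct)
      case base then show ?case using v eq by simp
    next
      case (step y z)
      then obtain i where "i < j" "(v, y) \<in> r ^^ i" by auto
      then have "(v, z) \<in> r ^^ Suc i" "Suc i < Suc j" using step by auto
      then have "z \<in> ?E (Suc j)" by blast
      then show ?case using eq by simp
    qed
    then have "{u. (v, u) \<in> r\<^sup>*} \<subseteq> ?E (Suc j)" unfolding eq by blast
    then show False using n has_card_mono[OF Suc.prems] by blast
  qed
qed

lemma has_card_cluster_iff:
  assumes "simple_graph G" "v \<in> verts G"
  shows "has_card j (cluster (G, \<rho>, w) v p) \<longleftrightarrow> has_card j {u. \<exists>i<j. (v, u) \<in> edge_rel (low_edges G w p) ^^ i}"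
proof -
  have "low_edges G w p \<subseteq> edges G" by auto
  from rtrancl_verts[OF assms(1) this _ assms(2)]
  have "cluster (G, \<rho>, w) v p = {u. (v, u) \<in> (edge_rel (low_edges G w p))\<^sup>*}"
    unfolding cluster_eq by blast
  then show ?thesis
    using reachable_has_card[of j v "edge_rel (low_edges G w p)"]
      has_card_mono[of j "{u. \<exists>i<j. (v, u) \<in> edge_rel (low_edges G w p) ^^ i}" "{u. (v, u) \<in> (edge_rel (low_edges G w p))\<^sup>*}"]
    by (auto dest: relpow_imp_rtrancl)
qed

text \<open>
  For radius \<open>j\<close>, the weights of these edges determine whether the cluster of \<open>v\<close> has at least \<open>j\<close> vertices.
\<close>
definition near_edges :: "real \<Rightarrow> 'v graph \<Rightarrow> 'v \<Rightarrow> 'v set set" where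
  "near_edges r G v = {e \<in> edges G. e \<subseteq> ball_set r (edges G) v}"

lemma has_card_cluster_local:
  assumes "simple_graph G" "v \<in> verts G" and agree: "\<And>e. e \<in> near_edges (real j) G v \<Longrightarrow> w e = w' e"
  shows "has_card j (cluster (G, \<rho>, w) v p) \<longleftrightarrow> has_card j (cluster (G, \<rho>', w') v p)"
proof -
  have 1: "(v, u) \<in> edge_rel (low_edges G w' p) ^^ i" if "(v, u) \<in> edge_rel (low_edges G w p) ^^ i" "i < j"
    "\<And>e. e \<in> near_edges (real j) G v \<Longrightarrow> w e = w' e" for u i w w'
    by (rule relpow_local[of _ "edges G" "real j" v, OF _ _ that(1)]) (use that in \<open>auto simp: near_edges_def\<close>)
  have "{u. \<exists>i<j. (v, u) \<in> edge_rel (low_edges G w p) ^^ i} = {u. \<exists>i<j. (v, u) \<in> edge_rel (low_edges G w' p) ^^ i}"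
    using 1[of _ _ w w'] 1[of _ _ w' w] agree by auto
  then show ?thesis by (simp add: has_card_cluster_iff[OF assms(1,2)])
qed

lemma has_card_image: "inj_on f S \<Longrightarrow> has_card j (f ` S) \<longleftrightarrow> has_card j S"
  by (auto simp: has_card_iff card_image finite_image_iff)

lemma has_card_cluster_iso:
  assumes rs: "rooted_simple G \<rho>" "rooted_simple G' \<rho>'"
    and iso: "ball_iso R (edges G) \<rho> (edges G') \<rho>' \<phi>" and R: "real j \<le> R"
    and agree: "\<And>e. e \<in> near_edges (real j) G \<rho> \<Longrightarrow> w e = w' (\<phi> ` e)"
  shows "has_card j (cluster (G, \<rho>, w) \<rho> p) \<longleftrightarrow> has_card j (cluster (G', \<rho>', w') \<rho>' p)"
proof -
  note D = ball_isoD[OF iso]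
  have iff: "{u, v} \<in> low_edges G w p \<longleftrightarrow> {\<phi> u, \<phi> v} \<in> low_edges G' w' p"
    if "u \<in> ball_set (real j) (edges G) \<rho>" "v \<in> ball_set (real j) (edges G) \<rho>" for u v
  proof -
    have "u \<in> ball_set R (edges G) \<rho>" "v \<in> ball_set R (edges G) \<rho>" using that ball_set_mono[OF R order_refl[of "edges G"]] by auto
    then have "{u, v} \<in> edges G \<longleftrightarrow> {\<phi> u, \<phi> v} \<in> edges G'" by (rule D(4))
    moreover have "{u, v} \<in> edges G \<Longrightarrow> w {u, v} = w' {\<phi> u, \<phi> v}" using agree[of "{u, v}"] that by (simp add: near_edges_def)
    ultimately show ?thesis by auto
  qed
  have sub: "low_edges G w p \<subseteq> edges G" "low_edges G' w' p \<subseteq> edges G'" by auto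
  let ?E = "{u. \<exists>i<j. (\<rho>, u) \<in> edge_rel (low_edges G w p) ^^ i}"
  let ?E' = "{u. \<exists>i<j. (\<rho>', u) \<in> edge_rel (low_edges G' w' p) ^^ i}"
  have rel: "(\<forall>v. (\<rho>, v) \<in> edge_rel (low_edges G w p) ^^ i \<longrightarrow> (\<rho>', \<phi> v) \<in> edge_rel (low_edges G' w' p) ^^ i) \<and>
         (\<forall>v'. (\<rho>', v') \<in> edge_rel (low_edges G' w' p) ^^ i \<longrightarrow> (\<exists>v. (\<rho>, v) \<in> edge_rel (low_edges G w p) ^^ i \<and> v' = \<phi> v))"
    if "i < j" for i
    by (rule ball_iso_subgraph_relpow[OF iso R sub iff]) (use that in auto)
  have "\<phi> ` ?E = ?E'"
  proof (intro set_eqI iffI)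
    fix x assume "x \<in> \<phi> ` ?E" then show "x \<in> ?E'" using rel by auto
  next
    fix x assume "x \<in> ?E'" then show "x \<in> \<phi> ` ?E" using rel by blast
  qed
  moreover have "?E \<subseteq> ball_set R (edges G) \<rho>"
  proof
    fix x assume "x \<in> ?E"
    then obtain i where "i < j" "(\<rho>, x) \<in> edge_rel (low_edges G w p) ^^ i" by blast
    then show "x \<in> ball_set R (edges G) \<rho>"
      using relpow_in_ball_set[OF edge_relpow_mono[OF sub(1)], of \<rho> x i R] R by simp
  qed
  then have "inj_on \<phi> ?E" using D(1) inj_on_subset by blast
  ultimately show ?thesis
    using has_card_image[of \<phi> ?E j] rs by (simp add: has_card_cluster_iff rooted_simple_def)
qed

section \<open>Conditioning on the graph\<close>

definition big_cluster :: "nat \<Rightarrow> real \<Rightarrow> nat rwgraph \<Rightarrow> bool" where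
  "big_cluster j p x \<longleftrightarrow> has_card j (cluster x (root_of x) p)"

lemma pred_big_cluster [measurable]: "Measurable.pred RW (big_cluster j p)"
  unfolding big_cluster_def[abs_def] by (rule pred_root_param) (rule pred_has_card[OF pred_cluster])

definition reroot :: "nat \<Rightarrow> nat rwgraph \<Rightarrow> nat rwgraph" where
  "reroot v x = (graph_of x, if v \<in> verts (graph_of x) then v else root_of x, weight_of x)"

lemma measurable_reroot [measurable]: "reroot v \<in> RW \<rightarrow>\<^sub>M RW"
  unfolding reroot_def by (rule measurable_RWI) (auto simp: space_RW rooted_graph_def)

definition reroot_count :: "(nat rwgraph \<Rightarrow> bool) \<Rightarrow> nat rwgraph \<Rightarrow> nat" where
  "reroot_count P x = card {v \<in> verts (graph_of x). P (graph_of x, v, weight_of x)}"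

lemma pred_reroot:
  assumes [measurable]: "Measurable.pred RW P"
  shows "Measurable.pred RW (\<lambda>x. v \<in> verts (graph_of x) \<and> P (graph_of x, v, weight_of x))"
proof -
  have "(\<lambda>x. v \<in> verts (graph_of x) \<and> P (graph_of x, v, weight_of x)) = (\<lambda>x. v \<in> verts (graph_of x) \<and> P (reroot v x))"
    by (auto simp: reroot_def)
  then show ?thesis by simp
qed

lemma measurable_reroot_count [measurable]:
  assumes "Measurable.pred RW P"
  shows "reroot_count P \<in> RW \<rightarrow>\<^sub>M count_space UNIV"
  unfolding reroot_count_def[abs_def] by (rule measurable_card) (use pred_reroot[OF assms] in simp)

lemma measurable_real_reroot_count [measurable]:
  assumes "Measurable.pred RW P"
  shows "(\<lambda>x. real (reroot_count P x)) \<in> borel_measurable RW"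
  by (rule measurable_compose[OF measurable_reroot_count[OF assms]]) simp

context standard_finite begin

lemma reroot_emeasure:
  assumes [measurable]: "Measurable.pred RW P"
  shows "emeasure M {\<omega> \<in> space M. P (\<GG> \<omega>)} = (\<integral>\<^sup>+\<omega>. ennreal (real (reroot_count P (\<GG> \<omega>)) / real n) \<partial>M)"
proof -
  let ?f = "\<lambda>x. indicator {x. P x} x :: ennreal"
  have fm [measurable]: "?f \<in> borel_measurable RW" by measurable
  let ?g = "\<lambda>x. ennreal (real (reroot_count P x) / real n)"
  note [measurable] = measurable_real_reroot_count[OF assms]
  have gm [measurable]: "?g \<in> borel_measurable RW" by measurable
  have [measurable]: "{\<omega> \<in> space M. P (\<GG> \<omega>)} \<in> sets M" by measurable
  have "emeasure M {\<omega> \<in> space M. P (\<GG> \<omega>)} = (\<integral>\<^sup>+\<omega>. indicator {\<omega> \<in> space M. P (\<GG> \<omega>)} \<omega> \<partial>M)"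
    by (rule nn_integral_indicator[symmetric]) measurable
  also have "\<dots> = (\<integral>\<^sup>+\<omega>. ?f (\<GG> \<omega>) \<partial>M)"
    by (rule nn_integral_cong) (auto simp: indicator_def)
  also have "\<dots> = (\<integral>\<^sup>+\<omega>. \<integral>\<^sup>+w. ?f (graph_of (\<GG> \<omega>), root_of (\<GG> \<omega>), w) \<partial>weight_law \<partial>M)" by (rule fubini(1)[OF fm])
  also have "\<dots> = (\<integral>\<^sup>+\<omega>. (\<Sum>v\<in>verts (graph_of (\<GG> \<omega>)). \<integral>\<^sup>+w. ?f (graph_of (\<GG> \<omega>), v, w) \<partial>weight_law) * ennreal (1 / real n) \<partial>M)"
    using reroot_graph[OF fubini(2)[OF fm]] by simp
  also have "\<dots> = (\<integral>\<^sup>+\<omega>. \<integral>\<^sup>+w. ?g (graph_of (\<GG> \<omega>), root_of (\<GG> \<omega>), w) \<partial>weight_law \<partial>M)"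
  proof (rule nn_integral_cong)
    fix \<omega> assume \<omega>: "\<omega> \<in> space M"
    let ?G = "graph_of (\<GG> \<omega>)"
    have G: "simple_graph ?G" "locally_finite_graph ?G" using \<GG>_space[OF \<omega>] by (auto simp: rooted_graph_def)
    have m: "(\<lambda>w. ?f (?G, v, w)) \<in> borel_measurable weight_law" if "v \<in> verts ?G" for v
    proof -
      have "(\<lambda>w. (?G, v, w)) \<in> weight_law \<rightarrow>\<^sub>M RW"
        by (rule measurable_RWI) (use that G in \<open>auto simp: space_graph_space measurable_ident_sets\<close>)
      from measurable_compose[OF this fm] show ?thesis .
    qed
    have "(\<Sum>v\<in>verts ?G. \<integral>\<^sup>+w. ?f (?G, v, w) \<partial>weight_law) * ennreal (1 / real n) =
        (\<integral>\<^sup>+w. (\<Sum>v\<in>verts ?G. ?f (?G, v, w)) * ennreal (1 / real n) \<partial>weight_law)"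
      by (subst nn_integral_sum[symmetric]) (use m in \<open>auto simp: nn_integral_multc\<close>)
    also have "\<dots> = (\<integral>\<^sup>+w. ?g (?G, root_of (\<GG> \<omega>), w) \<partial>weight_law)"
    proof (rule nn_integral_cong)
      fix w
      have "(\<Sum>v\<in>verts ?G. ?f (?G, v, w)) = (\<Sum>v\<in>verts ?G. if P (?G, v, w) then 1 else 0)"
        by (auto intro!: sum.cong simp: indicator_def)
      also have "\<dots> = of_nat (card {v \<in> verts ?G. P (?G, v, w)})"
        using fin[OF \<omega>] by (simp flip: sum.inter_filter)
      finally show "(\<Sum>v\<in>verts ?G. ?f (?G, v, w)) * ennreal (1 / real n) = ?g (?G, root_of (\<GG> \<omega>), w)"
        by (simp add: reroot_count_def ennreal_of_nat_eq_real_of_nat ennreal_mult[symmetric])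
    qed
    finally show "(\<Sum>v\<in>verts ?G. \<integral>\<^sup>+w. ?f (?G, v, w) \<partial>weight_law) * ennreal (1 / real n) =
        (\<integral>\<^sup>+w. ?g (?G, root_of (\<GG> \<omega>), w) \<partial>weight_law)" .
  qed
  also have "\<dots> = (\<integral>\<^sup>+\<omega>. ?g (\<GG> \<omega>) \<partial>M)" by (rule fubini(1)[OF gm, symmetric])
  finally show ?thesis .
qed

lemma reroot_count_le: "\<omega> \<in> space M \<Longrightarrow> reroot_count P (\<GG> \<omega>) \<le> n"
  unfolding reroot_count_def using fin[of \<omega>] card_mono[of "verts (graph_of (\<GG> \<omega>))"] by (metis (no_types, lifting) mem_Collect_eq subsetI)

text \<open>
  Since the root is uniform and the weights are independent of it, the probability of \<open>P\<close> is the expected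
  proportion of the vertices from which \<open>P\<close> holds.
\<close>
lemma reroot_prob:
  assumes [measurable]: "Measurable.pred RW P"
  shows "integrable M (\<lambda>\<omega>. real (reroot_count P (\<GG> \<omega>)))"
    "prob {\<omega> \<in> space M. P (\<GG> \<omega>)} = (\<integral>\<omega>. real (reroot_count P (\<GG> \<omega>)) \<partial>M) / real n"
proof -
  have m [measurable]: "(\<lambda>\<omega>. real (reroot_count P (\<GG> \<omega>))) \<in> borel_measurable M"
    using measurable_compose[OF \<GG>_measurable measurable_real_reroot_count[OF assms]] .
  show int: "integrable M (\<lambda>\<omega>. real (reroot_count P (\<GG> \<omega>)))"
    by (rule integrable_const_bound[of _ "real n"]) (auto simp: reroot_count_le m)
  have "ennreal (prob {\<omega> \<in> space M. P (\<GG> \<omega>)}) = (\<integral>\<^sup>+\<omega>. ennreal (real (reroot_count P (\<GG> \<omega>)) / real n) \<partial>M)"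
    using reroot_emeasure[OF assms] by (simp add: emeasure_eq_measure)
  also have "\<dots> = ennreal (\<integral>\<omega>. real (reroot_count P (\<GG> \<omega>)) / real n \<partial>M)"
    by (rule nn_integral_eq_integral) (use int in auto)
  finally show "prob {\<omega> \<in> space M. P (\<GG> \<omega>)} = (\<integral>\<omega>. real (reroot_count P (\<GG> \<omega>)) \<partial>M) / real n"
    by (subst (asm) ennreal_inj) (auto intro!: divide_nonneg_nonneg integral_nonneg)
qed

lemma section_measurable:
  fixes h :: "nat graph \<times> nat \<Rightarrow> real"
  assumes h [measurable]: "h \<in> borel_measurable rooted_graph_space"
  shows "(\<lambda>G. if v \<in> verts G then h (G, v) else 0) \<in> borel_measurable graph_space"
proof -
  have Om: "{G \<in> space graph_space. v \<in> verts G} \<in> sets graph_space" using pred_verts[of v] by (simp add: pred_def)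
  have "(\<lambda>G. (G, v)) \<in> restrict_space graph_space {G. v \<in> verts G} \<rightarrow>\<^sub>M rooted_graph_space"
    unfolding rooted_graph_space_def
    by (rule measurable_restrict_space2) (auto simp: space_restrict_space space_graph_space intro!: measurable_restrict_space1 measurable_Pair)
  from measurable_compose[OF this h]
  have "(\<lambda>G. indicator {G. v \<in> verts G} G *\<^sub>R h (G, v)) \<in> borel_measurable graph_space"
    using Om by (subst (asm) borel_measurable_restrict_space_iff) (auto simp: Int_def conj_commute)
  then show ?thesis by (rule measurable_cong[THEN iffD1, rotated]) auto
qed

text \<open>
  The sum runs over all natural numbers, which makes it measurable as a function of the graph; for finite graphs
  it is the average over the \<open>n\<close> vertices.
\<close>
definition avg :: "(nat graph \<times> nat \<Rightarrow> real) \<Rightarrow> nat graph \<Rightarrow> real" where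
  "avg h G = (\<Sum>v. if v \<in> verts G then h (G, v) else 0) / real n"

lemma avg_measurable [measurable]: "h \<in> borel_measurable rooted_graph_space \<Longrightarrow> avg h \<in> borel_measurable graph_space"
  unfolding avg_def[abs_def] by (intro borel_measurable_divide borel_measurable_suminf section_measurable) auto

lemma avg_finite: "finite (verts G) \<Longrightarrow> avg h G = (\<Sum>v\<in>verts G. h (G, v)) / real n"
proof -
  assume "finite (verts G)"
  then have "(\<Sum>v. if v \<in> verts G then h (G, v) else 0) = (\<Sum>v\<in>verts G. if v \<in> verts G then h (G, v) else 0)"
    by (intro suminf_finite) auto
  then show ?thesis by (simp add: avg_def)
qed

text \<open>
  Given the graph, the root is uniform.
\<close>
lemma cond_exp_avg:
  fixes h :: "nat graph \<times> nat \<Rightarrow> real"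
  assumes h [measurable]: "h \<in> borel_measurable rooted_graph_space" and b: "\<And>x. 0 \<le> h x" "\<And>x. h x \<le> 1"
  shows "AE \<omega> in M. real_cond_exp M (graph_algebra M \<GG>) (\<lambda>\<omega>. h (gr \<omega>)) \<omega> = avg h (graph_of (\<GG> \<omega>))"
    and "(\<lambda>\<omega>. avg h (graph_of (\<GG> \<omega>))) \<in> borel_measurable M"
proof -
  have \<phi>m: "avg h \<in> borel_measurable graph_space" using avg_measurable[OF h] .
  have GAm: "(\<lambda>\<omega>. avg h (graph_of (\<GG> \<omega>))) \<in> borel_measurable (graph_algebra M \<GG>)"
  proof -
    have "(\<lambda>\<omega>. graph_of (\<GG> \<omega>)) \<in> graph_algebra M \<GG> \<rightarrow>\<^sub>M graph_space"
      unfolding graph_algebra_def by (rule measurable_vimage_algebra1) (use measurable_space[OF graph_measurable] in auto)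
    from measurable_compose[OF this \<phi>m] show ?thesis .
  qed
  show mM: "(\<lambda>\<omega>. avg h (graph_of (\<GG> \<omega>))) \<in> borel_measurable M"
    using measurable_from_subalg[OF subalg GAm] .
  have avg_b: "0 \<le> avg h (graph_of (\<GG> \<omega>)) \<and> avg h (graph_of (\<GG> \<omega>)) \<le> 1" if "\<omega> \<in> space M" for \<omega>
  proof -
    have "(\<Sum>v\<in>verts (graph_of (\<GG> \<omega>)). h (graph_of (\<GG> \<omega>), v)) \<le> real (card (verts (graph_of (\<GG> \<omega>)))) * 1"
      by (rule sum_bounded_above) (use b in auto)
    then show ?thesis using fin[OF that] n b by (auto simp: avg_finite intro!: divide_nonneg_nonneg sum_nonneg)
  qed
  have hm [measurable]: "(\<lambda>\<omega>. h (gr \<omega>)) \<in> borel_measurable M" using measurable_compose[OF gr_measurable h] .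
  have int1: "integrable M (\<lambda>\<omega>. h (gr \<omega>))"
    by (rule integrable_const_bound[of _ 1]) (use b in auto)
  have int2: "integrable M (\<lambda>\<omega>. avg h (graph_of (\<GG> \<omega>)))"
    by (rule integrable_const_bound[of _ 1]) (use avg_b mM in auto)
  show "AE \<omega> in M. real_cond_exp M (graph_algebra M \<GG>) (\<lambda>\<omega>. h (gr \<omega>)) \<omega> = avg h (graph_of (\<GG> \<omega>))"
  proof (rule GA.real_cond_exp_charact[OF _ int1 int2 GAm])
    fix A assume "A \<in> sets (graph_algebra M \<GG>)"
    moreover have "(\<lambda>\<omega>. graph_of (\<GG> \<omega>)) \<in> space M \<rightarrow> space graph_space" using measurable_space[OF graph_measurable] by auto
    note S = sets_vimage_algebra2[OF this]
    ultimately obtain B where B: "A = (\<lambda>\<omega>. graph_of (\<GG> \<omega>)) -` B \<inter> space M" and Bm [measurable]: "B \<in> sets graph_space"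
      unfolding graph_algebra_def S by auto
    have Am [measurable]: "A \<in> sets M" unfolding B by measurable
    let ?f = "\<lambda>g. ennreal (indicator B (fst g) * h g)"
    have fm: "?f \<in> borel_measurable rooted_graph_space"
      using rooted_components(1) by measurable
    have "(\<integral>\<^sup>+\<omega>. ennreal (indicator A \<omega> * h (gr \<omega>)) \<partial>M) = (\<integral>\<^sup>+\<omega>. ?f (gr \<omega>) \<partial>M)"
      by (rule nn_integral_cong) (auto simp: B indicator_def)
    also have "\<dots> = (\<integral>\<^sup>+\<omega>. (\<Sum>v\<in>verts (graph_of (\<GG> \<omega>)). ?f (graph_of (\<GG> \<omega>), v)) * ennreal (1 / real n) \<partial>M)"
      by (rule reroot_graph[OF fm])
    also have "\<dots> = (\<integral>\<^sup>+\<omega>. ennreal (indicator A \<omega> * avg h (graph_of (\<GG> \<omega>))) \<partial>M)"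
    proof (rule nn_integral_cong)
      fix \<omega> assume \<omega>: "\<omega> \<in> space M"
      have "(\<Sum>v\<in>verts (graph_of (\<GG> \<omega>)). ?f (graph_of (\<GG> \<omega>), v)) = ennreal (\<Sum>v\<in>verts (graph_of (\<GG> \<omega>)). indicator B (graph_of (\<GG> \<omega>)) * h (graph_of (\<GG> \<omega>), v))"
        by (subst sum_ennreal) (use b in auto)
      then show "(\<Sum>v\<in>verts (graph_of (\<GG> \<omega>)). ?f (graph_of (\<GG> \<omega>), v)) * ennreal (1 / real n) = ennreal (indicator A \<omega> * avg h (graph_of (\<GG> \<omega>)))"
        using \<omega> b fin[OF \<omega>] by (simp add: ennreal_mult[symmetric] sum_nonneg avg_finite sum_distrib_left[symmetric] B indicator_def)
    qed
    finally have eq: "(\<integral>\<^sup>+\<omega>. ennreal (indicator A \<omega> * h (gr \<omega>)) \<partial>M) = (\<integral>\<^sup>+\<omega>. ennreal (indicator A \<omega> * avg h (graph_of (\<GG> \<omega>))) \<partial>M)" .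
    have "(LINT \<omega>:A|M. h (gr \<omega>)) = enn2real (\<integral>\<^sup>+\<omega>. ennreal (indicator A \<omega> * h (gr \<omega>)) \<partial>M)"
      unfolding set_lebesgue_integral_def
      by (subst integral_eq_nn_integral) (use b in auto)
    also have "\<dots> = (LINT \<omega>:A|M. avg h (graph_of (\<GG> \<omega>)))"
      unfolding set_lebesgue_integral_def eq
      by (subst integral_eq_nn_integral) (use avg_b mM in \<open>auto intro!: AE_I2\<close>)
    finally show "(LINT \<omega>:A|M. h (gr \<omega>)) = (LINT \<omega>:A|M. avg h (graph_of (\<GG> \<omega>)))" .
  qed
qed

end

section \<open>Percolation probabilities and the second moment\<close>

definition ext0 :: "'e set \<Rightarrow> ('e \<Rightarrow> real) \<Rightarrow> 'e \<Rightarrow> real" where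
  "ext0 J x e = (if e \<in> J then x e else 0)"

text \<open>
  The quenched version of \<open>\<theta>\<^sub>j(p)\<close>, a function of the rooted graph alone.
\<close>
definition perc :: "nat \<Rightarrow> real \<Rightarrow> nat graph \<times> nat \<Rightarrow> real" where
  "perc j p = (\<lambda>(G, v). measure weight_law {w. big_cluster j p (G, v, w)})"

lemma measurable_fixed_graph:
  assumes "rooted_graph (G, v)" "w \<in> N \<rightarrow>\<^sub>M weight_space"
  shows "(\<lambda>x. (G, v, w x)) \<in> N \<rightarrow>\<^sub>M RW"
  by (rule measurable_RWI) (use assms in \<open>auto simp: space_graph_space rooted_graph_def\<close>)

lemma near_edges_all: "simple_graph G \<Longrightarrow> near_edges r G v \<subseteq> all_edges"
  by (auto simp: near_edges_def all_edges_def simple_graph_def)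

lemma big_cluster_local:
  assumes "rooted_graph (G, v)" "\<And>e. e \<in> near_edges (real j) G v \<Longrightarrow> w e = w' e"
  shows "big_cluster j p (G, v, w) \<longleftrightarrow> big_cluster j p (G, v, w')"
  unfolding big_cluster_def fst_conv snd_conv
  by (rule has_card_cluster_local) (use assms in \<open>auto simp: rooted_graph_def\<close>)

lemma measurable_ext0:
  assumes "sets N = sets (borel :: real measure)"
  shows "ext0 J \<in> (\<Pi>\<^sub>M e\<in>J. N) \<rightarrow>\<^sub>M weight_space"
proof (rule measurable_weight_spaceI)
  fix e
  show "(\<lambda>x. ext0 J x e) \<in> borel_measurable (\<Pi>\<^sub>M e\<in>J. N)"
  proof (cases "e \<in> J")
    case True
    then have "(\<lambda>x. x e) \<in> (\<Pi>\<^sub>M e\<in>J. N) \<rightarrow>\<^sub>M N" by (rule measurable_component_singleton)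
    then have "(\<lambda>x. x e) \<in> borel_measurable (\<Pi>\<^sub>M e\<in>J. N)" using measurable_cong_sets[OF refl assms] by blast
    then show ?thesis using True by (simp add: ext0_def)
  qed (simp add: ext0_def)
qed

text \<open>
  The event depends on finitely many independent uniform weights only, so its probability is that of an event in the
  finite product, whatever labels \<open>f\<close> the weights carry.
\<close>
lemma perc_PiM:
  assumes G: "rooted_graph (G, v)" and f: "inj_on f (near_edges (real j) G v)" "f \<in> near_edges (real j) G v \<rightarrow> all_edges"
    and Q: "\<And>w. Q w \<longleftrightarrow> big_cluster j p (G, v, \<lambda>e. w (f e))" and Qm: "{w. Q w} \<in> sets weight_space"
  shows "measure weight_law {w. Q w} =
    measure (\<Pi>\<^sub>M e\<in>near_edges (real j) G v. U01) {x \<in> space (\<Pi>\<^sub>M e\<in>near_edges (real j) G v. U01). big_cluster j p (G, v, ext0 (near_edges (real j) G v) x)}"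
proof -
  let ?J = "near_edges (real j) G v"
  let ?P = "\<Pi>\<^sub>M e\<in>all_edges. U01" and ?PJ = "\<Pi>\<^sub>M e\<in>?J. U01"
  let ?B = "{x \<in> space ?PJ. big_cluster j p (G, v, ext0 ?J x)}"
  have "(\<lambda>x. (G, v, ext0 ?J x)) \<in> ?PJ \<rightarrow>\<^sub>M RW" by (rule measurable_fixed_graph[OF G measurable_ext0]) simp
  from measurable_compose[OF this pred_big_cluster] have B: "?B \<in> sets ?PJ" by (simp add: pred_def)
  let ?T = "\<lambda>\<omega>. \<lambda>e\<in>?J. \<omega> (f e)"
  have T: "?T \<in> ?P \<rightarrow>\<^sub>M ?PJ"
    by (rule measurable_restrict) (use f in \<open>auto intro: measurable_component_singleton\<close>)
  have "measure weight_law {w. Q w} = measure ?P {w \<in> space ?P. Q w}"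
    unfolding weight_law_def by (subst measure_distr[OF measurable_PiM_weight Qm]) (simp add: vimage_def Int_def conj_commute)
  also have "{w \<in> space ?P. Q w} = ?T -` ?B \<inter> space ?P"
  proof -
    have "Q w \<longleftrightarrow> ?T w \<in> ?B" if "w \<in> space ?P" for w
      using measurable_space[OF T that] big_cluster_local[OF G, of j "\<lambda>e. w (f e)" "ext0 ?J (?T w)" p] Q[of w]
      by (auto simp: ext0_def)
    then show ?thesis by auto
  qed
  also have "measure ?P (?T -` ?B \<inter> space ?P) = measure (distr ?P ?PJ ?T) ?B"
    by (rule measure_distr[OF T B, symmetric])
  also have "distr ?P ?PJ ?T = ?PJ" using f by (intro distr_PiM_reindex prob_space_U01)
  finally show ?thesis .
qed

lemma sets_big_cluster:
  assumes "rooted_graph (G, v)" shows "{w. big_cluster j p (G, v, w)} \<in> sets weight_space"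
proof -
  have "(\<lambda>w. (G, v, w)) \<in> weight_space \<rightarrow>\<^sub>M RW" by (rule measurable_fixed_graph[OF assms]) simp
  from measurable_compose[OF this pred_big_cluster] show ?thesis by (simp add: pred_def)
qed

lemma perc_iso:
  assumes G: "rooted_graph (G, \<rho>)" "rooted_graph (G', \<rho>')"
    and iso: "ball_iso R (edges G) \<rho> (edges G') \<rho>' \<phi>" and R: "real j \<le> R"
  shows "perc j p (G, \<rho>) = perc j p (G', \<rho>')"
proof -
  let ?J = "near_edges (real j) G \<rho>"
  have rs: "rooted_simple G \<rho>" "rooted_simple G' \<rho>'" using G by (auto simp: rooted_graph_def rooted_simple_def)
  have JB: "e \<subseteq> ball_set R (edges G) \<rho>" if "e \<in> ?J" for e
    using that ball_set_mono[OF R order_refl[of "edges G"]] by (auto simp: near_edges_def)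
  have inj: "inj_on ((`) \<phi>) ?J"
    using inj_on_image_eq_iff[OF ball_isoD(1)[OF iso] JB JB] by (intro inj_onI) blast
  have im: "(`) \<phi> \<in> ?J \<rightarrow> all_edges"
  proof
    fix e assume e: "e \<in> ?J"
    have "inj_on \<phi> e" using inj_on_subset[OF ball_isoD(1)[OF iso] JB[OF e]] .
    then have "card (\<phi> ` e) = card e" by (rule card_image)
    then show "\<phi> ` e \<in> all_edges" using e rs(1) by (auto simp: all_edges_def near_edges_def rooted_simple_def simple_graph_def)
  qed
  have "big_cluster j p (G', \<rho>', w) \<longleftrightarrow> big_cluster j p (G, \<rho>, \<lambda>e. w (\<phi> ` e))" for w
    unfolding big_cluster_def fst_conv snd_conv
    by (rule has_card_cluster_iso[OF rs iso R, symmetric]) simp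
  from perc_PiM[OF G(1) inj im this sets_big_cluster[OF G(2)]]
  have "perc j p (G', \<rho>') = measure (\<Pi>\<^sub>M e\<in>?J. U01) {x \<in> space (\<Pi>\<^sub>M e\<in>?J. U01). big_cluster j p (G, \<rho>, ext0 ?J x)}"
    by (simp add: perc_def)
  also have "\<dots> = perc j p (G, \<rho>)"
  proof -
    have id: "(\<lambda>e. e) \<in> ?J \<rightarrow> all_edges" using near_edges_all[of G "real j" \<rho>] rs(1) by (auto simp: rooted_simple_def)
    from perc_PiM[OF G(1) _ id refl sets_big_cluster[OF G(1)], of p] show ?thesis by (simp add: perc_def)
  qed
  finally show ?thesis by simp
qed

lemma perc_bounds: "0 \<le> perc j p x" "perc j p x \<le> 1"
  using prob_space.prob_le_1[OF prob_space_weight_law] by (auto simp: perc_def case_prod_beta)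

lemma local_equiv_0:
  assumes "rooted_simple G \<rho>" "rooted_simple G' \<rho>'"
  shows "local_equiv 0 (G, \<rho>, w) (G', \<rho>', w')"
proof -
  have b: "ball_set 0 E v = {v}" for E and v :: 'c by (auto simp: ball_set_def)
  have "{\<rho>} \<notin> edges G" "{\<rho>'} \<notin> edges G'" using assms by (auto simp: rooted_simple_def simple_graph_def)
  then show ?thesis unfolding local_equiv_iff[OF assms] ball_iso_def b
  proof (intro exI[of _ "\<lambda>_. \<rho>'"] conjI ballI impI)
    fix e assume "e \<in> edges G" "e \<subseteq> {\<rho>}"
    then show "\<bar>w e - w' ((\<lambda>_. \<rho>') ` e)\<bar> \<le> 1 / 0" using assms by (auto simp: rooted_simple_def simple_graph_def subset_singleton_iff)
  qed (auto simp: bij_betw_def)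
qed

text \<open>
  \<open>perc j p\<close> is constant on balls of the local distance, because by \<open>perc_iso\<close> it depends on the ball of radius \<open>j\<close> only.  This is
  what makes it a test function for local convergence in probability.
\<close>
lemma perc_continuous: "bounded_local_continuous (perc j p)"
  unfolding bounded_local_continuous_def
proof (intro conjI allI impI)
  show "\<exists>B. \<forall>x. rooted_graph x \<longrightarrow> \<bar>perc j p x\<bar> \<le> B"
  proof (intro exI[of _ 1] allI impI)
    show "\<bar>perc j p x\<bar> \<le> 1" for x using perc_bounds[of j p x] by simp
  qed
  fix x :: "nat graph \<times> nat" and \<epsilon> :: real assume x: "rooted_graph x" and \<epsilon>: "0 < \<epsilon>"
  obtain G \<rho> where xe: "x = (G, \<rho>)" by (cases x)
  show "\<exists>\<delta>>0. \<forall>y. rooted_graph y \<longrightarrow> local_dist_unweighted x y < \<delta> \<longrightarrow> \<bar>perc j p x - perc j p y\<bar> < \<epsilon>"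
  proof (intro exI[of _ "1 / (1 + (real j + 1))"] conjI allI impI)
    fix y :: "nat graph \<times> nat" assume y: "rooted_graph y" and d: "local_dist_unweighted x y < 1 / (1 + (real j + 1))"
    obtain G' \<rho>' where ye: "y = (G', \<rho>')" by (cases y)
    have rs: "rooted_simple G \<rho>" "rooted_simple G' \<rho>'" using x y xe ye by (auto simp: rooted_graph_def rooted_simple_def)
    obtain r where r: "real j + 1 < r" "local_equiv r (G, \<rho>, \<lambda>_. 1) (G', \<rho>', \<lambda>_. 1)"
    proof -
      have "local_dist (G, \<rho>, \<lambda>_. 1) (G', \<rho>', \<lambda>_. 1) < 1 / (1 + (real j + 1))"
        using d by (simp only: local_dist_unweighted_def xe ye prod.case)
      then show thesis by (rule local_dist_less_imp_equiv[OF _ _ local_equiv_0[OF rs]]) (use that in auto)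
    qed
    then obtain \<phi> :: "nat \<Rightarrow> nat" where "ball_iso r (edges G) \<rho> (edges G') \<rho>' \<phi>" unfolding local_equiv_iff[OF rs] by blast
    then have "perc j p x = perc j p y" using perc_iso[of G \<rho> G' \<rho>' r \<phi> j p] x y xe ye r by simp
    then show "\<bar>perc j p x - perc j p y\<bar> < \<epsilon>" using \<epsilon> by simp
  qed simp
qed

lemma ball_set_sym: "u \<in> ball_set r E v \<Longrightarrow> v \<in> ball_set r E u"
proof -
  have "(v, u) \<in> edge_rel E ^^ n" if "(u, v) \<in> edge_rel E ^^ n" for u v n
    using that
  proof (induction n arbitrary: v)
    case (Suc n)
    then obtain y where "(u, y) \<in> edge_rel E ^^ n" "{y, v} \<in> E" unfolding relpow_Suc_edge by blast
    then have "(v, y) \<in> edge_rel E" "(y, u) \<in> edge_rel E ^^ n" using Suc.IH by (auto simp: edge_rel_def insert_commute)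
    then show ?case by (rule relpow_Suc_I2)
  qed simp
  then show "u \<in> ball_set r E v \<Longrightarrow> v \<in> ball_set r E u" by (auto simp: ball_set_def)
qed

lemma ball_set_trans: "x \<in> ball_set r E u \<Longrightarrow> v \<in> ball_set s E x \<Longrightarrow> v \<in> ball_set (r + s) E u"
proof -
  assume "x \<in> ball_set r E u" "v \<in> ball_set s E x"
  then obtain m n where "real m \<le> r" "(u, x) \<in> edge_rel E ^^ m" "real n \<le> s" "(x, v) \<in> edge_rel E ^^ n"
    by (auto simp: ball_set_def)
  then have "(u, v) \<in> edge_rel E ^^ (m + n)" "real (m + n) \<le> r + s" by (auto simp: relpow_add)
  then show "v \<in> ball_set (r + s) E u" by (rule relpow_in_ball_set)
qed

context standard_rooted begin

lemma perc_measurable [measurable]: "perc j p \<in> borel_measurable rooted_graph_space"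
proof -
  let ?f = "\<lambda>x. indicator {x. big_cluster j p x} x :: ennreal"
  have fm: "?f \<in> borel_measurable RW" by measurable
  have "(\<lambda>g. enn2real (\<integral>\<^sup>+w. ?f (fst g, snd g, w) \<partial>weight_law)) \<in> borel_measurable rooted_graph_space"
    using fubini(2)[OF fm] by measurable
  then show ?thesis
  proof (rule measurable_cong[THEN iffD1, rotated])
    fix g assume "g \<in> space rooted_graph_space"
    then have g: "rooted_graph (fst g, snd g)" by (auto simp: space_rooted)
    have "(\<integral>\<^sup>+w. ?f (fst g, snd g, w) \<partial>weight_law) = (\<integral>\<^sup>+w. indicator {w. big_cluster j p (fst g, snd g, w)} w \<partial>weight_law)"
      by (rule nn_integral_cong) (simp add: indicator_def)
    also have "\<dots> = emeasure weight_law {w. big_cluster j p (fst g, snd g, w)}"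
      using sets_big_cluster[OF g] by (intro nn_integral_indicator) simp
    finally show "enn2real (\<integral>\<^sup>+w. ?f (fst g, snd g, w) \<partial>weight_law) = perc j p g"
      by (simp add: perc_def measure_def case_prod_beta)
  qed
qed

lemma perc_expectation: "(\<integral>\<omega>. perc j p (gr \<omega>) \<partial>M) = prob {\<omega> \<in> space M. big_cluster j p (\<GG> \<omega>)}"
proof -
  let ?f = "\<lambda>x. indicator {x. big_cluster j p x} x :: ennreal"
  have fm: "?f \<in> borel_measurable RW" by measurable
  have "emeasure M {\<omega> \<in> space M. big_cluster j p (\<GG> \<omega>)} = (\<integral>\<^sup>+\<omega>. indicator {\<omega> \<in> space M. big_cluster j p (\<GG> \<omega>)} \<omega> \<partial>M)"
    by (rule nn_integral_indicator[symmetric]) measurable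
  also have "\<dots> = (\<integral>\<^sup>+\<omega>. ?f (\<GG> \<omega>) \<partial>M)" by (rule nn_integral_cong) (auto simp: indicator_def)
  also have "\<dots> = (\<integral>\<^sup>+\<omega>. \<integral>\<^sup>+w. ?f (graph_of (\<GG> \<omega>), root_of (\<GG> \<omega>), w) \<partial>weight_law \<partial>M)" by (rule fubini(1)[OF fm])
  also have "\<dots> = (\<integral>\<^sup>+\<omega>. ennreal (perc j p (gr \<omega>)) \<partial>M)"
  proof (rule nn_integral_cong)
    fix \<omega> assume "\<omega> \<in> space M"
    then have g: "rooted_graph (graph_of (\<GG> \<omega>), root_of (\<GG> \<omega>))" by (rule \<GG>_space)
    have "(\<integral>\<^sup>+w. ?f (graph_of (\<GG> \<omega>), root_of (\<GG> \<omega>), w) \<partial>weight_law) = (\<integral>\<^sup>+w. indicator {w. big_cluster j p (graph_of (\<GG> \<omega>), root_of (\<GG> \<omega>), w)} w \<partial>weight_law)"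
      by (rule nn_integral_cong) (simp add: indicator_def)
    also have "\<dots> = emeasure weight_law {w. big_cluster j p (graph_of (\<GG> \<omega>), root_of (\<GG> \<omega>), w)}"
      using sets_big_cluster[OF g] by (intro nn_integral_indicator) simp
    finally show "(\<integral>\<^sup>+w. ?f (graph_of (\<GG> \<omega>), root_of (\<GG> \<omega>), w) \<partial>weight_law) = ennreal (perc j p (gr \<omega>))"
      using finite_measure.emeasure_eq_measure[OF prob_space.finite_measure[OF prob_space_weight_law]] by (simp add: perc_def)
  qed
  finally have eq: "emeasure M {\<omega> \<in> space M. big_cluster j p (\<GG> \<omega>)} = (\<integral>\<^sup>+\<omega>. ennreal (perc j p (gr \<omega>)) \<partial>M)" .
  have "(\<integral>\<omega>. perc j p (gr \<omega>) \<partial>M) = enn2real (\<integral>\<^sup>+\<omega>. ennreal (perc j p (gr \<omega>)) \<partial>M)"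
    using measurable_compose[OF gr_measurable perc_measurable] perc_bounds by (intro integral_eq_nn_integral) auto
  then show ?thesis using eq by (simp add: measure_def)
qed

lemma perc_prob:
  assumes "rooted_graph (G, v)"
  shows "prob {\<omega> \<in> space M. big_cluster j p (G, v, wt \<omega>)} = perc j p (G, v)"
    and "{\<omega> \<in> space M. big_cluster j p (G, v, wt \<omega>)} \<in> events"
proof -
  have "measure weight_law {w. big_cluster j p (G, v, w)} = prob (wt -` {w. big_cluster j p (G, v, w)} \<inter> space M)"
    unfolding distr_wt[symmetric] by (rule measure_distr) (use sets_big_cluster[OF assms] in auto)
  then show "prob {\<omega> \<in> space M. big_cluster j p (G, v, wt \<omega>)} = perc j p (G, v)"
    by (simp add: perc_def vimage_def Int_def conj_commute)
  have "wt -` {w. big_cluster j p (G, v, w)} \<inter> space M \<in> events"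
    using sets_big_cluster[OF assms] by (intro measurable_sets[OF wt_measurable]) auto
  then show "{\<omega> \<in> space M. big_cluster j p (G, v, wt \<omega>)} \<in> events" by (simp add: vimage_def Int_def conj_commute)
qed

text \<open>
  The two events depend on disjoint families of independent weights.
\<close>
lemma big_cluster_indep:
  assumes G: "rooted_graph (G, u)" "rooted_graph (G, v)" and disj: "near_edges (real j) G u \<inter> near_edges (real j) G v = {}"
  shows "prob {\<omega> \<in> space M. big_cluster j p (G, u, wt \<omega>) \<and> big_cluster j p (G, v, wt \<omega>)} = perc j p (G, u) * perc j p (G, v)"
proof -
  let ?J = "\<lambda>v. near_edges (real j) G v"
  let ?P = "\<lambda>v. \<Pi>\<^sub>M e\<in>?J v. (borel :: real measure)"
  let ?B = "\<lambda>v. {x \<in> space (?P v). big_cluster j p (G, v, ext0 (?J v) x)}"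
  let ?T = "\<lambda>v \<omega>. restrict (\<lambda>e. weight_of (\<GG> \<omega>) e) (?J v)"
  have iv: "indep_vars (\<lambda>_. borel) (\<lambda>e \<omega>. weight_of (\<GG> \<omega>) e) all_edges"
    using std by (simp add: standard_extension_rooted_def)
  have sub: "?J v \<subseteq> all_edges" for v using near_edges_all G by (auto simp: rooted_graph_def)
  have B: "?B v \<in> sets (?P v)" if "rooted_graph (G, v)" for v
  proof -
    have "(\<lambda>x. (G, v, ext0 (?J v) x)) \<in> ?P v \<rightarrow>\<^sub>M RW" by (rule measurable_fixed_graph[OF that measurable_ext0]) simp
    from measurable_compose[OF this pred_big_cluster] show ?thesis by (simp add: pred_def)
  qed
  have T: "big_cluster j p (G, v, wt \<omega>) \<longleftrightarrow> ?T v \<omega> \<in> ?B v" if "rooted_graph (G, v)" for v \<omega>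
    using big_cluster_local[OF that, of j "wt \<omega>" "ext0 (?J v) (?T v \<omega>)" p] by (auto simp: ext0_def space_PiM)
  have "prob ((\<lambda>\<omega>. (?T u \<omega>, ?T v \<omega>)) -` (?B u \<times> ?B v) \<inter> space M) = prob (?T u -` ?B u \<inter> space M) * prob (?T v -` ?B v \<inter> space M)"
    by (rule indep_varD[OF indep_var_restrict[OF iv disj sub sub] B[OF G(1)] B[OF G(2)]])
  moreover have "(\<lambda>\<omega>. (?T u \<omega>, ?T v \<omega>)) -` (?B u \<times> ?B v) \<inter> space M =
      {\<omega> \<in> space M. big_cluster j p (G, u, wt \<omega>) \<and> big_cluster j p (G, v, wt \<omega>)}"
    using T[OF G(1)] T[OF G(2)] by auto
  moreover have "?T v -` ?B v \<inter> space M = {\<omega> \<in> space M. big_cluster j p (G, v, wt \<omega>)}" if "rooted_graph (G, v)" for v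
    using T[OF that] by auto
  ultimately show ?thesis using perc_prob(1) G by simp
qed

text \<open>
  The covariance of the events at \<open>u\<close> and \<open>v\<close> vanishes if the balls of radius \<open>j\<close> around \<open>u\<close> and \<open>v\<close> have no
  common edge, in particular if \<open>v\<close> has distance more than \<open>2 * j\<close> from \<open>u\<close>.  So the variance is at most the number of pairs at
  distance at most \<open>2 * j\<close>.
\<close>
lemma count_chebyshev:
  fixes G :: "nat graph"
  assumes G: "simple_graph G" "locally_finite_graph G" "finite (verts G)" and c: "0 < c"
    and X_def: "X = (\<lambda>\<omega>. real (card {v \<in> verts G. big_cluster j p (G, v, wt \<omega>)}) - (\<Sum>v\<in>verts G. perc j p (G, v)))"
  shows "prob {\<omega> \<in> space M. c \<le> \<bar>X \<omega>\<bar>} \<le>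
    (\<Sum>u\<in>verts G. real (card (verts G \<inter> ball_set (2 * real j) (edges G) u))) / c\<^sup>2"
    and "X \<in> borel_measurable M"
proof -
  let ?V = "verts G"
  have rg: "rooted_graph (G, v)" if "v \<in> ?V" for v using G that by (simp add: rooted_graph_def)
  let ?A = "\<lambda>v. {\<omega> \<in> space M. big_cluster j p (G, v, wt \<omega>)}"
  have A [measurable]: "?A v \<in> events" if "v \<in> ?V" for v using perc_prob(2)[OF rg[OF that]] .
  let ?q = "\<lambda>v. perc j p (G, v)"
  let ?Y = "\<lambda>v \<omega>. indicator (?A v) \<omega> - ?q v :: real"
  have X: "X \<omega> = (\<Sum>v\<in>?V. ?Y v \<omega>)" if "\<omega> \<in> space M" for \<omega>
  proof -
    have "(\<Sum>v\<in>?V. indicator (?A v) \<omega> :: real) = (\<Sum>v\<in>?V. if big_cluster j p (G, v, wt \<omega>) then 1 else 0)"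
      using that by (intro sum.cong) (auto simp: indicator_def)
    also have "\<dots> = real (card {v \<in> ?V. big_cluster j p (G, v, wt \<omega>)})" using G(3) by (simp flip: sum.inter_filter)
    finally show ?thesis by (simp add: X_def sum_subtractf)
  qed
  have Ym: "?Y v \<in> borel_measurable M" if "v \<in> ?V" for v using A[OF that] by measurable
  show Xm: "X \<in> borel_measurable M"
    by (rule measurable_cong[THEN iffD2, OF X]) (auto intro: Ym)
  have Yb: "\<bar>?Y v \<omega>\<bar> \<le> 1" for v \<omega> using perc_bounds[of j p "(G, v)"] by (auto simp: indicator_def)
  have Yint: "integrable M (\<lambda>\<omega>. ?Y u \<omega> * ?Y v \<omega>)" if "u \<in> ?V" "v \<in> ?V" for u v
    by (rule integrable_const_bound[of _ 1])
       (use Ym[OF that(1)] Ym[OF that(2)] Yb in \<open>auto simp: abs_mult intro!: mult_le_one\<close>)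
  let ?N = "\<lambda>u. ?V \<inter> ball_set (2 * real j) (edges G) u"
  have cov: "(\<integral>\<omega>. ?Y u \<omega> * ?Y v \<omega> \<partial>M) \<le> (if v \<in> ?N u then 1 else 0)" if uv: "u \<in> ?V" "v \<in> ?V" for u v
  proof (cases "v \<in> ?N u")
    case True
    have "(\<integral>\<omega>. ?Y u \<omega> * ?Y v \<omega> \<partial>M) \<le> (\<integral>\<omega>. 1 \<partial>M)"
    proof (rule integral_mono[OF Yint[OF uv]])
      fix \<omega>
      have "\<bar>?Y u \<omega> * ?Y v \<omega>\<bar> \<le> 1" unfolding abs_mult by (rule mult_le_one) (use Yb in auto)
      then show "?Y u \<omega> * ?Y v \<omega> \<le> 1" by simp
    qed simp
    then show ?thesis using True by (simp add: prob_space)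
  next
    case False
    have "near_edges (real j) G u \<inter> near_edges (real j) G v = {}"
    proof (rule ccontr)
      assume "near_edges (real j) G u \<inter> near_edges (real j) G v \<noteq> {}"
      then obtain e where e: "e \<in> edges G" "e \<subseteq> ball_set (real j) (edges G) u" "e \<subseteq> ball_set (real j) (edges G) v"
        by (auto simp: near_edges_def)
      then obtain x where "x \<in> e" using G(1) by (auto simp: simple_graph_def) (metis card.empty ex_in_conv zero_neq_numeral)
      then have "v \<in> ball_set (real j + real j) (edges G) u" using e ball_set_trans ball_set_sym by (metis subsetD)
      then show False using False uv by simp
    qed
    note ind = big_cluster_indep[OF rg[OF uv(1)] rg[OF uv(2)] this, of p]
    have AA: "?A u \<inter> ?A v = {\<omega> \<in> space M. big_cluster j p (G, u, wt \<omega>) \<and> big_cluster j p (G, v, wt \<omega>)}" by auto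
    have "(\<integral>\<omega>. ?Y u \<omega> * ?Y v \<omega> \<partial>M) =
        (\<integral>\<omega>. indicator (?A u \<inter> ?A v) \<omega> - ?q v * indicator (?A u) \<omega> - ?q u * indicator (?A v) \<omega> + ?q u * ?q v \<partial>M)"
      by (rule Bochner_Integration.integral_cong) (auto simp: indicator_def algebra_simps)
    also have "\<dots> = prob (?A u \<inter> ?A v) - ?q v * prob (?A u) - ?q u * prob (?A v) + ?q u * ?q v"
    proof -
      have i: "integrable M (indicator S :: _ \<Rightarrow> real)" if "S \<in> events" for S
        using that by (simp add: emeasure_eq_measure)
      have AB: "?A u \<inter> ?A v \<in> events" using A[OF uv(1)] A[OF uv(2)] by (rule sets.Int)
      show ?thesis
        using A[OF uv(1)] A[OF uv(2)] AB i[OF A[OF uv(1)]] i[OF A[OF uv(2)]] i[OF AB] by (simp add: prob_space del: Int_iff)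
    qed
    also have "\<dots> = 0" unfolding AA ind perc_prob(1)[OF rg[OF uv(1)]] perc_prob(1)[OF rg[OF uv(2)]] by (simp add: algebra_simps)
    finally show ?thesis using False by simp
  qed
  have sq: "(X \<omega>)\<^sup>2 = (\<Sum>u\<in>?V. \<Sum>v\<in>?V. ?Y u \<omega> * ?Y v \<omega>)" if "\<omega> \<in> space M" for \<omega>
    unfolding X[OF that] power2_eq_square by (rule sum_product)
  have sqint: "integrable M (\<lambda>\<omega>. \<Sum>u\<in>?V. \<Sum>v\<in>?V. ?Y u \<omega> * ?Y v \<omega>)"
    by (intro Bochner_Integration.integrable_sum Yint)
  have Xint: "integrable M (\<lambda>\<omega>. (X \<omega>)\<^sup>2)" using sqint sq by (subst Bochner_Integration.integrable_cong[OF refl sq]) auto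
  have "(\<integral>\<omega>. (X \<omega>)\<^sup>2 \<partial>M) = (\<integral>\<omega>. (\<Sum>u\<in>?V. \<Sum>v\<in>?V. ?Y u \<omega> * ?Y v \<omega>) \<partial>M)"
    by (rule Bochner_Integration.integral_cong[OF refl sq])
  also have "\<dots> = (\<Sum>u\<in>?V. \<integral>\<omega>. (\<Sum>v\<in>?V. ?Y u \<omega> * ?Y v \<omega>) \<partial>M)"
    by (rule Bochner_Integration.integral_sum) (intro Bochner_Integration.integrable_sum Yint)
  also have "\<dots> = (\<Sum>u\<in>?V. \<Sum>v\<in>?V. \<integral>\<omega>. ?Y u \<omega> * ?Y v \<omega> \<partial>M)"
    by (intro sum.cong refl Bochner_Integration.integral_sum Yint)
  also have "\<dots> \<le> (\<Sum>u\<in>?V. \<Sum>v\<in>?V. if v \<in> ?N u then 1 else 0)" by (intro sum_mono cov)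
  also have "\<dots> = (\<Sum>u\<in>?V. real (card (?N u)))"
    using G(3) by (intro sum.cong refl) (simp flip: sum.inter_restrict add: Int_def)
  finally have E: "(\<integral>\<omega>. (X \<omega>)\<^sup>2 \<partial>M) \<le> (\<Sum>u\<in>?V. real (card (?N u)))" .
  have "{\<omega> \<in> space M. c \<le> \<bar>X \<omega>\<bar>} = {\<omega> \<in> space M. c\<^sup>2 \<le> (X \<omega>)\<^sup>2}"
    using c by (auto simp: abs_le_square_iff[symmetric])
  then have "prob {\<omega> \<in> space M. c \<le> \<bar>X \<omega>\<bar>} = prob {\<omega> \<in> space M. c\<^sup>2 \<le> (X \<omega>)\<^sup>2}" by simp
  also have "\<dots> \<le> (\<integral>\<omega>. (X \<omega>)\<^sup>2 \<partial>M) / c\<^sup>2"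
    using Xint c by (intro integral_Markov_inequality_measure[where A="space M"]) auto
  also have "\<dots> \<le> (\<Sum>u\<in>?V. real (card (?N u))) / c\<^sup>2" using E by (intro divide_right_mono) auto
  finally show "prob {\<omega> \<in> space M. c \<le> \<bar>X \<omega>\<bar>} \<le> (\<Sum>u\<in>?V. real (card (?N u))) / c\<^sup>2" .
qed

end

section \<open>Averaging over a uniform root\<close>

text \<open>
  Both the variance bound and mass transport require that the ball around a typical vertex has at most \<open>D\<close> vertices.
\<close>
definition big_ball :: "nat \<Rightarrow> real \<Rightarrow> nat rwgraph \<Rightarrow> bool" where
  "big_ball D r x \<longleftrightarrow> has_card (Suc D) (ball_set r (edges (graph_of x)) (root_of x))"

lemma pred_big_ball [measurable]: "Measurable.pred RW (big_ball D r)"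
  unfolding big_ball_def[abs_def] by (rule pred_has_card) measurable

lemma pred_near:
  assumes P: "Measurable.pred RW P"
  shows "Measurable.pred RW (\<lambda>x. \<exists>u\<in>ball_set r (edges (graph_of x)) (root_of x). P (graph_of x, u, weight_of x))"
proof (rule pred_RWI)
  note [measurable] = pred_reroot[OF P]
  show "Measurable.pred RW (\<lambda>x. \<exists>u. u \<in> ball_set r (edges (graph_of x)) (root_of x) \<and>
      (u \<in> verts (graph_of x) \<and> P (graph_of x, u, weight_of x)))" by measurable
  fix x assume "x \<in> space RW"
  then have "ball_set r (edges (graph_of x)) (root_of x) \<subseteq> verts (graph_of x)"
    by (intro ball_set_verts) (auto simp: space_RW rooted_graph_def)
  then show "(\<exists>u\<in>ball_set r (edges (graph_of x)) (root_of x). P (graph_of x, u, weight_of x)) \<longleftrightarrow> (\<exists>u. u \<in> ball_set r (edges (graph_of x)) (root_of x) \<and>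
      (u \<in> verts (graph_of x) \<and> P (graph_of x, u, weight_of x)))" by blast
qed

definition separated_pairs :: "nat \<Rightarrow> real \<Rightarrow> nat rwgraph \<Rightarrow> (nat \<times> nat) set" where
  "separated_pairs j p x = {(u, v). u \<in> verts (graph_of x) \<and> v \<in> verts (graph_of x) \<and>
      card (cluster x u p) \<ge> j \<and> card (cluster x v p) \<ge> j \<and> cluster x u p \<inter> cluster x v p = {}}"

text \<open>
  A cluster of at least \<open>j\<close> vertices that a tree of \<open>l\<close> vertices might swallow.
\<close>
definition intermediate :: "nat \<Rightarrow> nat \<Rightarrow> real \<Rightarrow> nat rwgraph \<Rightarrow> bool" where
  "intermediate j l p x \<longleftrightarrow> big_cluster j p x \<and> \<not> big_cluster (Suc l) p x"

lemma pred_intermediate [measurable]: "Measurable.pred RW (intermediate j l p)"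
  unfolding intermediate_def[abs_def] by measurable

lemma cluster_sym_disjoint:
  assumes "v \<notin> cluster (G, \<rho>, w) u p" "u \<in> verts G" "v \<in> verts G"
  shows "cluster (G, \<rho>, w) u p \<inter> cluster (G, \<rho>, w) v p = {}"
proof (rule ccontr)
  assume "\<not> ?thesis"
  then obtain x where "(u, x) \<in> (edge_rel (low_edges G w p))\<^sup>*" "(v, x) \<in> (edge_rel (low_edges G w p))\<^sup>*"
    by (auto simp: cluster_eq)
  then have "(u, v) \<in> (edge_rel (low_edges G w p))\<^sup>*" using edge_rel_rtrancl_sym by (meson rtrancl_trans)
  then show False using assms by (auto simp: cluster_eq)
qed

context standard_finite begin

lemma pred_M: "Measurable.pred RW P \<Longrightarrow> {\<omega> \<in> space M. P (\<GG> \<omega>)} \<in> events"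
  using measurable_compose[OF \<GG>_measurable, of P "count_space UNIV"] by (simp add: pred_def)

text \<open>
  Given the graph, \<open>count_chebyshev\<close> bounds the deviation by the number of pairs at distance at most \<open>2 * j\<close>.  This
  number is at most \<open>n * D\<close> up to the contribution of the vertices whose ball has more than \<open>D\<close> vertices, and their
  expected proportion is the probability that the ball around the root is that large.
\<close>
lemma concentration_bound:
  assumes \<epsilon>: "0 < \<epsilon>"
  shows "prob {\<omega> \<in> space M. \<epsilon> \<le> \<bar>real (reroot_count (big_cluster j p) (\<GG> \<omega>)) / real n - avg (perc j p) (graph_of (\<GG> \<omega>))\<bar>}
    \<le> (real D / real n + prob {\<omega> \<in> space M. big_ball D (2 * real j) (\<GG> \<omega>)}) / \<epsilon>\<^sup>2"
proof -
  let ?P = "big_cluster j p"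
  let ?S = "\<lambda>x. \<epsilon> \<le> \<bar>real (reroot_count ?P x) / real n - avg (perc j p) (graph_of x)\<bar>"
  let ?b = "\<lambda>x. (real D / real n + real (reroot_count (big_ball D (2 * real j)) x) / real n) / \<epsilon>\<^sup>2"
  have avgm: "(\<lambda>x. avg (perc j p) (graph_of x)) \<in> borel_measurable RW"
    using measurable_compose[OF RW_components(1) avg_measurable[OF perc_measurable]] .
  have Sm: "Measurable.pred RW ?S"
    using avgm measurable_real_reroot_count[OF pred_big_cluster[of j p]] by measurable
  let ?f = "\<lambda>x. indicator {x. ?S x} x :: ennreal"
  have fm: "?f \<in> borel_measurable RW" using Sm by measurable
  have Se: "{\<omega> \<in> space M. ?S (\<GG> \<omega>)} \<in> events" by (rule pred_M[OF Sm])
  note bigm = measurable_real_reroot_count[OF pred_big_ball[of D "2 * real j"]]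
  have bm: "(\<lambda>\<omega>. ?b (\<GG> \<omega>)) \<in> borel_measurable M"
    using measurable_compose[OF \<GG>_measurable bigm] by measurable
  have bound: "(\<integral>\<^sup>+w. ?f (graph_of (\<GG> \<omega>), root_of (\<GG> \<omega>), w) \<partial>weight_law) \<le> ennreal (?b (\<GG> \<omega>))" if \<omega>: "\<omega> \<in> space M" for \<omega>
  proof -
    let ?G = "graph_of (\<GG> \<omega>)" and ?o = "root_of (\<GG> \<omega>)"
    let ?V = "verts ?G"
    have G: "simple_graph ?G" "locally_finite_graph ?G" "finite ?V" "card ?V = n" and rg: "rooted_graph (?G, ?o)"
      using \<GG>_space[OF \<omega>] fin[OF \<omega>] by (auto simp: rooted_graph_def)
    let ?X = "\<lambda>\<omega>'. real (card {v \<in> ?V. ?P (?G, v, wt \<omega>')}) - (\<Sum>v\<in>?V. perc j p (?G, v))"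
    have c: "0 < \<epsilon> * real n" using \<epsilon> n by simp
    have S: "?S (?G, ?o, w) \<longleftrightarrow> \<epsilon> * real n \<le> \<bar>real (card {v \<in> ?V. ?P (?G, v, w)}) - (\<Sum>v\<in>?V. perc j p (?G, v))\<bar>" for w
    proof -
      have eq: "real (reroot_count ?P (?G, ?o, w)) / real n - avg (perc j p) ?G =
          (real (card {v \<in> ?V. ?P (?G, v, w)}) - (\<Sum>v\<in>?V. perc j p (?G, v))) / real n"
        by (simp add: reroot_count_def avg_finite[OF G(3)] diff_divide_distrib)
      show ?thesis unfolding fst_conv eq abs_divide using n by (simp add: pos_le_divide_eq)
    qed
    have "(\<lambda>w. (?G, ?o, w)) \<in> weight_space \<rightarrow>\<^sub>M RW" by (rule measurable_fixed_graph[OF rg]) simp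
    from measurable_compose[OF this Sm] have SW: "{w. ?S (?G, ?o, w)} \<in> sets weight_space" by (simp add: pred_def)
    have "(\<integral>\<^sup>+w. ?f (?G, ?o, w) \<partial>weight_law) = (\<integral>\<^sup>+w. indicator {w. ?S (?G, ?o, w)} w \<partial>weight_law)"
      by (rule nn_integral_cong) (simp add: indicator_def)
    also have "\<dots> = emeasure weight_law {w. ?S (?G, ?o, w)}" using SW by (intro nn_integral_indicator) simp
    also have "\<dots> = emeasure M (wt -` {w. ?S (?G, ?o, w)} \<inter> space M)"
      unfolding distr_wt[symmetric] by (rule emeasure_distr[OF wt_measurable SW])
    also have "wt -` {w. ?S (?G, ?o, w)} \<inter> space M = {\<omega>' \<in> space M. \<epsilon> * real n \<le> \<bar>?X \<omega>'\<bar>}"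
      unfolding S by auto
    also have "emeasure M \<dots> \<le> ennreal ((\<Sum>u\<in>?V. real (card (?V \<inter> ball_set (2 * real j) (edges ?G) u))) / (\<epsilon> * real n)\<^sup>2)"
      unfolding emeasure_eq_measure by (rule ennreal_leI) (rule count_chebyshev(1)[OF G(1-3) c refl])
    also have "\<dots> \<le> ennreal (?b (\<GG> \<omega>))"
    proof (rule ennreal_leI)
      let ?B = "{u \<in> ?V. has_card (Suc D) (ball_set (2 * real j) (edges ?G) u)}"
      have "(\<Sum>u\<in>?V. real (card (?V \<inter> ball_set (2 * real j) (edges ?G) u))) \<le> (\<Sum>u\<in>?V. real D + (if u \<in> ?B then real n else 0))"
      proof (rule sum_mono)
        fix u assume u: "u \<in> ?V"
        have "card (?V \<inter> ball_set (2 * real j) (edges ?G) u) \<le> n" using card_mono[OF G(3), of "?V \<inter> ball_set (2 * real j) (edges ?G) u"] G(4) by auto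
        moreover have "card (?V \<inter> ball_set (2 * real j) (edges ?G) u) \<le> D" if "u \<notin> ?B"
        proof -
          have "finite (ball_set (2 * real j) (edges ?G) u)" "card (ball_set (2 * real j) (edges ?G) u) \<le> D"
            using that u by (auto simp: has_card_iff)
          then show ?thesis using card_mono[of "ball_set (2 * real j) (edges ?G) u" "?V \<inter> ball_set (2 * real j) (edges ?G) u"] by auto
        qed
        ultimately show "real (card (?V \<inter> ball_set (2 * real j) (edges ?G) u)) \<le> real D + (if u \<in> ?B then real n else 0)"
          by auto
      qed
      also have "\<dots> = real n * (real D + real (card ?B))"
        using G(3,4) by (simp add: sum.distrib sum.If_cases Int_def algebra_simps)
      finally have "(\<Sum>u\<in>?V. real (card (?V \<inter> ball_set (2 * real j) (edges ?G) u))) / (\<epsilon> * real n)\<^sup>2 \<le> real n * (real D + real (card ?B)) / (\<epsilon> * real n)\<^sup>2"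
        by (rule divide_right_mono) simp
      also have "\<dots> = ?b (\<GG> \<omega>)" using n \<epsilon> by (simp add: reroot_count_def big_ball_def power2_eq_square field_simps)
      finally show "(\<Sum>u\<in>?V. real (card (?V \<inter> ball_set (2 * real j) (edges ?G) u))) / (\<epsilon> * real n)\<^sup>2 \<le> ?b (\<GG> \<omega>)" .
    qed
    finally show ?thesis .
  qed
  note bint = reroot_prob[OF pred_big_ball[of D "2 * real j"]]
  have "emeasure M {\<omega> \<in> space M. ?S (\<GG> \<omega>)} = (\<integral>\<^sup>+\<omega>. indicator {\<omega> \<in> space M. ?S (\<GG> \<omega>)} \<omega> \<partial>M)"
    by (rule nn_integral_indicator[symmetric, OF Se])
  also have "\<dots> = (\<integral>\<^sup>+\<omega>. ?f (\<GG> \<omega>) \<partial>M)" by (rule nn_integral_cong) (auto simp: indicator_def)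
  also have "\<dots> = (\<integral>\<^sup>+\<omega>. \<integral>\<^sup>+w. ?f (graph_of (\<GG> \<omega>), root_of (\<GG> \<omega>), w) \<partial>weight_law \<partial>M)" by (rule fubini(1)[OF fm])
  also have "\<dots> \<le> (\<integral>\<^sup>+\<omega>. ennreal (?b (\<GG> \<omega>)) \<partial>M)" by (rule nn_integral_mono) (rule bound)
  also have "\<dots> = ennreal (\<integral>\<omega>. ?b (\<GG> \<omega>) \<partial>M)"
    using bint(1) by (intro nn_integral_eq_integral) auto
  also have "(\<integral>\<omega>. ?b (\<GG> \<omega>) \<partial>M) = (real D / real n + prob {\<omega> \<in> space M. big_ball D (2 * real j) (\<GG> \<omega>)}) / \<epsilon>\<^sup>2"
    using bint by (simp add: prob_space)
  finally show ?thesis unfolding emeasure_eq_measure by (subst (asm) ennreal_le_iff) (auto intro!: divide_nonneg_nonneg add_nonneg_nonneg)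
qed

text \<open>
  Count the pairs \<open>(v, u)\<close> at distance at most \<open>r\<close> where \<open>P\<close> holds at \<open>u\<close>.  If the ball of
  radius \<open>2 * r\<close> around \<open>v\<close> has at most \<open>D\<close> vertices, so has the ball of radius \<open>r\<close> around \<open>u\<close>; hence every
  \<open>u\<close> is charged by at most \<open>D\<close> such \<open>v\<close>.
\<close>
lemma mass_transport:
  assumes P: "Measurable.pred RW P"
  shows "prob {\<omega> \<in> space M. \<exists>u\<in>ball_set r (edges (graph_of (\<GG> \<omega>))) (root_of (\<GG> \<omega>)). P (graph_of (\<GG> \<omega>), u, weight_of (\<GG> \<omega>))}
    \<le> prob {\<omega> \<in> space M. big_ball D (2 * r) (\<GG> \<omega>)} + real D * prob {\<omega> \<in> space M. P (\<GG> \<omega>)}"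
    (is "prob ?E \<le> _")
    and "{\<omega> \<in> space M. \<exists>u\<in>ball_set r (edges (graph_of (\<GG> \<omega>))) (root_of (\<GG> \<omega>)). P (graph_of (\<GG> \<omega>), u, weight_of (\<GG> \<omega>))} \<in> events"
proof -
  let ?N = "\<lambda>x. \<exists>u\<in>ball_set r (edges (graph_of x)) (root_of x). P (graph_of x, u, weight_of x)"
  have Nm: "Measurable.pred RW ?N" by (rule pred_near[OF P])
  show Ee: "?E \<in> events" by (rule pred_M[OF Nm])
  let ?S = "\<lambda>x. ?N x \<and> \<not> big_ball D (2 * r) x"
  have Sm: "Measurable.pred RW ?S" using Nm by measurable
  have count: "real (reroot_count ?S (\<GG> \<omega>)) \<le> real D * real (reroot_count P (\<GG> \<omega>))" if \<omega>: "\<omega> \<in> space M" for \<omega>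
  proof -
    let ?G = "graph_of (\<GG> \<omega>)" and ?w = "weight_of (\<GG> \<omega>)"
    let ?B = "\<lambda>v. ball_set r (edges ?G) v"
    have G: "simple_graph ?G" "finite (verts ?G)" using \<GG>_space[OF \<omega>] fin[OF \<omega>] by (auto simp: rooted_graph_def)
    let ?U = "{u \<in> verts ?G. P (?G, u, ?w) \<and> card (?B u) \<le> D}"
    have finB: "finite (?B v)" if "v \<in> verts ?G" for v
      using ball_set_verts[OF G(1) that order_refl] G(2) finite_subset by blast
    have "{v \<in> verts ?G. ?S (?G, v, ?w)} \<subseteq> (\<Union>u\<in>?U. ?B u)"
    proof
      fix v assume "v \<in> {v \<in> verts ?G. ?S (?G, v, ?w)}"
      then have v: "v \<in> verts ?G" and S: "?S (?G, v, ?w)" by auto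
      obtain u where u: "u \<in> ?B v" "P (?G, u, ?w)" using S unfolding fst_conv snd_conv by blast
      have nb: "\<not> has_card (Suc D) (ball_set (2 * r) (edges ?G) v)" using S by (simp add: big_ball_def)
      have uV: "u \<in> verts ?G" using ball_set_verts[OF G(1) v order_refl] u(1) by blast
      have "?B u \<subseteq> ball_set (2 * r) (edges ?G) v"
      proof
        fix z assume "z \<in> ?B u"
        from ball_set_trans[OF u(1) this] show "z \<in> ball_set (2 * r) (edges ?G) v" unfolding mult_2 .
      qed
      then have "card (?B u) \<le> D"
        using nb card_mono[of "ball_set (2 * r) (edges ?G) v" "?B u"] by (auto simp: has_card_iff)
      then have "u \<in> ?U" using u uV by simp
      then show "v \<in> (\<Union>u\<in>?U. ?B u)" using ball_set_sym[OF u(1)] by blast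
    qed
    then have "card {v \<in> verts ?G. ?S (?G, v, ?w)} \<le> card (\<Union>u\<in>?U. ?B u)"
      using G(2) finB by (intro card_mono) auto
    also have "\<dots> \<le> (\<Sum>u\<in>?U. card (?B u))" using G(2) by (intro card_UN_le) simp
    also have "\<dots> \<le> card ?U * D" using sum_bounded_above[of ?U "\<lambda>u. card (?B u)" D] by simp
    also have "\<dots> \<le> card {u \<in> verts ?G. P (?G, u, ?w)} * D" using G(2) by (intro mult_right_mono card_mono) auto
    finally show ?thesis by (simp add: reroot_count_def mult.commute flip: of_nat_mult)
  qed
  have "prob {\<omega> \<in> space M. ?S (\<GG> \<omega>)} = (\<integral>\<omega>. real (reroot_count ?S (\<GG> \<omega>)) \<partial>M) / real n" by (rule reroot_prob(2)[OF Sm])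
  also have "\<dots> \<le> (\<integral>\<omega>. real D * real (reroot_count P (\<GG> \<omega>)) \<partial>M) / real n"
    using reroot_prob(1)[OF Sm] reroot_prob(1)[OF P] by (intro divide_right_mono integral_mono count) auto
  also have "\<dots> = real D * prob {\<omega> \<in> space M. P (\<GG> \<omega>)}" unfolding reroot_prob(2)[OF P] by simp
  finally have S: "prob {\<omega> \<in> space M. ?S (\<GG> \<omega>)} \<le> real D * prob {\<omega> \<in> space M. P (\<GG> \<omega>)}" .
  have "prob ?E \<le> prob ({\<omega> \<in> space M. big_ball D (2 * r) (\<GG> \<omega>)} \<union> {\<omega> \<in> space M. ?S (\<GG> \<omega>)})"
    by (rule finite_measure_mono) (use pred_M[OF Sm] pred_M[OF pred_big_ball] in auto)
  also have "\<dots> \<le> prob {\<omega> \<in> space M. big_ball D (2 * r) (\<GG> \<omega>)} + prob {\<omega> \<in> space M. ?S (\<GG> \<omega>)}"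
    by (rule measure_Un_le) (use pred_M[OF Sm] pred_M[OF pred_big_ball] in auto)
  finally show "prob ?E \<le> prob {\<omega> \<in> space M. big_ball D (2 * r) (\<GG> \<omega>)} + real D * prob {\<omega> \<in> space M. P (\<GG> \<omega>)}" using S by simp
qed

text \<open>
  If at least \<open>a * n\<close> vertices have clusters of size at least \<open>j\<close>, a vertex with an intermediate cluster, of
  at most \<open>b * n\<close> vertices, is separated from at least \<open>(a - b) * n\<close> of them.
\<close>
lemma intermediate_prob:
  assumes ab: "b < a" and l: "real l \<le> b * real n"
  shows "prob {\<omega> \<in> space M. intermediate j l p (\<GG> \<omega>)} \<le>
     (1 / (real n)\<^sup>2 * (\<integral>\<omega>. real (card (separated_pairs j p (\<GG> \<omega>))) \<partial>M)) / (a - b)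
     + prob {\<omega> \<in> space M. real (reroot_count (big_cluster j p) (\<GG> \<omega>)) < a * real n}"
proof -
  let ?D = "\<lambda>\<omega>. real (card (separated_pairs j p (\<GG> \<omega>)))"
  let ?I = "intermediate j l p"
  let ?L = "{\<omega> \<in> space M. real (reroot_count (big_cluster j p) (\<GG> \<omega>)) < a * real n}"
  have Lm [measurable]: "?L \<in> events"
    by (rule pred_M) (use measurable_real_reroot_count[OF pred_big_cluster] in measurable)
  have cardm: "(\<lambda>x. card (cluster x u p)) \<in> RW \<rightarrow>\<^sub>M count_space UNIV" for u by (rule measurable_card) measurable
  have pm: "Measurable.pred RW (\<lambda>x. z \<in> separated_pairs j p x)" for z
  proof -
    obtain u v where z: "z = (u, v)" by (cases z)
    have 1: "Measurable.pred RW (\<lambda>x. j \<le> card (cluster x u p))" for u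
      using measurable_compose[OF cardm[of u], of "\<lambda>c. j \<le> c" "count_space UNIV"] by simp
    have "Measurable.pred RW (\<lambda>x. u \<in> verts (graph_of x) \<and> v \<in> verts (graph_of x) \<and>
      card (cluster x u p) \<ge> j \<and> card (cluster x v p) \<ge> j \<and> (\<forall>y. \<not> (y \<in> cluster x u p \<and> y \<in> cluster x v p)))"
      using 1[of u] 1[of v] by measurable
    moreover have "(\<lambda>x. z \<in> separated_pairs j p x) = (\<lambda>x. u \<in> verts (graph_of x) \<and> v \<in> verts (graph_of x) \<and>
      card (cluster x u p) \<ge> j \<and> card (cluster x v p) \<ge> j \<and> (\<forall>y. \<not> (y \<in> cluster x u p \<and> y \<in> cluster x v p)))"
      unfolding separated_pairs_def z by blast
    ultimately show ?thesis by simp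
  qed
  have "(\<lambda>x. real (card (separated_pairs j p x))) \<in> borel_measurable RW"
    by (rule measurable_compose[OF measurable_card[OF pm]]) simp
  then have Dm [measurable]: "?D \<in> borel_measurable M" using measurable_compose[OF \<GG>_measurable] by blast
  have sub: "separated_pairs j p (\<GG> \<omega>) \<subseteq> verts (graph_of (\<GG> \<omega>)) \<times> verts (graph_of (\<GG> \<omega>))" for \<omega>
    by (auto simp: separated_pairs_def)
  have Dint: "integrable M ?D"
  proof (rule integrable_const_bound[of _ "real (n * n)"])
    have "?D \<omega> \<le> real (n * n)" if "\<omega> \<in> space M" for \<omega>
      using card_mono[OF _ sub[of \<omega>]] fin[OF that] by (simp add: card_cartesian_product flip: of_nat_mult)
    then show "AE \<omega> in M. norm (?D \<omega>) \<le> real (n * n)" by auto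
  qed simp
  have pt: "real (reroot_count ?I (\<GG> \<omega>)) \<le> ?D \<omega> / ((a - b) * real n) + real n * indicator ?L \<omega>" if \<omega>: "\<omega> \<in> space M" for \<omega>
  proof (cases "\<omega> \<in> ?L")
    case True
    have "0 \<le> ?D \<omega> / ((a - b) * real n)" using ab by simp
    moreover have "real (reroot_count ?I (\<GG> \<omega>)) \<le> real n" using reroot_count_le[OF \<omega>] by simp
    ultimately show ?thesis using True by simp
  next
    case False
    obtain G \<rho> w where x: "\<GG> \<omega> = (G, \<rho>, w)" by (cases "\<GG> \<omega>")
    have V: "finite (verts G)" "card (verts G) = n" using fin[OF \<omega>] x by auto
    have fc: "finite (cluster (G, \<rho>', w) u p)" for u \<rho>' using V by (auto simp: cluster_eq)
    have rho: "cluster (G, \<rho>', w) u p = cluster (G, \<rho>, w) u p" for u \<rho>' by (simp add: cluster_eq)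
    let ?C = "\<lambda>u. cluster (G, \<rho>, w) u p"
    let ?U = "{u \<in> verts G. ?I (G, u, w)}" and ?Bg = "{v \<in> verts G. big_cluster j p (G, v, w)}"
    have U: "u \<in> ?U \<longleftrightarrow> u \<in> verts G \<and> j \<le> card (?C u) \<and> card (?C u) \<le> l" for u
      using fc rho[of u u] by (auto simp: intermediate_def big_cluster_def has_card_iff)
    have Bg: "v \<in> ?Bg \<longleftrightarrow> v \<in> verts G \<and> j \<le> card (?C v)" for v
      using fc rho[of v v] by (auto simp: big_cluster_def has_card_iff)
    have "(SIGMA u:?U. ?Bg - ?C u) \<subseteq> separated_pairs j p (\<GG> \<omega>)"
    proof
      fix z assume "z \<in> (SIGMA u:?U. ?Bg - ?C u)"
      then obtain u v where z: "z = (u, v)" and u: "u \<in> ?U" and v: "v \<in> ?Bg" "v \<notin> ?C u" by blast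
      then show "z \<in> separated_pairs j p (\<GG> \<omega>)"
        using cluster_sym_disjoint[of v G \<rho> w u p] U[of u] Bg[of v] unfolding separated_pairs_def x by simp
    qed
    moreover have "finite (separated_pairs j p (\<GG> \<omega>))" using sub[of \<omega>] V x finite_subset by fastforce
    ultimately have "card (SIGMA u:?U. ?Bg - ?C u) \<le> card (separated_pairs j p (\<GG> \<omega>))" by (rule card_mono[rotated])
    moreover have "card (SIGMA u:?U. ?Bg - ?C u) = (\<Sum>u\<in>?U. card (?Bg - ?C u))" using V by (subst card_SigmaI) auto
    moreover have "real (card ?U) * ((a - b) * real n) \<le> (\<Sum>u\<in>?U. real (card (?Bg - ?C u)))"
    proof -
      have "(a - b) * real n \<le> real (card (?Bg - ?C u))" if "u \<in> ?U" for u
      proof -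
        have "a * real n \<le> real (card ?Bg)" using False \<omega> x by (simp add: reroot_count_def)
        moreover have "card ?Bg - card (?C u) \<le> card (?Bg - ?C u)" by (rule diff_card_le_card_Diff[OF fc])
        moreover have "real (card (?C u)) \<le> b * real n" using U that l by force
        ultimately show ?thesis by (simp add: left_diff_distrib)
      qed
      then show ?thesis using sum_bounded_below[of ?U "(a - b) * real n" "\<lambda>u. real (card (?Bg - ?C u))"] by simp
    qed
    ultimately have "real (card ?U) * ((a - b) * real n) \<le> real (\<Sum>u\<in>?U. card (?Bg - ?C u))"
      "(\<Sum>u\<in>?U. card (?Bg - ?C u)) \<le> card (separated_pairs j p (\<GG> \<omega>))" by simp_all
    then have "real (card ?U) * ((a - b) * real n) \<le> ?D \<omega>" by linarith
    moreover have "0 < (a - b) * real n" using ab n by simp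
    ultimately have "real (card ?U) \<le> ?D \<omega> / ((a - b) * real n)" by (simp add: pos_le_divide_eq)
    then show ?thesis using False by (simp add: reroot_count_def x)
  qed
  have Lint: "integrable M (indicator ?L :: _ \<Rightarrow> real)"
    by (rule integrable_real_indicator[OF Lm]) (simp add: emeasure_eq_measure)
  have "prob {\<omega> \<in> space M. ?I (\<GG> \<omega>)} = (\<integral>\<omega>. real (reroot_count ?I (\<GG> \<omega>)) \<partial>M) / real n" by (rule reroot_prob(2)[OF pred_intermediate])
  also have "\<dots> \<le> (\<integral>\<omega>. ?D \<omega> / ((a - b) * real n) + real n * indicator ?L \<omega> \<partial>M) / real n"
    using reroot_prob(1)[OF pred_intermediate] Dint Lint
    by (intro divide_right_mono integral_mono pt Bochner_Integration.integrable_add integrable_mult_right) auto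
  also have "(\<integral>\<omega>. ?D \<omega> / ((a - b) * real n) + real n * indicator ?L \<omega> \<partial>M) = (\<integral>\<omega>. ?D \<omega> \<partial>M) / ((a - b) * real n) + real n * prob ?L"
    using Dint Lint Lm by (subst Bochner_Integration.integral_add) auto
  also have "\<dots> / real n = (1 / (real n)\<^sup>2 * (\<integral>\<omega>. ?D \<omega> \<partial>M)) / (a - b) + prob ?L"
    using n ab by (simp add: field_simps power2_eq_square)
  finally show ?thesis .
qed

end

section \<open>The sequence of graphs and its coupling to the limit\<close>

text \<open>
  Outer measure at most \<open>e\<close>; monotone and subadditive for arbitrary sets.
\<close>
definition outer_le :: "'q measure \<Rightarrow> 'q set \<Rightarrow> real \<Rightarrow> bool" where
  "outer_le N A e \<longleftrightarrow> (\<exists>B\<in>sets N. A \<subseteq> B \<and> measure N B \<le> e)"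

lemma outer_le_mono: "outer_le N A e \<Longrightarrow> A' \<subseteq> A \<Longrightarrow> e \<le> e' \<Longrightarrow> outer_le N A' e'"
  unfolding outer_le_def by (meson order_trans subset_trans)

lemma outer_leI: "A \<in> sets N \<Longrightarrow> measure N A \<le> e \<Longrightarrow> outer_le N A e"
  unfolding outer_le_def by blast

lemma outer_le_Un: "outer_le N A a \<Longrightarrow> outer_le N B b \<Longrightarrow> outer_le N (A \<union> B) (a + b)"
  unfolding outer_le_def
proof (elim bexE conjE)
  fix X Y assume "X \<in> sets N" "A \<subseteq> X" "measure N X \<le> a" "Y \<in> sets N" "B \<subseteq> Y" "measure N Y \<le> b"
  then show "\<exists>Z\<in>sets N. A \<union> B \<subseteq> Z \<and> measure N Z \<le> a + b"
    using measure_Un_le[of X N Y] by (intro bexI[of _ "X \<union> Y"]) auto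
qed

lemma (in finite_measure) outer_le_measure: "outer_le M A e \<Longrightarrow> 0 \<le> e \<Longrightarrow> measure M A \<le> e"
  unfolding outer_le_def using finite_measure_mono by (meson order_trans)

text \<open>
  The almost sure properties used in all deterministic arguments.  Weights are distinct on all pairs, not only on the edges of
  the graph, so that this part does not depend on the graph.
\<close>
definition nice :: "nat rwgraph \<Rightarrow> bool" where
  "nice x \<longleftrightarrow> rooted_graph (graph_of x, root_of x) \<and> connected_graph (graph_of x) \<and> inj_on (weight_of x) all_edges \<and>
     (\<forall>e\<in>all_edges. 0 < weight_of x e \<and> weight_of x e < 1)"

lemma nice_prim:
  assumes "nice (G, \<rho>, w)" shows "connected_prim_graph G \<rho> w" "inj_prim_graph G \<rho> w" "rooted_simple G \<rho>"
proof -
  have "edges G \<subseteq> all_edges" using assms by (auto simp: nice_def rooted_graph_def simple_graph_def all_edges_def)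
  then have "inj_on w (edges G)" using assms inj_on_subset by (auto simp: nice_def)
  then show "connected_prim_graph G \<rho> w" "inj_prim_graph G \<rho> w" "rooted_simple G \<rho>"
    using assms by (auto simp: nice_def rooted_graph_def rooted_simple_def connected_prim_graph_def connected_prim_graph_axioms_def
        inj_prim_graph_def inj_prim_graph_axioms_def prim_graph_def)
qed

lemma nice_weight: "nice (G, \<rho>, w) \<Longrightarrow> e \<in> edges G \<Longrightarrow> 0 < w e \<and> w e < 1"
  by (auto simp: nice_def rooted_graph_def simple_graph_def all_edges_def)

lemma nice_space: "nice x \<Longrightarrow> x \<in> space RW"
  by (cases x) (auto simp: nice_def space_RW)

lemma all_edges_eq: "all_edges = {{a, b} |a b. a \<noteq> b}"
  by (auto simp: all_edges_def card_2_iff)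

lemma pred_nice [measurable]: "Measurable.pred RW nice"
proof (rule pred_RWI)
  have [measurable]: "Measurable.pred RW (\<lambda>x. (u, v) \<in> (edge_rel (edges (graph_of x)))\<^sup>*)" for u v
    by (rule pred_edge_rel_rtrancl) measurable
  show "Measurable.pred RW (\<lambda>x. (\<exists>v. v \<in> verts (graph_of x)) \<and>
      (\<forall>u v. u \<in> verts (graph_of x) \<longrightarrow> v \<in> verts (graph_of x) \<longrightarrow> (u, v) \<in> (edge_rel (edges (graph_of x)))\<^sup>*) \<and>
      (\<forall>a b c d. a \<noteq> b \<longrightarrow> c \<noteq> d \<longrightarrow> {a, b} \<noteq> {c, d} \<longrightarrow> pair_weight x a b \<noteq> pair_weight x c d) \<and>
      (\<forall>a b. a \<noteq> b \<longrightarrow> 0 < pair_weight x a b \<and> pair_weight x a b < 1))" by measurable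
  fix x assume "x \<in> space RW"
  then have "rooted_graph (graph_of x, root_of x)" by (auto simp: space_RW)
  moreover have "inj_on (weight_of x) all_edges \<longleftrightarrow>
      (\<forall>a b c d. a \<noteq> b \<longrightarrow> c \<noteq> d \<longrightarrow> {a, b} \<noteq> {c, d} \<longrightarrow> pair_weight x a b \<noteq> pair_weight x c d)"
  proof
    assume "inj_on (weight_of x) all_edges"
    then show "\<forall>a b c d. a \<noteq> b \<longrightarrow> c \<noteq> d \<longrightarrow> {a, b} \<noteq> {c, d} \<longrightarrow> pair_weight x a b \<noteq> pair_weight x c d"
      by (simp add: pair_weight_def inj_on_eq_iff all_edges_def)
  next
    assume R: "\<forall>a b c d. a \<noteq> b \<longrightarrow> c \<noteq> d \<longrightarrow> {a, b} \<noteq> {c, d} \<longrightarrow> pair_weight x a b \<noteq> pair_weight x c d"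
    show "inj_on (weight_of x) all_edges"
    proof (rule inj_onI, rule ccontr)
      fix e f assume ef: "e \<in> all_edges" "f \<in> all_edges" "weight_of x e = weight_of x f" "e \<noteq> f"
      then obtain a b c d where "e = {a, b}" "a \<noteq> b" "f = {c, d}" "c \<noteq> d" unfolding all_edges_eq by blast
      then show False using ef R[rule_format, of a b c d] by (simp add: pair_weight_def)
    qed
  qed
  moreover have "(\<forall>e\<in>all_edges. 0 < weight_of x e \<and> weight_of x e < 1) \<longleftrightarrow>
      (\<forall>a b. a \<noteq> b \<longrightarrow> 0 < pair_weight x a b \<and> pair_weight x a b < 1)"
    unfolding all_edges_eq pair_weight_def by auto
  moreover have "connected_graph (graph_of x) \<longleftrightarrow> (\<exists>v. v \<in> verts (graph_of x)) \<and>
      (\<forall>u v. u \<in> verts (graph_of x) \<longrightarrow> v \<in> verts (graph_of x) \<longrightarrow> (u, v) \<in> (edge_rel (edges (graph_of x)))\<^sup>*)"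
    unfolding connected_graph_def adj_eq by blast
  ultimately show "nice x \<longleftrightarrow> (\<exists>v. v \<in> verts (graph_of x)) \<and>
      (\<forall>u v. u \<in> verts (graph_of x) \<longrightarrow> v \<in> verts (graph_of x) \<longrightarrow> (u, v) \<in> (edge_rel (edges (graph_of x)))\<^sup>*) \<and>
      (\<forall>a b c d. a \<noteq> b \<longrightarrow> c \<noteq> d \<longrightarrow> {a, b} \<noteq> {c, d} \<longrightarrow> pair_weight x a b \<noteq> pair_weight x c d) \<and>
      (\<forall>a b. a \<noteq> b \<longrightarrow> 0 < pair_weight x a b \<and> pair_weight x a b < 1)"
    unfolding nice_def by (simp only: simp_thms conj_assoc)
qed

text \<open>
  The two models together with a fixed coupling \<open>Q\<close> of the whole sequence and the limit.
\<close>
locale coupled_setup =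
  fixes M :: "nat \<Rightarrow> 'a measure" and \<GG> :: "nat \<Rightarrow> 'a \<Rightarrow> nat rwgraph"
    and M' :: "'b measure" and \<GG>' :: "'b \<Rightarrow> nat rwgraph"
    and k :: "nat \<Rightarrow> real \<Rightarrow> nat" and Q :: "((nat \<Rightarrow> nat rwgraph) \<times> nat rwgraph) measure"
  assumes se: "\<And>n. n \<ge> 1 \<Longrightarrow> standard_extension (M n) (\<GG> n)"
    and finite_n: "\<And>n \<omega>. n \<ge> 1 \<Longrightarrow> \<omega> \<in> space (M n) \<Longrightarrow>
           finite (verts (graph_of (\<GG> n \<omega>))) \<and> card (verts (graph_of (\<GG> n \<omega>))) = n \<and>
           connected_graph (graph_of (\<GG> n \<omega>))"
    and se': "standard_extension_rooted M' \<GG>'"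
    and conn': "\<And>\<omega>. \<omega> \<in> space M' \<Longrightarrow> connected_graph (graph_of (\<GG>' \<omega>))"
    and lcp: "local_convergence_in_probability M \<GG> M' \<GG>'"
    and growth: "\<And>t. t \<in> {0..1} \<Longrightarrow> (\<lambda>n. real (k n t) / real n) \<longlonglongrightarrow> t"
    and radius: "filterlim (\<lambda>n. k n 0) at_top sequentially"
    and coup: "coupling (\<lambda>n. distr (M n) rwgraph_space (\<GG> n)) (distr M' rwgraph_space \<GG>') Q"
    and agree: "(\<lambda>n. INF m\<in>{n..}. \<P>(z in Q.
            local_equiv (real (k n 0)) (fst z m) (snd z) \<and>
            local_equiv (real (k n 0)) (msf (fst z m)) (msf (snd z)))) \<longlonglongrightarrow> 1"
    and msf_hits: "\<And>p. p \<in> {0..1} \<Longrightarrow>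
           theta M' \<GG>' p > 0 \<longleftrightarrow>
           \<P>(\<omega> in M'. \<exists>v\<in>verts (graph_of (msf (\<GG>' \<omega>))). infinite (cluster (\<GG>' \<omega>) v p)) = 1"
    and strict: "strict_mono_on {p_crit M' \<GG>'<..1} (theta M' \<GG>')"
    and giant: "\<And>p. p \<in> {0..1} \<Longrightarrow>
           (\<lambda>j. limsup (\<lambda>n. ereal (1 / (real n)\<^sup>2 *
              (\<integral>\<omega>. real (card {(u, v). u \<in> verts (graph_of (\<GG> n \<omega>)) \<and> v \<in> verts (graph_of (\<GG> n \<omega>)) \<and>
                   card (cluster (\<GG> n \<omega>) u p) \<ge> j \<and> card (cluster (\<GG> n \<omega>) v p) \<ge> j \<and>
                   cluster (\<GG> n \<omega>) u p \<inter> cluster (\<GG> n \<omega>) v p = {}}) \<partial>M n)))) \<longlonglongrightarrow> 0"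
begin

lemma standard_finite_n: "n \<ge> 1 \<Longrightarrow> standard_finite (M n) (\<GG> n) n"
  using se[of n] finite_n[of n] unfolding standard_finite_def standard_finite_axioms_def standard_rooted_def standard_extension_def by blast

lemma standard_rooted_n: "n \<ge> 1 \<Longrightarrow> standard_rooted (M n) (\<GG> n)"
  using standard_finite_n unfolding standard_finite_def by blast

sublocale L: standard_rooted M' \<GG>' by (rule standard_rooted.intro) (rule se')

sublocale Q: prob_space Q using coup by (simp add: coupling_def)

lemma sets_Q: "sets Q = sets ((\<Pi>\<^sub>M n\<in>{1..}. rwgraph_space) \<Otimes>\<^sub>M rwgraph_space)"
  using coup by (simp add: coupling_def)

lemma snd_Q [measurable]: "snd \<in> Q \<rightarrow>\<^sub>M RW"
  unfolding measurable_cong_sets[OF sets_Q refl] by measurable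

lemma fst_Q [measurable]: "n \<ge> 1 \<Longrightarrow> (\<lambda>z. fst z n) \<in> Q \<rightarrow>\<^sub>M RW"
  unfolding measurable_cong_sets[OF sets_Q refl]
  by (rule measurable_compose[OF measurable_fst measurable_component_singleton]) simp

text \<open>
  Events on \<open>M n\<close> and on \<open>M'\<close> are moved to the coupling space, where both graphs can be compared.
\<close>
lemma Q_fst:
  assumes n: "n \<ge> 1" and P: "Measurable.pred RW P"
  shows "measure (M n) {\<omega> \<in> space (M n). P (\<GG> n \<omega>)} = measure Q {z \<in> space Q. P (fst z n)}"
    and "{z \<in> space Q. P (fst z n)} \<in> sets Q"
proof -
  interpret S: standard_rooted "M n" "\<GG> n" by (rule standard_rooted_n[OF n])
  have A: "{x \<in> space RW. P x} \<in> sets RW" using P by (simp add: pred_def)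
  have c: "distr Q RW (\<lambda>(x, y). x n) = distr (M n) RW (\<GG> n)" using coup n unfolding coupling_def by blast
  have "(\<lambda>(x, y). x n) = (\<lambda>z :: (nat \<Rightarrow> nat rwgraph) \<times> nat rwgraph. fst z n)" by auto
  then have D: "distr Q RW (\<lambda>z. fst z n) = distr (M n) RW (\<GG> n)" using c by (simp only:)
  have "measure Q {z \<in> space Q. P (fst z n)} = measure (distr Q RW (\<lambda>z. fst z n)) {x \<in> space RW. P x}"
    by (subst measure_distr[OF fst_Q[OF n] A]) (rule arg_cong2[where f=measure], use measurable_space[OF fst_Q[OF n]] in auto)
  also have "\<dots> = measure (M n) {\<omega> \<in> space (M n). P (\<GG> n \<omega>)}"
    unfolding D by (subst measure_distr[OF S.\<GG>_measurable A]) (rule arg_cong2[where f=measure], use measurable_space[OF S.\<GG>_measurable] in auto)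
  finally show "measure (M n) {\<omega> \<in> space (M n). P (\<GG> n \<omega>)} = measure Q {z \<in> space Q. P (fst z n)}" by simp
  show "{z \<in> space Q. P (fst z n)} \<in> sets Q"
    using measurable_compose[OF fst_Q[OF n] P] by (simp add: pred_def)
qed

lemma Q_snd:
  assumes P: "Measurable.pred RW P"
  shows "measure M' {\<omega> \<in> space M'. P (\<GG>' \<omega>)} = measure Q {z \<in> space Q. P (snd z)}"
    and "{z \<in> space Q. P (snd z)} \<in> sets Q"
proof -
  have A: "{x \<in> space RW. P x} \<in> sets RW" using P by (simp add: pred_def)
  have D: "distr Q RW snd = distr M' RW \<GG>'" using coup by (simp add: coupling_def)
  have "measure Q {z \<in> space Q. P (snd z)} = measure (distr Q RW snd) {x \<in> space RW. P x}"
    by (subst measure_distr[OF snd_Q A]) (rule arg_cong2[where f=measure], use measurable_space[OF snd_Q] in auto)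
  also have "\<dots> = measure M' {\<omega> \<in> space M'. P (\<GG>' \<omega>)}"
    unfolding D by (subst measure_distr[OF L.\<GG>_measurable A]) (rule arg_cong2[where f=measure], use measurable_space[OF L.\<GG>_measurable] in auto)
  finally show "measure M' {\<omega> \<in> space M'. P (\<GG>' \<omega>)} = measure Q {z \<in> space Q. P (snd z)}" by simp
  show "{z \<in> space Q. P (snd z)} \<in> sets Q"
    using measurable_compose[OF snd_Q P] by (simp add: pred_def)
qed

lemma pred_M': "Measurable.pred RW P \<Longrightarrow> {\<omega> \<in> space M'. P (\<GG>' \<omega>)} \<in> sets M'"
  using measurable_compose[OF L.\<GG>_measurable, of P "count_space UNIV"] by (simp add: pred_def)

lemma AE_nice': "AE \<omega> in M'. nice (\<GG>' \<omega>)"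
  using L.AE_inj L.AE_weight_range AE_space
  by eventually_elim (auto simp: nice_def conn' L.\<GG>_space)

lemma AE_nice_n: "n \<ge> 1 \<Longrightarrow> AE \<omega> in M n. nice (\<GG> n \<omega>)"
proof -
  assume n: "n \<ge> 1"
  interpret S: standard_rooted "M n" "\<GG> n" by (rule standard_rooted_n[OF n])
  show ?thesis using S.AE_inj S.AE_weight_range AE_space
    by eventually_elim (use finite_n[OF n] S.\<GG>_space in \<open>auto simp: nice_def\<close>)
qed

lemma Q_nice: "outer_le Q {z \<in> space Q. \<not> nice (snd z)} 0"
  "n \<ge> 1 \<Longrightarrow> outer_le Q {z \<in> space Q. \<not> (nice (fst z n) \<and> finite (verts (graph_of (fst z n))) \<and> card (verts (graph_of (fst z n))) = n)} 0"
proof -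
  have P: "Measurable.pred RW (\<lambda>x. \<not> nice x)" by measurable
  have "measure M' {\<omega> \<in> space M'. \<not> nice (\<GG>' \<omega>)} = 0"
    using AE_nice' by (intro L.prob_eq_0[THEN iffD2] pred_M'[OF P]) auto
  then show "outer_le Q {z \<in> space Q. \<not> nice (snd z)} 0"
    using Q_snd[OF P] by (intro outer_leI) simp_all
  assume n: "n \<ge> 1"
  interpret S: standard_finite "M n" "\<GG> n" n by (rule standard_finite_n[OF n])
  let ?P = "\<lambda>x. nice x \<and> has_card n (verts (graph_of x)) \<and> \<not> has_card (Suc n) (verts (graph_of x))"
  have [measurable]: "Measurable.pred RW (\<lambda>x. has_card j (verts (graph_of x)))" for j
    by (rule pred_has_card) measurable
  have P: "Measurable.pred RW (\<lambda>x. \<not> ?P x)" by measurable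
  have "AE \<omega> in M n. ?P (\<GG> n \<omega>)"
    using AE_nice_n[OF n] AE_space by eventually_elim (use finite_n[OF n] in \<open>auto simp: has_card_iff\<close>)
  then have "measure (M n) {\<omega> \<in> space (M n). \<not> ?P (\<GG> n \<omega>)} = 0"
    by (intro S.prob_eq_0[THEN iffD2] S.pred_M[OF P]) auto
  then have "outer_le Q {z \<in> space Q. \<not> ?P (fst z n)} 0"
    using Q_fst[OF n P] by (intro outer_leI) simp_all
  then show "outer_le Q {z \<in> space Q. \<not> (nice (fst z n) \<and> finite (verts (graph_of (fst z n))) \<and> card (verts (graph_of (fst z n))) = n)} 0"
    by (rule outer_le_mono) (auto simp: has_card_iff)
qed

definition agrees :: "nat \<Rightarrow> ((nat \<Rightarrow> nat rwgraph) \<times> nat rwgraph) \<Rightarrow> bool" where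
  "agrees n z \<longleftrightarrow> nice (fst z n) \<and> finite (verts (graph_of (fst z n))) \<and> card (verts (graph_of (fst z n))) = n \<and> nice (snd z) \<and>
     local_equiv (real (k n 0)) (fst z n) (snd z) \<and> local_equiv (real (k n 0)) (msf (fst z n)) (msf (snd z))"

text \<open>
  The probability at \<open>m = n\<close> is at least the infimum over \<open>m \<ge> n\<close>.  A positive measure forces the event to be
  measurable, since the measure of a nonmeasurable set is \<open>0\<close>.
\<close>
lemma agrees_whp:
  assumes e: "0 < e" shows "\<forall>\<^sub>F n in sequentially. outer_le Q {z \<in> space Q. \<not> agrees n z} e"
proof -
  let ?E = "\<lambda>n m. {z \<in> space Q. local_equiv (real (k n 0)) (fst z m) (snd z) \<and> local_equiv (real (k n 0)) (msf (fst z m)) (msf (snd z))}"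
  have "\<forall>\<^sub>F n in sequentially. max 0 (1 - e) < (INF m\<in>{n..}. Q.prob (?E n m))"
    using agree e by (intro order_tendstoD(1)) auto
  then show ?thesis
    using eventually_ge_at_top[of 1]
  proof eventually_elim
    case (elim n)
    have "(INF m\<in>{n..}. Q.prob (?E n m)) \<le> Q.prob (?E n n)"
      by (rule cINF_lower) (auto intro!: bdd_belowI[of _ 0])
    then have g: "max 0 (1 - e) < Q.prob (?E n n)" using elim by simp
    then have "?E n n \<in> Q.events" using measure_notin_sets[of "?E n n" Q] by fastforce
    then have "outer_le Q (space Q - ?E n n) e"
      using g by (intro outer_leI) (auto simp: Q.prob_compl)
    from outer_le_Un[OF outer_le_Un[OF this Q_nice(1)] Q_nice(2)[OF elim(2)]]
    show ?case by (rule outer_le_mono) (auto simp: agrees_def)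
  qed
qed

lemma eventually_radius: "\<forall>\<^sub>F n in sequentially. c \<le> real (k n 0)"
proof -
  have "\<forall>\<^sub>F n in sequentially. nat \<lceil>c\<rceil> \<le> k n 0" using radius unfolding filterlim_at_top by blast
  then show ?thesis by eventually_elim linarith
qed

text \<open>
  An increasing sequence of properties, one of which holds almost surely, holds from some index on up to
  a small error.  This is how the constants that depend on the random limit graph become deterministic.
\<close>
lemma eventually_limit:
  assumes P: "\<And>i::nat. Measurable.pred RW (P i)" and mono: "\<And>i x. x \<in> space RW \<Longrightarrow> P i x \<Longrightarrow> P (Suc i) x"
    and ae: "AE \<omega> in M'. \<exists>i. P i (\<GG>' \<omega>)" and e: "0 < e"
  obtains i0 where "\<And>i. i0 \<le> i \<Longrightarrow> outer_le Q {z \<in> space Q. \<not> P i (snd z)} e"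
proof -
  let ?A = "\<lambda>i. {\<omega> \<in> space M'. P i (\<GG>' \<omega>)}"
  have A: "?A i \<in> sets M'" for i by (rule pred_M'[OF P])
  have "(\<lambda>i. L.prob (?A i)) \<longlonglongrightarrow> L.prob (\<Union>i. ?A i)"
  proof (rule L.finite_Lim_measure_incseq)
    show "range ?A \<subseteq> sets M'" using A by auto
    show "incseq ?A"
      by (rule incseq_SucI) (use mono[OF measurable_space[OF L.\<GG>_measurable]] in auto)
  qed
  moreover have "L.prob (\<Union>i. ?A i) = 1"
    using ae A by (intro L.prob_eq_1[THEN iffD2]) auto
  ultimately have "\<forall>\<^sub>F i in sequentially. 1 - e < L.prob (?A i)"
    using e by (intro order_tendstoD(1)) auto
  then obtain i0 where i0: "\<And>i. i0 \<le> i \<Longrightarrow> 1 - e < L.prob (?A i)" by (auto simp: eventually_sequentially)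
  show thesis
  proof
    fix i assume "i0 \<le> i"
    then have "1 - e < Q.prob {z \<in> space Q. P i (snd z)}" using i0 Q_snd(1)[OF P] by simp
    then have "Q.prob (space Q - {z \<in> space Q. P i (snd z)}) \<le> e"
      using Q.prob_compl[OF Q_snd(2)[OF P]] by simp
    moreover have "space Q - {z \<in> space Q. P i (snd z)} = {z \<in> space Q. \<not> P i (snd z)}" by auto
    ultimately show "outer_le Q {z \<in> space Q. \<not> P i (snd z)} e"
      using Q_snd(2)[of "\<lambda>x. \<not> P i x"] P by (intro outer_leI) auto
  qed
qed

text \<open>
  The size of the ball is tight for the limit, and the balls agree with high probability.
\<close>
lemma tightness:
  assumes r: "0 < r" and e: "0 < e"
  obtains D where "\<forall>\<^sub>F n in sequentially. measure (M n) {\<omega> \<in> space (M n). big_ball D r (\<GG> n \<omega>)} \<le> e"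
proof -
  have ae: "AE \<omega> in M'. \<exists>D. \<not> big_ball D r (\<GG>' \<omega>)"
    using AE_space
  proof eventually_elim
    case (elim \<omega>)
    have "finite (ball_set r (edges (graph_of (\<GG>' \<omega>))) (root_of (\<GG>' \<omega>)))"
      using L.\<GG>_space[OF elim] by (intro finite_ball_set) (simp add: prim_graph_def rooted_graph_def)
    then show ?case
      by (intro exI[of _ "card (ball_set r (edges (graph_of (\<GG>' \<omega>))) (root_of (\<GG>' \<omega>)))"]) (simp add: big_ball_def has_card_iff)
  qed
  obtain D where D: "outer_le Q {z \<in> space Q. \<not> \<not> big_ball D r (snd z)} (e / 2)"
  proof (rule eventually_limit[of "\<lambda>D x. \<not> big_ball D r x" "e / 2"])
    show "Measurable.pred RW (\<lambda>x. \<not> big_ball i r x)" for i by measurable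
    show "\<not> big_ball i r x \<Longrightarrow> \<not> big_ball (Suc i) r x" for i x by (auto simp: big_ball_def has_card_iff)
    show "AE \<omega> in M'. \<exists>D. \<not> big_ball D r (\<GG>' \<omega>)" by fact
    fix i0 assume "\<And>i. i0 \<le> i \<Longrightarrow> outer_le Q {z \<in> space Q. \<not> \<not> big_ball i r (snd z)} (e / 2)"
    then show thesis using that[of i0] by simp
  qed (use e in simp)
  have "\<forall>\<^sub>F n in sequentially. measure (M n) {\<omega> \<in> space (M n). big_ball D r (\<GG> n \<omega>)} \<le> e"
    using agrees_whp[OF half_gt_zero[OF e]] eventually_radius[of r] eventually_ge_at_top[of 1]
  proof eventually_elim
    case (elim n)
    have "outer_le Q {z \<in> space Q. big_ball D r (fst z n)} (e / 2 + e / 2)"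
    proof (rule outer_le_mono[OF outer_le_Un[OF elim(1) D] _ order_refl])
      show "{z \<in> space Q. big_ball D r (fst z n)} \<subseteq> {z \<in> space Q. \<not> agrees n z} \<union> {z \<in> space Q. \<not> \<not> big_ball D r (snd z)}"
      proof safe
        fix x y assume z: "big_ball D r (fst (x, y) n)" "\<not> big_ball D r (snd (x, y))" "agrees n (x, y)"
        obtain G \<rho> w G' \<rho>' w' where g: "x n = (G, \<rho>, w)" "y = (G', \<rho>', w')" by (cases "x n", cases y)
        have nc: "nice (G, \<rho>, w)" "nice (G', \<rho>', w')" "local_equiv (real (k n 0)) (G, \<rho>, w) (G', \<rho>', w')"
          using z(3) g by (auto simp: agrees_def)
        obtain \<phi> where "ball_iso (real (k n 0)) (edges G) \<rho> (edges G') \<rho>' \<phi>"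
          using nc(3) unfolding local_equiv_iff[OF nice_prim(3)[OF nc(1)] nice_prim(3)[OF nc(2)]] by blast
        from ball_iso_mono[OF this elim(2)] have "bij_betw \<phi> (ball_set r (edges G) \<rho>) (ball_set r (edges G') \<rho>')"
          by (simp add: ball_iso_def)
        then have "has_card (Suc D) (ball_set r (edges G') \<rho>')"
          using has_card_image[of \<phi> "ball_set r (edges G) \<rho>" "Suc D"] z(1) g by (auto simp: bij_betw_def big_ball_def)
        then show False using z(2) g by (simp add: big_ball_def)
      qed
    qed
    then show ?case
      using Q.outer_le_measure[of "{z \<in> space Q. big_ball D r (fst z n)}" e] Q_fst(1)[OF elim(3), of "big_ball D r"] e by simp
  qed
  then show thesis by (rule that)
qed

text \<open>
  A finite-volume version of \<open>\<theta>(p)\<close>, which decreases to \<open>\<theta>(p)\<close> as \<open>j\<close> grows.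
\<close>
definition theta_j :: "nat \<Rightarrow> real \<Rightarrow> real" where
  "theta_j j p = L.prob {\<omega> \<in> space M'. big_cluster j p (\<GG>' \<omega>)}"

text \<open>
  The average of \<open>perc j p\<close> over the vertices converges to \<open>theta_j j p\<close> by local convergence in probability, and
  \<open>concentration_bound\<close> compares it with the actual proportion.
\<close>
lemma concentration:
  assumes \<epsilon>: "0 < \<epsilon>"
  shows "(\<lambda>n. measure (M n) {\<omega> \<in> space (M n). \<epsilon> \<le> \<bar>real (reroot_count (big_cluster j p) (\<GG> n \<omega>)) / real n - theta_j j p\<bar>}) \<longlonglongrightarrow> 0"
proof (rule tendstoI)
  fix e :: real assume e: "0 < e"
  obtain D where D: "\<forall>\<^sub>F n in sequentially. measure (M n) {\<omega> \<in> space (M n). big_ball D (2 * real j + 1) (\<GG> n \<omega>)} \<le> e * (\<epsilon> / 2)\<^sup>2 / 4"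
    using tightness[of "2 * real j + 1" "e * (\<epsilon> / 2)\<^sup>2 / 4"] e \<epsilon> by auto
  have lim1: "(\<lambda>n. real D / real n) \<longlonglongrightarrow> 0" by (rule lim_const_over_n)
  have D1: "\<forall>\<^sub>F n in sequentially. real D / real n < e * (\<epsilon> / 2)\<^sup>2 / 4"
    using lim1 e \<epsilon> by (intro order_tendstoD(2)) auto
  have "(\<lambda>n. \<P>(\<omega> in M n. \<epsilon> / 2 \<le> \<bar>real_cond_exp (M n) (graph_algebra (M n) (\<GG> n))
              (\<lambda>\<omega>. perc j p (graph_of (\<GG> n \<omega>), root_of (\<GG> n \<omega>))) \<omega>
           - (\<integral>\<omega>'. perc j p (graph_of (\<GG>' \<omega>'), root_of (\<GG>' \<omega>')) \<partial>M')\<bar>)) \<longlonglongrightarrow> 0"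
    using lcp[unfolded local_convergence_in_probability_def, rule_format, OF perc_continuous[of j p], of "\<epsilon> / 2"] \<epsilon> by simp
  then have D2: "\<forall>\<^sub>F n in sequentially. \<P>(\<omega> in M n. \<epsilon> / 2 \<le> \<bar>real_cond_exp (M n) (graph_algebra (M n) (\<GG> n))
              (\<lambda>\<omega>. perc j p (graph_of (\<GG> n \<omega>), root_of (\<GG> n \<omega>))) \<omega>
           - (\<integral>\<omega>'. perc j p (graph_of (\<GG>' \<omega>'), root_of (\<GG>' \<omega>')) \<partial>M')\<bar>) < e / 4"
    using e by (intro order_tendstoD(2)) auto
  show "\<forall>\<^sub>F n in sequentially. dist (measure (M n) {\<omega> \<in> space (M n). \<epsilon> \<le> \<bar>real (reroot_count (big_cluster j p) (\<GG> n \<omega>)) / real n - theta_j j p\<bar>}) 0 < e"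
    using D D1 D2 eventually_ge_at_top[of 1]
  proof eventually_elim
    case (elim n)
    interpret S: standard_finite "M n" "\<GG> n" n by (rule standard_finite_n[OF elim(4)])
    let ?r = "\<lambda>\<omega>. real (reroot_count (big_cluster j p) (\<GG> n \<omega>)) / real n"
    let ?av = "\<lambda>\<omega>. S.avg (perc j p) (graph_of (\<GG> n \<omega>))"
    let ?B1 = "{\<omega> \<in> space (M n). \<epsilon> / 2 \<le> \<bar>?r \<omega> - ?av \<omega>\<bar>}"
    let ?B2 = "{\<omega> \<in> space (M n). \<epsilon> / 2 \<le> \<bar>?av \<omega> - theta_j j p\<bar>}"
    have rm [measurable]: "?r \<in> borel_measurable (M n)"
      using measurable_compose[OF S.\<GG>_measurable measurable_real_reroot_count[OF pred_big_cluster[of j p]]] by measurable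
    have am [measurable]: "?av \<in> borel_measurable (M n)"
      by (rule S.cond_exp_avg(2)[OF S.perc_measurable perc_bounds])
    have B: "?B1 \<in> S.events" "?B2 \<in> S.events" by measurable
    have sub: "S.prob {\<omega> \<in> space (M n). big_ball D (2 * real j) (\<GG> n \<omega>)} \<le> e * (\<epsilon> / 2)\<^sup>2 / 4"
    proof (rule order_trans[OF _ elim(1)], rule S.finite_measure_mono)
      show "{\<omega> \<in> space (M n). big_ball D (2 * real j) (\<GG> n \<omega>)} \<subseteq> {\<omega> \<in> space (M n). big_ball D (2 * real j + 1) (\<GG> n \<omega>)}"
        using has_card_mono[OF _ ball_set_mono[of "2 * real j" "2 * real j + 1", OF _ order_refl]] by (auto simp: big_ball_def)
    qed (rule S.pred_M[OF pred_big_ball])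
    have "S.prob ?B1 \<le> (real D / real n + S.prob {\<omega> \<in> space (M n). big_ball D (2 * real j) (\<GG> n \<omega>)}) / (\<epsilon> / 2)\<^sup>2"
      using \<epsilon> by (intro S.concentration_bound) simp
    also have "\<dots> \<le> (e * (\<epsilon> / 2)\<^sup>2 / 4 + e * (\<epsilon> / 2)\<^sup>2 / 4) / (\<epsilon> / 2)\<^sup>2"
      using sub elim(2) by (intro divide_right_mono add_mono) auto
    also have "\<dots> = e / 2" using \<epsilon> by (simp add: field_simps)
    finally have b1: "S.prob ?B1 \<le> e / 2" .
    have "S.prob ?B2 = \<P>(\<omega> in M n. \<epsilon> / 2 \<le> \<bar>real_cond_exp (M n) (graph_algebra (M n) (\<GG> n))
              (\<lambda>\<omega>. perc j p (graph_of (\<GG> n \<omega>), root_of (\<GG> n \<omega>))) \<omega>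
           - (\<integral>\<omega>'. perc j p (graph_of (\<GG>' \<omega>'), root_of (\<GG>' \<omega>')) \<partial>M')\<bar>)"
    proof (rule S.finite_measure_eq_AE)
      show "AE \<omega> in M n. (\<omega> \<in> ?B2) = (\<omega> \<in> {\<omega> \<in> space (M n). \<epsilon> / 2 \<le> \<bar>real_cond_exp (M n) (graph_algebra (M n) (\<GG> n))
              (\<lambda>\<omega>. perc j p (graph_of (\<GG> n \<omega>), root_of (\<GG> n \<omega>))) \<omega>
           - (\<integral>\<omega>'. perc j p (graph_of (\<GG>' \<omega>'), root_of (\<GG>' \<omega>')) \<partial>M')\<bar>})"
        using S.cond_exp_avg(1)[OF S.perc_measurable perc_bounds, of j p]
        by eventually_elim (simp add: L.perc_expectation theta_j_def)
    qed (use B in measurable)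
    then have b2: "S.prob ?B2 < e / 4" using elim(3) by simp
    have "S.prob {\<omega> \<in> space (M n). \<epsilon> \<le> \<bar>?r \<omega> - theta_j j p\<bar>} \<le> S.prob (?B1 \<union> ?B2)"
    proof (rule S.finite_measure_mono)
      have "\<epsilon> / 2 \<le> \<bar>r - a\<bar> \<or> \<epsilon> / 2 \<le> \<bar>a - th\<bar>" if "\<epsilon> \<le> \<bar>r - th\<bar>" for r a th :: real
        using that by linarith
      then show "{\<omega> \<in> space (M n). \<epsilon> \<le> \<bar>?r \<omega> - theta_j j p\<bar>} \<subseteq> ?B1 \<union> ?B2" by blast
    qed (use B in auto)
    also have "\<dots> \<le> S.prob ?B1 + S.prob ?B2" using B by (intro measure_Un_le)
    finally show ?case using b1 b2 e by simp
  qed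
qed

lemma theta_meas: "{\<omega> \<in> space M'. infinite (cluster (\<GG>' \<omega>) (root_of (\<GG>' \<omega>)) p)} \<in> sets M'"
proof -
  have "Measurable.pred RW (\<lambda>x. infinite (cluster x (root_of x) p))"
    by (rule pred_root_param) (rule pred_infinite[OF pred_cluster])
  then show ?thesis by (rule pred_M')
qed

lemma theta_le_theta_j: "theta M' \<GG>' p \<le> theta_j j p"
  unfolding theta_def theta_j_def
  by (rule L.finite_measure_mono[OF _ pred_M'[OF pred_big_cluster]]) (auto simp: big_cluster_def has_card_iff)

lemma theta_j_tendsto: "(\<lambda>j. theta_j j p) \<longlonglongrightarrow> theta M' \<GG>' p"
proof -
  have "(\<lambda>j. theta_j j p) \<longlonglongrightarrow> L.prob (\<Inter>j. {\<omega> \<in> space M'. big_cluster j p (\<GG>' \<omega>)})"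
    unfolding theta_j_def
    by (rule L.finite_Lim_measure_decseq)
       (auto intro!: pred_M'[OF pred_big_cluster] decseq_SucI simp: big_cluster_def has_card_iff)
  moreover have "(\<Inter>j. {\<omega> \<in> space M'. big_cluster j p (\<GG>' \<omega>)}) = {\<omega> \<in> space M'. infinite (cluster (\<GG>' \<omega>) (root_of (\<GG>' \<omega>)) p)}"
  proof -
    have "(\<forall>j. big_cluster j p x) \<longleftrightarrow> infinite (cluster x (root_of x) p)" for x
      by (auto simp: big_cluster_def has_card_iff dest: spec[of _ "Suc (card (cluster x (root_of x) p))"])
    moreover have "(\<Inter>j. {\<omega> \<in> space M'. big_cluster j p (\<GG>' \<omega>)}) = {\<omega> \<in> space M'. \<forall>j. big_cluster j p (\<GG>' \<omega>)}" by auto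
    ultimately show ?thesis by (simp only:)
  qed
  ultimately show ?thesis by (simp add: theta_def)
qed

lemma theta_mono: "p \<le> q \<Longrightarrow> theta M' \<GG>' p \<le> theta M' \<GG>' q"
  unfolding theta_def
proof (rule L.finite_measure_mono[OF _ theta_meas], safe)
  fix \<omega> assume "p \<le> q" and inf: "infinite (cluster (\<GG>' \<omega>) (root_of (\<GG>' \<omega>)) p)" and fin: "finite (cluster (\<GG>' \<omega>) (root_of (\<GG>' \<omega>)) q)"
  obtain G \<rho> w where x: "\<GG>' \<omega> = (G, \<rho>, w)" by (cases "\<GG>' \<omega>")
  have "low_edges G w p \<subseteq> low_edges G w q" using \<open>p \<le> q\<close> by auto
  then have "cluster (G, \<rho>, w) \<rho> p \<subseteq> cluster (G, \<rho>, w) \<rho> q" using edge_rel_rtrancl_mono[of "low_edges G w p" "low_edges G w q"] unfolding cluster_eq by blast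
  then show False using inf fin finite_subset unfolding x fst_conv snd_conv by blast
qed

lemma separated_pairs_eq: "{(u, v). u \<in> verts (graph_of x) \<and> v \<in> verts (graph_of x) \<and>
                   card (cluster x u p) \<ge> j \<and> card (cluster x v p) \<ge> j \<and>
                   cluster x u p \<inter> cluster x v p = {}} = separated_pairs j p x"
  by (simp add: separated_pairs_def)

text \<open>
  With \<open>t < b < a < \<theta>(p)\<close>, about \<open>\<theta>\<^sub>j(p) * n > a * n\<close> vertices have clusters of size at least \<open>j\<close>, while \<open>l n < b * n\<close>; so
  \<open>intermediate_prob\<close> bounds the probability by the expected density of separated pairs, which is small for large \<open>j\<close>.
\<close>
lemma intermediate_small:
  assumes p: "p \<in> {0..1}" and t: "t < theta M' \<GG>' p" and l: "(\<lambda>n. real (l n) / real n) \<longlonglongrightarrow> t" and \<eta>: "0 < \<eta>"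
  obtains j where "\<forall>\<^sub>F n in sequentially. measure (M n) {\<omega> \<in> space (M n). intermediate j (l n) p (\<GG> n \<omega>)} \<le> \<eta>"
proof -
  obtain b where b: "t < b" "b < theta M' \<GG>' p" using t dense by blast
  obtain a where a: "b < a" "a < theta M' \<GG>' p" using b(2) dense by blast
  let ?D = "\<lambda>j n. 1 / (real n)\<^sup>2 * (\<integral>\<omega>. real (card (separated_pairs j p (\<GG> n \<omega>))) \<partial>M n)"
  have "(\<lambda>j. limsup (\<lambda>n. ereal (?D j n))) \<longlonglongrightarrow> 0" using giant[OF p] unfolding separated_pairs_eq .
  then have "\<forall>\<^sub>F j in sequentially. limsup (\<lambda>n. ereal (?D j n)) < ereal (\<eta> * (a - b) / 2)"
    using \<eta> a by (intro order_tendstoD(2)) auto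
  then obtain j where "limsup (\<lambda>n. ereal (?D j n)) < ereal (\<eta> * (a - b) / 2)" by (auto simp: eventually_sequentially)
  then have 1: "\<forall>\<^sub>F n in sequentially. ereal (?D j n) < ereal (\<eta> * (a - b) / 2)" by (rule Limsup_lessD)
  have "0 < theta_j j p - a" using theta_le_theta_j[of p j] a by simp
  from order_tendstoD(2)[OF concentration[OF this, of j p], of "\<eta> / 2"]
  have 2: "\<forall>\<^sub>F n in sequentially. measure (M n) {\<omega> \<in> space (M n). theta_j j p - a \<le> \<bar>real (reroot_count (big_cluster j p) (\<GG> n \<omega>)) / real n - theta_j j p\<bar>} < \<eta> / 2"
    using \<eta> by simp
  have 3: "\<forall>\<^sub>F n in sequentially. real (l n) / real n < b" using l b by (intro order_tendstoD(2))
  have "\<forall>\<^sub>F n in sequentially. measure (M n) {\<omega> \<in> space (M n). intermediate j (l n) p (\<GG> n \<omega>)} \<le> \<eta>"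
    using 1 2 3 eventually_ge_at_top[of 1]
  proof eventually_elim
    case (elim n)
    interpret S: standard_finite "M n" "\<GG> n" n by (rule standard_finite_n[OF elim(4)])
    have n: "0 < real n" using elim by simp
    have m: "(\<lambda>\<omega>. real (reroot_count (big_cluster j p) (\<GG> n \<omega>))) \<in> borel_measurable (M n)"
      by (rule measurable_compose[OF S.\<GG>_measurable measurable_real_reroot_count[OF pred_big_cluster]])
    have "S.prob {\<omega> \<in> space (M n). intermediate j (l n) p (\<GG> n \<omega>)} \<le> ?D j n / (a - b) +
        S.prob {\<omega> \<in> space (M n). real (reroot_count (big_cluster j p) (\<GG> n \<omega>)) < a * real n}"
      by (rule S.intermediate_prob[OF a(1)]) (use elim(3) n in \<open>simp add: field_simps\<close>)
    also have "?D j n / (a - b) \<le> \<eta> / 2"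
    proof -
      have "d / (a - b) \<le> \<eta> / 2" if "ereal d < ereal (\<eta> * (a - b) / 2)" for d
        using that a by (simp add: pos_divide_le_eq)
      then show ?thesis using elim(1) .
    qed
    also have "S.prob {\<omega> \<in> space (M n). real (reroot_count (big_cluster j p) (\<GG> n \<omega>)) < a * real n} \<le>
        S.prob {\<omega> \<in> space (M n). theta_j j p - a \<le> \<bar>real (reroot_count (big_cluster j p) (\<GG> n \<omega>)) / real n - theta_j j p\<bar>}"
    proof (rule S.finite_measure_mono)
      show "{\<omega> \<in> space (M n). theta_j j p - a \<le> \<bar>real (reroot_count (big_cluster j p) (\<GG> n \<omega>)) / real n - theta_j j p\<bar>} \<in> S.events"
        using m by measurable
      show "{\<omega> \<in> space (M n). real (reroot_count (big_cluster j p) (\<GG> n \<omega>)) < a * real n} \<subseteq>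
         {\<omega> \<in> space (M n). theta_j j p - a \<le> \<bar>real (reroot_count (big_cluster j p) (\<GG> n \<omega>)) / real n - theta_j j p\<bar>}"
      proof safe
        fix \<omega> assume "real (reroot_count (big_cluster j p) (\<GG> n \<omega>)) < a * real n"
        then have "real (reroot_count (big_cluster j p) (\<GG> n \<omega>)) / real n < a" using n by (simp add: pos_divide_less_eq)
        then show "theta_j j p - a \<le> \<bar>real (reroot_count (big_cluster j p) (\<GG> n \<omega>)) / real n - theta_j j p\<bar>" by linarith
      qed
    qed
    finally show ?case using elim(2) by simp
  qed
  then show thesis by (rule that)
qed

end

section \<open>Upper and lower levels of the growing tree\<close>

lemma pred_all_edges:
  assumes [measurable]: "\<And>a b. a \<noteq> b \<Longrightarrow> Measurable.pred RW (\<lambda>x. R x {a, b})"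
  shows "Measurable.pred RW (\<lambda>x. \<forall>e\<in>edges (graph_of x). R x e)"
proof (rule pred_RWI)
  have [measurable]: "Measurable.pred RW (\<lambda>x. a \<noteq> b \<longrightarrow> R x {a, b})" for a b
    by (cases "a = b") (use assms in auto)
  show "Measurable.pred RW (\<lambda>x. \<forall>a b. {a, b} \<in> edges (graph_of x) \<longrightarrow> (a \<noteq> b \<longrightarrow> R x {a, b}))" by measurable
  fix x assume x: "x \<in> space RW"
  show "(\<forall>e\<in>edges (graph_of x). R x e) \<longleftrightarrow> (\<forall>a b. {a, b} \<in> edges (graph_of x) \<longrightarrow> (a \<noteq> b \<longrightarrow> R x {a, b}))"
    using RW_edgeE[OF x] RW_no_loop[OF x] by metis
qed

lemma pair_weight_measurable: "a \<noteq> b \<Longrightarrow> (\<lambda>x. weight_of x {a, b}) \<in> borel_measurable RW"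
  using measurable_pair_weight[of a b] by (simp add: pair_weight_def)

lemma pred_in_ball: "Measurable.pred RW (\<lambda>x. {a, b} \<subseteq> ball_set r (edges (graph_of x)) (root_of x))"
  using pred_intros_logic(3)[OF pred_ball_set[of a r] pred_ball_set[of b r]] by simp

text \<open>
  Weights near the root are far enough apart for \<open>tr_ball_iso\<close>.
\<close>
definition spread :: "real \<Rightarrow> real \<Rightarrow> nat rwgraph \<Rightarrow> bool" where
  "spread r \<delta> x \<longleftrightarrow> (\<forall>e\<in>edges (graph_of x). \<forall>f\<in>edges (graph_of x). e \<subseteq> ball_set r (edges (graph_of x)) (root_of x) \<longrightarrow>
     f \<subseteq> ball_set r (edges (graph_of x)) (root_of x) \<longrightarrow> e \<noteq> f \<longrightarrow> \<bar>weight_of x e - weight_of x f\<bar> > \<delta>)"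

text \<open>
  No weight near the root is close to one of the critical values \<open>C\<close>.
\<close>
definition gap :: "real \<Rightarrow> real set \<Rightarrow> real \<Rightarrow> nat rwgraph \<Rightarrow> bool" where
  "gap r C \<delta> x \<longleftrightarrow> (\<forall>e\<in>edges (graph_of x). e \<subseteq> ball_set r (edges (graph_of x)) (root_of x) \<longrightarrow> (\<forall>c\<in>C. \<bar>weight_of x e - c\<bar> > \<delta>))"

text \<open>
  Between the steps \<open>K\<close> and \<open>l\<close> only edges of weight at most \<open>p\<close> are added.
\<close>
definition low_after :: "nat \<Rightarrow> nat \<Rightarrow> real \<Rightarrow> nat rwgraph \<Rightarrow> bool" where
  "low_after K l p x \<longleftrightarrow> (\<forall>e\<in>edges (graph_of x). e \<in> edges (prim_tree x l) \<longrightarrow> e \<notin> edges (prim_tree x (Suc K)) \<longrightarrow> weight_of x e \<le> p)"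

text \<open>
  Near the root, the invasion is finished after step \<open>K\<close>.
\<close>
definition captured :: "real \<Rightarrow> nat \<Rightarrow> nat rwgraph \<Rightarrow> bool" where
  "captured r K x \<longleftrightarrow> (\<forall>e\<in>edges (graph_of x). e \<subseteq> ball_set r (edges (graph_of x)) (root_of x) \<longrightarrow>
     (\<exists>l. e \<in> edges (prim_tree x (Suc l))) \<longrightarrow> e \<in> edges (prim_tree x (Suc K)))"

lemma pred_spread [measurable]: "Measurable.pred RW (spread r \<delta>)"
  unfolding spread_def[abs_def]
proof (intro pred_all_edges)
  fix a b c d :: nat assume "a \<noteq> b" "c \<noteq> d"
  note [measurable] = pair_weight_measurable[OF this(1)] pair_weight_measurable[OF this(2)] pred_in_ball
  show "Measurable.pred RW (\<lambda>x. {a, b} \<subseteq> ball_set r (edges (graph_of x)) (root_of x) \<longrightarrow>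
     {c, d} \<subseteq> ball_set r (edges (graph_of x)) (root_of x) \<longrightarrow> {a, b} \<noteq> {c, d} \<longrightarrow> \<bar>weight_of x {a, b} - weight_of x {c, d}\<bar> > \<delta>)" by measurable
qed

lemma pred_gap [measurable]: "finite C \<Longrightarrow> Measurable.pred RW (gap r C \<delta>)"
  unfolding gap_def[abs_def]
proof (intro pred_all_edges)
  fix a b :: nat assume C: "finite C" and "a \<noteq> b"
  note [measurable] = pair_weight_measurable[OF this(2)] pred_in_ball
  have [measurable]: "Measurable.pred RW (\<lambda>x. \<forall>c\<in>C. \<bar>weight_of x {a, b} - c\<bar> > \<delta>)"
    by (rule pred_intros_finite(3)[OF C]) measurable
  show "Measurable.pred RW (\<lambda>x. {a, b} \<subseteq> ball_set r (edges (graph_of x)) (root_of x) \<longrightarrow> (\<forall>c\<in>C. \<bar>weight_of x {a, b} - c\<bar> > \<delta>))" by measurable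
qed

lemma pred_low_after [measurable]: "Measurable.pred RW (low_after K l p)"
  unfolding low_after_def[abs_def]
proof (intro pred_all_edges)
  fix a b :: nat assume "a \<noteq> b"
  note [measurable] = pair_weight_measurable[OF this] pred_prim_tree
  show "Measurable.pred RW (\<lambda>x. {a, b} \<in> edges (prim_tree x l) \<longrightarrow> {a, b} \<notin> edges (prim_tree x (Suc K)) \<longrightarrow> weight_of x {a, b} \<le> p)" by measurable
qed

lemma pred_captured [measurable]: "Measurable.pred RW (captured r K)"
  unfolding captured_def[abs_def]
proof (intro pred_all_edges)
  fix a b :: nat
  note [measurable] = pred_in_ball pred_prim_tree
  show "Measurable.pred RW (\<lambda>x. {a, b} \<subseteq> ball_set r (edges (graph_of x)) (root_of x) \<longrightarrow>
     (\<exists>l. {a, b} \<in> edges (prim_tree x (Suc l))) \<longrightarrow> {a, b} \<in> edges (prim_tree x (Suc K)))" by measurable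
qed

lemma finite_pos_bound:
  assumes "finite S" "\<And>s. s \<in> S \<Longrightarrow> (0::real) < s"
  shows "\<exists>i::nat. \<forall>s\<in>S. 1 / real (Suc i) < s"
proof (cases "S = {}")
  case False
  then have "0 < Min S" using assms by simp
  then obtain i where "inverse (real (Suc i)) < Min S" using reals_Archimedean by blast
  then show ?thesis using assms(1) False by (auto simp: inverse_eq_divide)
qed simp

lemma finite_ball_edges:
  assumes "nice x" shows "finite {e \<in> edges (graph_of x). e \<subseteq> ball_set r (edges (graph_of x)) (root_of x)}"
proof -
  have "finite (ball_set r (edges (graph_of x)) (root_of x))"
    using assms by (intro finite_ball_set) (simp add: nice_def prim_graph_def rooted_graph_def)
  then have "finite (Pow (ball_set r (edges (graph_of x)) (root_of x)))" by simp
  then show ?thesis by (rule rev_finite_subset) auto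
qed

lemma nice_edge: "nice x \<Longrightarrow> e \<in> edges (graph_of x) \<Longrightarrow> e \<in> all_edges"
  by (auto simp: nice_def rooted_graph_def simple_graph_def all_edges_def)

lemma ex_spread: "nice x \<Longrightarrow> \<exists>i. spread r (1 / real (Suc i)) x"
proof -
  assume x: "nice x"
  let ?E = "{e \<in> edges (graph_of x). e \<subseteq> ball_set r (edges (graph_of x)) (root_of x)}"
  let ?S = "(\<lambda>(e, f). \<bar>weight_of x e - weight_of x f\<bar>) ` {(e, f) \<in> ?E \<times> ?E. e \<noteq> f}"
  have "finite (?E \<times> ?E)" using finite_ball_edges[OF x, of r] by simp
  then have "finite {(e, f) \<in> ?E \<times> ?E. e \<noteq> f}" by (rule rev_finite_subset) auto
  then have "finite ?S" by (rule finite_imageI)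
  moreover have "0 < s" if s: "s \<in> ?S" for s
  proof -
    obtain e f where ef: "e \<in> edges (graph_of x)" "f \<in> edges (graph_of x)" "e \<noteq> f" "s = \<bar>weight_of x e - weight_of x f\<bar>"
      using s by auto
    have "inj_on (weight_of x) all_edges" using x by (simp add: nice_def)
    from inj_on_eq_iff[OF this nice_edge[OF x ef(1)] nice_edge[OF x ef(2)]]
    have "weight_of x e \<noteq> weight_of x f" using ef(3) by blast
    then show ?thesis using ef(4) by simp
  qed
  ultimately obtain i where i: "\<forall>s\<in>?S. 1 / real (Suc i) < s" using finite_pos_bound by blast
  have "spread r (1 / real (Suc i)) x"
    unfolding spread_def
  proof (intro ballI impI)
    fix e f assume "e \<in> edges (graph_of x)" "f \<in> edges (graph_of x)" "e \<subseteq> ball_set r (edges (graph_of x)) (root_of x)"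
      "f \<subseteq> ball_set r (edges (graph_of x)) (root_of x)" "e \<noteq> f"
    then have "\<bar>weight_of x e - weight_of x f\<bar> \<in> ?S" by force
    then show "1 / real (Suc i) < \<bar>weight_of x e - weight_of x f\<bar>" using i by blast
  qed
  then show ?thesis ..
qed

lemma ex_gap:
  assumes x: "nice x" and C: "finite C" "\<forall>e\<in>all_edges. \<forall>c\<in>C. weight_of x e \<noteq> c"
  shows "\<exists>i. gap r C (1 / real (Suc i)) x"
proof -
  let ?E = "{e \<in> edges (graph_of x). e \<subseteq> ball_set r (edges (graph_of x)) (root_of x)}"
  let ?S = "(\<lambda>(e, c). \<bar>weight_of x e - c\<bar>) ` (?E \<times> C)"
  have "finite ?S" using finite_ball_edges[OF x, of r] C by auto
  moreover have "0 < s" if "s \<in> ?S" for s using that nice_edge[OF x] C(2) by auto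
  ultimately obtain i where i: "\<forall>s\<in>?S. 1 / real (Suc i) < s" using finite_pos_bound by blast
  have "gap r C (1 / real (Suc i)) x"
    unfolding gap_def
  proof (intro ballI impI)
    fix e c assume "e \<in> edges (graph_of x)" "e \<subseteq> ball_set r (edges (graph_of x)) (root_of x)" "c \<in> C"
    then have "\<bar>weight_of x e - c\<bar> \<in> ?S" by force
    then show "1 / real (Suc i) < \<bar>weight_of x e - c\<bar>" using i by blast
  qed
  then show ?thesis ..
qed

lemma prim_tree_mono: "x \<in> space RW \<Longrightarrow> i \<le> j \<Longrightarrow> edges (prim_tree x i) \<subseteq> edges (prim_tree x j) \<and> verts (prim_tree x i) \<subseteq> verts (prim_tree x j)"
proof -
  assume x: "x \<in> space RW" "i \<le> j"
  obtain G \<rho> w where g: "x = (G, \<rho>, w)" by (cases x)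
  interpret prim_graph G \<rho> w using x prim_graph_RW g by blast
  show ?thesis using edges_tr_mono[of "i - 1" "j - 1"] verts_tr_mono[of "i - 1" "j - 1"] x(2) by (simp add: g prim_tree_tr diff_le_mono)
qed

lemma ex_captured: "nice x \<Longrightarrow> \<exists>K. captured r K x"
proof -
  assume x: "nice x"
  let ?E = "{e \<in> edges (graph_of x). e \<subseteq> ball_set r (edges (graph_of x)) (root_of x)}"
  let ?l = "\<lambda>e. LEAST l. e \<in> edges (prim_tree x (Suc l))"
  let ?K = "Max (insert 0 (?l ` ?E))"
  have "captured r ?K x"
    unfolding captured_def
  proof (intro ballI impI)
    fix e assume e: "e \<in> edges (graph_of x)" "e \<subseteq> ball_set r (edges (graph_of x)) (root_of x)" "\<exists>l. e \<in> edges (prim_tree x (Suc l))"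
    have "e \<in> edges (prim_tree x (Suc (?l e)))" using e(3) by (rule LeastI_ex)
    moreover have "?l e \<le> ?K" using e finite_ball_edges[OF x, of r] by (intro Max_ge) auto
    ultimately show "e \<in> edges (prim_tree x (Suc ?K))" using prim_tree_mono[OF nice_space[OF x], of "Suc (?l e)" "Suc ?K"] by auto
  qed
  then show ?thesis ..
qed

text \<open>
  The level-\<open>p\<close> clusters of all vertices of the early tree have been swallowed at step \<open>l\<close>.
\<close>
definition engulfs :: "nat \<Rightarrow> nat \<Rightarrow> real \<Rightarrow> nat rwgraph \<Rightarrow> bool" where
  "engulfs K l p x \<longleftrightarrow> (\<forall>u\<in>verts (prim_tree x (Suc K)). cluster x u p \<subseteq> verts (prim_tree x l))"

text \<open>
  By \<open>unexhausted_cluster_keeps_low\<close> and \<open>tr_covered_by_clusters\<close>, the whole tree, which has \<open>min l n\<close> vertices, is covered by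
  the clusters.
\<close>
lemma not_engulfs_covered:
  assumes x: "nice x" "finite (verts (graph_of x))" "card (verts (graph_of x)) = n" and K: "Suc K \<le> l" and ne: "\<not> engulfs K l p x"
  shows "min l n \<le> card (\<Union>u\<in>verts (prim_tree x (Suc K)). cluster x u p)"
proof -
  obtain G \<rho> w where g: "x = (G, \<rho>, w)" by (cases x)
  interpret connected_prim_graph G \<rho> w using nice_prim x g by blast
  obtain u where u: "u \<in> verts (tr K)" "\<not> cluster (G, \<rho>, w) u p \<subseteq> verts (tr (l - 1))"
    using ne by (auto simp: engulfs_def g prim_tree_tr)
  have Kl: "K \<le> l - 1" using K by simp
  have "verts (tr (l - 1)) \<subseteq> (\<Union>u\<in>verts (tr K). cluster (G, \<rho>, w) u p)"
    using unexhausted_cluster_keeps_low[OF u(1) Kl u(2)] by (intro tr_covered_by_clusters[OF Kl]) auto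
  moreover have "finite (\<Union>u\<in>verts (tr K). cluster (G, \<rho>, w) u p)"
    by (rule finite_subset[of _ "verts G"]) (use x g in \<open>auto simp: cluster_eq\<close>)
  ultimately have "card (verts (tr (l - 1))) \<le> card (\<Union>u\<in>verts (tr K). cluster (G, \<rho>, w) u p)" by (intro card_mono)
  moreover have "card (verts (tr (l - 1))) = min l n" using card_tr_finite[of "l - 1"] x g K by simp
  ultimately show ?thesis by (simp add: g prim_tree_tr)
qed

lemma card_prim_tree_le: "x \<in> space RW \<Longrightarrow> card (verts (prim_tree x l)) \<le> Suc l \<and> finite (verts (prim_tree x l))"
proof -
  assume x: "x \<in> space RW"
  obtain G \<rho> w where g: "x = (G, \<rho>, w)" by (cases x)
  interpret prim_graph G \<rho> w using x prim_graph_RW g by blast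
  show ?thesis using card_tr_le[of "l - 1"] finite_verts_tr by (simp add: g prim_tree_tr)
qed

text \<open>
  The union of the clusters with at least \<open>j\<close> vertices consists of vertices counted by \<open>reroot_count\<close>; each of the others
  adds fewer than \<open>j\<close> vertices.
\<close>
lemma card_covered_le:
  assumes x: "nice x" "finite (verts (graph_of x))"
  shows "card (\<Union>u\<in>verts (prim_tree x (Suc K)). cluster x u p) \<le> reroot_count (big_cluster j p) x + Suc (Suc K) * j"
    and "(\<And>u. u \<in> verts (prim_tree x (Suc K)) \<Longrightarrow> \<not> big_cluster j p (graph_of x, u, weight_of x)) \<Longrightarrow>
      card (\<Union>u\<in>verts (prim_tree x (Suc K)). cluster x u p) \<le> Suc (Suc K) * j"
proof -
  obtain G \<rho> w where g: "x = (G, \<rho>, w)" by (cases x)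
  let ?T = "verts (prim_tree x (Suc K))"
  have fc: "finite (cluster x u p)" for u using x g by (auto simp: cluster_eq)
  have T: "finite ?T" "card ?T \<le> Suc (Suc K)" using card_prim_tree_le[OF nice_space[OF x(1)], of "Suc K"] by auto
  have big: "big_cluster j p (graph_of x, u, weight_of x) \<longleftrightarrow> j \<le> card (cluster x u p)" for u
    using fc[of u] by (auto simp: big_cluster_def has_card_iff g cluster_eq)
  let ?N = "{v \<in> verts (graph_of x). big_cluster j p (graph_of x, v, weight_of x)}"
  let ?S = "{u \<in> ?T. \<not> big_cluster j p (graph_of x, u, weight_of x)}"
  have small: "card (\<Union>u\<in>?S. cluster x u p) \<le> Suc (Suc K) * j"
  proof -
    have "card (\<Union>u\<in>?S. cluster x u p) \<le> (\<Sum>u\<in>?S. card (cluster x u p))" using T by (intro card_UN_le) simp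
    also have "\<dots> \<le> card ?S * j" using sum_bounded_above[of ?S "\<lambda>u. card (cluster x u p)" j] big by simp
    also have "\<dots> \<le> Suc (Suc K) * j"
    proof (rule mult_le_mono1)
      show "card ?S \<le> Suc (Suc K)" using T card_mono[of ?T ?S] by auto
    qed
    finally show ?thesis .
  qed
  then show "(\<And>u. u \<in> ?T \<Longrightarrow> \<not> big_cluster j p (graph_of x, u, weight_of x)) \<Longrightarrow> card (\<Union>u\<in>?T. cluster x u p) \<le> Suc (Suc K) * j"
  proof -
    assume "\<And>u. u \<in> ?T \<Longrightarrow> \<not> big_cluster j p (graph_of x, u, weight_of x)"
    then have "?S = ?T" by blast
    then show ?thesis using small by simp
  qed
  have "(\<Union>u\<in>?T. cluster x u p) \<subseteq> ?N \<union> (\<Union>u\<in>?S. cluster x u p)"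
  proof
    fix v assume "v \<in> (\<Union>u\<in>?T. cluster x u p)"
    then obtain u where u: "u \<in> ?T" "v \<in> cluster x u p" by blast
    show "v \<in> ?N \<union> (\<Union>u\<in>?S. cluster x u p)"
    proof (cases "u \<in> ?S")
      case False
      have uv: "(u, v) \<in> (edge_rel (low_edges G w p))\<^sup>*" "v \<in> verts G" using u(2) by (auto simp: g cluster_eq)
      have "cluster x u p \<subseteq> cluster x v p"
        using rtrancl_trans[OF edge_rel_rtrancl_sym[OF uv(1)]] by (auto simp: g cluster_eq)
      then have "j \<le> card (cluster x v p)" using False u(1) big[of u] card_mono[OF fc[of v]] by (metis (no_types, lifting) mem_Collect_eq order_trans)
      then show ?thesis using big[of v] uv(2) g by auto
    qed (use u in blast)
  qed
  then have "card (\<Union>u\<in>?T. cluster x u p) \<le> card (?N \<union> (\<Union>u\<in>?S. cluster x u p))"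
    using x T fc by (intro card_mono) auto
  also have "\<dots> \<le> card ?N + card (\<Union>u\<in>?S. cluster x u p)" by (rule card_Un_le)
  finally show "card (\<Union>u\<in>?T. cluster x u p) \<le> reroot_count (big_cluster j p) x + Suc (Suc K) * j"
    using small by (simp add: reroot_count_def)
qed

lemma prim_tree_near: "x \<in> space RW \<Longrightarrow> verts (prim_tree x (Suc K)) \<subseteq> ball_set (real (Suc K)) (edges (graph_of x)) (root_of x)"
proof -
  assume x: "x \<in> space RW"
  obtain G \<rho> w where g: "x = (G, \<rho>, w)" by (cases x)
  interpret prim_graph G \<rho> w using x prim_graph_RW g by blast
  show ?thesis using tr_in_ball[of K] ball_set_mono[of "real K" "real (Suc K)" "edges G", OF _ order_refl] by (auto simp: g prim_tree_tr)
qed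

context coupled_setup begin

text \<open>
  By tightness, \<open>mass_transport\<close> applies with a bound \<open>D\<close> on the sizes of balls that works for all large \<open>n\<close>.
\<close>
lemma transport:
  assumes r: "0 < r" and e: "0 < e"
  obtains \<eta> where "0 < \<eta>" "\<And>P. (\<And>n. Measurable.pred RW (P n)) \<Longrightarrow>
    (\<forall>\<^sub>F n in sequentially. measure (M n) {\<omega> \<in> space (M n). P n (\<GG> n \<omega>)} \<le> \<eta>) \<Longrightarrow>
    (\<forall>\<^sub>F n in sequentially. outer_le Q {z \<in> space Q. \<exists>u\<in>ball_set r (edges (graph_of (fst z n))) (root_of (fst z n)).
        P n (graph_of (fst z n), u, weight_of (fst z n))} e)"
proof -
  obtain D where D: "\<forall>\<^sub>F n in sequentially. measure (M n) {\<omega> \<in> space (M n). big_ball D (2 * r) (\<GG> n \<omega>)} \<le> e / 2"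
    using tightness[of "2 * r" "e / 2"] r e by auto
  show thesis
  proof (rule that[of "e / (2 * (real D + 1))"])
    show "0 < e / (2 * (real D + 1))" using e by simp
    fix P assume P: "\<And>n. Measurable.pred RW (P n)"
      and small: "\<forall>\<^sub>F n in sequentially. measure (M n) {\<omega> \<in> space (M n). P n (\<GG> n \<omega>)} \<le> e / (2 * (real D + 1))"
    show "\<forall>\<^sub>F n in sequentially. outer_le Q {z \<in> space Q. \<exists>u\<in>ball_set r (edges (graph_of (fst z n))) (root_of (fst z n)).
        P n (graph_of (fst z n), u, weight_of (fst z n))} e"
      using D small eventually_ge_at_top[of 1]
    proof eventually_elim
      case (elim n)
      interpret S: standard_finite "M n" "\<GG> n" n by (rule standard_finite_n[OF elim(3)])
      have "real D * S.prob {\<omega> \<in> space (M n). P n (\<GG> n \<omega>)} \<le> real D * (e / (2 * (real D + 1)))"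
        using elim(2) by (rule mult_left_mono) simp
      also have "\<dots> \<le> e / 2" using e by (simp add: field_simps)
      finally show ?case
        using Q_fst[OF elim(3) pred_near[OF P, of r n]] S.mass_transport(1)[OF P, of r n D] elim(1)
        by (intro outer_leI) simp_all
    qed
  qed
qed

lemma prim_steps_unbounded:
  assumes "t \<in> {0..1}" shows "\<forall>\<^sub>F n in sequentially. c \<le> k n t"
proof (cases "t = 0")
  case True then show ?thesis using radius unfolding filterlim_at_top by blast
next
  case False
  then have "t / 2 < t" "0 < t" using assms by auto
  have "\<forall>\<^sub>F n in sequentially. t / 2 < real (k n t) / real n"
    using growth[OF assms] \<open>t / 2 < t\<close> by (rule order_tendstoD(1))
  moreover have "\<forall>\<^sub>F n in sequentially. real c / (t / 2) \<le> real n"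
    by (rule eventually_ge_at_top[of "real c / (t / 2)", THEN filterlim_real_sequentially[unfolded filterlim_iff, rule_format]])
  ultimately show ?thesis using eventually_ge_at_top[of 1]
  proof eventually_elim
    case (elim n)
    then have "real c \<le> t / 2 * real n" using \<open>0 < t\<close> by (simp add: field_simps)
    also have "\<dots> \<le> real (k n t)" using elim by (simp add: field_simps)
    finally show ?case by simp
  qed
qed

text \<open>
  By assumption the spanning tree of the limit meets an infinite level-\<open>p\<close> cluster, hence the invasion does; an
  infinite cluster is never swallowed.
\<close>
lemma AE_quiet:
  assumes p: "p \<in> {0..1}" "0 < theta M' \<GG>' p"
  shows "AE \<omega> in M'. \<exists>K. \<forall>l. low_after K l p (\<GG>' \<omega>)"
proof -
  have m1: "\<P>(\<omega> in M'. \<exists>v\<in>verts (graph_of (msf (\<GG>' \<omega>))). infinite (cluster (\<GG>' \<omega>) v p)) = 1"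
    using msf_hits[OF p(1)] p(2) by blast
  then have "{\<omega> \<in> space M'. \<exists>v\<in>verts (graph_of (msf (\<GG>' \<omega>))). infinite (cluster (\<GG>' \<omega>) v p)} \<in> sets M'"
    using measure_notin_sets by fastforce
  then have "AE \<omega> in M'. \<exists>v\<in>verts (graph_of (msf (\<GG>' \<omega>))). infinite (cluster (\<GG>' \<omega>) v p)"
    using m1 by (subst (asm) L.prob_eq_1) auto
  then show ?thesis using AE_nice'
  proof eventually_elim
    case (elim \<omega>)
    obtain G \<rho> w where g: "\<GG>' \<omega> = (G, \<rho>, w)" by (cases "\<GG>' \<omega>")
    interpret C: connected_prim_graph G \<rho> w using nice_prim elim g by auto
    obtain v where "v \<in> verts C.A" "infinite (cluster (G, \<rho>, w) v p)" using elim(1) g by auto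
    then obtain K u where u: "u \<in> verts (C.tr K)" "infinite (cluster (G, \<rho>, w) u p)"
      by (rule C.invasion_hits_infinite_cluster)
    have "w e \<le> p" if e: "e \<in> edges (C.tr l)" "e \<notin> edges (C.tr K)" for e l
    proof -
      have "K \<le> l" using C.edges_tr_mono[of l K] e by (meson nle_le subsetD)
      moreover have "\<not> cluster (G, \<rho>, w) u p \<subseteq> verts (C.tr l)" using u(2) C.finite_verts_tr finite_subset by blast
      ultimately show ?thesis using C.unexhausted_cluster_keeps_low[OF u(1)] e by blast
    qed
    then show ?case by (intro exI[of _ K]) (auto simp: low_after_def g C.prim_tree_tr)
  qed
qed

text \<open>
  In the limit, only weights up to \<open>p1\<close> occur after step \<open>K\<close>.  This is copied to \<open>\<GG>\<^sub>n\<close> for as many steps as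
  the pigeonhole principle needs to find a vertex of \<open>T\<^sub>K\<close> with a level-\<open>p2\<close> cluster of at least \<open>j\<close> vertices.  By \<open>transport\<close>,
  no vertex near the root has an intermediate cluster, so that this cluster has more than \<open>k n t + 1\<close> vertices
  and is not swallowed.
\<close>
lemma upper:
  assumes t: "t \<in> {0..1}" and p: "p1 \<in> {0..1}" "p2 \<in> {0..1}" "p1 < p2" "t < theta M' \<GG>' p1" and e: "0 < e"
  obtains K0 where "\<And>K. K0 \<le> K \<Longrightarrow> \<forall>\<^sub>F n in sequentially. outer_le Q {z \<in> space Q. \<not> low_after K (k n t) p2 (fst z n)} e"
proof -
  have e4: "0 < e / 4" using e by simp
  obtain K0 where K0: "\<And>K. K0 \<le> K \<Longrightarrow> outer_le Q {z \<in> space Q. \<not> (\<forall>l. low_after K l p1 (snd z))} (e / 4)"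
  proof (rule eventually_limit[of "\<lambda>K x. \<forall>l. low_after K l p1 x" "e / 4"])
    show "Measurable.pred RW (\<lambda>x. \<forall>l. low_after i l p1 x)" for i by measurable
    show "\<forall>l. low_after (Suc i) l p1 x" if "x \<in> space RW" "\<forall>l. low_after i l p1 x" for i x
      using that prim_tree_mono[OF that(1), of "Suc i" "Suc (Suc i)"] by (auto simp: low_after_def)
    show "AE \<omega> in M'. \<exists>K. \<forall>l. low_after K l p1 (\<GG>' \<omega>)"
      by (rule AE_quiet[OF p(1)]) (use t p(4) in auto)
  qed (use e that in auto)
  show thesis
  proof
    fix K assume K: "K0 \<le> K"
    obtain \<eta> where \<eta>: "0 < \<eta>" "\<And>P. (\<And>n. Measurable.pred RW (P n)) \<Longrightarrow>
      (\<forall>\<^sub>F n in sequentially. measure (M n) {\<omega> \<in> space (M n). P n (\<GG> n \<omega>)} \<le> \<eta>) \<Longrightarrow>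
      (\<forall>\<^sub>F n in sequentially. outer_le Q {z \<in> space Q. \<exists>u\<in>ball_set (real (Suc K)) (edges (graph_of (fst z n))) (root_of (fst z n)).
        P n (graph_of (fst z n), u, weight_of (fst z n))} (e / 4))"
      by (rule transport[OF _ e4, of "real (Suc K)"]) simp_all
    have l: "(\<lambda>n. real (Suc (k n t)) / real n) \<longlonglongrightarrow> t"
    proof -
      have "(\<lambda>n. real (k n t) / real n + 1 / real n) \<longlonglongrightarrow> t + 0"
        by (intro tendsto_add growth[OF t] lim_const_over_n)
      then show ?thesis by (simp add: add_divide_distrib add.commute)
    qed
    have t2: "t < theta M' \<GG>' p2" using p(4) theta_mono[of p1 p2] p(3) by simp
    obtain j where j: "\<forall>\<^sub>F n in sequentially. measure (M n) {\<omega> \<in> space (M n). intermediate j (Suc (k n t)) p2 (\<GG> n \<omega>)} \<le> \<eta>"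
      by (rule intermediate_small[OF p(2) t2 l \<eta>(1)])
    have far: "\<forall>\<^sub>F n in sequentially. outer_le Q {z \<in> space Q. \<exists>u\<in>ball_set (real (Suc K)) (edges (graph_of (fst z n))) (root_of (fst z n)).
        intermediate j (Suc (k n t)) p2 (graph_of (fst z n), u, weight_of (fst z n))} (e / 4)"
      by (rule \<eta>(2)[OF pred_intermediate j])
    let ?m = "K + Suc K * j"
    obtain i where i: "outer_le Q {z \<in> space Q. \<not> spread (real ?m) (1 / real (Suc i)) (snd z)} (e / 4)"
    proof (rule eventually_limit[of "\<lambda>i. spread (real ?m) (1 / real (Suc i))" "e / 4"])
      show "spread (real ?m) (1 / real (Suc (Suc i))) x" if "spread (real ?m) (1 / real (Suc i)) x" for i x
      proof -
        have "1 / real (Suc (Suc i)) \<le> 1 / real (Suc i)" by (simp add: frac_le)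
        then show ?thesis using that unfolding spread_def by (meson le_less_trans)
      qed
      show "AE \<omega> in M'. \<exists>i. spread (real ?m) (1 / real (Suc i)) (\<GG>' \<omega>)"
        using AE_nice' by eventually_elim (rule ex_spread)
    qed (use e that in auto)
    show "\<forall>\<^sub>F n in sequentially. outer_le Q {z \<in> space Q. \<not> low_after K (k n t) p2 (fst z n)} e"
      using agrees_whp[OF e4] far eventually_radius[of "real ?m + 2 * real (Suc i) + 1 / (p2 - p1)"]
        prim_steps_unbounded[OF t, of "Suc K"] eventually_gt_at_top[of ?m]
    proof eventually_elim
      case (elim n)
      let ?F = "{z \<in> space Q. \<exists>u\<in>ball_set (real (Suc K)) (edges (graph_of (fst z n))) (root_of (fst z n)).
        intermediate j (Suc (k n t)) p2 (graph_of (fst z n), u, weight_of (fst z n))}"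
      let ?R = "real (k n 0)"
      have ip: "0 < 1 / (p2 - p1)" using p by simp
      have mi: "0 \<le> real ?m" "0 < real (Suc i)" by simp_all
      have R: "real ?m \<le> ?R" "2 * real (Suc i) \<le> ?R" "1 / (p2 - p1) \<le> ?R" "0 < ?R"
        using elim(3) ip mi by linarith+
      have R1: "2 / ?R \<le> 1 / real (Suc i)" using R by (simp add: field_simps)
      have R2: "p1 + 1 / ?R \<le> p2" using R(3,4) p(3) by (simp add: field_simps)
      have main: "{z \<in> space Q. \<not> low_after K (k n t) p2 (fst z n)} \<subseteq>
         ({z \<in> space Q. \<not> agrees n z} \<union> ?F) \<union> ({z \<in> space Q. \<not> spread (real ?m) (1 / real (Suc i)) (snd z)} \<union>
          {z \<in> space Q. \<not> (\<forall>l. low_after K l p1 (snd z))})"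
      proof (rule subsetI, rule ccontr)
        fix z assume z: "z \<in> {z \<in> space Q. \<not> low_after K (k n t) p2 (fst z n)}"
          and "z \<notin> ({z \<in> space Q. \<not> agrees n z} \<union> ?F) \<union> ({z \<in> space Q. \<not> spread (real ?m) (1 / real (Suc i)) (snd z)} \<union>
          {z \<in> space Q. \<not> (\<forall>l. low_after K l p1 (snd z))})"
        then have ag: "agrees n z" and nF: "z \<notin> ?F" and sp: "spread (real ?m) (1 / real (Suc i)) (snd z)"
          and q: "\<And>l. low_after K l p1 (snd z)" by auto
        obtain G \<rho> w G' \<rho>' w' where g: "fst z n = (G, \<rho>, w)" "snd z = (G', \<rho>', w')" by (cases "fst z n", cases "snd z")
        have nc: "nice (G, \<rho>, w)" "nice (G', \<rho>', w')" "local_equiv ?R (msf (G, \<rho>, w)) (msf (G', \<rho>', w'))"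
          "finite (verts G)" "card (verts G) = n" using ag g by (auto simp: agrees_def)
        interpret C: connected_prim_graph G \<rho> w using nice_prim nc by auto
        interpret C': connected_prim_graph G' \<rho>' w' using nice_prim nc by auto
        have low: "w f \<le> p2" if f: "f \<in> edges (C.tr ?m)" "f \<notin> edges (C.tr K)" for f
        proof -
          have "w f \<le> p1 + 1 / ?R"
          proof (rule tr_low_weights_transfer[OF nice_prim(2)[OF nc(1)] nice_prim(2)[OF nc(2)] _ order_refl R(1) nc(3) _ _ f])
            show "K \<le> ?m" by simp
            show "2 / ?R < \<bar>w' e - w' f\<bar>" if "e \<in> edges G'" "f \<in> edges G'" "e \<subseteq> ball_set (real ?m) (edges G') \<rho>'"
              "f \<subseteq> ball_set (real ?m) (edges G') \<rho>'" "e \<noteq> f" for e f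
              using sp R1 that unfolding spread_def g fst_conv snd_conv by (meson le_less_trans)
            show "w' e \<le> p1" if "e \<in> edges (C'.tr ?m)" "e \<notin> edges (C'.tr K)" for e
              using q[of "Suc ?m"] that C'.edges_tr_sub by (auto simp: low_after_def g C'.prim_tree_tr)
          qed
          then show ?thesis using R2 by simp
        qed
        obtain u where u: "u \<in> verts (C.tr K)" "j \<le> card (cluster (G, \<rho>, w) u p2)"
          using C.pigeonhole_cluster[OF nc(4) _ low] elim(5) nc(5) by blast
        have uB: "u \<in> ball_set (real (Suc K)) (edges G) \<rho>"
          using prim_tree_near[OF nice_space[OF nc(1)], of K] u(1) by (auto simp: C.prim_tree_tr)
        then have "\<not> intermediate j (Suc (k n t)) p2 (G, u, w)" using nF z g by auto
        moreover have fc: "finite (cluster (G, \<rho>, w) u p2)" using nc(4) by (auto simp: cluster_eq)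
        moreover have "cluster (G, u, w) u p2 = cluster (G, \<rho>, w) u p2" by (simp add: cluster_eq)
        ultimately have "Suc (Suc (k n t)) \<le> card (cluster (G, \<rho>, w) u p2)"
          using u(2) by (auto simp: intermediate_def big_cluster_def has_card_iff)
        moreover have "card (verts (C.tr (k n t - 1))) \<le> Suc (k n t)" using C.card_tr_le[of "k n t - 1"] by simp
        ultimately have ns: "\<not> cluster (G, \<rho>, w) u p2 \<subseteq> verts (C.tr (k n t - 1))"
          using card_mono[OF C.finite_verts_tr[of "k n t - 1"], of "cluster (G, \<rho>, w) u p2"] by linarith
        have "low_after K (k n t) p2 (G, \<rho>, w)"
          using C.unexhausted_cluster_keeps_low[OF u(1) _ ns] elim(4) by (auto simp: low_after_def C.prim_tree_tr)
        then show False using z g by simp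
      qed
      have "outer_le Q (({z \<in> space Q. \<not> agrees n z} \<union> ?F) \<union> ({z \<in> space Q. \<not> spread (real ?m) (1 / real (Suc i)) (snd z)} \<union>
          {z \<in> space Q. \<not> (\<forall>l. low_after K l p1 (snd z))})) ((e / 4 + e / 4) + (e / 4 + e / 4))"
        by (intro outer_le_Un elim(1,2) i K0 K)
      then show ?case by (rule outer_le_mono[OF _ main]) simp
    qed
  qed
qed

text \<open>
  If some cluster is not swallowed, \<open>not_engulfs_covered\<close> and \<open>card_covered_le\<close> bound the number of steps by \<open>\<theta>\<^sub>j(p) n\<close> up to
  a constant, which contradicts \<open>\<theta>\<^sub>j(p) < t\<close>.  For \<open>t = 0\<close> the number of steps only tends to infinity; but then \<open>\<theta>(p) = 0\<close>, so that
  by \<open>transport\<close> all clusters near the root have fewer than \<open>j\<close> vertices, and they can cover a bounded number of vertices only.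
\<close>
lemma lower:
  assumes t: "t \<in> {0..1}" and p: "theta M' \<GG>' p < t \<or> t = 0 \<and> theta M' \<GG>' p = 0" and e: "0 < e"
  shows "\<forall>\<^sub>F n in sequentially. outer_le Q {z \<in> space Q. \<not> engulfs K (k n t) p (fst z n)} e"
proof (cases "theta M' \<GG>' p < t")
  case True
  obtain c where c: "theta M' \<GG>' p < c" "c < t" using True dense by blast
  obtain d where d: "c < d" "d < t" using c(2) dense by blast
  have "\<forall>\<^sub>F j in sequentially. theta_j j p < c" using theta_j_tendsto c(1) by (rule order_tendstoD(2))
  then obtain j where j: "theta_j j p < c" by (auto simp: eventually_sequentially)
  let ?P = "\<lambda>n x. d - theta_j j p \<le> \<bar>real (reroot_count (big_cluster j p) x) / real n - theta_j j p\<bar>"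
  have "0 < d - theta_j j p" using j d by simp
  from order_tendstoD(2)[OF concentration[OF this, of j p] e]
  have 1: "\<forall>\<^sub>F n in sequentially. measure (M n) {\<omega> \<in> space (M n). ?P n (\<GG> n \<omega>)} < e" .
  obtain d' where d': "d < d'" "d' < t" using d(2) dense by blast
  have 2: "\<forall>\<^sub>F n in sequentially. d' < real (k n t) / real n" using growth[OF t] d'(2) by (rule order_tendstoD(1))
  have 3: "\<forall>\<^sub>F n in sequentially. real (Suc (Suc K) * j) / real n < d' - d"
    using d'(1) by (intro order_tendstoD(2)[OF lim_const_over_n]) auto
  show ?thesis
    using 1 2 3 eventually_ge_at_top[of 1] prim_steps_unbounded[OF t, of "Suc K"]
  proof eventually_elim
    case (elim n)
    have n: "0 < real n" using elim by simp
    have Pm: "Measurable.pred RW (?P n)" using measurable_real_reroot_count[OF pred_big_cluster[of j p]] by measurable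
    have "outer_le Q {z \<in> space Q. ?P n (fst z n)} e"
      by (rule outer_leI[OF Q_fst(2)[OF elim(4) Pm]])
         (use elim(1) in \<open>simp only: Q_fst(1)[OF elim(4) Pm] less_imp_le\<close>)
    from outer_le_Un[OF this Q_nice(2)[OF elim(4)]]
    show ?case
    proof (rule outer_le_mono)
      show "{z \<in> space Q. \<not> engulfs K (k n t) p (fst z n)} \<subseteq> {z \<in> space Q. ?P n (fst z n)} \<union>
        {z \<in> space Q. \<not> (nice (fst z n) \<and> finite (verts (graph_of (fst z n))) \<and> card (verts (graph_of (fst z n))) = n)}"
      proof (rule subsetI, rule ccontr)
        fix z assume z: "z \<in> {z \<in> space Q. \<not> engulfs K (k n t) p (fst z n)}"
          and "z \<notin> {z \<in> space Q. ?P n (fst z n)} \<union>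
            {z \<in> space Q. \<not> (nice (fst z n) \<and> finite (verts (graph_of (fst z n))) \<and> card (verts (graph_of (fst z n))) = n)}"
        then have nP: "\<not> ?P n (fst z n)" and nc: "nice (fst z n)" "finite (verts (graph_of (fst z n)))" "card (verts (graph_of (fst z n))) = n" by auto
        have "min (k n t) n \<le> card (\<Union>u\<in>verts (prim_tree (fst z n) (Suc K)). cluster (fst z n) u p)"
          using z elim(5) by (intro not_engulfs_covered[OF nc]) auto
        also have "\<dots> \<le> reroot_count (big_cluster j p) (fst z n) + Suc (Suc K) * j" by (rule card_covered_le(1)[OF nc(1,2)])
        finally have "real (min (k n t) n) \<le> real (reroot_count (big_cluster j p) (fst z n)) + real (Suc (Suc K) * j)"
          by (metis of_nat_add of_nat_le_iff)
        then have "real (min (k n t) n) / real n \<le> real (reroot_count (big_cluster j p) (fst z n)) / real n + real (Suc (Suc K) * j) / real n"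
          using n by (simp add: divide_right_mono flip: add_divide_distrib)
        moreover have "real (reroot_count (big_cluster j p) (fst z n)) / real n < d" using nP by linarith
        moreover have "d' \<le> real (min (k n t) n) / real n" using elim(2) d'(2) t n by (auto simp: min_def)
        ultimately show False using elim(3) by linarith
      qed
    qed simp
  qed
next
  case False
  then have t0: "t = 0" and p0: "theta M' \<GG>' p = 0" using p by auto
  obtain \<eta> where \<eta>: "0 < \<eta>" "\<And>P. (\<And>n. Measurable.pred RW (P n)) \<Longrightarrow>
      (\<forall>\<^sub>F n in sequentially. measure (M n) {\<omega> \<in> space (M n). P n (\<GG> n \<omega>)} \<le> \<eta>) \<Longrightarrow>
      (\<forall>\<^sub>F n in sequentially. outer_le Q {z \<in> space Q. \<exists>u\<in>ball_set (real (Suc K)) (edges (graph_of (fst z n))) (root_of (fst z n)).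
        P n (graph_of (fst z n), u, weight_of (fst z n))} e)"
    by (rule transport[OF _ e, of "real (Suc K)"]) simp_all
  have "\<forall>\<^sub>F j in sequentially. theta_j j p < \<eta> / 3" using theta_j_tendsto[of p] p0 \<eta>(1) by (intro order_tendstoD(2)) auto
  then obtain j where j: "theta_j j p < \<eta> / 3" by (auto simp: eventually_sequentially)
  let ?P = "\<lambda>n x. \<eta> / 3 \<le> \<bar>real (reroot_count (big_cluster j p) x) / real n - theta_j j p\<bar>"
  have "0 < \<eta> / 3" using \<eta> by simp
  from order_tendstoD(2)[OF concentration[OF this, of j p] this]
  have 1: "\<forall>\<^sub>F n in sequentially. measure (M n) {\<omega> \<in> space (M n). ?P n (\<GG> n \<omega>)} < \<eta> / 3" .
  have "\<forall>\<^sub>F n in sequentially. measure (M n) {\<omega> \<in> space (M n). big_cluster j p (\<GG> n \<omega>)} \<le> \<eta>"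
    using 1 eventually_ge_at_top[of 1]
  proof eventually_elim
    case (elim n)
    interpret S: standard_finite "M n" "\<GG> n" n by (rule standard_finite_n[OF elim(2)])
    have n: "0 < real n" using elim by simp
    note rp = S.reroot_prob[OF pred_big_cluster[of j p]]
    have Pm: "Measurable.pred RW (?P n)" using measurable_real_reroot_count[OF pred_big_cluster[of j p]] by measurable
    let ?B = "{\<omega> \<in> space (M n). ?P n (\<GG> n \<omega>)}"
    have B: "?B \<in> S.events" by (rule S.pred_M[OF Pm])
    have iB: "integrable (M n) (indicator ?B :: _ \<Rightarrow> real)" by (rule integrable_real_indicator[OF B]) (simp add: S.emeasure_eq_measure)
    have "(\<integral>\<omega>. real (reroot_count (big_cluster j p) (\<GG> n \<omega>)) \<partial>M n) \<le> (\<integral>\<omega>. real n * (2 * \<eta> / 3) + real n * indicator ?B \<omega> \<partial>M n)"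
    proof (rule integral_mono[OF rp(1)])
      show "integrable (M n) (\<lambda>\<omega>. real n * (2 * \<eta> / 3) + real n * indicator ?B \<omega>)" using iB by auto
      fix \<omega> assume \<omega>: "\<omega> \<in> space (M n)"
      show "real (reroot_count (big_cluster j p) (\<GG> n \<omega>)) \<le> real n * (2 * \<eta> / 3) + real n * indicator ?B \<omega>"
      proof (cases "\<omega> \<in> ?B")
        case True
        then show ?thesis using S.reroot_count_le[OF \<omega>, of "big_cluster j p"] \<eta>(1) by (simp add: add_increasing)
      next
        case False
        then have "\<not> \<eta> / 3 \<le> \<bar>real (reroot_count (big_cluster j p) (\<GG> n \<omega>)) / real n - theta_j j p\<bar>" using \<omega> by blast
        then have "real (reroot_count (big_cluster j p) (\<GG> n \<omega>)) / real n < 2 * \<eta> / 3" using j by linarith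
        then show ?thesis using False n by (simp add: field_simps)
      qed
    qed
    also have "\<dots> = real n * (2 * \<eta> / 3) + real n * S.prob ?B"
      using iB B by (subst Bochner_Integration.integral_add) (auto simp: S.prob_space)
    also have "\<dots> \<le> real n * (2 * \<eta> / 3) + real n * (\<eta> / 3)" using elim(1) n by (intro add_left_mono mult_left_mono) auto
    finally show ?case unfolding rp(2) using n by (simp add: field_simps)
  qed
  from \<eta>(2)[OF pred_big_cluster this]
  have 2: "\<forall>\<^sub>F n in sequentially. outer_le Q {z \<in> space Q. \<exists>u\<in>ball_set (real (Suc K)) (edges (graph_of (fst z n))) (root_of (fst z n)).
        big_cluster j p (graph_of (fst z n), u, weight_of (fst z n))} e" .
  show ?thesis
    using 2 prim_steps_unbounded[OF t, of "Suc K + Suc (Suc (Suc K) * j)"] eventually_gt_at_top[of "Suc (Suc K) * j"]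
  proof eventually_elim
    case (elim n)
    have n1: "1 \<le> n" using elim(3) by simp
    let ?F = "{z \<in> space Q. \<exists>u\<in>ball_set (real (Suc K)) (edges (graph_of (fst z n))) (root_of (fst z n)).
        big_cluster j p (graph_of (fst z n), u, weight_of (fst z n))}"
    from outer_le_Un[OF elim(1) Q_nice(2)[OF n1]]
    show ?case
    proof (rule outer_le_mono)
      show "{z \<in> space Q. \<not> engulfs K (k n t) p (fst z n)} \<subseteq> ?F \<union>
        {z \<in> space Q. \<not> (nice (fst z n) \<and> finite (verts (graph_of (fst z n))) \<and> card (verts (graph_of (fst z n))) = n)}"
      proof (rule subsetI, rule ccontr)
        fix z assume z: "z \<in> {z \<in> space Q. \<not> engulfs K (k n t) p (fst z n)}"
          and "z \<notin> ?F \<union> {z \<in> space Q. \<not> (nice (fst z n) \<and> finite (verts (graph_of (fst z n))) \<and> card (verts (graph_of (fst z n))) = n)}"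
        then have nF: "\<And>u. u\<in>ball_set (real (Suc K)) (edges (graph_of (fst z n))) (root_of (fst z n)) \<Longrightarrow> \<not> big_cluster j p (graph_of (fst z n), u, weight_of (fst z n))"
          and nc: "nice (fst z n)" "finite (verts (graph_of (fst z n)))" "card (verts (graph_of (fst z n))) = n" by auto
        have "min (k n t) n \<le> card (\<Union>u\<in>verts (prim_tree (fst z n) (Suc K)). cluster (fst z n) u p)"
          using z elim(2) by (intro not_engulfs_covered[OF nc]) auto
        also have "\<dots> \<le> Suc (Suc K) * j"
          using nF prim_tree_near[OF nice_space[OF nc(1)], of K] by (intro card_covered_le(2)[OF nc(1,2)]) blast
        finally show False using elim(2,3) by auto
      qed
    qed simp
  qed
qed

end

section \<open>The inverse of the percolation function\<close>

lemma (in finite_measure) outer_le_diff: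
  assumes A: "A \<in> sets M" "B \<in> sets M" and d: "outer_le M C e" "A \<subseteq> B \<union> C" "B \<subseteq> A \<union> C"
  shows "\<bar>measure M A - measure M B\<bar> \<le> e"
proof -
  obtain X where X: "X \<in> sets M" "C \<subseteq> X" "measure M X \<le> e" using d(1) by (auto simp: outer_le_def)
  have "measure M A \<le> measure M (B \<union> X)" using A X d by (intro finite_measure_mono) auto
  also have "\<dots> \<le> measure M B + measure M X" using A X by (intro measure_Un_le)
  finally have 1: "measure M A \<le> measure M B + e" using X(3) by simp
  have "measure M B \<le> measure M (A \<union> X)" using A X d by (intro finite_measure_mono) auto
  also have "\<dots> \<le> measure M A + measure M X" using A X by (intro measure_Un_le)
  finally show ?thesis using 1 X(3) by simp
qed

context coupled_setup begin

lemma prob_limit_le: "Measurable.pred RW P \<Longrightarrow> outer_le Q {z \<in> space Q. P (snd z)} e \<Longrightarrow> 0 \<le> e \<Longrightarrow> measure M' {\<omega> \<in> space M'. P (\<GG>' \<omega>)} \<le> e"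
  using Q.outer_le_measure[of "{z \<in> space Q. P (snd z)}" e] Q_snd(1)[of P] by simp

text \<open>
  A ball of radius \<open>s\<close> in a connected graph with more than \<open>s\<close> vertices has more than \<open>s\<close> vertices, and the balls of the
  limit are balls of such graphs.
\<close>
lemma AE_infinite: "AE \<omega> in M'. infinite (verts (graph_of (\<GG>' \<omega>)))"
proof -
  have "AE \<omega> in M'. has_card (Suc s) (verts (graph_of (\<GG>' \<omega>)))" for s
  proof -
    have P: "Measurable.pred RW (\<lambda>x. \<not> has_card (Suc s) (verts (graph_of x)))"
      by (intro pred_intros_logic(2) pred_has_card) measurable
    have "measure M' {\<omega> \<in> space M'. \<not> has_card (Suc s) (verts (graph_of (\<GG>' \<omega>)))} \<le> 0 + e" if e: "0 < e" for e
    proof -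
      have "\<forall>\<^sub>F n in sequentially. outer_le Q {z \<in> space Q. \<not> has_card (Suc s) (verts (graph_of (snd z)))} e"
        using agrees_whp[OF e] eventually_radius[of "real s"] eventually_gt_at_top[of s]
      proof eventually_elim
        case (elim n)
        show ?case
        proof (rule outer_le_mono[OF elim(1) _ order_refl], rule subsetI, rule ccontr)
          fix z assume z: "z \<in> {z \<in> space Q. \<not> has_card (Suc s) (verts (graph_of (snd z)))}" "z \<notin> {z \<in> space Q. \<not> agrees n z}"
          then have ag: "agrees n z" by auto
          obtain G \<rho> w G' \<rho>' w' where g: "fst z n = (G, \<rho>, w)" "snd z = (G', \<rho>', w')" by (cases "fst z n", cases "snd z")
          have nc: "nice (G, \<rho>, w)" "nice (G', \<rho>', w')" "local_equiv (real (k n 0)) (G, \<rho>, w) (G', \<rho>', w')"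
            "finite (verts G)" "card (verts G) = n" using ag g by (auto simp: agrees_def)
          interpret C: connected_prim_graph G \<rho> w using nice_prim nc by auto
          interpret C': connected_prim_graph G' \<rho>' w' using nice_prim nc by auto
          obtain \<phi> where "ball_iso (real (k n 0)) (edges G) \<rho> (edges G') \<rho>' \<phi>"
            using nc(3) unfolding local_equiv_iff[OF nice_prim(3)[OF nc(1)] nice_prim(3)[OF nc(2)]] by blast
          from ball_isoD[OF ball_iso_mono[OF this elim(2)]]
          have D: "inj_on \<phi> (ball_set (real s) (edges G) \<rho>)" "\<phi> ` ball_set (real s) (edges G) \<rho> = ball_set (real s) (edges G') \<rho>'" by auto
          have "\<phi> ` verts (C.tr s) \<subseteq> verts G'"
            using image_mono[OF C.tr_in_ball[of s], of \<phi>] D(2) ball_set_verts[OF C'.simple C'.root order_refl, of "real s"] by simp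
          moreover have "card (\<phi> ` verts (C.tr s)) = Suc s"
            using card_image[OF inj_on_subset[OF D(1) C.tr_in_ball]] C.card_tr_finite[of s] nc(4,5) elim(3) by simp
          ultimately have "has_card (Suc s) (verts G')"
            unfolding has_card_iff using card_mono[of "verts G'" "\<phi> ` verts (C.tr s)"] by auto
          then show False using z g by simp
        qed
      qed
      then have "outer_le Q {z \<in> space Q. \<not> has_card (Suc s) (verts (graph_of (snd z)))} e"
        by (auto simp: eventually_sequentially)
      then show ?thesis using prob_limit_le[OF P] e by simp
    qed
    then have "measure M' {\<omega> \<in> space M'. \<not> has_card (Suc s) (verts (graph_of (\<GG>' \<omega>)))} \<le> 0"
      by (rule field_le_epsilon)
    then have "measure M' {\<omega> \<in> space M'. \<not> has_card (Suc s) (verts (graph_of (\<GG>' \<omega>)))} = 0" by (simp add: measure_le_0_iff)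
    then have "AE \<omega> in M'. \<not> \<not> has_card (Suc s) (verts (graph_of (\<GG>' \<omega>)))"
      using pred_M'[OF P] by (subst (asm) L.prob_eq_0) auto
    then show ?thesis by simp
  qed
  then have "AE \<omega> in M'. \<forall>s. has_card (Suc s) (verts (graph_of (\<GG>' \<omega>)))" by (subst AE_all_countable) simp
  then show ?thesis
  proof eventually_elim
    case (elim \<omega>)
    show ?case using elim[rule_format, of "card (verts (graph_of (\<GG>' \<omega>)))"] by (auto simp: has_card_iff)
  qed
qed

lemma theta_1: "theta M' \<GG>' 1 = 1"
proof -
  have "AE \<omega> in M'. infinite (cluster (\<GG>' \<omega>) (root_of (\<GG>' \<omega>)) 1)"
    using AE_infinite AE_nice'
  proof eventually_elim
    case (elim \<omega>)
    obtain G \<rho> w where g: "\<GG>' \<omega> = (G, \<rho>, w)" by (cases "\<GG>' \<omega>")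
    have n: "nice (G, \<rho>, w)" using elim g by simp
    interpret C: connected_prim_graph G \<rho> w using nice_prim n by auto
    have "low_edges G w 1 = edges G" using nice_weight[OF n] by force
    then have "cluster (G, \<rho>, w) \<rho> 1 = verts G"
      using C.conn C.root by (auto simp: cluster_eq connected_graph_def adj_eq)
    then show ?case using elim g by simp
  qed
  then show ?thesis unfolding theta_def by (subst L.prob_eq_1[OF theta_meas]) auto
qed

lemma theta_nonpos: "q \<le> 0 \<Longrightarrow> theta M' \<GG>' q = 0"
proof -
  assume q: "q \<le> 0"
  have "AE \<omega> in M'. \<not> infinite (cluster (\<GG>' \<omega>) (root_of (\<GG>' \<omega>)) q)"
    using AE_nice'
  proof eventually_elim
    case (elim \<omega>)
    obtain G \<rho> w where g: "\<GG>' \<omega> = (G, \<rho>, w)" by (cases "\<GG>' \<omega>")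
    have n: "nice (G, \<rho>, w)" using elim g by simp
    have low: "low_edges G w q = {}" using nice_weight[OF n] q by force
    have "cluster (G, \<rho>, w) \<rho> q \<subseteq> {\<rho>}" unfolding cluster_eq low by (auto simp: edge_rel_def)
    then have "finite (cluster (G, \<rho>, w) \<rho> q)" by (rule finite_subset) simp
    then show ?case by (simp add: g)
  qed
  then show ?thesis unfolding theta_def by (subst L.prob_eq_0[OF theta_meas]) auto
qed

lemma theta_le_1: "theta M' \<GG>' q \<le> 1" unfolding theta_def by simp

lemma theta_nonneg: "0 \<le> theta M' \<GG>' q" unfolding theta_def by simp

abbreviation \<Theta> :: "real \<Rightarrow> real" where "\<Theta> \<equiv> theta_inv M' \<GG>'"

lemma theta_inv_1: "\<Theta> 1 = 1" by (simp add: theta_inv_def)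

lemma theta_inv_le: "t \<noteq> 1 \<Longrightarrow> q \<in> {0..1} \<Longrightarrow> t < theta M' \<GG>' q \<Longrightarrow> \<Theta> t \<le> q"
  unfolding theta_inv_def by (auto intro!: cInf_lower bdd_belowI[of _ 0])

text \<open>
  The set that defines \<open>\<theta>\<inverse>(t)\<close> is nonempty, because \<open>\<theta>(1) = 1\<close>; this uses that the limit graph is infinite.
\<close>
lemma theta_inv_less:
  assumes "t < 1" "\<Theta> t < q" shows "t < theta M' \<GG>' q"
proof -
  let ?S = "{p \<in> {0..1}. theta M' \<GG>' p > t}"
  have "1 \<in> ?S" using assms theta_1 by simp
  then have ne: "?S \<noteq> {}" by blast
  have "Inf ?S < q" using assms by (simp add: theta_inv_def)
  then obtain p where "p \<in> ?S" "p < q" using cInf_lessD[OF ne] by blast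
  then show ?thesis using theta_mono[of p q] by simp
qed

lemma theta_inv_bounds: "t \<in> {0..1} \<Longrightarrow> 0 \<le> \<Theta> t \<and> \<Theta> t \<le> 1"
proof (cases "t = 1")
  case False
  assume "t \<in> {0..1}"
  then have t: "t < 1" using False by simp
  have "0 \<le> Inf {p \<in> {0..1}. theta M' \<GG>' p > t}"
    by (rule cInf_greatest) (use t theta_1 in auto)
  moreover have "\<Theta> t \<le> 1" using theta_inv_le[of t 1] t theta_1 by simp
  ultimately show ?thesis using False by (simp add: theta_inv_def)
qed (simp add: theta_inv_1)

lemma theta_inv_mono:
  assumes "s \<le> t" "s \<in> {0..1}" "t \<in> {0..1}" shows "\<Theta> s \<le> \<Theta> t"
proof (cases "t = 1")
  case True then show ?thesis using theta_inv_bounds assms theta_inv_1 by auto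
next
  case False
  show ?thesis
  proof (rule field_le_epsilon)
    fix d :: real assume d: "0 < d"
    have "s < theta M' \<GG>' (\<Theta> t + d)" using theta_inv_less[of t "\<Theta> t + d"] assms False d by simp
    moreover have "\<Theta> s \<le> 1" "0 \<le> \<Theta> t" using theta_inv_bounds assms by auto
    ultimately show "\<Theta> s \<le> \<Theta> t + d"
      using theta_inv_le[of s "\<Theta> t + d"] assms False d by (cases "\<Theta> t + d \<le> 1") auto
  qed
qed

text \<open>
  Strict monotonicity excludes a plateau of \<open>\<theta>\<close> at a height in \<open>(0, 1)\<close>: otherwise \<open>\<theta>(q) = t\<close> would be possible for some \<open>q < \<theta>\<inverse>(t)\<close>.
\<close>
lemma theta_inv_greater:
  assumes t: "t \<in> {0..1}" and q: "q < \<Theta> t"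
  shows "theta M' \<GG>' q < t \<or> t = 0 \<and> theta M' \<GG>' q = 0"
proof (cases "t = 0 \<or> theta M' \<GG>' q = 0")
  case True
  have "theta M' \<GG>' q = 0" if "t = 0"
  proof (cases "q \<le> 0")
    case False
    then have "\<not> 0 < theta M' \<GG>' q"
      using theta_inv_le[of 0 q] q that theta_inv_bounds[OF t] by auto
    then show ?thesis using theta_nonneg[of q] by simp
  qed (rule theta_nonpos)
  then show ?thesis using True t by auto
next
  case False
  then have pos: "0 < t" "0 < theta M' \<GG>' q" using t theta_nonneg[of q] by auto
  then have q0: "0 < q" using theta_nonpos[of q] by force
  obtain q1 where q1: "q < q1" "q1 < \<Theta> t" using q dense by blast
  obtain q2 where q2: "q1 < q2" "q2 < \<Theta> t" using q1(2) dense by blast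
  have le1: "q2 < 1" using q2 theta_inv_bounds[OF t] by simp
  have "p_crit M' \<GG>' \<le> q"
    unfolding p_crit_def by (rule cInf_lower) (use q0 q1 q2 le1 pos in \<open>auto intro!: bdd_belowI[of _ 0]\<close>)
  then have "theta M' \<GG>' q1 < theta M' \<GG>' q2"
    using strict_mono_onD[OF strict, of q1 q2] q1 q2 le1 by auto
  moreover have "theta M' \<GG>' q \<le> theta M' \<GG>' q1" using q1 theta_mono by simp
  moreover have "theta M' \<GG>' q2 \<le> t"
  proof (cases "t = 1")
    case True then show ?thesis using theta_le_1 by simp
  next
    case False
    then show ?thesis using theta_inv_le[of t q2] q0 q1 q2 le1 by (cases "t < theta M' \<GG>' q2") auto
  qed
  ultimately show ?thesis by simp
qed

section \<open>Convergence of the finite-dimensional marginals\<close>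

lemma AE_gap:
  assumes "finite C" shows "AE \<omega> in M'. \<exists>i. gap r C (1 / real (Suc i)) (\<GG>' \<omega>)"
proof -
  have "AE \<omega> in M'. \<forall>e\<in>all_edges. \<forall>c\<in>C. weight_of (\<GG>' \<omega>) e \<noteq> c"
    unfolding AE_ball_countable[OF countable_all_edges] AE_ball_countable[OF countable_finite[OF assms]]
    using L.AE_weight_neq by blast
  then show ?thesis using AE_nice' by eventually_elim (rule ex_gap[OF _ assms])
qed

lemma eventually_gap:
  assumes "finite C" "0 < e"
  obtains i where "outer_le Q {z \<in> space Q. \<not> gap r C (1 / real (Suc i)) (snd z)} e"
proof (rule eventually_limit[of "\<lambda>i. gap r C (1 / real (Suc i))" e])
  show "Measurable.pred RW (gap r C (1 / real (Suc i)))" for i by (rule pred_gap[OF assms(1)])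
  show "gap r C (1 / real (Suc (Suc i))) x" if "gap r C (1 / real (Suc i)) x" for i x
  proof -
    have "1 / real (Suc (Suc i)) \<le> 1 / real (Suc i)" by (simp add: frac_le)
    then show ?thesis using that unfolding gap_def by (meson le_less_trans)
  qed
  show "AE \<omega> in M'. \<exists>i. gap r C (1 / real (Suc i)) (\<GG>' \<omega>)" by (rule AE_gap[OF assms(1)])
qed (use assms that in auto)

text \<open>
  All parameters are chosen from the limit: the distance of the weights near the root to \<open>\<theta>\<inverse>(t)\<close> and to the values where the
  comparison with \<open>H\<close> changes, a step \<open>K\<close> at which the invasion is finished near the root, and the separation of the weights.
  With \<open>upper\<close> and \<open>lower\<close> at levels on both sides of \<open>\<theta>\<inverse>(t)\<close>, \<open>prim_local_agreement\<close> applies for all large \<open>n\<close>.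
\<close>
lemma closeness:
  assumes t: "t \<in> {0..1}" and r: "1 \<le> r" and H: "rooted_weighted_graph (Hg :: nat graph, h, wH)" and e: "0 < e"
  shows "\<forall>\<^sub>F n in sequentially. outer_le Q {z \<in> space Q. local_equiv (real r) (prim (k n t) (fst z n)) (Hg, h, wH) \<noteq>
      local_equiv (real r) (expanded_invasion_cluster (\<Theta> t) (snd z)) (Hg, h, wH)} e"
proof -
  let ?p = "\<Theta> t"
  have e8: "0 < e / 8" using e by simp
  have Hs: "rooted_simple Hg h" "prim_graph Hg h"
    using H by (auto simp: rooted_weighted_graph_def rooted_graph_def rooted_simple_def prim_graph_def)
  let ?EH = "{f \<in> edges Hg. f \<subseteq> ball_set (real r) (edges Hg) h}"
  have "finite (Pow (ball_set (real r) (edges Hg) h))" using finite_ball_set[OF Hs(2)] by simp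
  then have fEH: "finite ?EH" by (rule rev_finite_subset) auto
  \<comment> \<open>A weight at distance exactly \<open>1 / r\<close> from a weight of \<open>H\<close> is where local equivalence to \<open>H\<close> may change.\<close>
  let ?C = "insert ?p ((\<lambda>f. wH f + 1 / real r) ` ?EH \<union> (\<lambda>f. wH f - 1 / real r) ` ?EH)"
  have fC: "finite ?C" using fEH by simp
  obtain i where i: "outer_le Q {z \<in> space Q. \<not> gap (real r) ?C (1 / real (Suc i)) (snd z)} (e / 8)"
    by (rule eventually_gap[OF fC e8])
  let ?d = "1 / real (Suc i)"
  have d: "0 < ?d" by simp
  obtain K1 where K1: "\<And>K. K1 \<le> K \<Longrightarrow> outer_le Q {z \<in> space Q. \<not> captured (real r) K (snd z)} (e / 8)"
  proof (rule eventually_limit[of "captured (real r)" "e / 8"])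
    show "captured (real r) (Suc i) x" if "x \<in> space RW" "captured (real r) i x" for i x
      using that prim_tree_mono[OF that(1), of "Suc i" "Suc (Suc i)"] unfolding captured_def by auto
    show "AE \<omega> in M'. \<exists>i. captured (real r) i (\<GG>' \<omega>)"
      using AE_nice' by eventually_elim (rule ex_captured)
  qed (use e that in auto)
  obtain K0 where K0: "\<And>K. K0 \<le> K \<Longrightarrow> \<forall>\<^sub>F n in sequentially. outer_le Q {z \<in> space Q. \<not> low_after K (k n t) (?p + ?d / 2) (fst z n)} (e / 8)"
  proof (cases "?p + ?d / 2 \<le> 1")
    case True
    then have "t \<noteq> 1" using d theta_inv_1 by auto
    then have t1: "t < 1" using t by simp
    have th: "t < theta M' \<GG>' (?p + ?d / 4)" using d by (intro theta_inv_less[OF t1]) simp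
    have lin: "p + x / 4 \<in> {0..1} \<and> p + x / 2 \<in> {0..1} \<and> p + x / 4 < p + x / 2"
      if "p + x / 2 \<le> 1" "0 \<le> p" "0 < x" for p x :: real using that by auto
    note b = lin[OF True conjunct1[OF theta_inv_bounds[OF t]] d]
    show thesis
    proof (rule upper[OF t _ _ _ th e8, of "?p + ?d / 2"])
      show "?p + ?d / 4 \<in> {0..1}" "?p + ?d / 2 \<in> {0..1}" "?p + ?d / 4 < ?p + ?d / 2" using b by blast+
    qed (rule that)
  next
    case False
    \<comment> \<open>The level exceeds \<open>1\<close>, and all weights are below \<open>1\<close>.\<close>
    have "\<forall>\<^sub>F n in sequentially. outer_le Q {z \<in> space Q. \<not> low_after K (k n t) (?p + ?d / 2) (fst z n)} (e / 8)" for K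
      using eventually_ge_at_top[of 1]
    proof eventually_elim
      case (elim n)
      from Q_nice(2)[OF elim] show ?case
      proof (rule outer_le_mono)
        show "{z \<in> space Q. \<not> low_after K (k n t) (?p + ?d / 2) (fst z n)} \<subseteq>
          {z \<in> space Q. \<not> (nice (fst z n) \<and> finite (verts (graph_of (fst z n))) \<and> card (verts (graph_of (fst z n))) = n)}"
        proof (rule subsetI, rule ccontr)
          fix z assume z: "z \<in> {z \<in> space Q. \<not> low_after K (k n t) (?p + ?d / 2) (fst z n)}"
            "z \<notin> {z \<in> space Q. \<not> (nice (fst z n) \<and> finite (verts (graph_of (fst z n))) \<and> card (verts (graph_of (fst z n))) = n)}"
          then have "nice (fst z n)" by auto
          then have "weight_of (fst z n) f < 1" if "f \<in> edges (graph_of (fst z n))" for f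
            using that nice_edge[of "fst z n" f] by (simp add: nice_def)
          then have "low_after K (k n t) (?p + ?d / 2) (fst z n)" using False by (force simp: low_after_def)
          then show False using z by simp
        qed
      qed (use e in simp)
    qed
    then show thesis using that by blast
  qed
  define K where "K = max K0 K1"
  define m where "m = max r K"
  obtain l where l: "outer_le Q {z \<in> space Q. \<not> spread (real m) (1 / real (Suc l)) (snd z)} (e / 8)"
  proof (rule eventually_limit[of "\<lambda>i. spread (real m) (1 / real (Suc i))" "e / 8"])
    show "spread (real m) (1 / real (Suc (Suc i))) x" if "spread (real m) (1 / real (Suc i)) x" for i x
    proof -
      have "1 / real (Suc (Suc i)) \<le> 1 / real (Suc i)" by (simp add: frac_le)
      then show ?thesis using that unfolding spread_def by (meson le_less_trans)
    qed
    show "AE \<omega> in M'. \<exists>i. spread (real m) (1 / real (Suc i)) (\<GG>' \<omega>)"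
      using AE_nice' by eventually_elim (rule ex_spread)
  qed (use e that in auto)
  have low: "theta M' \<GG>' (?p - ?d / 2) < t \<or> t = 0 \<and> theta M' \<GG>' (?p - ?d / 2) = 0"
    using d by (intro theta_inv_greater[OF t]) simp
  have K0K: "K0 \<le> K" "K1 \<le> K" by (simp_all add: K_def)
  show ?thesis
    using agrees_whp[OF e8] K0[OF K0K(1)] lower[OF t low e8, of K] prim_steps_unbounded[OF t, of "Suc K"]
      eventually_radius[of "real m + 2 * real (Suc i) + 2 * real (Suc l)"]
  proof eventually_elim
    case (elim n)
    let ?R = "real (k n 0)"
    have mi: "0 \<le> real m" "0 < real (Suc i)" "0 < real (Suc l)" by simp_all
    have lin: "a \<le> d \<and> 2 * b \<le> d \<and> 2 * c \<le> d \<and> 0 < d" if "a + 2 * b + 2 * c \<le> d" "0 \<le> a" "0 < b" "0 < c" for a b c d :: real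
      using that by linarith
    from lin[OF elim(5) mi]
    have R: "real m \<le> ?R" "2 * real (Suc i) \<le> ?R" "2 * real (Suc l) \<le> ?R" "0 < ?R" by blast+
    have R1: "2 / ?R \<le> 1 / real (Suc l)" using R by (simp add: field_simps)
    have R2: "1 / ?R \<le> ?d / 2" using R by (simp add: field_simps)
    have main: "{z \<in> space Q. local_equiv (real r) (prim (k n t) (fst z n)) (Hg, h, wH) \<noteq>
      local_equiv (real r) (expanded_invasion_cluster (\<Theta> t) (snd z)) (Hg, h, wH)} \<subseteq>
      (({z \<in> space Q. \<not> agrees n z} \<union> {z \<in> space Q. \<not> low_after K (k n t) (?p + ?d / 2) (fst z n)}) \<union>
       ({z \<in> space Q. \<not> engulfs K (k n t) (?p - ?d / 2) (fst z n)} \<union> {z \<in> space Q. \<not> gap (real r) ?C ?d (snd z)})) \<union>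
      ({z \<in> space Q. \<not> captured (real r) K (snd z)} \<union> {z \<in> space Q. \<not> spread (real m) (1 / real (Suc l)) (snd z)})"
      (is "?L \<subseteq> ?U")
    proof (rule subsetI, rule ccontr)
      fix z assume z: "z \<in> ?L" and nz: "z \<notin> ?U"
      have zs: "z \<in> space Q" using z by blast
      have ag: "agrees n z" and up: "low_after K (k n t) (?p + ?d / 2) (fst z n)"
        and en: "engulfs K (k n t) (?p - ?d / 2) (fst z n)" and ga: "gap (real r) ?C ?d (snd z)"
        and ca: "captured (real r) K (snd z)" and sp: "spread (real m) (1 / real (Suc l)) (snd z)"
        using nz zs by blast+
      obtain G \<rho> w G' \<rho>' w' where g: "fst z n = (G, \<rho>, w)" "snd z = (G', \<rho>', w')" by (cases "fst z n", cases "snd z")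
      have nc: "nice (G, \<rho>, w)" "nice (G', \<rho>', w')" "local_equiv ?R (msf (G, \<rho>, w)) (msf (G', \<rho>', w'))"
        using ag g by (auto simp: agrees_def)
      interpret C: connected_prim_graph G \<rho> w using nice_prim nc by auto
      interpret C': connected_prim_graph G' \<rho>' w' using nice_prim nc by auto
      have gap': "\<bar>w' e - c\<bar> > ?d" if "e \<in> edges G'" "e \<subseteq> ball_set (real r) (edges G') \<rho>'" "c \<in> ?C" for e c
        using ga that unfolding gap_def g fst_conv snd_conv by blast
      have kS: "Suc (k n t - 1) = k n t" using elim(4) by simp
      have "local_equiv (real r) (prim (Suc (k n t - 1)) (G, \<rho>, w)) (Hg, h, wH) \<longleftrightarrow>
         local_equiv (real r) (expanded_invasion_cluster ?p (G', \<rho>', w')) (Hg, h, wH)"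
      proof (rule prim_local_agreement[where K=K and m=m and R="?R" and p'="?p + ?d / 2" and p''="?p - ?d / 2"])
        show "inj_prim_graph G \<rho> w" "inj_prim_graph G' \<rho>' w'" "rooted_simple Hg h"
          by (rule nice_prim(2)[OF nc(1)] nice_prim(2)[OF nc(2)] Hs(1))+
        show "K \<le> k n t - 1" using elim(4) by simp
        show "0 < real r" "real r \<le> real m" "K \<le> m" using r by (auto simp: m_def)
        show "real m \<le> ?R" by (rule R(1))
        show "cluster (G, \<rho>, w) x (?p - ?d / 2) \<subseteq> verts (C.tr (k n t - 1))" if "x \<in> verts (C.tr K)" for x
          using en that unfolding engulfs_def g by (simp add: C.prim_tree_tr)
        show "w f \<le> ?p + ?d / 2" if "f \<in> edges (C.tr (k n t - 1))" "f \<notin> edges (C.tr K)" for f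
          using up that C.edges_tr_sub unfolding low_after_def g by (auto simp: C.prim_tree_tr)
        show "local_equiv ?R (msf (G, \<rho>, w)) (msf (G', \<rho>', w'))" by (rule nc(3))
        show "2 / ?R < \<bar>w' e - w' f\<bar>" if "e \<in> edges G'" "f \<in> edges G'" "e \<subseteq> ball_set (real m) (edges G') \<rho>'"
              "f \<subseteq> ball_set (real m) (edges G') \<rho>'" "e \<noteq> f" for e f
          using sp R1 that unfolding spread_def g fst_conv snd_conv by (meson le_less_trans)
        show "?p - ?d / 2 \<le> ?p" "?p \<le> ?p + ?d / 2" using d by simp_all
        have "x < p - d / 2 - y \<or> p + d / 2 + y < x" if "d < \<bar>x - p\<bar>" "y \<le> d / 2" for x p y d :: real
          using that by argo
        then show "w' e < ?p - ?d / 2 - 1 / ?R \<or> ?p + ?d / 2 + 1 / ?R < w' e"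
          if "e \<in> edges G'" "e \<subseteq> ball_set (real r) (edges G') \<rho>'" for e
          using gap'[OF that, of ?p] R2 by blast
        show "e \<in> edges (C'.tr K)" if "e \<in> C'.inv_edges" "e \<subseteq> ball_set (real r) (edges G') \<rho>'" for e
        proof -
          from that(1) obtain l where l: "e \<in> edges (C'.tr l)" by (auto simp: C'.inv_edges_def)
          then have "e \<in> edges G'" using C'.edges_tr_sub by blast
          then show ?thesis using ca that(2) l unfolding captured_def g by (auto simp: C'.prim_tree_tr)
        qed
        have lin: "y < \<bar>\<bar>x - c\<bar> - a\<bar>" if "d < \<bar>x - (c + a)\<bar>" "d < \<bar>x - (c - a)\<bar>" "y \<le> d / 2" "0 < d" for x c a y d :: real
          using that by argo
        show "1 / ?R < \<bar>\<bar>w' e - wH f\<bar> - 1 / real r\<bar>"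
          if "e \<in> edges G'" "e \<subseteq> ball_set (real r) (edges G') \<rho>'" "f \<in> edges Hg" "f \<subseteq> ball_set (real r) (edges Hg) h" for e f
        proof -
          have "wH f + 1 / real r \<in> ?C" "wH f - 1 / real r \<in> ?C" using that(3,4) by blast+
          from lin[OF gap'[OF that(1,2) this(1)] gap'[OF that(1,2) this(2)] R2 d] show ?thesis .
        qed
      qed
      then show False using z unfolding kS by (simp add: g)
    qed
    have "outer_le Q ?U ((e / 8 + e / 8) + (e / 8 + e / 8) + (e / 8 + e / 8))"
      by (intro outer_le_Un elim(1,2,3) i K1 K0K l)
    then show ?case by (rule outer_le_mono[OF _ main]) (use e in simp)
  qed
qed

lemma closeness_list:
  assumes r: "1 \<le> r" and tHs: "\<forall>(t, H)\<in>set tHs. t \<in> {0..1} \<and> rooted_weighted_graph (H :: nat rwgraph)" and e: "0 < e"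
  shows "\<forall>\<^sub>F n in sequentially. outer_le Q {z \<in> space Q. \<not> (\<forall>(t, H)\<in>set tHs. local_equiv (real r) (prim (k n t) (fst z n)) H \<longleftrightarrow>
      local_equiv (real r) (expanded_invasion_cluster (\<Theta> t) (snd z)) H)} e"
  using tHs e
proof (induction tHs arbitrary: e)
  case Nil
  have "outer_le Q {} e" using Nil by (intro outer_leI) auto
  then show ?case by simp
next
  case (Cons a tHs)
  obtain t H where a: "a = (t, H)" by (cases a)
  obtain Hg h wH where H: "H = (Hg, h, wH)" by (cases H)
  have t: "t \<in> {0..1}" "rooted_weighted_graph (Hg, h, wH)" using Cons.prems(1) a H by auto
  have e2: "0 < e / 2" using Cons.prems by simp
  have IH: "\<forall>\<^sub>F n in sequentially. outer_le Q {z \<in> space Q. \<not> (\<forall>(t, H)\<in>set tHs. local_equiv (real r) (prim (k n t) (fst z n)) H \<longleftrightarrow>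
      local_equiv (real r) (expanded_invasion_cluster (\<Theta> t) (snd z)) H)} (e / 2)"
    using Cons.IH[OF _ e2] Cons.prems(1) by simp
  show ?case using IH closeness[OF t(1) r t(2) e2]
  proof eventually_elim
    case (elim n)
    from outer_le_Un[OF elim] show ?case
      by (rule outer_le_mono) (auto simp: a H)
  qed
qed

lemma pred_equiv_rwgraph:
  assumes "rooted_weighted_graph (H :: nat rwgraph)" "1 \<le> r" shows "Measurable.pred RW (\<lambda>x. local_equiv (real r) x H)"
proof -
  obtain Hg h wH where H: "H = (Hg, h, wH)" by (cases H)
  have Hs: "rooted_simple Hg h" "prim_graph Hg h"
    using assms H by (auto simp: rooted_weighted_graph_def rooted_graph_def rooted_simple_def prim_graph_def)
  show ?thesis unfolding H by (rule pred_local_equiv[OF Hs(1) finite_ball_set[OF Hs(2)]]) (use assms in simp)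
qed

lemma marginals_converge:
  assumes r: "1 \<le> r" and tHs: "\<forall>(t, H)\<in>set tHs. t \<in> {0..1} \<and> rooted_weighted_graph (H :: nat rwgraph)"
  shows "(\<lambda>n. \<P>(\<omega> in M n. \<forall>(t, H)\<in>set tHs. local_equiv (real r) (prim (k n t) (\<GG> n \<omega>)) H))
     \<longlonglongrightarrow> \<P>(\<omega> in M'. \<forall>(t, H)\<in>set tHs. local_equiv (real r) (expanded_invasion_cluster (\<Theta> t) (\<GG>' \<omega>)) H)"
proof -
  let ?P = "\<lambda>n x. \<forall>a\<in>set tHs. local_equiv (real r) (prim (k n (fst a)) x) (snd a)"
  let ?P' = "\<lambda>x. \<forall>a\<in>set tHs. local_equiv (real r) (expanded_invasion_cluster (\<Theta> (fst a)) x) (snd a)"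
  have P: "Measurable.pred RW (?P n)" for n
  proof (rule pred_intros_finite(3)[OF finite_set])
    fix a assume "a \<in> set tHs"
    then have "rooted_weighted_graph (snd a)" using tHs by auto
    from measurable_compose[OF measurable_prim pred_equiv_rwgraph[OF this r]]
    show "Measurable.pred RW (\<lambda>x. local_equiv (real r) (prim (k n (fst a)) x) (snd a))" .
  qed
  have P': "Measurable.pred RW ?P'"
  proof (rule pred_intros_finite(3)[OF finite_set])
    fix a assume "a \<in> set tHs"
    then have "rooted_weighted_graph (snd a)" using tHs by auto
    from measurable_compose[OF measurable_expanded pred_equiv_rwgraph[OF this r]]
    show "Measurable.pred RW (\<lambda>x. local_equiv (real r) (expanded_invasion_cluster (\<Theta> (fst a)) x) (snd a))" .
  qed
  have "(\<lambda>n. measure (M n) {\<omega> \<in> space (M n). ?P n (\<GG> n \<omega>)}) \<longlonglongrightarrow> measure M' {\<omega> \<in> space M'. ?P' (\<GG>' \<omega>)}"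
  proof (rule tendstoI)
    fix e :: real assume e: "0 < e"
    then have e2: "0 < e / 2" by simp
    show "\<forall>\<^sub>F n in sequentially. dist (measure (M n) {\<omega> \<in> space (M n). ?P n (\<GG> n \<omega>)}) (measure M' {\<omega> \<in> space M'. ?P' (\<GG>' \<omega>)}) < e"
      using closeness_list[OF r tHs e2] eventually_ge_at_top[of 1]
    proof eventually_elim
      case (elim n)
      have "\<bar>Q.prob {z \<in> space Q. ?P n (fst z n)} - Q.prob {z \<in> space Q. ?P' (snd z)}\<bar> \<le> e / 2"
        by (rule Q.outer_le_diff[OF Q_fst(2)[OF elim(2) P] Q_snd(2)[OF P'] elim(1)]) force+
      then show ?case using e by (simp add: Q_fst(1)[OF elim(2) P] Q_snd(1)[OF P'] dist_real_def)
    qed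
  qed
  then show ?thesis by (simp add: case_prod_unfold)
qed

end

section \<open>Path properties of the processes\<close>

lemma local_equiv_refl: "0 \<le> r \<Longrightarrow> local_equiv r x x"
  unfolding local_equiv_def Let_def by (rule exI[of _ "\<lambda>v. v"]) (auto simp: bij_betw_def)

lemma local_dist_refl: "local_dist x x = 0"
proof -
  have "local_dist x x \<le> 1 / (1 + real n)" if "1 \<le> n" for n
    using that by (intro local_dist_le(1) local_equiv_refl) auto
  then have "local_dist x x \<le> 0 + e" if e: "0 < e" for e
  proof -
    obtain n where n: "inverse (real (Suc n)) < e" using reals_Archimedean[OF e] by blast
    have "local_dist x x \<le> 1 / (1 + real (Suc n))" by (intro local_dist_le(1) local_equiv_refl) auto
    also have "\<dots> \<le> inverse (real (Suc n))" by (simp add: inverse_eq_divide frac_le)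
    finally show ?thesis using n by simp
  qed
  then have "local_dist x x \<le> 0" by (rule field_le_epsilon)
  moreover have "0 \<le> local_dist x x" by (rule local_dist_le(2)[of 1]) (simp_all add: local_equiv_refl)
  ultimately show ?thesis by simp
qed

lemma radius_for_dist:
  assumes "0 < \<epsilon>" obtains r :: nat where "1 \<le> r" "\<And>x y. local_equiv (real r) x y \<Longrightarrow> 0 \<le> local_dist x y \<and> local_dist x y < \<epsilon>"
proof -
  obtain n where n: "inverse (real (Suc n)) < \<epsilon>" using reals_Archimedean[OF assms] by blast
  show thesis
  proof (rule that[of "Suc n"])
    fix x y assume "local_equiv (real (Suc n)) x y"
    from local_dist_le[OF _ this] have "0 \<le> local_dist x y" "local_dist x y \<le> 1 / (1 + real (Suc n))" by simp_all
    moreover have "1 / (1 + real (Suc n)) \<le> inverse (real (Suc n))" by (simp add: inverse_eq_divide frac_le)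
    ultimately show "0 \<le> local_dist x y \<and> local_dist x y < \<epsilon>" using n by simp
  qed simp
qed

lemma nat_cadlag_right:
  assumes "cadlag_path dist UNIV (f :: real \<Rightarrow> nat)" "t \<in> {0..<1}"
  shows "\<forall>\<^sub>F s in at_right t. f s = f t"
proof -
  have "((\<lambda>s. dist (f s) (f t)) \<longlongrightarrow> 0) (at_right t)" using assms by (simp add: cadlag_path_def)
  then have "\<forall>\<^sub>F s in at_right t. dist (f s) (f t) < 1" by (rule order_tendstoD(2)) simp
  then show ?thesis by eventually_elim (simp add: dist_real_def abs_less_iff)
qed

lemma nat_cadlag_left:
  assumes "cadlag_path dist UNIV (f :: real \<Rightarrow> nat)" "t \<in> {0<..1}"
  obtains y where "\<forall>\<^sub>F s in at_left t. f s = y"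
proof -
  have "\<exists>y\<in>(UNIV :: nat set). ((\<lambda>s. dist (f s) y) \<longlongrightarrow> 0) (at_left t)" using assms unfolding cadlag_path_def by blast
  then obtain y :: nat where "((\<lambda>s. dist (f s) y) \<longlongrightarrow> 0) (at_left t)" by blast
  then have "\<forall>\<^sub>F s in at_left t. dist (f s) y < 1" by (rule order_tendstoD(2)) simp
  then have "\<forall>\<^sub>F s in at_left t. f s = y" by eventually_elim (simp add: dist_real_def abs_less_iff)
  then show thesis by (rule that)
qed

text \<open>
  A path with values in \<open>\<nat>\<close> and one-sided limits is constant on both sides of \<open>s\<close>.
\<close>
lemma nat_cadlag_local:
  assumes f: "cadlag_path dist UNIV (f :: real \<Rightarrow> nat)" and s: "s \<in> {0..1}"
  shows "\<exists>\<eta>>0. (\<forall>x\<in>{0..1}. s \<le> x \<longrightarrow> x < s + \<eta> \<longrightarrow> f x = f s) \<and>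
    (\<forall>x\<in>{0..1}. \<forall>y\<in>{0..1}. s - \<eta> < x \<longrightarrow> x < s \<longrightarrow> s - \<eta> < y \<longrightarrow> y < s \<longrightarrow> f x = f y)"
proof -
  obtain a where a: "0 < a" "\<And>x. x \<in> {0..1} \<Longrightarrow> s \<le> x \<Longrightarrow> x < s + a \<Longrightarrow> f x = f s"
  proof (cases "s = 1")
    case True then show thesis by (intro that[of 1]) auto
  next
    case False
    then have "\<forall>\<^sub>F x in at_right s. f x = f s" using s by (intro nat_cadlag_right[OF f]) auto
    then obtain b where "s < b" "\<And>x. s < x \<Longrightarrow> x < b \<Longrightarrow> f x = f s"
      unfolding eventually_at_right_field by blast
    then show thesis by (intro that[of "b - s"]) (auto simp: le_less)
  qed
  obtain c where c: "0 < c" "\<And>x y. x \<in> {0..1} \<Longrightarrow> y \<in> {0..1} \<Longrightarrow> s - c < x \<Longrightarrow> x < s \<Longrightarrow> s - c < y \<Longrightarrow> y < s \<Longrightarrow> f x = f y"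
  proof (cases "s = 0")
    case True then show thesis by (intro that[of 1]) auto
  next
    case False
    then obtain z where "\<forall>\<^sub>F x in at_left s. f x = z" using nat_cadlag_left[OF f, of s] s by auto
    then obtain b where "b < s" "\<And>x. b < x \<Longrightarrow> x < s \<Longrightarrow> f x = z"
      unfolding eventually_at_left_field by blast
    then show thesis by (intro that[of "s - b"]) auto
  qed
  show ?thesis
  proof (intro exI[of _ "min a c"] conjI ballI impI)
    show "0 < min a c" using a(1) c(1) by simp
    show "f x = f s" if "x \<in> {0..1}" "s \<le> x" "x < s + min a c" for x using a(2)[OF that(1,2)] that(3) by simp
    show "f x = f y" if "x \<in> {0..1}" "y \<in> {0..1}" "s - min a c < x" "x < s" "s - min a c < y" "y < s" for x y
      using c(2)[OF that(1,2) _ that(4) _ that(6)] that(3,5) by simp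
  qed
qed

text \<open>
  By compactness, intervals of a fixed length \<open>\<delta>\<close> lie in one of the neighbourhoods of \<open>nat_cadlag_local\<close>, where the path
  has at most one jump.
\<close>
lemma nat_cadlag_no_close_jumps:
  assumes f: "cadlag_path dist UNIV (f :: real \<Rightarrow> nat)"
  shows "\<exists>\<delta>. 0 < \<delta> \<and> \<delta> < 1 \<and> (\<forall>t t' t''. {t, t', t''} \<subseteq> {0..1} \<longrightarrow> t < t' \<longrightarrow> t' < t'' \<longrightarrow> t'' < t + \<delta> \<longrightarrow> f t = f t' \<or> f t' = f t'')"
proof -
  have "\<forall>s\<in>{0..1}. \<exists>\<eta>>0. (\<forall>x\<in>{0..1}. s \<le> x \<longrightarrow> x < s + \<eta> \<longrightarrow> f x = f s) \<and>
    (\<forall>x\<in>{0..1}. \<forall>y\<in>{0..1}. s - \<eta> < x \<longrightarrow> x < s \<longrightarrow> s - \<eta> < y \<longrightarrow> y < s \<longrightarrow> f x = f y)"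
    using nat_cadlag_local[OF f] by blast
  then obtain \<eta> where \<eta>': "\<forall>s\<in>{0..1}. \<eta> s > 0 \<and> (\<forall>x\<in>{0..1}. s \<le> x \<longrightarrow> x < s + \<eta> s \<longrightarrow> f x = f s) \<and>
    (\<forall>x\<in>{0..1}. \<forall>y\<in>{0..1}. s - \<eta> s < x \<longrightarrow> x < s \<longrightarrow> s - \<eta> s < y \<longrightarrow> y < s \<longrightarrow> f x = f y)"
    by (rule bchoice[THEN exE])
  have \<eta>: "\<And>s. s \<in> {0..1} \<Longrightarrow> 0 < \<eta> s"
    "\<And>s x. s \<in> {0..1} \<Longrightarrow> x \<in> {0..1} \<Longrightarrow> s \<le> x \<Longrightarrow> x < s + \<eta> s \<Longrightarrow> f x = f s"
    "\<And>s x y. s \<in> {0..1} \<Longrightarrow> x \<in> {0..1} \<Longrightarrow> y \<in> {0..1} \<Longrightarrow> s - \<eta> s < x \<Longrightarrow> x < s \<Longrightarrow> s - \<eta> s < y \<Longrightarrow> y < s \<Longrightarrow> f x = f y"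
    using \<eta>' by blast+
  let ?G = "(\<lambda>s. ball s (\<eta> s)) ` {0..1}"
  have cov: "{0..1} \<subseteq> \<Union> ?G" using \<eta>(1) by force
  have op: "open G" if "G \<in> ?G" for G using that by auto
  obtain d where d: "0 < d" "\<And>x. x \<in> {0..1} \<Longrightarrow> \<exists>G\<in>?G. ball x d \<subseteq> G"
    by (rule Heine_Borel_lemma[OF compact_Icc cov op]) blast+
  have "f t = f t' \<or> f t' = f t''"
    if t: "{t, t', t''} \<subseteq> {0..1}" "t < t'" "t' < t''" "t'' < t + d" for t t' t''
  proof -
    have "t \<in> {0..1}" using t(1) by simp
    from d(2)[OF this] obtain s where s: "s \<in> {0..1}" "ball t d \<subseteq> ball s (\<eta> s)" by blast
    have "t \<in> ball t d" "t' \<in> ball t d" "t'' \<in> ball t d" using t d(1) by (auto simp: dist_real_def)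
    then have "t \<in> ball s (\<eta> s)" "t' \<in> ball s (\<eta> s)" "t'' \<in> ball s (\<eta> s)" using s(2) by blast+
    then have "s - \<eta> s < t" "s - \<eta> s < t'" "t' < s + \<eta> s" "t'' < s + \<eta> s"
      unfolding mem_ball dist_real_def by linarith+
    then show ?thesis using \<eta>(2)[OF s(1), of t'] \<eta>(2)[OF s(1), of t''] \<eta>(3)[OF s(1), of t t'] t by (cases "t' < s") auto
  qed
  then show ?thesis using d(1) by (intro exI[of _ "min d (1/2)"]) auto
qed

lemma rwgraph_prim: "nice x \<Longrightarrow> rooted_weighted_graph (prim k x)"
proof -
  assume x: "nice x"
  obtain G \<rho> w where g: "x = (G, \<rho>, w)" by (cases x)
  interpret inj_prim_graph G \<rho> w using nice_prim x g by auto
  have "prim k x \<in> space RW" using measurable_space[OF measurable_prim nice_space[OF x]] .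
  moreover have "inj_on w (edges (tr (k - 1)))" using inj_on_subset[OF inj edges_tr_sub] .
  ultimately show ?thesis by (simp add: space_RW rooted_weighted_graph_def prim_def g prim_tree_tr)
qed

lemma cadlag_prim:
  assumes f: "cadlag_path dist UNIV (f :: real \<Rightarrow> nat)" and x: "nice x"
  shows "cadlag_path local_dist (Collect rooted_weighted_graph) (\<lambda>t. prim (f t) x)"
  unfolding cadlag_path_def
proof (intro conjI ballI)
  fix t :: real assume "t \<in> {0..<1}"
  from nat_cadlag_right[OF f this] have "\<forall>\<^sub>F s in at_right t. local_dist (prim (f s) x) (prim (f t) x) = 0"
    by eventually_elim (simp add: local_dist_refl)
  then show "((\<lambda>s. local_dist (prim (f s) x) (prim (f t) x)) \<longlongrightarrow> 0) (at_right t)" by (rule tendsto_eventually)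
next
  fix t :: real assume t: "t \<in> {0<..1}"
  obtain y where "\<forall>\<^sub>F s in at_left t. f s = y" by (rule nat_cadlag_left[OF f t])
  then have "\<forall>\<^sub>F s in at_left t. local_dist (prim (f s) x) (prim y x) = 0"
    by eventually_elim (simp add: local_dist_refl)
  then have "((\<lambda>s. local_dist (prim (f s) x) (prim y x)) \<longlongrightarrow> 0) (at_left t)" by (rule tendsto_eventually)
  then show "\<exists>y\<in>Collect (rooted_weighted_graph :: nat rwgraph \<Rightarrow> bool). ((\<lambda>s. local_dist (prim (f s) x) y) \<longlongrightarrow> 0) (at_left t)"
    using rwgraph_prim[OF x, of y] by (intro bexI[of _ "prim y x"]) simp_all
qed

context inj_prim_graph begin

text \<open>
  Only the finitely many edges in a ball around the root matter for a given distance.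
\<close>
lemma expanded_tendsto:
  assumes "\<And>e. e \<in> edges G \<Longrightarrow> \<forall>\<^sub>F s in \<Phi>. q s e \<longleftrightarrow> q' e"
  shows "((\<lambda>s. local_dist (expanded (q s)) (expanded q')) \<longlongrightarrow> 0) \<Phi>"
proof (rule tendstoI)
  fix \<epsilon> :: real assume "0 < \<epsilon>"
  then obtain r :: nat where r: "1 \<le> r" "\<And>(x :: 'a rwgraph) (y :: 'a rwgraph). local_equiv (real r) x y \<Longrightarrow> 0 \<le> local_dist x y \<and> local_dist x y < \<epsilon>"
    by (rule radius_for_dist) blast
  have "prim_graph G \<rho>" by unfold_locales
  then have "finite (Pow (ball_set (real r) (edges G) \<rho>))" using finite_ball_set[of G \<rho>] by simp
  then have "finite {e \<in> edges G. e \<subseteq> ball_set (real r) (edges G) \<rho>}" by (rule rev_finite_subset) auto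
  then have "\<forall>\<^sub>F s in \<Phi>. \<forall>e\<in>{e \<in> edges G. e \<subseteq> ball_set (real r) (edges G) \<rho>}. q s e \<longleftrightarrow> q' e"
    by (rule eventually_ball_finite) (use assms in blast)
  then show "\<forall>\<^sub>F s in \<Phi>. dist (local_dist (expanded (q s)) (expanded q')) 0 < \<epsilon>"
  proof eventually_elim
    case (elim s)
    have "local_equiv (real r) (expanded (q s)) (expanded q')" using r(1) elim by (intro expanded_equiv) auto
    from r(2)[OF this] show ?case by (simp add: dist_real_def)
  qed
qed

end

context coupled_setup begin

lemma theta_inv_right:
  assumes t: "t \<in> {0..<1}" and c: "\<Theta> t < c" "c \<le> 1"
  shows "\<forall>\<^sub>F s in at_right t. \<Theta> s < c"
proof -
  obtain q where q: "\<Theta> t < q" "q < c" using c dense by blast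
  have th: "t < theta M' \<GG>' q" using t q(1) by (intro theta_inv_less) auto
  have "0 \<le> \<Theta> t" using theta_inv_bounds t by simp
  then have "q \<in> {0..1}" using q c by auto
  then have "\<Theta> s < c" if "t < s" "s < min 1 (theta M' \<GG>' q)" for s
    using theta_inv_le[of s q] that q by auto
  then show ?thesis unfolding eventually_at_right_field using t th by (intro exI[of _ "min 1 (theta M' \<GG>' q)"]) auto
qed

lemma cadlag_expanded:
  assumes x: "nice x"
  shows "cadlag_path local_dist (Collect rooted_weighted_graph) (\<lambda>t. expanded_invasion_cluster (\<Theta> t) x)"
proof -
  obtain G \<rho> w where g: "x = (G, \<rho>, w)" by (cases x)
  interpret inj_prim_graph G \<rho> w using nice_prim x g by auto
  have w1: "w e < 1" if "e \<in> edges G" for e using nice_weight x g that by blast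
  show ?thesis
    unfolding cadlag_path_def g expanded_le
  proof (intro conjI ballI)
    fix t :: real assume t: "t \<in> {0..<1}"
    show "((\<lambda>s. local_dist (expanded (\<lambda>e. w e \<le> \<Theta> s)) (expanded (\<lambda>e. w e \<le> \<Theta> t))) \<longlongrightarrow> 0) (at_right t)"
    proof (rule expanded_tendsto)
      fix e assume e: "e \<in> edges G"
      have r1: "\<forall>\<^sub>F s in at_right t. t < s \<and> s < 1"
        unfolding eventually_at_right_field using t by (intro exI[of _ 1]) auto
      show "\<forall>\<^sub>F s in at_right t. (w e \<le> \<Theta> s) = (w e \<le> \<Theta> t)"
      proof (cases "w e \<le> \<Theta> t")
        case True
        from r1 show ?thesis
        proof eventually_elim
          case (elim s)
          then show ?case using theta_inv_mono[of t s] t True by simp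
        qed
      next
        case False
        from theta_inv_right[OF t, of "w e"] False w1[OF e]
        have "\<forall>\<^sub>F s in at_right t. \<Theta> s < w e" by simp
        then show ?thesis by eventually_elim (use False in simp)
      qed
    qed
  next
    fix t :: real assume t: "t \<in> {0<..1}"
    \<comment> \<open>The left limit keeps an edge iff its weight is reached strictly before time \<open>t\<close>.\<close>
    let ?q = "\<lambda>e. \<exists>s. 0 \<le> s \<and> s < t \<and> w e \<le> \<Theta> s"
    have "((\<lambda>s. local_dist (expanded (\<lambda>e. w e \<le> \<Theta> s)) (expanded ?q)) \<longlongrightarrow> 0) (at_left t)"
    proof (rule expanded_tendsto)
      fix e assume e: "e \<in> edges G"
      have l: "\<forall>\<^sub>F s in at_left t. b < s \<and> s < t" if "b < t" for b
        unfolding eventually_at_left_field using that by (intro exI[of _ b]) auto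
      show "\<forall>\<^sub>F s in at_left t. (w e \<le> \<Theta> s) = ?q e"
      proof (cases "?q e")
        case True
        then obtain b where b: "0 \<le> b" "b < t" "w e \<le> \<Theta> b" by blast
        from l[OF b(2)] show ?thesis
        proof eventually_elim
          case (elim s)
          then show ?case using theta_inv_mono[of b s] t True b by auto
        qed
      next
        case False
        have "0 < t" using t by simp
        from l[OF this] show ?thesis by eventually_elim (use False in auto)
      qed
    qed
    then show "\<exists>y\<in>Collect (rooted_weighted_graph :: nat rwgraph \<Rightarrow> bool). ((\<lambda>s. local_dist (expanded (\<lambda>e. w e \<le> \<Theta> s)) y) \<longlongrightarrow> 0) (at_left t)"
      using expanded_rwgraph[of ?q] by (intro bexI[of _ "expanded ?q"]) simp_all
  qed
qed

text \<open>
  All weights are below \<open>1\<close>, so near the root they are at most some \<open>c < 1\<close>.  As \<open>\<theta>(c) < 1\<close>, the level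
  \<open>\<theta>\<inverse>(1 - \<delta>)\<close> exceeds \<open>c\<close> for small \<open>\<delta>\<close>.
\<close>
lemma continuous_at_end:
  assumes \<epsilon>: "0 < \<epsilon>"
  shows "((\<lambda>\<delta>. \<P>(\<omega> in M'. local_dist (expanded_invasion_cluster (\<Theta> 1) (\<GG>' \<omega>)) (expanded_invasion_cluster (\<Theta> (1 - \<delta>)) (\<GG>' \<omega>)) \<ge> \<epsilon>)) \<longlongrightarrow> 0) (at_right 0)"
proof (rule tendstoI)
  fix e :: real assume e: "0 < e"
  then have e2: "0 < e / 2" by simp
  obtain r :: nat where r: "1 \<le> r" "\<And>(x :: nat rwgraph) (y :: nat rwgraph). local_equiv (real r) x y \<Longrightarrow> 0 \<le> local_dist x y \<and> local_dist x y < \<epsilon>"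
    by (rule radius_for_dist[OF \<epsilon>]) blast
  obtain i where i: "outer_le Q {z \<in> space Q. \<not> gap (real r) {1} (1 / real (Suc i)) (snd z)} (e / 2)"
    by (rule eventually_gap[OF _ e2, of "{1}"]) simp_all
  let ?P = "\<lambda>x. \<not> (nice x \<and> gap (real r) {1} (1 / real (Suc i)) x)"
  have P: "Measurable.pred RW ?P" by (intro pred_intros_logic pred_nice pred_gap) simp
  from outer_le_Un[OF Q_nice(1) i]
  have ou: "outer_le Q {z \<in> space Q. ?P (snd z)} (e / 2)" by (rule outer_le_mono) auto
  have small: "L.prob {\<omega> \<in> space M'. ?P (\<GG>' \<omega>)} \<le> e / 2" by (rule prob_limit_le[OF P ou]) (use e in simp)
  let ?c = "1 - 1 / real (Suc i)"
  have "?c < \<Theta> 1" by (simp add: theta_inv_1)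
  then have "theta M' \<GG>' ?c < 1" using theta_inv_greater[of 1 ?c] by simp
  then have "\<forall>\<^sub>F \<delta> in at_right 0. 0 < \<delta> \<and> \<delta> < min 1 (1 - theta M' \<GG>' ?c)"
    unfolding eventually_at_right_field by (intro exI[of _ "min 1 (1 - theta M' \<GG>' ?c)"]) auto
  then show "\<forall>\<^sub>F \<delta> in at_right 0. dist (\<P>(\<omega> in M'. local_dist (expanded_invasion_cluster (\<Theta> 1) (\<GG>' \<omega>)) (expanded_invasion_cluster (\<Theta> (1 - \<delta>)) (\<GG>' \<omega>)) \<ge> \<epsilon>)) 0 < e"
  proof eventually_elim
    case (elim \<delta>)
    have lev: "?c \<le> \<Theta> (1 - \<delta>)"
      using theta_inv_less[of "1 - \<delta>" ?c] elim by (cases "\<Theta> (1 - \<delta>) < ?c") auto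
    have "L.prob {\<omega> \<in> space M'. local_dist (expanded_invasion_cluster (\<Theta> 1) (\<GG>' \<omega>)) (expanded_invasion_cluster (\<Theta> (1 - \<delta>)) (\<GG>' \<omega>)) \<ge> \<epsilon>}
      \<le> L.prob {\<omega> \<in> space M'. ?P (\<GG>' \<omega>)}"
    proof (rule L.finite_measure_mono[OF _ pred_M'[OF P]], rule subsetI, rule ccontr)
      fix \<omega> assume \<omega>: "\<omega> \<in> {\<omega> \<in> space M'. local_dist (expanded_invasion_cluster (\<Theta> 1) (\<GG>' \<omega>)) (expanded_invasion_cluster (\<Theta> (1 - \<delta>)) (\<GG>' \<omega>)) \<ge> \<epsilon>}"
        and "\<omega> \<notin> {\<omega> \<in> space M'. ?P (\<GG>' \<omega>)}"
      then have x: "nice (\<GG>' \<omega>)" "gap (real r) {1} (1 / real (Suc i)) (\<GG>' \<omega>)" by auto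
      obtain G \<rho> w where g: "\<GG>' \<omega> = (G, \<rho>, w)" by (cases "\<GG>' \<omega>")
      interpret inj_prim_graph G \<rho> w using nice_prim x g by auto
      have "local_equiv (real r) (expanded (\<lambda>e. w e \<le> \<Theta> 1)) (expanded (\<lambda>e. w e \<le> \<Theta> (1 - \<delta>)))"
      proof (rule expanded_equiv)
        fix f assume f: "f \<in> edges G" "f \<subseteq> ball_set (real r) (edges G) \<rho>"
        have "1 / real (Suc i) < \<bar>w f - 1\<bar>" using x(2) f unfolding gap_def g by simp
        moreover have wf: "w f < 1" using nice_weight[OF x(1)[unfolded g] f(1)] by simp
        ultimately have "w f \<le> ?c" by linarith
        then show "(w f \<le> \<Theta> 1) = (w f \<le> \<Theta> (1 - \<delta>))" using lev wf by (simp add: theta_inv_1)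
      qed (use r(1) in simp)
      from r(2)[OF this] show False using \<omega> by (simp add: g expanded_le)
    qed
    then show ?case using small e by simp
  qed
qed

text \<open>
  The condition on close oscillations holds trivially: for each \<open>n\<close> the step function \<open>k n\<close> has finitely many jumps, so with a
  small \<open>\<delta> n\<close> no two jumps are closer than \<open>\<delta> n\<close>.
\<close>
lemma process_convergence:
  assumes cad: "\<And>n. n \<ge> 1 \<Longrightarrow> cadlag_path dist UNIV (k n)"
  shows "local_process_convergence
           M (\<lambda>n t \<omega>. prim (k n t) (\<GG> n \<omega>))
           M' (\<lambda>t \<omega>. expanded_invasion_cluster (theta_inv M' \<GG>' t) (\<GG>' \<omega>))"
  unfolding local_process_convergence_def
proof (intro conjI allI impI)
  fix n :: nat assume n: "1 \<le> n"
  interpret S: standard_rooted "M n" "\<GG> n" by (rule standard_rooted_n[OF n])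
  show "cadlag_process (M n) (\<lambda>t \<omega>. prim (k n t) (\<GG> n \<omega>))"
    unfolding cadlag_process_def
  proof (intro conjI ballI)
    show "(\<lambda>\<omega>. prim (k n t) (\<GG> n \<omega>)) \<in> M n \<rightarrow>\<^sub>M RW" for t
      by (rule measurable_compose[OF S.\<GG>_measurable measurable_prim])
    show "AE \<omega> in M n. cadlag_path local_dist (Collect rooted_weighted_graph) (\<lambda>t. prim (k n t) (\<GG> n \<omega>))"
      using AE_nice_n[OF n] by eventually_elim (rule cadlag_prim[OF cad[OF n]])
  qed
next
  show "cadlag_process M' (\<lambda>t \<omega>. expanded_invasion_cluster (\<Theta> t) (\<GG>' \<omega>))"
    unfolding cadlag_process_def
  proof (intro conjI ballI)
    show "(\<lambda>\<omega>. expanded_invasion_cluster (\<Theta> t) (\<GG>' \<omega>)) \<in> M' \<rightarrow>\<^sub>M RW" for t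
      by (rule measurable_compose[OF L.\<GG>_measurable measurable_expanded])
    show "AE \<omega> in M'. cadlag_path local_dist (Collect rooted_weighted_graph) (\<lambda>t. expanded_invasion_cluster (\<Theta> t) (\<GG>' \<omega>))"
      using AE_nice' by eventually_elim (rule cadlag_expanded)
  qed
next
  fix r :: nat and tHs :: "(real \<times> nat rwgraph) list"
  assume "1 \<le> r" "\<forall>(t, H)\<in>set tHs. t \<in> {0..1} \<and> rooted_weighted_graph H"
  then show "(\<lambda>n. \<P>(\<omega> in M n. \<forall>(t, H)\<in>set tHs. local_equiv (real r) (prim (k n t) (\<GG> n \<omega>)) H))
     \<longlonglongrightarrow> \<P>(\<omega> in M'. \<forall>(t, H)\<in>set tHs. local_equiv (real r) (expanded_invasion_cluster (\<Theta> t) (\<GG>' \<omega>)) H)"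
    by (rule marginals_converge)
next
  fix \<epsilon> :: real assume "0 < \<epsilon>"
  then show "((\<lambda>\<delta>. \<P>(\<omega> in M'. \<epsilon> \<le> local_dist (expanded_invasion_cluster (\<Theta> 1) (\<GG>' \<omega>)) (expanded_invasion_cluster (\<Theta> (1 - \<delta>)) (\<GG>' \<omega>)))) \<longlongrightarrow> 0) (at_right 0)"
    by (rule continuous_at_end)
next
  fix \<epsilon> :: real assume \<epsilon>: "0 < \<epsilon>"
  have "\<exists>\<delta>. 0 < \<delta> \<and> \<delta> < 1 \<and> (1 \<le> n \<longrightarrow> (\<forall>t t' t''. {t, t', t''} \<subseteq> {0..1} \<longrightarrow> t < t' \<longrightarrow> t' < t'' \<longrightarrow> t'' < t + \<delta> \<longrightarrow> k n t = k n t' \<or> k n t' = k n t''))" for n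
  proof (cases "1 \<le> n")
    case True then show ?thesis using nat_cadlag_no_close_jumps[OF cad[OF True]] by blast
  next
    case False then show ?thesis by (intro exI[of _ "1/2"]) auto
  qed
  then obtain \<delta> where \<delta>: "\<And>n. 0 < \<delta> n \<and> \<delta> n < 1"
    "\<And>n t t' t''. 1 \<le> n \<Longrightarrow> {t, t', t''} \<subseteq> {0..1} \<Longrightarrow> t < t' \<Longrightarrow> t' < t'' \<Longrightarrow> t'' < t + \<delta> n \<Longrightarrow> k n t = k n t' \<or> k n t' = k n t''"
    by metis
  let ?P = "\<lambda>n. \<P>(\<omega> in M n. \<exists>t t' t''. {t, t', t''} \<subseteq> {0..1} \<and> t < t' \<and> t' < t'' \<and> t'' < t + \<delta> n \<and>
           \<epsilon> \<le> local_dist (prim (k n t) (\<GG> n \<omega>)) (prim (k n t') (\<GG> n \<omega>)) \<and>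
           \<epsilon> \<le> local_dist (prim (k n t') (\<GG> n \<omega>)) (prim (k n t'') (\<GG> n \<omega>)))"
  have "?P n = 0" if n: "1 \<le> n" for n
  proof -
    have "{\<omega> \<in> space (M n). \<exists>t t' t''. {t, t', t''} \<subseteq> {0..1} \<and> t < t' \<and> t' < t'' \<and> t'' < t + \<delta> n \<and>
           \<epsilon> \<le> local_dist (prim (k n t) (\<GG> n \<omega>)) (prim (k n t') (\<GG> n \<omega>)) \<and>
           \<epsilon> \<le> local_dist (prim (k n t') (\<GG> n \<omega>)) (prim (k n t'') (\<GG> n \<omega>))} = {}" (is "?S = {}")
    proof (rule equals0I)
      fix \<omega> assume "\<omega> \<in> ?S"
      then obtain t t' t'' where t: "{t, t', t''} \<subseteq> {0..1}" "t < t'" "t' < t''" "t'' < t + \<delta> n"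
        and d: "\<epsilon> \<le> local_dist (prim (k n t) (\<GG> n \<omega>)) (prim (k n t') (\<GG> n \<omega>))"
           "\<epsilon> \<le> local_dist (prim (k n t') (\<GG> n \<omega>)) (prim (k n t'') (\<GG> n \<omega>))" by blast
      have "k n t = k n t' \<or> k n t' = k n t''" by (rule \<delta>(2)[OF n t])
      then show False using d \<epsilon> local_dist_refl[of "prim (k n t') (\<GG> n \<omega>)"] by auto
    qed
    then show ?thesis by (simp only: measure_empty)
  qed
  then have "\<forall>\<^sub>F n in sequentially. ?P n = 0" by (rule eventually_mono[OF eventually_ge_at_top[of 1]])
  then have "?P \<longlonglongrightarrow> 0" by (rule tendsto_eventually)
  then show "\<exists>\<delta>. (\<forall>n. 0 < \<delta> n \<and> \<delta> n < 1) \<and>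
        (\<lambda>n. \<P>(\<omega> in M n. \<exists>t t' t''. {t, t', t''} \<subseteq> {0..1} \<and> t < t' \<and> t' < t'' \<and> t'' < t + \<delta> n \<and>
           \<epsilon> \<le> local_dist (prim (k n t) (\<GG> n \<omega>)) (prim (k n t') (\<GG> n \<omega>)) \<and>
           \<epsilon> \<le> local_dist (prim (k n t') (\<GG> n \<omega>)) (prim (k n t'') (\<GG> n \<omega>)))) \<longlonglongrightarrow> 0"
    using \<delta>(1) by blast
qed

end

theorem theorem1p1:
  fixes M :: "nat \<Rightarrow> 'a measure" and \<GG> :: "nat \<Rightarrow> 'a \<Rightarrow> nat rwgraph"
    and M' :: "'b measure" and \<GG>' :: "'b \<Rightarrow> nat rwgraph"
    and k :: "nat \<Rightarrow> real \<Rightarrow> nat"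
  assumes "\<And>n. n \<ge> 1 \<Longrightarrow> standard_extension (M n) (\<GG> n)"
    and "\<And>n \<omega>. n \<ge> 1 \<Longrightarrow> \<omega> \<in> space (M n) \<Longrightarrow>
           finite (verts (graph_of (\<GG> n \<omega>))) \<and> card (verts (graph_of (\<GG> n \<omega>))) = n \<and>
           connected_graph (graph_of (\<GG> n \<omega>))"
    and "standard_extension_rooted M' \<GG>'"
    and "\<And>\<omega>. \<omega> \<in> space M' \<Longrightarrow> connected_graph (graph_of (\<GG>' \<omega>))"
    and "local_convergence_in_probability M \<GG> M' \<GG>'"
    and "linearly_growing M \<GG> M' \<GG>' k"
    and "\<And>p. p \<in> {0..1} \<Longrightarrow>
           theta M' \<GG>' p > 0 \<longleftrightarrow>
           \<P>(\<omega> in M'. \<exists>v\<in>verts (graph_of (msf (\<GG>' \<omega>))). infinite (cluster (\<GG>' \<omega>) v p)) = 1"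
    and "continuous_on {p_crit M' \<GG>'<..1} (theta M' \<GG>')"
    and "strict_mono_on {p_crit M' \<GG>'<..1} (theta M' \<GG>')"
    and "\<And>p. p \<in> {0..1} \<Longrightarrow>
           (\<lambda>j. limsup (\<lambda>n. ereal (1 / (real n)\<^sup>2 *
              (\<integral>\<omega>. real (card {(u, v). u \<in> verts (graph_of (\<GG> n \<omega>)) \<and> v \<in> verts (graph_of (\<GG> n \<omega>)) \<and>
                   card (cluster (\<GG> n \<omega>) u p) \<ge> j \<and> card (cluster (\<GG> n \<omega>) v p) \<ge> j \<and>
                   cluster (\<GG> n \<omega>) u p \<inter> cluster (\<GG> n \<omega>) v p = {}}) \<partial>M n)))) \<longlonglongrightarrow> 0"
  shows "local_process_convergence
           M (\<lambda>n t \<omega>. prim (k n t) (\<GG> n \<omega>))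
           M' (\<lambda>t \<omega>. expanded_invasion_cluster (theta_inv M' \<GG>' t) (\<GG>' \<omega>))"
proof -
  note grow = assms(6)[unfolded linearly_growing_def]
  obtain Q where Q: "coupling (\<lambda>n. distr (M n) rwgraph_space (\<GG> n)) (distr M' rwgraph_space \<GG>') Q"
    "(\<lambda>n. INF m\<in>{n..}. \<P>(z in Q.
            local_equiv (real (k n 0)) (fst z m) (snd z) \<and>
            local_equiv (real (k n 0)) (msf (fst z m)) (msf (snd z)))) \<longlonglongrightarrow> 1"
    using grow by blast
  interpret coupled_setup M \<GG> M' \<GG>' k Q
  proof
    show "(\<lambda>n. real (k n t) / real n) \<longlonglongrightarrow> t" if "t \<in> {0..1}" for t using grow that by blast
    show "filterlim (\<lambda>n. k n 0) at_top sequentially" using grow by blast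
  qed (fact assms Q)+
  show ?thesis by (rule process_convergence) (use grow in blast)
qed

end
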